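(* The following hold. (1) For any $C^2$ function $\phi$ on $[-2,2]$, $\mathcal{E}\mathcal{N}\phi=\phi-\int\phi\,d\beta$ and $\mathcal{N}\mathcal{E}\phi=\phi-\int\phi\,d\beta$. (2) $\mathcal{E}\phi_0=0$, $\mathcal{E}\phi_n=\frac1n\phi_n$ for $n\ge1$, and $\mathcal{N}\phi_n=n\phi_n$ for any $n\ge0$. In other words, $\mathcal{N}$ is the counting number operator for the Chebyshev basis in $L^2(\beta)$. (3) For any $C^1$ functions $\phi,\psi$ on $[-2,2]$, $$\langle\mathcal{N}\phi,\psi\rangle=2\iint\frac{(\phi(x)-\phi(y))(\psi(x)-\psi(y))}{(x-y)^2}\,\omega(dx\,dy).$$ In particular, $\langle\mathcal{N}\phi,\psi\rangle=\langle\phi,\mathcal{N}\psi\rangle$. (4) If we take $\mathcal{L}\phi=\mathcal{N}^2\phi$ for $C^2$ functions, then $$\langle\mathcal{L}\phi,\psi\rangle=2\int\phi'\psi'\,d\alpha.$$ The operator $\mathcal{L}$ is actually the Jacobi operator $(\mathcal{L}\phi)(x)=-(4-x^2)\phi''(x)+x\phi'(x)$, with invariant measure the arcsine law $\beta$. Moreover, $\mathcal{L}$ has a unique selfadjoint extension, still denoted by $\mathcal{L}$ and defined on $$\mathcal{H}=\Big\{\phi:[-2,2]\to\mathbb{R}\ :\ \phi\in L^2(\beta)\text{ and }\phi(x)=\int_{-2}^x\psi(y)\,dy\text{ for }\beta\text{-a.s. }x\in[-2,2]\text{ with }\psi\in L^2(\alpha)\Big\}.$$ (5) For a $C^3$ potential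 $V$ on $[-2,2]$ and $A\in\mathbb{R}$, the (unique) signed measure $\mu$ of finite total variation on $[-2,2]$ with $\mu([-2,2])=A$ such that, for some constant $C$, $2\int\log|x-y|\,\mu(dy)=V(x)+C$ for Lebesgue-almost every $x\in[-2,2]$, is $$\mu(dx)=\left(A-\tfrac12(\mathcal{N}V)(x)\right)\beta(dx).$$ (6) Let $V$ be a $C^3$ potential on $[-2,2]$. If the minimizer of $E_V$ on $[-2,2]$ has full support, then $$E_V=\int V\,d\beta-\frac14\langle\mathcal{N}V,V\rangle=\int V\,d\beta-\frac12\iint\left(\frac{V(x)-V(y)}{x-y}\right)^2\omega(dx\,dy).$$
   Context: On $[-2,2]$ (resp. $[-2,2]^2$): $\alpha(dx)=\frac{\sqrt{4-x^2}}{2\pi}dx$, $\beta(dx)=\frac{dx}{\pi\sqrt{4-x^2}}$ (the arcsine law), $\omega(dx\,dy)=\frac{(4-xy)\,dx\,dy}{4\pi^2\sqrt{(4-x^2)(4-y^2)}}$. $\langle\cdot,\cdot\rangle$ is the inner product of $L^2(\beta)$. $\phi_n(x)=T_n(x/2)$, where $T_n(\cos\theta)=\cos(n\theta)$ are the Chebyshev polynomials of the first kind; they form an orthogonal basis of $L^2(\beta)$. For a $C^2$ function $\phi:[-2,2]\to\mathbb{R}$, $$(\mathcal{E}\phi)(x)=-\int\log|x-y|\,\phi(y)\beta(dy),$$ $$(\mathcal{N}\phi)(x)=\int y\phi'(y)\beta(dy)+x\int\phi'(y)\beta(dy)-(4-x^2)\int\frac{\phi'(x)-\phi'(y)}{x-y}\beta(dy).$$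 When $\mathcal{E}$ is applied to $\mathcal{N}\phi$ in (1), the same formula is used. Where $\mathcal{N}$ is applied to functions that are not $C^2$ (in (3), and in $\mathcal{N}^2$ in (4)), it is understood as the counting number operator $\sum_n a_n\phi_n\mapsto\sum_n n a_n\phi_n$ in $L^2(\beta)$. For $V$ on $[-2,2]$ and a probability measure $\mu$ on $[-2,2]$, $E_V(\mu)=\int V\,d\mu-\iint\log|x-y|\,\mu(dx)\mu(dy)$, and $E_V$ without argument denotes its minimum over probability measures on $[-2,2]$ (attained at a unique measure).
   Formalization: In (4), "defined on H" is replaced by: the quadratic-form domain of the unique selfadjoint extension is H plus constants. Literally it fails: the constant 1 is C² but not in H, and √(2+x) is in H but not in the operator domain. *)

theory Defs
  imports "HOL-Probability.Probability" "HOL-Computational_Algebra.Polynomial"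
begin

text \<open>A function on $[-2,2]$ is modelled by a function \<open>real \<Rightarrow> real\<close> of which only the values on
  \<open>{-2..2}\<close> matter. For this reason the measures live on the space \<open>{-2..2}\<close> (and not on the
  whole line), and derivatives are taken within \<open>{-2..2}\<close>, hence one-sided at the endpoints.\<close>

abbreviation I2 :: "real set" where "I2 \<equiv> {-2..2}"

definition alpha :: "real measure" where
  "alpha = density (restrict_space lborel I2) (\<lambda>x. ennreal (sqrt (4 - x\<^sup>2) / (2 * pi)))"

definition beta :: "real measure" where
  "beta = density (restrict_space lborel I2) (\<lambda>x. ennreal (1 / (pi * sqrt (4 - x\<^sup>2))))"

definition omega :: "(real \<times> real) measure" where
  "omega = density (restrict_space lborel (I2 \<times> I2))
     (\<lambda>(x, y). ennreal ((4 - x * y) / (4 * pi\<^sup>2 * sqrt ((4 - x\<^sup>2) * (4 - y\<^sup>2)))))"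

definition dI :: "(real \<Rightarrow> real) \<Rightarrow> real \<Rightarrow> real" where
  "dI f x = vector_derivative f (at x within I2)"

primrec Ck :: "nat \<Rightarrow> (real \<Rightarrow> real) \<Rightarrow> bool" where
  "Ck 0 f \<longleftrightarrow> continuous_on I2 f"
| "Ck (Suc k) f \<longleftrightarrow> f differentiable_on I2 \<and> Ck k (dI f)"

fun cheb_T :: "nat \<Rightarrow> real poly" where
  "cheb_T 0 = 1"
| "cheb_T (Suc 0) = [:0, 1:]"
| "cheb_T (Suc (Suc n)) = [:0, 2:] * cheb_T (Suc n) - cheb_T n"

lemma cheb_T_cos: "poly (cheb_T n) (cos t) = cos (real n * t)"
proof (induction n rule: cheb_T.induct)
  case (3 n)
  have "cos (real (Suc (Suc n)) * t) + cos (real n * t) = 2 * cos t * cos (real (Suc n) * t)"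
    using cos_times_cos[of t "real (Suc n) * t"] cos_minus[of "real n * t"]
    by (simp add: algebra_simps)
  then show ?case using 3 by simp
qed auto

definition phi :: "nat \<Rightarrow> real \<Rightarrow> real" where
  "phi n x = poly (cheb_T n) (x / 2)"


subsection \<open>The operators on smooth functions\<close>

definition E_op :: "(real \<Rightarrow> real) \<Rightarrow> real \<Rightarrow> real" where
  "E_op f x = - (\<integral>y. ln \<bar>x - y\<bar> * f y \<partial>beta)"

text \<open>The last integrand is undefined at \<open>y = x\<close> only, which is a \<open>beta\<close>-null set.\<close>

definition N_op :: "(real \<Rightarrow> real) \<Rightarrow> real \<Rightarrow> real" where
  "N_op f x = (\<integral>y. y * dI f y \<partial>beta) + x * (\<integral>y. dI f y \<partial>beta)
     - (4 - x\<^sup>2) * (\<integral>y. (dI f x - dI f y) / (x - y) \<partial>beta)"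

definition jacobi :: "(real \<Rightarrow> real) \<Rightarrow> real \<Rightarrow> real" where
  "jacobi f x = - (4 - x\<^sup>2) * dI (dI f) x + x * dI f x"


subsection \<open>Square integrable functions and unbounded operators\<close>

definition L2 :: "'a measure \<Rightarrow> ('a \<Rightarrow> real) set" where
  "L2 M = {f \<in> borel_measurable M. integrable M (\<lambda>x. (f x)\<^sup>2)}"

definition ip :: "'a measure \<Rightarrow> ('a \<Rightarrow> real) \<Rightarrow> ('a \<Rightarrow> real) \<Rightarrow> real" where
  "ip M f g = (\<integral>x. f x * g x \<partial>M)"

definition L2_lim :: "'a measure \<Rightarrow> (nat \<Rightarrow> 'a \<Rightarrow> real) \<Rightarrow> ('a \<Rightarrow> real) \<Rightarrow> bool" where
  "L2_lim M u f \<longleftrightarrow> (\<forall>k. u k \<in> L2 M) \<and> f \<in> L2 M \<and>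
     (\<lambda>k. \<integral>x. (u k x - f x)\<^sup>2 \<partial>M) \<longlonglongrightarrow> 0"

text \<open>An operator on \<open>L2 M\<close> is given by its graph, a set of pairs of functions. Functions are not
  identified when they agree almost everywhere, so single-valuedness is up to null sets.\<close>

definition operator_graph :: "'a measure \<Rightarrow> (('a \<Rightarrow> real) \<times> ('a \<Rightarrow> real)) set \<Rightarrow> bool" where
  "operator_graph M G \<longleftrightarrow> G \<subseteq> L2 M \<times> L2 M \<and> ((\<lambda>x. 0), (\<lambda>x. 0)) \<in> G \<and>
     (\<forall>f g f' g'. (f, g) \<in> G \<longrightarrow> (f', g') \<in> G \<longrightarrow> ((\<lambda>x. f x + f' x), (\<lambda>x. g x + g' x)) \<in> G) \<and>
     (\<forall>c f g. (f, g) \<in> G \<longrightarrow> ((\<lambda>x. c * f x), (\<lambda>x. c * g x)) \<in> G) \<and>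
     (\<forall>f g f' g'. (f, g) \<in> G \<longrightarrow> (f', g') \<in> G \<longrightarrow> (AE x in M. f x = f' x) \<longrightarrow> (AE x in M. g x = g' x))"

definition densely_defined :: "'a measure \<Rightarrow> (('a \<Rightarrow> real) \<times> ('a \<Rightarrow> real)) set \<Rightarrow> bool" where
  "densely_defined M G \<longleftrightarrow> (\<forall>f \<in> L2 M. \<exists>u. (\<forall>k. u k \<in> Domain G) \<and> L2_lim M u f)"

definition adjoint_graph ::
    "'a measure \<Rightarrow> (('a \<Rightarrow> real) \<times> ('a \<Rightarrow> real)) set \<Rightarrow> (('a \<Rightarrow> real) \<times> ('a \<Rightarrow> real)) set" where
  "adjoint_graph M G = {(g, h). g \<in> L2 M \<and> h \<in> L2 M \<and> (\<forall>(f, k) \<in> G. ip M k g = ip M f h)}"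

text \<open>Equality of \<open>G\<close> with its adjoint makes \<open>G\<close> saturated under almost everywhere equality, so that
  equality of selfadjoint operators is plain equality of graphs.\<close>

definition selfadjoint :: "'a measure \<Rightarrow> (('a \<Rightarrow> real) \<times> ('a \<Rightarrow> real)) set \<Rightarrow> bool" where
  "selfadjoint M G \<longleftrightarrow> operator_graph M G \<and> densely_defined M G \<and> adjoint_graph M G = G"

text \<open>The domain of the closure of the quadratic form $f \mapsto \langle Gf,f\rangle$ of a nonnegative
  selfadjoint operator.\<close>

definition form_domain :: "'a measure \<Rightarrow> (('a \<Rightarrow> real) \<times> ('a \<Rightarrow> real)) set \<Rightarrow> ('a \<Rightarrow> real) set" where
  "form_domain M G = {f. \<exists>u v. (\<forall>k. (u k, v k) \<in> G) \<and> L2_lim M u f \<and>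
     (\<forall>e>0. \<exists>K. \<forall>k\<ge>K. \<forall>l\<ge>K.
        \<bar>ip M (\<lambda>x. v k x - v l x) (\<lambda>x. u k x - u l x)\<bar> < e)}"

text \<open>The counting number operator $\sum_n a_n\phi_n \mapsto \sum_n n a_n\phi_n$, both series converging in
  $L^2(\beta)$. Since the $\phi_n$ are orthogonal and nonzero, the coefficients are determined by the
  function, and \<open>number_op f\<close> is determined almost everywhere for \<open>f\<close> in the domain of the graph.\<close>

definition number_graph :: "((real \<Rightarrow> real) \<times> (real \<Rightarrow> real)) set" where
  "number_graph = {(f, g). \<exists>a :: nat \<Rightarrow> real.
      L2_lim beta (\<lambda>k x. \<Sum>n<k. a n * phi n x) f \<and>
      L2_lim beta (\<lambda>k x. \<Sum>n<k. real n * a n * phi n x) g}"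

definition number_op :: "(real \<Rightarrow> real) \<Rightarrow> real \<Rightarrow> real" where
  "number_op f = (SOME g. (f, g) \<in> number_graph)"

definition L_op :: "(real \<Rightarrow> real) \<Rightarrow> real \<Rightarrow> real" where
  "L_op f = number_op (number_op f)"

definition L_graph :: "((real \<Rightarrow> real) \<times> (real \<Rightarrow> real)) set" where
  "L_graph = {(f, L_op f) | f. Ck 2 f}"

text \<open>Infinitesimal invariance of \<open>M\<close> for an operator with domain \<open>D\<close>.\<close>

definition invariant_measure ::
    "'a measure \<Rightarrow> (('a \<Rightarrow> real) \<Rightarrow> 'a \<Rightarrow> real) \<Rightarrow> ('a \<Rightarrow> real) set \<Rightarrow> bool" where
  "invariant_measure M T D \<longleftrightarrow> (\<forall>f \<in> D. integrable M (T f) \<and> (\<integral>x. T f x \<partial>M) = 0)"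

text \<open>The functions in \<open>H_space\<close> have (continuous versions with) value \<open>0\<close> at \<open>-2\<close>, so \<open>H_space\<close> does
  not contain the nonzero constants. A function \<open>g\<close> in \<open>L2 alpha\<close> is integrable on \<open>{-2..2}\<close>.\<close>

definition H_space :: "(real \<Rightarrow> real) set" where
  "H_space = {f \<in> L2 beta. \<exists>g \<in> L2 alpha. AE x in beta. f x = (LINT y:{-2..x}|lborel. g y)}"


subsection \<open>Signed measures\<close>

definition signed_measure :: "'a measure \<Rightarrow> ('a set \<Rightarrow> real) \<Rightarrow> bool" where
  "signed_measure M \<nu> \<longleftrightarrow> (\<forall>A :: nat \<Rightarrow> 'a set. range A \<subseteq> sets M \<longrightarrow> disjoint_family A \<longrightarrow>
     (\<lambda>i. \<nu> (A i)) sums \<nu> (\<Union>i. A i))"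

definition total_variation :: "'a measure \<Rightarrow> ('a set \<Rightarrow> real) \<Rightarrow> 'a set \<Rightarrow> ennreal" where
  "total_variation M \<nu> A =
     (SUP F \<in> {F. finite F \<and> F \<subseteq> sets M \<and> disjoint F \<and> \<Union>F \<subseteq> A}. ennreal (\<Sum>B\<in>F. \<bar>\<nu> B\<bar>))"

definition finite_signed_measure :: "'a measure \<Rightarrow> ('a set \<Rightarrow> real) \<Rightarrow> bool" where
  "finite_signed_measure M \<nu> \<longleftrightarrow> signed_measure M \<nu> \<and> total_variation M \<nu> (space M) < \<infinity>"

text \<open>Jordan decomposition $\nu^\pm = (|\nu| \pm \nu)/2$.\<close>

definition pos_variation :: "'a measure \<Rightarrow> ('a set \<Rightarrow> real) \<Rightarrow> 'a measure" where
  "pos_variation M \<nu> = measure_of (space M) (sets M)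
     (\<lambda>A. ennreal ((enn2real (total_variation M \<nu> A) + \<nu> A) / 2))"

definition neg_variation :: "'a measure \<Rightarrow> ('a set \<Rightarrow> real) \<Rightarrow> 'a measure" where
  "neg_variation M \<nu> = measure_of (space M) (sets M)
     (\<lambda>A. ennreal ((enn2real (total_variation M \<nu> A) - \<nu> A) / 2))"

definition signed_integral :: "'a measure \<Rightarrow> ('a set \<Rightarrow> real) \<Rightarrow> ('a \<Rightarrow> real) \<Rightarrow> real" where
  "signed_integral M \<nu> f = (\<integral>x. f x \<partial>pos_variation M \<nu>) - (\<integral>x. f x \<partial>neg_variation M \<nu>)"


subsection \<open>Logarithmic energy\<close>

definition prob_measures :: "real measure set" where
  "prob_measures = {\<mu>. prob_space \<mu> \<and> sets \<mu> = sets (restrict_space borel I2)}"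

text \<open>The energy may be $+\infty$; in particular the kernel has to be $+\infty$ on the diagonal, so that
  measures with atoms have infinite energy (whereas \<open>ln 0 = 0\<close>). The negative part of
  the kernel is bounded on the square.\<close>

definition neg_log :: "real \<Rightarrow> ereal" where
  "neg_log r = (if r = 0 then \<infinity> else ereal (- ln \<bar>r\<bar>))"

definition log_energy :: "real measure \<Rightarrow> ereal" where
  "log_energy \<mu> =
     enn2ereal (\<integral>\<^sup>+(x, y). e2ennreal (neg_log (x - y)) \<partial>(\<mu> \<Otimes>\<^sub>M \<mu>))
     - enn2ereal (\<integral>\<^sup>+(x, y). e2ennreal (- neg_log (x - y)) \<partial>(\<mu> \<Otimes>\<^sub>M \<mu>))"

definition energy :: "(real \<Rightarrow> real) \<Rightarrow> real measure \<Rightarrow> ereal" where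
  "energy V \<mu> = ereal (\<integral>x. V x \<partial>\<mu>) + log_energy \<mu>"

definition min_energy :: "(real \<Rightarrow> real) \<Rightarrow> ereal" where
  "min_energy V = (INF \<mu> \<in> prob_measures. energy V \<mu>)"

definition is_minimizer :: "(real \<Rightarrow> real) \<Rightarrow> real measure \<Rightarrow> bool" where
  "is_minimizer V \<mu> \<longleftrightarrow> \<mu> \<in> prob_measures \<and> (\<forall>\<nu> \<in> prob_measures. energy V \<mu> \<le> energy V \<nu>)"

definition supp :: "real measure \<Rightarrow> real set" where
  "supp \<mu> = {x \<in> space \<mu>. \<forall>U. open U \<longrightarrow> x \<in> U \<longrightarrow> 0 < emeasure \<mu> (U \<inter> space \<mu>)}"

end

theory Submission
  imports Defs
begin

text \<open>
  Substituting $x=2\cos t$ turns \<open>beta\<close> into the uniform law on the circle and $\phi_n$ into $\cos nt$.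
  In this picture the logarithmic potential is the Fourier multiplier $1/n$ and $\mathcal{N}$ is the
  multiplier $n$; the six claims say this on the level of functions, forms and measures.

  \<^emph>\<open>The potential.\<close> The expansion $\log|x-y| = -\sum_{n\ge1}\frac2n\phi_n(x)\phi_n(y)$ is used through
  its Abel means, which have the closed form \<open>abel_log\<close>. For radii $r\ge\frac12$ these lie between
  $\log|x-y|-\log 2$ and $\log 4$ (\<open>abel_log_bounds\<close>), so dominated convergence gives the eigenvalue equation
  \<open>E_op_phi\<close>. The equation \<open>N_op_phi\<close> is algebra: the difference quotients of $\phi_n$ integrate to
  $\psi_n=\frac12U_{n-1}(x/2)$, where $\phi_n'=n\psi_n$ and $(4-x^2)\psi_n=\phi_{n-1}-\phi_{n+1}$.
  The other identities for \<open>E_op\<close> and \<open>N_op\<close> are linear, so they extend from the $\phi_n$ by density. For $C^2$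
  functions the extension needs that $\mathcal{N}$ is continuous from the $C^2$ norm to the supremum
  norm (\<open>N_op_approx\<close>) and that the potential of a $C^2$ function is $C^2$. The second fact holds
  because the derivative of the potential of a polynomial is the integral of its difference quotients,
  whose own slopes are bounded by the second derivative (\<open>quot_diff_le\<close>).

  \<^emph>\<open>The forms.\<close> The weight of \<open>omega\<close> divided by $(x-y)^2$ is an exact derivative in \<open>y\<close>, so one
  integration by parts removes the singularity and yields \<open>omega_form_phi\<close>. A $C^1$ function is in
  the domain of the counting number operator since $\|\mathcal{N}p\|^2=2\int p'^2\,d\alpha$ for
  polynomials (\<open>number_norm_poly\<close>). The square of $\mathcal{N}$ is the Jacobi operator because that
  operator, integrated by parts, multiplies Chebyshev coefficients by $n^2$ (\<open>ip_jacobi_phi\<close>). Its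
  selfadjoint extension is multiplication of coefficients by $n^2$ on the maximal domain: testing
  against the $\phi_n$ alone forces every selfadjoint extension into this graph
  (\<open>selfadjoint_extension_unique\<close>). The form domain consists of the functions with
  $\sum_n n^2\langle f,\phi_n\rangle^2<\infty$, and these are the ones with a weak derivative in
  $L^2(\alpha)$ because the derivatives $n\psi_n$ of the $\phi_n$ are orthogonal there.

  \<^emph>\<open>Measures.\<close> If $2\int\log|x-y|\,\mu(dy)=V(x)+C$ almost everywhere, then integrating both
  sides against $\phi_n$ and exchanging the integrals determines the Chebyshev moments of $\mu$, hence
  $\mu$; conversely $\mathcal{E}\mathcal{N}V=V-\int V\,d\beta$ produces the potential of the
  stated density (\<open>signed_log_potential\<close>). For an energy minimizer with full support, the
  Euler--Lagrange condition (\<open>minimizer_potential\<close>) identifies its potential \<open>beta\<close>-almost everywhere,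
  and integrating this against $\mathcal{N}V$ gives $\int V\,d\mu$ and with it the minimal energy
  (\<open>min_energy_eq\<close>).
\<close>


section \<open>Square integrable functions with respect to a finite measure\<close>

lemma L2_D:
  assumes "f \<in> L2 M"
  shows "f \<in> borel_measurable M" "integrable M (\<lambda>x. (f x)\<^sup>2)"
  using assms by (auto simp: L2_def)

lemma L2_integrable_mult:
  assumes "f \<in> L2 M" "g \<in> L2 M"
  shows "integrable M (\<lambda>x. f x * g x)"
proof (rule Bochner_Integration.integrable_bound)
  show "integrable M (\<lambda>x. (f x)\<^sup>2 + (g x)\<^sup>2)"
    using assms by (simp add: L2_D)
  show "(\<lambda>x. f x * g x) \<in> borel_measurable M"
    using assms[THEN L2_D(1)] by simp
  have "\<bar>a * b\<bar> \<le> a\<^sup>2 + b\<^sup>2" for a b :: real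
  proof -
    have "2 * (\<bar>a\<bar> * \<bar>b\<bar>) \<le> a\<^sup>2 + b\<^sup>2" "0 \<le> \<bar>a\<bar> * \<bar>b\<bar>"
      using sum_squares_bound[of "\<bar>a\<bar>" "\<bar>b\<bar>"] by (simp_all add: mult.assoc)
    then show ?thesis unfolding abs_mult by linarith
  qed
  then show "AE x in M. norm (f x * g x) \<le> norm ((f x)\<^sup>2 + (g x)\<^sup>2)"
    by (simp add: abs_mult)
qed

lemma L2_add: "f \<in> L2 M \<Longrightarrow> g \<in> L2 M \<Longrightarrow> (\<lambda>x. f x + g x) \<in> L2 M"
  using L2_integrable_mult[of f M g] by (auto simp: L2_def power2_sum mult.assoc)

lemma L2_cmult: "f \<in> L2 M \<Longrightarrow> (\<lambda>x. c * f x) \<in> L2 M"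
  by (auto simp: L2_def power_mult_distrib)

lemma L2_diff: "f \<in> L2 M \<Longrightarrow> g \<in> L2 M \<Longrightarrow> (\<lambda>x. f x - g x) \<in> L2 M"
  using L2_add[of f M "\<lambda>x. (-1) * g x"] L2_cmult[of g M "-1"] by simp

lemma L2_abs:
  assumes "f \<in> L2 M" shows "(\<lambda>x. \<bar>f x\<bar>) \<in> L2 M"
proof -
  have [measurable]: "f \<in> borel_measurable M" using assms by (rule L2_D)
  show ?thesis using L2_D(2)[OF assms] by (simp add: L2_def)
qed

lemma L2_zero: "(\<lambda>x. 0) \<in> L2 M"
  by (simp add: L2_def)

lemma L2_sum: "(\<And>i. i \<in> I \<Longrightarrow> f i \<in> L2 M) \<Longrightarrow> (\<lambda>x. \<Sum>i\<in>I. f i x) \<in> L2 M"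
  by (induction I rule: infinite_finite_induct) (auto intro: L2_add L2_zero)

lemma ip_commute: "ip M f g = ip M g f"
  by (simp add: ip_def mult.commute)

lemma ip_add_left:
  "f \<in> L2 M \<Longrightarrow> g \<in> L2 M \<Longrightarrow> h \<in> L2 M \<Longrightarrow> ip M (\<lambda>x. f x + g x) h = ip M f h + ip M g h"
  by (simp add: ip_def distrib_right L2_integrable_mult)

lemma ip_diff_left:
  "f \<in> L2 M \<Longrightarrow> g \<in> L2 M \<Longrightarrow> h \<in> L2 M \<Longrightarrow> ip M (\<lambda>x. f x - g x) h = ip M f h - ip M g h"
  by (simp add: ip_def left_diff_distrib L2_integrable_mult)

lemma ip_cmult_left: "ip M (\<lambda>x. c * f x) h = c * ip M f h"
  by (simp add: ip_def mult.assoc)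

lemma ip_zero_left: "ip M (\<lambda>x. 0) h = 0"
  by (simp add: ip_def)

lemma ip_sum_left:
  "(\<And>i. i \<in> I \<Longrightarrow> f i \<in> L2 M) \<Longrightarrow> h \<in> L2 M \<Longrightarrow>
    ip M (\<lambda>x. \<Sum>i\<in>I. f i x) h = (\<Sum>i\<in>I. ip M (f i) h)"
  by (induction I rule: infinite_finite_induct) (auto simp: ip_add_left L2_sum ip_zero_left)

lemma ip_add_right:
  "f \<in> L2 M \<Longrightarrow> g \<in> L2 M \<Longrightarrow> h \<in> L2 M \<Longrightarrow> ip M h (\<lambda>x. f x + g x) = ip M h f + ip M h g"
  by (simp add: ip_commute[of M h] ip_add_left)

lemma ip_diff_right:
  "f \<in> L2 M \<Longrightarrow> g \<in> L2 M \<Longrightarrow> h \<in> L2 M \<Longrightarrow> ip M h (\<lambda>x. f x - g x) = ip M h f - ip M h g"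
  by (simp add: ip_commute[of M h] ip_diff_left)

lemma ip_cmult_right: "ip M h (\<lambda>x. c * f x) = c * ip M h f"
  by (simp add: ip_commute[of M h] ip_cmult_left)

lemma ip_sum_right:
  "(\<And>i. i \<in> I \<Longrightarrow> f i \<in> L2 M) \<Longrightarrow> h \<in> L2 M \<Longrightarrow>
    ip M h (\<lambda>x. \<Sum>i\<in>I. f i x) = (\<Sum>i\<in>I. ip M h (f i))"
  by (simp add: ip_commute[of M h] ip_sum_left)

lemma ip_self: "ip M f f = (\<integral>x. (f x)\<^sup>2 \<partial>M)"
  by (simp add: ip_def power2_eq_square)

lemma ip_self_nonneg: "0 \<le> ip M f f"
  by (simp add: ip_self)

lemma ip_cong_AE:
  assumes "f \<in> borel_measurable M" "f' \<in> borel_measurable M"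
    "g \<in> borel_measurable M" "g' \<in> borel_measurable M"
    "AE x in M. f x = f' x" "AE x in M. g x = g' x"
  shows "ip M f g = ip M f' g'"
  unfolding ip_def using assms by (intro integral_cong_AE) auto

lemma ip_self_diff_le:
  assumes "f \<in> L2 M" "g \<in> L2 M"
  shows "ip M (\<lambda>x. f x - g x) (\<lambda>x. f x - g x) \<le> 2 * ip M f f + 2 * ip M g g"
proof -
  have "0 \<le> ip M (\<lambda>x. f x + g x) (\<lambda>x. f x + g x)" by (rule ip_self_nonneg)
  then show ?thesis using assms
    by (simp add: ip_add_left ip_add_right ip_diff_left ip_diff_right L2_add L2_diff ip_commute[of M g f])
qed

lemma ip_self_add_le:
  assumes "f \<in> L2 M" "g \<in> L2 M"
  shows "ip M (\<lambda>x. f x + g x) (\<lambda>x. f x + g x) \<le> 2 * ip M f f + 2 * ip M g g"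
  using ip_self_diff_le[OF assms(1) L2_cmult[OF assms(2), of "-1"]]
    ip_cmult_left[of M "-1" g "\<lambda>x. - g x"] ip_cmult_right[of M g "-1" g] by simp

lemma Cauchy_Schwarz_ip:
  assumes f: "f \<in> L2 M" and g: "g \<in> L2 M"
  shows "(ip M f g)\<^sup>2 \<le> ip M f f * ip M g g"
proof -
  define a b c where "a = ip M f f" "b = ip M f g" "c = ip M g g"
  have nn: "0 \<le> a - 2 * t * b + t\<^sup>2 * c" for t
  proof -
    have "0 \<le> ip M (\<lambda>x. f x - t * g x) (\<lambda>x. f x - t * g x)"
      by (rule ip_self_nonneg)
    also have "\<dots> = a - 2 * t * b + t\<^sup>2 * c"
      using f g by (simp add: a_b_c_def ip_diff_left ip_diff_right ip_cmult_left ip_cmult_right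
          L2_cmult L2_diff ip_commute[of M g f] algebra_simps power2_eq_square)
    finally show ?thesis .
  qed
  have c: "0 \<le> c" by (simp add: a_b_c_def ip_self_nonneg)
  have "b\<^sup>2 \<le> a * c"
  proof (cases "c = 0")
    case True
    have "b = 0"
    proof (rule ccontr)
      assume "b \<noteq> 0"
      then show False using nn[of "(a + 1) / (2 * b)"] True by (simp add: field_simps)
    qed
    then show ?thesis using True by simp
  next
    case False
    have "0 \<le> a - 2 * (b / c) * b + (b / c)\<^sup>2 * c" by (rule nn)
    also have "\<dots> = a - b\<^sup>2 / c" using False by (simp add: field_simps power2_eq_square)
    finally show ?thesis using c False by (simp add: field_simps)
  qed
  then show ?thesis by (simp add: a_b_c_def)
qed

lemma tendsto_zero_square_bound:
  fixes a b :: "nat \<Rightarrow> real"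
  assumes "\<And>k. (a k)\<^sup>2 \<le> b k" "b \<longlonglongrightarrow> 0"
  shows "a \<longlonglongrightarrow> 0"
proof (rule Lim_null_comparison)
  show "(\<lambda>k. sqrt (b k)) \<longlonglongrightarrow> 0" using tendsto_real_sqrt[OF assms(2)] by simp
  show "\<forall>\<^sub>F k in sequentially. norm (a k) \<le> sqrt (b k)"
    using assms(1) real_le_rsqrt by (auto simp: abs_le_iff intro!: real_le_rsqrt)
qed

lemma L2_limD:
  assumes "L2_lim M u f"
  shows "u k \<in> L2 M" "f \<in> L2 M" "(\<lambda>k. ip M (\<lambda>x. u k x - f x) (\<lambda>x. u k x - f x)) \<longlonglongrightarrow> 0"
  using assms by (auto simp: L2_lim_def ip_self)

lemma L2_limI:
  assumes "\<And>k. u k \<in> L2 M" "f \<in> L2 M" "(\<lambda>k. ip M (\<lambda>x. u k x - f x) (\<lambda>x. u k x - f x)) \<longlonglongrightarrow> 0"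
  shows "L2_lim M u f"
  using assms by (auto simp: L2_lim_def ip_self)

lemma L2_lim_const: "f \<in> L2 M \<Longrightarrow> L2_lim M (\<lambda>k. f) f"
  by (simp add: L2_lim_def)

lemma L2_lim_ip:
  assumes u: "L2_lim M u f" and v: "L2_lim M v g"
  shows "(\<lambda>k. ip M (u k) (v k)) \<longlonglongrightarrow> ip M f g"
proof -
  note [simp] = L2_limD(1,2)[OF u] L2_limD(1,2)[OF v]
  let ?a = "\<lambda>k. ip M (\<lambda>x. u k x - f x) (\<lambda>x. u k x - f x)"
  let ?b = "\<lambda>k. ip M (\<lambda>x. v k x - g x) (\<lambda>x. v k x - g x)"
  have a: "?a \<longlonglongrightarrow> 0" and b: "?b \<longlonglongrightarrow> 0"
    using u v by (simp_all add: L2_limD)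
  have 1: "(\<lambda>k. ip M (\<lambda>x. u k x - f x) (\<lambda>x. v k x - g x)) \<longlonglongrightarrow> 0"
    by (rule tendsto_zero_square_bound[where b = "\<lambda>k. ?a k * ?b k"])
      (use tendsto_mult[OF a b] in \<open>auto intro!: Cauchy_Schwarz_ip L2_diff\<close>)
  have 2: "(\<lambda>k. ip M (\<lambda>x. u k x - f x) g) \<longlonglongrightarrow> 0"
    by (rule tendsto_zero_square_bound[where b = "\<lambda>k. ?a k * ip M g g"])
      (use tendsto_mult_right[OF a, of "ip M g g"] in \<open>auto intro!: Cauchy_Schwarz_ip L2_diff\<close>)
  have 3: "(\<lambda>k. ip M f (\<lambda>x. v k x - g x)) \<longlonglongrightarrow> 0"
    by (rule tendsto_zero_square_bound[where b = "\<lambda>k. ip M f f * ?b k"])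
      (use tendsto_mult_left[OF b, of "ip M f f"] in \<open>auto intro!: Cauchy_Schwarz_ip L2_diff\<close>)
  have "(\<lambda>k. ip M (\<lambda>x. u k x - f x) (\<lambda>x. v k x - g x) + ip M (\<lambda>x. u k x - f x) g
      + ip M f (\<lambda>x. v k x - g x) + ip M f g) \<longlonglongrightarrow> 0 + 0 + 0 + ip M f g"
    by (intro tendsto_intros 1 2 3)
  then show ?thesis
    by (simp add: ip_diff_left ip_diff_right L2_diff)
qed

lemma L2_lim_ip_const: "L2_lim M u f \<Longrightarrow> g \<in> L2 M \<Longrightarrow> (\<lambda>k. ip M (u k) g) \<longlonglongrightarrow> ip M f g"
  by (rule L2_lim_ip[OF _ L2_lim_const])

lemma L2_lim_cmult:
  assumes "L2_lim M u f" shows "L2_lim M (\<lambda>k x. c * u k x) (\<lambda>x. c * f x)"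
proof (rule L2_limI)
  have "(\<lambda>k. c\<^sup>2 * ip M (\<lambda>x. u k x - f x) (\<lambda>x. u k x - f x)) \<longlonglongrightarrow> c\<^sup>2 * 0"
    using assms by (intro tendsto_intros L2_limD)
  then show "(\<lambda>k. ip M (\<lambda>x. c * u k x - c * f x) (\<lambda>x. c * u k x - c * f x)) \<longlonglongrightarrow> 0"
    by (simp add: right_diff_distrib[symmetric] ip_cmult_left ip_cmult_right power2_eq_square mult.assoc)
qed (use assms in \<open>auto intro: L2_cmult L2_limD\<close>)

lemma L2_lim_add:
  assumes u: "L2_lim M u f" and v: "L2_lim M v g"
  shows "L2_lim M (\<lambda>k x. u k x + v k x) (\<lambda>x. f x + g x)"
proof (rule L2_limI)
  note [simp] = L2_limD(1,2)[OF u] L2_limD(1,2)[OF v]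
  let ?d = "\<lambda>k x. u k x - f x" let ?e = "\<lambda>k x. v k x - g x"
  have "(\<lambda>k. 2 * ip M (?d k) (?d k) + 2 * ip M (?e k) (?e k)) \<longlonglongrightarrow> 2 * 0 + 2 * 0"
    using u v by (intro tendsto_intros L2_limD)
  then have lim: "(\<lambda>k. 2 * ip M (?d k) (?d k) + 2 * ip M (?e k) (?e k)) \<longlonglongrightarrow> 0" by simp
  show "(\<lambda>k. ip M (\<lambda>x. u k x + v k x - (f x + g x)) (\<lambda>x. u k x + v k x - (f x + g x))) \<longlonglongrightarrow> 0"
  proof (rule tendsto_sandwich[OF _ _ tendsto_const lim])
    show "\<forall>\<^sub>F k in sequentially. 0 \<le> ip M (\<lambda>x. u k x + v k x - (f x + g x)) (\<lambda>x. u k x + v k x - (f x + g x))"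
      by (simp add: ip_self_nonneg)
    have "ip M (\<lambda>x. u k x + v k x - (f x + g x)) (\<lambda>x. u k x + v k x - (f x + g x))
        \<le> 2 * ip M (?d k) (?d k) + 2 * ip M (?e k) (?e k)" for k
    proof -
      have eq: "(\<lambda>x. u k x + v k x - (f x + g x)) = (\<lambda>x. ?d k x + ?e k x)" by auto
      show ?thesis unfolding eq by (intro ip_self_add_le L2_diff) simp_all
    qed
    then show "\<forall>\<^sub>F k in sequentially. ip M (\<lambda>x. u k x + v k x - (f x + g x)) (\<lambda>x. u k x + v k x - (f x + g x))
        \<le> 2 * ip M (?d k) (?d k) + 2 * ip M (?e k) (?e k)" by simp
  qed
qed (use assms in \<open>auto intro: L2_add L2_limD\<close>)

lemma L2_lim_diff:
  "L2_lim M u f \<Longrightarrow> L2_lim M v g \<Longrightarrow> L2_lim M (\<lambda>k x. u k x - v k x) (\<lambda>x. f x - g x)"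
  using L2_lim_add[of M u f "\<lambda>k x. (-1) * v k x" "\<lambda>x. (-1) * g x"] L2_lim_cmult[of M v g "-1"]
  by simp

lemma ip_self_eq_0_AE: "f \<in> L2 M \<Longrightarrow> ip M f f = 0 \<Longrightarrow> AE x in M. f x = 0"
  using integral_nonneg_eq_0_iff_AE[of M "\<lambda>x. (f x)\<^sup>2"] by (simp add: ip_self L2_D)

lemma L2_lim_unique:
  assumes "L2_lim M u f" "L2_lim M u g"
  shows "AE x in M. f x = g x"
proof -
  have l: "L2_lim M (\<lambda>k x. 0) (\<lambda>x. f x - g x)"
    using L2_lim_diff[OF assms] by simp
  have "ip M (\<lambda>x. f x - g x) (\<lambda>x. f x - g x) = 0"
    using LIMSEQ_unique[OF L2_lim_ip[OF l l]] by (simp add: ip_zero_left)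
  then show ?thesis using ip_self_eq_0_AE[OF L2_limD(2)[OF l]] by simp
qed

lemma L2_lim_Cauchy:
  assumes u: "L2_lim M u f" and e: "0 < e"
  shows "\<exists>K. \<forall>k\<ge>K. \<forall>l\<ge>K. ip M (\<lambda>x. u k x - u l x) (\<lambda>x. u k x - u l x) < e"
proof -
  let ?d = "\<lambda>k x. u k x - f x"
  note [simp] = L2_limD(1,2)[OF u]
  have "\<forall>\<^sub>F k in sequentially. ip M (?d k) (?d k) < e / 4"
    using L2_limD(3)[OF u] e by (intro order_tendstoD(2)) auto
  then obtain K where K: "\<And>k. k \<ge> K \<Longrightarrow> ip M (?d k) (?d k) < e / 4"
    by (auto simp: eventually_sequentially)
  have "ip M (\<lambda>x. u k x - u l x) (\<lambda>x. u k x - u l x) < e" if "k \<ge> K" "l \<ge> K" for k l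
  proof -
    have eq: "(\<lambda>x. u k x - u l x) = (\<lambda>x. ?d k x - ?d l x)" by auto
    have "ip M (\<lambda>x. ?d k x - ?d l x) (\<lambda>x. ?d k x - ?d l x)
        \<le> 2 * ip M (?d k) (?d k) + 2 * ip M (?d l) (?d l)"
      by (intro ip_self_diff_le L2_diff) simp_all
    then show ?thesis using K[OF that(1)] K[OF that(2)] unfolding eq by linarith
  qed
  then show ?thesis by blast
qed

context finite_measure
begin

lemma bounded_integrable:
  fixes f :: "'a \<Rightarrow> real"
  assumes "f \<in> borel_measurable M" "\<And>x. x \<in> space M \<Longrightarrow> \<bar>f x\<bar> \<le> B"
  shows "integrable M f"
  using assms by (intro integrable_const_bound[where B = B]) auto

lemma bounded_L2:
  assumes "f \<in> borel_measurable M" "\<And>x. x \<in> space M \<Longrightarrow> \<bar>f x\<bar> \<le> B"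
  shows "f \<in> L2 M"
proof -
  have "(f x)\<^sup>2 \<le> B\<^sup>2" if "x \<in> space M" for x
    using power_mono[OF assms(2)[OF that] abs_ge_zero, of 2] by simp
  then show ?thesis
    unfolding L2_def using assms(1) by (auto intro!: bounded_integrable[where B = "B\<^sup>2"])
qed

lemma L2_integrable: "f \<in> L2 M \<Longrightarrow> integrable M f"
  by (rule square_integrable_imp_integrable) (simp_all add: L2_D)

lemma L2_lim_uniform:
  assumes u: "\<And>k. u k \<in> L2 M" and f: "f \<in> L2 M" and e: "e \<longlonglongrightarrow> 0"
    and bound: "\<And>k x. x \<in> space M \<Longrightarrow> \<bar>u k x - f x\<bar> \<le> e k"
  shows "L2_lim M u f"
proof (rule L2_limI[OF u f])
  have lim: "(\<lambda>k. (e k)\<^sup>2 * measure M (space M)) \<longlonglongrightarrow> 0"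
    using tendsto_mult_right[OF tendsto_power[OF e, of 2], of "measure M (space M)"] by simp
  have "ip M (\<lambda>x. u k x - f x) (\<lambda>x. u k x - f x) \<le> (e k)\<^sup>2 * measure M (space M)" for k
  proof -
    have "(\<integral>x. (u k x - f x)\<^sup>2 \<partial>M) \<le> (\<integral>x. (e k)\<^sup>2 \<partial>M)"
      using L2_D(2)[OF L2_diff[OF u f]] bound[of _ k]
      by (intro integral_mono) (auto simp: abs_le_square_iff[symmetric] intro: order_trans[OF _ abs_ge_self])
    then show ?thesis by (simp add: ip_self mult.commute)
  qed
  then show "(\<lambda>k. ip M (\<lambda>x. u k x - f x) (\<lambda>x. u k x - f x)) \<longlonglongrightarrow> 0"
    by (intro tendsto_sandwich[OF _ _ tendsto_const lim]) (auto simp: ip_self_nonneg)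
qed

text \<open>Riesz--Fischer: a subsequence whose successive $L^2$ distances are summable has $L^1$-summable
  increments and therefore converges almost everywhere; Fatou's lemma turns the pointwise limit into
  the $L^2$ limit of the whole sequence.\<close>

lemma L2_complete:
  assumes u: "\<And>k. u k \<in> L2 M"
    and Cauchy: "\<And>e. 0 < e \<Longrightarrow> \<exists>K. \<forall>k\<ge>K. \<forall>l\<ge>K. ip M (\<lambda>x. u k x - u l x) (\<lambda>x. u k x - u l x) < e"
  shows "\<exists>f. L2_lim M u f"
proof -
  have [measurable]: "u k \<in> borel_measurable M" for k using u by (simp add: L2_D)
  have "\<exists>K. \<forall>k\<ge>K. \<forall>l\<ge>K. ip M (\<lambda>x. u k x - u l x) (\<lambda>x. u k x - u l x) < (1/4)^j" for j :: nat
    by (rule Cauchy) simp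
  then obtain K where K: "\<And>j k l. k \<ge> K j \<Longrightarrow> l \<ge> K j \<Longrightarrow>
      ip M (\<lambda>x. u k x - u l x) (\<lambda>x. u k x - u l x) < (1/4)^j" by metis
  define r where "r j = j + (\<Sum>i\<le>j. K i)" for j
  have rK: "r j \<ge> K j" for j
    unfolding r_def using member_le_sum[of j "{..j}" K] by simp
  have rK': "r (Suc j) \<ge> K j" for j
    unfolding r_def using member_le_sum[of j "{..Suc j}" K] by simp
  have rj: "r j \<ge> j" for j by (simp add: r_def)
  define d where "d j x = u (r (Suc j)) x - u (r j) x" for j x
  have d2: "d j \<in> L2 M" for j unfolding d_def by (intro L2_diff u)
  have [measurable]: "d j \<in> borel_measurable M" for j using d2 by (simp add: L2_D)
  define C where "C = sqrt (measure M (space M))"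
  \<comment> \<open>Cauchy--Schwarz against the constant 1; the total mass is finite.\<close>
  have int_d: "(\<integral>x. \<bar>d j x\<bar> \<partial>M) \<le> C * (1/2)^j" for j
  proof -
    have "(ip M (\<lambda>x. \<bar>d j x\<bar>) (\<lambda>x. 1))\<^sup>2 \<le> ip M (\<lambda>x. \<bar>d j x\<bar>) (\<lambda>x. \<bar>d j x\<bar>) * ip M (\<lambda>x. 1) (\<lambda>x. 1)"
      using d2[of j] by (intro Cauchy_Schwarz_ip) (auto simp: L2_def)
    also have "\<dots> = ip M (d j) (d j) * measure M (space M)" by (simp add: ip_def)
    also have "\<dots> \<le> (1/4)^j * measure M (space M)"
      using K[OF rK' rK, of j] by (intro mult_right_mono) (auto simp: d_def[abs_def] less_imp_le)
    also have "\<dots> = (C * (1/2)^j)\<^sup>2"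
    proof -
      have "(1/4 :: real)^j = ((1/2)^j)\<^sup>2" by (simp add: power2_eq_square power_mult_distrib[symmetric])
      then show ?thesis by (simp add: C_def power_mult_distrib)
    qed
    finally have "\<bar>ip M (\<lambda>x. \<bar>d j x\<bar>) (\<lambda>x. 1)\<bar> \<le> \<bar>C * (1/2)^j\<bar>"
      by (simp only: abs_le_square_iff)
    then show ?thesis by (simp add: ip_def C_def)
  qed
  have dint: "integrable M (\<lambda>x. \<bar>d j x\<bar>)" for j using L2_integrable[OF d2] by simp
  have "(\<integral>\<^sup>+x. (\<Sum>j. ennreal \<bar>d j x\<bar>) \<partial>M) = (\<Sum>j. \<integral>\<^sup>+x. ennreal \<bar>d j x\<bar> \<partial>M)"
    by (intro nn_integral_suminf) simp
  also have "\<dots> \<le> (\<Sum>j. ennreal (C * (1/2)^j))"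
    using int_d dint by (intro suminf_le) (auto simp: nn_integral_eq_integral intro!: ennreal_leI)
  also have "\<dots> = ennreal (\<Sum>j. C * (1/2)^j)"
    by (intro suminf_ennreal2 summable_mult summable_geometric) (auto simp: C_def)
  finally have "(\<integral>\<^sup>+x. (\<Sum>j. ennreal \<bar>d j x\<bar>) \<partial>M) \<noteq> \<infinity>"
    by (metis ennreal_neq_top infinity_ennreal_def top_unique)
  then have "AE x in M. (\<Sum>j. ennreal \<bar>d j x\<bar>) \<noteq> \<infinity>"
    by (intro nn_integral_PInf_AE) auto
  then have conv: "AE x in M. convergent (\<lambda>j. u (r j) x)"
  proof (eventually_elim)
    case (elim x)
    have "summable (\<lambda>j. \<bar>d j x\<bar>)"
      using elim by (intro summable_suminf_not_top) auto
    then have "summable (\<lambda>j. d j x)" by (rule summable_rabs_cancel)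
    then have "convergent (\<lambda>n. (\<Sum>j<n. d j x))" by (simp add: summable_iff_convergent)
    moreover have "(\<Sum>j<n. d j x) = u (r n) x - u (r 0) x" for n
      by (simp add: d_def sum_lessThan_telescope[of "\<lambda>j. u (r j) x"])
    ultimately have "convergent (\<lambda>n. u (r n) x - u (r 0) x)" by simp
    from convergent_add[OF this convergent_const[of "u (r 0) x"]] show ?case by simp
  qed
  define f where "f x = lim (\<lambda>j. u (r j) x)" for x
  have [measurable]: "f \<in> borel_measurable M" unfolding f_def by measurable
  have lim: "AE x in M. (\<lambda>j. u (r j) x) \<longlonglongrightarrow> f x"
    using conv by eventually_elim (simp add: f_def convergent_LIMSEQ_iff)
  have nn: "(\<integral>\<^sup>+x. ennreal ((u k x - f x)\<^sup>2) \<partial>M) \<le> ennreal e"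
    if e: "\<And>l. l \<ge> N \<Longrightarrow> ip M (\<lambda>x. u k x - u l x) (\<lambda>x. u k x - u l x) \<le> e" for k N e
  proof -
    have "(\<integral>\<^sup>+x. ennreal ((u k x - f x)\<^sup>2) \<partial>M)
        = (\<integral>\<^sup>+x. liminf (\<lambda>j. ennreal ((u k x - u (r j) x)\<^sup>2)) \<partial>M)"
      using lim
    proof (intro nn_integral_cong_AE, eventually_elim)
      case (elim x)
      have "(\<lambda>j. ennreal ((u k x - u (r j) x)\<^sup>2)) \<longlonglongrightarrow> ennreal ((u k x - f x)\<^sup>2)"
        by (intro tendsto_ennrealI tendsto_intros elim)
      from lim_imp_Liminf[OF sequentially_bot this] show ?case by simp
    qed
    also have "\<dots> \<le> liminf (\<lambda>j. \<integral>\<^sup>+x. ennreal ((u k x - u (r j) x)\<^sup>2) \<partial>M)"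
      by (intro nn_integral_liminf) simp
    also have "\<dots> \<le> ennreal e"
    proof (rule Liminf_le)
      show "\<forall>\<^sub>F j in sequentially. (\<integral>\<^sup>+x. ennreal ((u k x - u (r j) x)\<^sup>2) \<partial>M) \<le> ennreal e"
        using eventually_ge_at_top[of N]
      proof eventually_elim
        case (elim j)
        have "(\<integral>\<^sup>+x. ennreal ((u k x - u (r j) x)\<^sup>2) \<partial>M) = ennreal (\<integral>x. (u k x - u (r j) x)\<^sup>2 \<partial>M)"
          by (intro nn_integral_eq_integral L2_D L2_diff u) simp
        then show ?case using e[of "r j"] elim rj[of j] by (simp add: ip_self ennreal_leI)
      qed
    qed simp
    finally show ?thesis .
  qed
  have sq: "(\<lambda>x. u k x - f x) \<in> L2 M \<and> ip M (\<lambda>x. u k x - f x) (\<lambda>x. u k x - f x) \<le> e"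
    if e: "\<And>l. l \<ge> N \<Longrightarrow> ip M (\<lambda>x. u k x - u l x) (\<lambda>x. u k x - u l x) \<le> e" and "0 \<le> e" for k N e
  proof -
    have *: "(\<integral>\<^sup>+x. ennreal ((u k x - f x)\<^sup>2) \<partial>M) \<le> ennreal e" by (rule nn[OF e])
    have int: "integrable M (\<lambda>x. (u k x - f x)\<^sup>2)"
      using * by (intro integrableI_bounded) (auto intro: le_less_trans)
    have "ennreal (\<integral>x. (u k x - f x)\<^sup>2 \<partial>M) \<le> ennreal e"
      using * nn_integral_eq_integral[OF int] by simp
    then show ?thesis using int \<open>0 \<le> e\<close> by (simp add: L2_def ip_self)
  qed
  obtain N where N: "\<And>k l. k \<ge> N \<Longrightarrow> l \<ge> N \<Longrightarrow> ip M (\<lambda>x. u k x - u l x) (\<lambda>x. u k x - u l x) < 1"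
    using Cauchy[of 1] by auto
  have "(\<lambda>x. u N x - f x) \<in> L2 M" using sq[of N N 1] N[of N] by (simp add: less_imp_le)
  from L2_diff[OF u[of N] this] have f: "f \<in> L2 M" by simp
  have "L2_lim M u f"
  proof (rule L2_limI[OF u f], rule LIMSEQ_I)
    fix e :: real assume "0 < e"
    then obtain N where N: "\<And>k l. k \<ge> N \<Longrightarrow> l \<ge> N \<Longrightarrow> ip M (\<lambda>x. u k x - u l x) (\<lambda>x. u k x - u l x) < e / 2"
      using Cauchy[of "e/2"] by auto
    have "norm (ip M (\<lambda>x. u k x - f x) (\<lambda>x. u k x - f x) - 0) < e" if "k \<ge> N" for k
      using sq[of N k "e/2"] N[OF that] \<open>0 < e\<close> ip_self_nonneg[of M "\<lambda>x. u k x - f x"]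
      by (auto simp: less_imp_le)
    then show "\<exists>no. \<forall>n\<ge>no. norm (ip M (\<lambda>x. u n x - f x) (\<lambda>x. u n x - f x) - 0) < e" by blast
  qed
  then show ?thesis by blast
qed

end


section \<open>Finite measures on the interval and density of polynomials\<close>

locale I2_measure = finite_measure M for M :: "real measure" +
  assumes sets_M: "sets M = sets (restrict_space borel I2)"
begin

lemma space_M: "space M = I2"
  using sets_eq_imp_space_eq[OF sets_M] by (simp add: space_restrict_space)

lemma continuous_measurable: "continuous_on I2 f \<Longrightarrow> f \<in> borel_measurable M"
  using borel_measurable_continuous_on_restrict[of I2 f] by (simp add: measurable_cong_sets[OF sets_M refl])

lemma borel_imp_measurable: "f \<in> borel_measurable borel \<Longrightarrow> f \<in> borel_measurable M"
  by (subst measurable_cong_sets[OF sets_M refl]) (rule measurable_restrict_space1)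

lemma continuous_L2:
  fixes f :: "real \<Rightarrow> real"
  assumes "continuous_on I2 f" shows "f \<in> L2 M"
proof -
  have "bounded (f ` I2)"
    by (intro compact_imp_bounded compact_continuous_image assms) simp
  then obtain B where "\<And>x. x \<in> I2 \<Longrightarrow> \<bar>f x\<bar> \<le> B" unfolding bounded_iff by force
  then show ?thesis using continuous_measurable[OF assms] by (intro bounded_L2) (auto simp: space_M)
qed

lemma poly_L2: "poly p \<in> L2 M"
  by (rule continuous_L2) (auto intro: continuous_intros)

text \<open>The half-lines are stable under intersection and generate the Borel sets, so a property that is
  stable under complements and disjoint unions need only be checked on them. Their
  indicators are pointwise limits of uniformly bounded polynomials.\<close>

lemma sets_induct [consumes 1, case_names basic empty compl union]:
  assumes A: "A \<in> sets M"
    and basic: "\<And>a. P (I2 \<inter> {a<..})"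
    and empty: "P {}"
    and compl: "\<And>A. A \<in> sets M \<Longrightarrow> P A \<Longrightarrow> P (I2 - A)"
    and union: "\<And>A::nat \<Rightarrow> real set. disjoint_family A \<Longrightarrow> range A \<subseteq> sets M \<Longrightarrow> (\<And>i. P (A i)) \<Longrightarrow> P (\<Union>i. A i)"
  shows "P A"
proof -
  let ?G = "range (\<lambda>a::real. I2 \<inter> {a<..})"
  have "sets M = sigma_sets I2 ((\<inter>) I2 ` range (\<lambda>a::real. {a<..}))"
  proof -
    have borel: "sets (borel :: real measure) = sigma_sets UNIV (range greaterThan)"
    proof -
      have "Collect (eucl_less a) = {a<..}" for a :: real by (auto simp: eucl_less_def)
      then show ?thesis by (subst borel_eq_greaterThan) (simp add: sets_measure_of)
    qed
    have "I2 \<in> sets (borel :: real measure)" by simp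
    then have "(\<inter>) I2 ` sigma_sets UNIV (range greaterThan) = sigma_sets I2 ((\<inter>) I2 ` range greaterThan)"
      unfolding borel by (rule sigma_sets_Int) simp
    then show ?thesis unfolding sets_M sets_restrict_space borel by simp
  qed
  then have eq: "sets M = sigma_sets I2 ?G" by (simp add: image_image)
  have "Int_stable ?G"
  proof (rule Int_stableI)
    fix A B assume "A \<in> ?G" "B \<in> ?G"
    then obtain a b where "A = I2 \<inter> {a<..}" "B = I2 \<inter> {b<..}" by auto
    then have "A \<inter> B = I2 \<inter> {max a b<..}" by auto
    then show "A \<inter> B \<in> ?G" by blast
  qed
  moreover have "?G \<subseteq> Pow I2" by auto
  moreover have "A \<in> sigma_sets I2 ?G" using A eq by simp
  ultimately show ?thesis
    by (induct rule: sigma_sets_induct_disjoint) (use assms eq in auto)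
qed

end

lemma Weierstrass_poly:
  fixes f :: "real \<Rightarrow> real"
  assumes "continuous_on {a..b} f" "0 < e"
  shows "\<exists>p. \<forall>x\<in>{a..b}. \<bar>f x - poly p x\<bar> < e"
proof -
  obtain g where g: "real_polynomial_function g" "\<And>x. x \<in> {a..b} \<Longrightarrow> \<bar>f x - g x\<bar> < e"
    using Stone_Weierstrass_real_polynomial_function[OF compact_Icc assms] by blast
  then obtain c n where "g = (\<lambda>x. \<Sum>i\<le>n. c i * x^i)"
    by (auto simp: real_polynomial_function_iff_sum)
  then have "g = poly (\<Sum>i\<le>n. monom (c i) i)" by (simp add: poly_sum poly_monom fun_eq_iff)
  then show ?thesis using g(2) by blast
qed

text \<open>Continuous ramps of slope \<open>k\<close> starting at \<open>a\<close> increase to the indicator; each is approximated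
  uniformly by a polynomial.\<close>

lemma poly_approx_indicator:
  fixes a :: real
  obtains p :: "nat \<Rightarrow> real poly"
    where "\<And>k x. x \<in> I2 \<Longrightarrow> \<bar>poly (p k) x\<bar> \<le> 2"
      and "\<And>x. x \<in> I2 \<Longrightarrow> (\<lambda>k. poly (p k) x) \<longlonglongrightarrow> indicator {a<..} x"
proof -
  define c where "c k x = min 1 (max 0 (real k * (x - a)))" for k x
  have "\<exists>p. \<forall>x\<in>I2. \<bar>c k x - poly p x\<bar> < 1 / real (Suc k)" for k
    by (rule Weierstrass_poly) (auto simp: c_def intro!: continuous_intros)
  then obtain p where p: "\<And>k x. x \<in> I2 \<Longrightarrow> \<bar>c k x - poly (p k) x\<bar> < 1 / real (Suc k)" by metis
  show ?thesis
  proof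
    fix k x assume "x \<in> I2"
    have "1 / real (Suc k) \<le> 1" by simp
    then have "\<bar>c k x - poly (p k) x\<bar> < 1" using p[OF \<open>x \<in> I2\<close>, of k] by linarith
    moreover have "\<bar>c k x\<bar> \<le> 1" by (auto simp: c_def)
    ultimately show "\<bar>poly (p k) x\<bar> \<le> 2" by linarith
  next
    fix x assume x: "x \<in> I2"
    have 1: "(\<lambda>k. poly (p k) x - c k x) \<longlonglongrightarrow> 0"
    proof (rule Lim_null_comparison)
      show "\<forall>\<^sub>F k in sequentially. norm (poly (p k) x - c k x) \<le> 1 / real (Suc k)"
        using p[OF x] by (auto simp: abs_minus_commute less_imp_le)
      show "(\<lambda>k. 1 / real (Suc k)) \<longlonglongrightarrow> 0" by (rule lim_inverse_n'[THEN LIMSEQ_Suc])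
    qed
    have 2: "(\<lambda>k. c k x) \<longlonglongrightarrow> indicator {a<..} x"
    proof (cases "a < x")
      case True
      obtain N :: nat where N: "1 < real N * (x - a)" using reals_Archimedean3[of "x - a"] True by auto
      have "c k x = 1" if "k \<ge> N" for k
      proof -
        have "real N * (x - a) \<le> real k * (x - a)" using that True by (intro mult_right_mono) auto
        then show ?thesis using N by (auto simp: c_def)
      qed
      then have "\<forall>\<^sub>F k in sequentially. c k x = 1" by (auto simp: eventually_sequentially)
      then show ?thesis using True by (simp add: tendsto_eventually)
    next
      case False
      then have "c k x = 0" for k using mult_nonneg_nonpos[of "real k" "x - a"] by (simp add: c_def)
      then show ?thesis using False by simp
    qed
    show "(\<lambda>k. poly (p k) x) \<longlonglongrightarrow> indicator {a<..} x"
      using tendsto_add[OF 1 2] by simp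
  qed
qed

context I2_measure
begin

definition poly_approx :: "(real \<Rightarrow> real) \<Rightarrow> bool" where
  "poly_approx f \<longleftrightarrow> (\<exists>p. L2_lim M (\<lambda>k. poly (p k)) f)"

lemma poly_approx_iff:
  "poly_approx f \<longleftrightarrow> f \<in> L2 M \<and> (\<forall>e>0. \<exists>p. ip M (\<lambda>x. poly p x - f x) (\<lambda>x. poly p x - f x) < e)"
proof safe
  assume "poly_approx f"
  then obtain p where p: "L2_lim M (\<lambda>k. poly (p k)) f" by (auto simp: poly_approx_def)
  then show "f \<in> L2 M" by (rule L2_limD)
  fix e :: real assume "0 < e"
  from order_tendstoD(2)[OF L2_limD(3)[OF p] this]
  have "\<exists>k. ip M (\<lambda>x. poly (p k) x - f x) (\<lambda>x. poly (p k) x - f x) < e"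
    by (auto simp: eventually_sequentially)
  then show "\<exists>p. ip M (\<lambda>x. poly p x - f x) (\<lambda>x. poly p x - f x) < e" by blast
next
  assume f: "f \<in> L2 M" and *: "\<forall>e>0. \<exists>p. ip M (\<lambda>x. poly p x - f x) (\<lambda>x. poly p x - f x) < e"
  have "\<exists>p. ip M (\<lambda>x. poly p x - f x) (\<lambda>x. poly p x - f x) < 1 / real (Suc k)" for k
    using * by simp
  then obtain p where p: "\<And>k. ip M (\<lambda>x. poly (p k) x - f x) (\<lambda>x. poly (p k) x - f x) < 1 / real (Suc k)" by metis
  have "L2_lim M (\<lambda>k. poly (p k)) f"
  proof (rule L2_limI[OF poly_L2 f])
    show "(\<lambda>k. ip M (\<lambda>x. poly (p k) x - f x) (\<lambda>x. poly (p k) x - f x)) \<longlonglongrightarrow> 0"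
      using p by (intro tendsto_sandwich[OF _ _ tendsto_const lim_inverse_n'[THEN LIMSEQ_Suc]])
        (auto simp: ip_self_nonneg less_imp_le)
  qed
  then show "poly_approx f" by (auto simp: poly_approx_def)
qed

lemma poly_approx_lim:
  assumes g: "\<And>k. poly_approx (g k)" and lim: "L2_lim M g f"
  shows "poly_approx f"
  unfolding poly_approx_iff
proof safe
  show f: "f \<in> L2 M" using lim by (rule L2_limD)
  fix e :: real assume "0 < e"
  then obtain k where k: "ip M (\<lambda>x. g k x - f x) (\<lambda>x. g k x - f x) < e / 4"
    using order_tendstoD(2)[OF L2_limD(3)[OF lim], of "e/4"] by (auto simp: eventually_sequentially)
  obtain p where p: "ip M (\<lambda>x. poly p x - g k x) (\<lambda>x. poly p x - g k x) < e / 4"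
    using g[of k] \<open>0 < e\<close> unfolding poly_approx_iff by (meson divide_pos_pos zero_less_numeral)
  let ?a = "\<lambda>x. poly p x - g k x" and ?b = "\<lambda>x. g k x - f x"
  have gk: "g k \<in> L2 M" using lim by (rule L2_limD)
  have ab: "?a \<in> L2 M" "?b \<in> L2 M" by (auto intro: L2_diff poly_L2 gk f)
  have "ip M (\<lambda>x. ?a x + ?b x) (\<lambda>x. ?a x + ?b x) \<le> 2 * ip M ?a ?a + 2 * ip M ?b ?b"
    by (rule ip_self_add_le[OF ab])
  then show "\<exists>p. ip M (\<lambda>x. poly p x - f x) (\<lambda>x. poly p x - f x) < e"
    using k p by (intro exI[of _ p]) simp
qed

lemma poly_approx_add:
  assumes "poly_approx f" "poly_approx g" shows "poly_approx (\<lambda>x. f x + g x)"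
proof -
  obtain p q where "L2_lim M (\<lambda>k. poly (p k)) f" "L2_lim M (\<lambda>k. poly (q k)) g"
    using assms by (auto simp: poly_approx_def)
  from L2_lim_add[OF this] show ?thesis
    by (auto simp: poly_approx_def poly_add[symmetric] simp del: poly_add intro!: exI[of _ "\<lambda>k. p k + q k"])
qed

lemma poly_approx_cmult:
  assumes "poly_approx f" shows "poly_approx (\<lambda>x. c * f x)"
proof -
  obtain p where "L2_lim M (\<lambda>k. poly (p k)) f"
    using assms by (auto simp: poly_approx_def)
  from L2_lim_cmult[OF this, of c] show ?thesis
    by (auto simp: poly_approx_def poly_smult[symmetric] simp del: poly_smult intro!: exI[of _ "\<lambda>k. smult c (p k)"])
qed

lemma poly_approx_poly: "poly_approx (poly p)"
  unfolding poly_approx_def by (intro exI[of _ "\<lambda>k. p"] L2_lim_const poly_L2)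

lemma poly_approx_sum:
  "(\<And>i. i \<in> I \<Longrightarrow> poly_approx (f i)) \<Longrightarrow> poly_approx (\<lambda>x. \<Sum>i\<in>I. f i x)"
proof (induction I rule: infinite_finite_induct)
  case empty show ?case using poly_approx_poly[of 0] by (simp add: poly_0[abs_def])
next
  case (infinite I) show ?case using poly_approx_poly[of 0] infinite by (simp add: poly_0[abs_def])
qed (auto intro: poly_approx_add)

lemma L2_lim_dominated:
  assumes g: "\<And>k. g k \<in> borel_measurable M" and f: "f \<in> borel_measurable M" and w: "w \<in> L2 M"
    and bound: "\<And>k x. x \<in> space M \<Longrightarrow> \<bar>g k x\<bar> \<le> w x"
    and lim: "\<And>x. x \<in> space M \<Longrightarrow> (\<lambda>k. g k x) \<longlonglongrightarrow> f x"
  shows "L2_lim M g f"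
proof -
  have fw: "\<bar>f x\<bar> \<le> w x" if "x \<in> space M" for x
    using tendsto_rabs[OF lim[OF that]] bound[OF that] by (intro LIMSEQ_le_const2) auto
  have sq: "a\<^sup>2 \<le> b\<^sup>2" if "\<bar>a\<bar> \<le> b" for a b :: real
    using power_mono[OF that abs_ge_zero, of 2] by simp
  have gL: "g k \<in> L2 M" for k
    unfolding L2_def using g bound L2_D(2)[OF w]
    by (auto intro!: Bochner_Integration.integrable_bound[OF L2_D(2)[OF w]] AE_I2 sq)
  have fL: "f \<in> L2 M"
    unfolding L2_def using f fw L2_D(2)[OF w]
    by (auto intro!: Bochner_Integration.integrable_bound[OF L2_D(2)[OF w]] AE_I2 sq)
  have "(\<lambda>k. \<integral>x. (g k x - f x)\<^sup>2 \<partial>M) \<longlonglongrightarrow> (\<integral>x. 0 \<partial>M)"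
  proof (rule integral_dominated_convergence[where w = "\<lambda>x. 4 * (w x)\<^sup>2"])
    show "AE x in M. (\<lambda>k. (g k x - f x)\<^sup>2) \<longlonglongrightarrow> 0"
    proof (rule AE_I2)
      fix x assume "x \<in> space M"
      have "(\<lambda>k. (g k x - f x)\<^sup>2) \<longlonglongrightarrow> (f x - f x)\<^sup>2" by (intro tendsto_intros lim \<open>x \<in> space M\<close>)
      then show "(\<lambda>k. (g k x - f x)\<^sup>2) \<longlonglongrightarrow> 0" by simp
    qed
    fix k
    show "AE x in M. norm ((g k x - f x)\<^sup>2) \<le> 4 * (w x)\<^sup>2"
    proof (rule AE_I2)
      fix x assume "x \<in> space M"
      then have "\<bar>g k x - f x\<bar> \<le> 2 * w x" using bound[of x k] fw[of x] by linarith
      from sq[OF this] show "norm ((g k x - f x)\<^sup>2) \<le> 4 * (w x)\<^sup>2" by (simp add: power_mult_distrib)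
    qed
  qed (use g f L2_D(2)[OF w] in auto)
  then show ?thesis using gL fL by (simp add: L2_lim_def)
qed

text \<open>The sets whose indicators are $L^2$ limits of polynomials form a Dynkin system; it contains the
  half-lines by \<open>poly_approx_indicator\<close>, hence all Borel sets.\<close>

lemma poly_approx_indicator_set:
  assumes "A \<in> sets M" shows "poly_approx (indicator A :: real \<Rightarrow> real)"
  using assms
proof (induction rule: sets_induct)
  case (basic a)
  obtain p where p: "\<And>k x. x \<in> I2 \<Longrightarrow> \<bar>poly (p k) x\<bar> \<le> 2"
      "\<And>x. x \<in> I2 \<Longrightarrow> (\<lambda>k. poly (p k) x) \<longlonglongrightarrow> indicator {a<..} x"
    using poly_approx_indicator[of a] by blast
  have "L2_lim M (\<lambda>k. poly (p k)) (indicator (I2 \<inter> {a<..}))"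
  proof (rule L2_lim_dominated[where w = "\<lambda>x. 2"])
    show "indicator (I2 \<inter> {a<..}) \<in> borel_measurable M"
      by (rule borel_imp_measurable) simp
    show "(\<lambda>x. 2) \<in> L2 M" by (rule continuous_L2) simp
  qed (use p poly_L2 in \<open>auto simp: space_M L2_D indicator_def\<close>)
  then show ?case by (auto simp: poly_approx_def)
next
  case empty
  then show ?case using poly_approx_poly[of 0] by (simp add: indicator_def poly_0[abs_def])
next
  case (compl A)
  have 1: "poly_approx (\<lambda>x. 1 + (-1) * indicator A x)"
    using poly_approx_add[OF poly_approx_poly[of 1] poly_approx_cmult[OF compl(2), of "-1"]] by simp
  have "L2_lim M (\<lambda>k x. 1 + (-1) * indicator A x) (indicator (I2 - A))"
    using compl(1) sets.compl_sets[OF compl(1)]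
    by (intro L2_lim_dominated[where w = "\<lambda>x. 2"])
       (auto simp: space_M indicator_def intro: continuous_L2)
  with 1 show ?case by (rule poly_approx_lim)
next
  case (union A)
  have 1: "poly_approx (\<lambda>x. \<Sum>i<k. indicator (A i) x)" for k
    by (intro poly_approx_sum union)
  have "L2_lim M (\<lambda>k x. \<Sum>i<k. indicator (A i) x) (indicator (\<Union>i. A i))"
  proof (intro L2_lim_dominated[where w = "\<lambda>x. 1"])
    show "(\<lambda>x. \<Sum>i<k. indicator (A i) x :: real) \<in> borel_measurable M" for k
      using union(2) by (intro borel_measurable_sum borel_measurable_indicator) auto
    show "(indicator (\<Union>i. A i) :: real \<Rightarrow> real) \<in> borel_measurable M"
      using union(2) by (intro borel_measurable_indicator) auto
    have sum_ind: "(\<Sum>i<k. indicator (A i) x) = (indicator (\<Union>i<k. A i) x :: real)" for x k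
      using disjoint_family_on_mono[OF _ union(1), of "{..<k}"] by (subst indicator_UN_disjoint) auto
    show "\<bar>\<Sum>i<k. indicator (A i) x :: real\<bar> \<le> 1" for x k
      unfolding sum_ind by (simp add: indicator_def)
    show "(\<lambda>k. \<Sum>i<k. indicator (A i) x :: real) \<longlonglongrightarrow> indicator (\<Union>i. A i) x" for x
      unfolding sum_ind by (rule LIMSEQ_indicator_UN)
  qed (auto intro: continuous_L2)
  with 1 show ?case by (rule poly_approx_lim)
qed

lemma polys_dense:
  assumes f: "f \<in> L2 M" shows "\<exists>p. L2_lim M (\<lambda>k. poly (p k)) f"
proof -
  have fm: "f \<in> borel_measurable M" using f by (rule L2_D)
  obtain F where F: "\<And>i. simple_function M (F i)" "\<And>x. x \<in> space M \<Longrightarrow> (\<lambda>i. F i x) \<longlonglongrightarrow> f x"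
    "\<And>i x. x \<in> space M \<Longrightarrow> dist (F i x) 0 \<le> 2 * dist (f x) 0"
    using borel_measurable_implies_sequence_metric[OF fm, of 0] by blast
  have "poly_approx (F i)" for i
  proof -
    let ?S = "\<lambda>x. \<Sum>y\<in>F i ` space M. y * indicator (F i -` {y} \<inter> space M) x"
    have fin: "finite (F i ` space M)" using F(1) by (rule simple_functionD)
    have eq: "F i x = ?S x" if "x \<in> space M" for x
    proof -
      have "?S x = (\<Sum>y\<in>F i ` space M. if y = F i x then y else 0)"
        using that by (intro sum.cong) (auto simp: indicator_def)
      also have "\<dots> = F i x" using that fin by (simp add: sum.delta)
      finally show ?thesis by simp
    qed
    have "poly_approx ?S"
      by (intro poly_approx_sum poly_approx_cmult poly_approx_indicator_set simple_functionD(2)[OF F(1)])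
    moreover have "L2_lim M (\<lambda>k. ?S) (F i)"
    proof (rule L2_lim_dominated[where w = "\<lambda>x. \<bar>?S x\<bar>"])
      have S: "?S \<in> L2 M" using \<open>poly_approx ?S\<close> by (simp add: poly_approx_iff)
      then show "?S \<in> borel_measurable M" by (rule L2_D)
      then show "F i \<in> borel_measurable M" using F(1) by (simp add: borel_measurable_simple_function)
      show "(\<lambda>x. \<bar>?S x\<bar>) \<in> L2 M" using S by (rule L2_abs)
      show "(\<lambda>k. ?S x) \<longlonglongrightarrow> F i x" if "x \<in> space M" for x
        unfolding eq[OF that, symmetric] by (rule tendsto_const)
    qed auto
    ultimately show ?thesis by (rule poly_approx_lim)
  qed
  moreover have "L2_lim M F f"
  proof (rule L2_lim_dominated[where w = "\<lambda>x. 2 * \<bar>f x\<bar>"])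
    show "(\<lambda>x. 2 * \<bar>f x\<bar>) \<in> L2 M" by (intro L2_cmult L2_abs f)
  qed (use F fm in \<open>auto simp: borel_measurable_simple_function\<close>)
  ultimately have "poly_approx f" by (rule poly_approx_lim)
  then show ?thesis by (simp add: poly_approx_def)
qed

end


section \<open>The arcsine law\<close>

lemma sets_beta: "sets beta = sets (restrict_space borel I2)"
  by (simp add: beta_def cong: sets_restrict_space_cong)

lemma space_beta: "space beta = I2"
  by (simp add: beta_def space_restrict_space)

lemma sqrt_pos: "x \<in> {-2<..<2} \<Longrightarrow> 0 < sqrt (4 - x\<^sup>2)"
  using abs_square_less_1[of "x / 2"] by (simp add: power_divide abs_less_iff)

lemma four_minus_sq_nonneg: "x \<in> I2 \<Longrightarrow> 0 \<le> 4 - (x::real)\<^sup>2"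
  using abs_square_le_1[of "x / 2"] by (simp add: power_divide abs_le_iff)

lemma sqrt_four_minus_sq_nonneg: "x \<in> I2 \<Longrightarrow> 0 \<le> sqrt (4 - (x::real)\<^sup>2)"
  using four_minus_sq_nonneg by simp

lemma arcsine_weight_nonneg: "x \<in> I2 \<Longrightarrow> 0 \<le> 1 / (pi * sqrt (4 - x\<^sup>2))"
  by (intro divide_nonneg_nonneg mult_nonneg_nonneg sqrt_four_minus_sq_nonneg) auto

lemma arcsine_weight_measurable:
  "(\<lambda>x. 1 / (pi * sqrt (4 - x\<^sup>2))) \<in> borel_measurable (restrict_space lborel I2)"
  by (intro measurable_restrict_space1) simp

lemma emeasure_beta_I2: "emeasure beta I2 = 1"
proof -
  have "((\<lambda>x. 1 / sqrt (4 - x\<^sup>2)) has_integral (arcsin (2/2) - arcsin (-2/2))) {-2..2}"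
  proof (rule fundamental_theorem_of_calculus_interior)
    show "continuous_on I2 (\<lambda>x. arcsin (x/2))"
      by (intro continuous_intros) auto
    fix x :: real assume x: "x \<in> {-2<..<2}"
    have "sqrt (1 - (x/2)\<^sup>2) = sqrt (4 - x\<^sup>2) / 2"
      using real_sqrt_divide[of "4 - x\<^sup>2" 4] by (simp add: power_divide diff_divide_distrib)
    moreover have "((\<lambda>x. arcsin (x/2)) has_real_derivative (inverse (sqrt (1 - (x/2)\<^sup>2)) * (1/2))) (at x)"
      using x by (auto intro!: derivative_eq_intros)
    ultimately show "((\<lambda>x. arcsin (x/2)) has_vector_derivative 1 / sqrt (4 - x\<^sup>2)) (at x)"
      by (simp add: has_real_derivative_iff_has_vector_derivative[symmetric] field_simps)
  qed simp
  then have "((\<lambda>x. 1 / pi * (1 / sqrt (4 - x\<^sup>2))) has_integral 1 / pi * pi) I2"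
    by (intro has_integral_mult_right) simp
  then have 1: "((\<lambda>x. 1 / (pi * sqrt (4 - x\<^sup>2))) has_integral 1) I2"
    by simp
  have "emeasure beta I2 = (\<integral>\<^sup>+x. ennreal (1 / (pi * sqrt (4 - x\<^sup>2))) \<partial>restrict_space lborel I2)"
    unfolding beta_def using measurable_compose[OF arcsine_weight_measurable measurable_ennreal]
    by (subst emeasure_density)
       (auto simp: sets_restrict_space space_restrict_space image_iff intro!: nn_integral_cong bexI[of _ UNIV])
  also have "\<dots> = (\<integral>\<^sup>+x. ennreal (indicator I2 x * (1 / (pi * sqrt (4 - x\<^sup>2)))) \<partial>lborel)"
    by (subst nn_integral_restrict_space) (auto intro!: nn_integral_cong simp: indicator_def)
  also have "\<dots> = ennreal 1"
    by (rule nn_integral_has_integral_lebesgue[OF _ 1]) (rule arcsine_weight_nonneg)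
  finally show ?thesis by simp
qed

interpretation beta: prob_space beta
  by (rule prob_spaceI) (simp add: space_beta emeasure_beta_I2)

interpretation beta: I2_measure beta
  by unfold_locales (rule sets_beta)

lemma beta_prob [simp]: "measure beta I2 = 1"
  by (simp add: measure_def emeasure_beta_I2)

lemma AE_beta_neq: "AE y in beta. y \<noteq> x"
  unfolding beta_def using measurable_compose[OF arcsine_weight_measurable measurable_ennreal]
  by (subst AE_density) (auto simp: AE_restrict_space_iff intro: AE_mp[OF AE_lborel_singleton[of x]])

lemma
  assumes f: "f \<in> borel_measurable beta"
  shows integral_beta: "(\<integral>x. f x \<partial>beta) = (LINT x:I2|lborel. f x / (pi * sqrt (4 - x\<^sup>2)))"
    and integrable_beta_iff: "integrable beta f \<longleftrightarrow> set_integrable lborel I2 (\<lambda>x. f x / (pi * sqrt (4 - x\<^sup>2)))"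
proof -
  have f': "f \<in> borel_measurable (restrict_space lborel I2)"
    using f unfolding beta_def by simp
  have nn: "AE x in restrict_space lborel I2. 0 \<le> 1 / (pi * sqrt (4 - x\<^sup>2))"
  proof (rule AE_I2)
    fix x assume "x \<in> space (restrict_space lborel I2)"
    then have "x \<in> I2" by (simp add: space_restrict_space)
    then show "0 \<le> 1 / (pi * sqrt (4 - x\<^sup>2))" by (rule arcsine_weight_nonneg)
  qed
  show "(\<integral>x. f x \<partial>beta) = (LINT x:I2|lborel. f x / (pi * sqrt (4 - x\<^sup>2)))"
    unfolding beta_def using f' nn arcsine_weight_measurable
    by (subst integral_density)
       (auto simp: integral_restrict_space set_lebesgue_integral_def intro!: Bochner_Integration.integral_cong)
  show "integrable beta f \<longleftrightarrow> set_integrable lborel I2 (\<lambda>x. f x / (pi * sqrt (4 - x\<^sup>2)))"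
    unfolding beta_def using f' nn arcsine_weight_measurable
    by (subst integrable_density)
       (auto simp: integrable_restrict_space set_integrable_def intro!: Bochner_Integration.integrable_cong)
qed

text \<open>All explicit integrals against the arcsine law reduce to this form of the fundamental theorem of
  calculus, applied to a \<open>G\<close> that contains the factor $\sqrt{4-x^2}$.\<close>

lemma beta_FTC:
  assumes f: "integrable beta f" and G: "continuous_on I2 G"
    and deriv: "\<And>x. x \<in> {-2<..<2} \<Longrightarrow> (G has_real_derivative f x / sqrt (4 - x\<^sup>2)) (at x)"
  shows "(\<integral>x. f x \<partial>beta) = (G 2 - G (-2)) / pi"
proof -
  let ?g = "\<lambda>x. f x / (pi * sqrt (4 - x\<^sup>2))"
  have "set_integrable lborel I2 ?g"
    using f integrable_beta_iff[of f] by auto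
  from set_borel_integral_eq_integral(2)[OF this]
  have "(\<integral>x. f x \<partial>beta) = integral I2 ?g"
    using integral_beta[of f] f by auto
  also have "\<dots> = G 2 / pi - G (-2) / pi"
  proof (rule integral_unique, rule fundamental_theorem_of_calculus_interior)
    show "continuous_on {- 2..2} (\<lambda>x. G x / pi)" using G by (intro continuous_intros) auto
    fix x :: real assume "x \<in> {-2<..<2}"
    from DERIV_cdivide[OF deriv[OF this], of pi]
    show "((\<lambda>x. G x / pi) has_vector_derivative ?g x) (at x)"
      by (simp add: has_real_derivative_iff_has_vector_derivative[symmetric] mult.commute)
  qed simp
  finally show ?thesis by (simp add: diff_divide_distrib)
qed

text \<open>The two densities differ by the factor $(4-x^2)/2$, which moves every integral against \<open>alpha\<close> to
  \<open>beta\<close>, where integration by parts takes place.\<close>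

lemma alpha_eq: "alpha = density beta (\<lambda>x. ennreal ((4 - x\<^sup>2) / 2))"
proof -
  have "density beta (\<lambda>x. ennreal ((4 - x\<^sup>2) / 2)) =
      density (restrict_space lborel I2) (\<lambda>x. ennreal (1 / (pi * sqrt (4 - x\<^sup>2))) * ennreal ((4 - x\<^sup>2) / 2))"
    unfolding beta_def
    by (intro density_density_eq measurable_restrict_space1) simp_all
  also have "\<dots> = alpha"
    unfolding alpha_def
  proof (intro density_cong)
    show "AE x in restrict_space lborel I2. ennreal (1 / (pi * sqrt (4 - x\<^sup>2))) * ennreal ((4 - x\<^sup>2) / 2)
        = ennreal (sqrt (4 - x\<^sup>2) / (2 * pi))"
    proof (rule AE_I2)
      fix x assume "x \<in> space (restrict_space lborel I2)"
      then have x: "x \<in> I2" by (simp add: space_restrict_space)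
      have "1 / (pi * sqrt (4 - x\<^sup>2)) * ((4 - x\<^sup>2) / 2) = sqrt (4 - x\<^sup>2) / (2 * pi)"
        using real_div_sqrt[OF four_minus_sq_nonneg[OF x]] by (simp add: divide_simps)
      then show "ennreal (1 / (pi * sqrt (4 - x\<^sup>2))) * ennreal ((4 - x\<^sup>2) / 2)
        = ennreal (sqrt (4 - x\<^sup>2) / (2 * pi))"
        using four_minus_sq_nonneg[OF x] by (subst ennreal_mult[symmetric]) auto
    qed
  qed (auto intro!: measurable_restrict_space1)
  finally show ?thesis ..
qed

lemma sets_alpha: "sets alpha = sets (restrict_space borel I2)"
  by (simp add: alpha_eq sets_beta)

lemma measurable_alpha [simp]: "borel_measurable alpha = borel_measurable beta"
  by (rule measurable_cong_sets) (simp_all add: sets_alpha sets_beta)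

lemma
  assumes f: "f \<in> borel_measurable beta"
  shows integral_alpha: "(\<integral>x. f x \<partial>alpha) = (\<integral>x. (4 - x\<^sup>2) / 2 * f x \<partial>beta)"
    and integrable_alpha_iff: "integrable alpha f \<longleftrightarrow> integrable beta (\<lambda>x. (4 - x\<^sup>2) / 2 * f x)"
proof -
  have m: "(\<lambda>x. (4 - x\<^sup>2) / 2) \<in> borel_measurable beta"
    by (intro beta.borel_imp_measurable) simp
  have nn: "AE x in beta. 0 \<le> (4 - x\<^sup>2) / 2"
    using four_minus_sq_nonneg by (intro AE_I2) (simp add: space_beta)
  show "(\<integral>x. f x \<partial>alpha) = (\<integral>x. (4 - x\<^sup>2) / 2 * f x \<partial>beta)"
    unfolding alpha_eq using integral_density[OF f m nn] by simp
  show "integrable alpha f \<longleftrightarrow> integrable beta (\<lambda>x. (4 - x\<^sup>2) / 2 * f x)"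
    unfolding alpha_eq using integrable_density[OF f m nn] by simp
qed

interpretation alpha: I2_measure alpha
proof -
  have "emeasure alpha (space alpha) < \<infinity>"
  proof -
    have sp: "space alpha = I2" using sets_eq_imp_space_eq[OF sets_alpha] by (simp add: space_restrict_space)
    have I2: "I2 \<in> sets beta" using sets.top[of beta] by (simp add: space_beta)
    have "emeasure alpha I2 = (\<integral>\<^sup>+x. ennreal ((4 - x\<^sup>2) / 2) * indicator I2 x \<partial>beta)"
      unfolding alpha_eq by (intro emeasure_density beta.borel_imp_measurable I2) auto
    also have "\<dots> \<le> (\<integral>\<^sup>+x. 2 \<partial>beta)"
      by (intro nn_integral_mono) (auto simp: indicator_def ennreal_le_iff2 simp flip: ennreal_numeral intro!: ennreal_leI)
    also have "\<dots> < \<infinity>" by (simp add: space_beta emeasure_beta_I2)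
    finally show ?thesis using sp by simp
  qed
  then have "finite_measure alpha" by (intro finite_measureI) auto
  then show "I2_measure alpha" by (simp add: I2_measure_def I2_measure_axioms_def sets_alpha)
qed


section \<open>Chebyshev polynomials\<close>

lemma phi_0: "phi 0 x = 1" and phi_1: "phi (Suc 0) x = x / 2"
  and phi_rec: "phi (Suc (Suc n)) x = x * phi (Suc n) x - phi n x"
  by (simp_all add: phi_def)

lemma phi_cos: "phi n (2 * cos t) = cos (real n * t)"
  by (simp add: phi_def cheb_T_cos)

lemma I2_cos: assumes "x \<in> I2" obtains t where "x = 2 * cos t"
proof
  show "x = 2 * cos (arccos (x / 2))" using assms by simp
qed

lemma abs_phi_le_1: "x \<in> I2 \<Longrightarrow> \<bar>phi n x\<bar> \<le> 1"
  by (metis I2_cos phi_cos abs_cos_le_one)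

definition phi_poly :: "nat \<Rightarrow> real poly" where
  "phi_poly n = pcompose (cheb_T n) [:0, 1/2:]"

lemma poly_phi: "poly (phi_poly n) = phi n"
  by (simp add: phi_poly_def phi_def poly_pcompose fun_eq_iff)

text \<open>The polynomial $\frac12 U_{n-1}(x/2)$, where $U_n$ is the Chebyshev polynomial of the second kind;
  at $x=2\cos t$ it is $\frac{\sin nt}{2\sin t}$.\<close>

fun psi :: "nat \<Rightarrow> real \<Rightarrow> real" where
  "psi 0 x = 0"
| "psi (Suc 0) x = 1 / 2"
| "psi (Suc (Suc n)) x = x * psi (Suc n) x - psi n x"

lemma psi_diff: "psi (Suc (Suc n)) x - psi n x = phi (Suc n) x"
proof (induction n x rule: psi.induct)
  case (3 n x)
  then show ?case unfolding phi_rec[of "Suc n"] by (simp add: algebra_simps)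
qed (simp_all add: phi_0 phi_1 phi_rec)

lemma four_minus_sq_psi: "(4 - x\<^sup>2) * psi (Suc n) x = phi n x - phi (Suc (Suc n)) x"
proof (induction n x rule: psi.induct)
  case (3 n x)
  have "(4 - x\<^sup>2) * psi (Suc (Suc (Suc n))) x
      = x * ((4 - x\<^sup>2) * psi (Suc (Suc n)) x) - (4 - x\<^sup>2) * psi (Suc n) x"
    by (simp add: algebra_simps)
  also have "\<dots> = x * (phi (Suc n) x - phi (Suc (Suc (Suc n))) x) - (phi n x - phi (Suc (Suc n)) x)"
    using 3 by simp
  also have "\<dots> = phi (Suc (Suc n)) x - phi (Suc (Suc (Suc (Suc n)))) x"
    unfolding phi_rec[of "Suc (Suc n)"] phi_rec[of n] by (simp add: algebra_simps)
  finally show ?case .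
qed (simp_all add: phi_0 phi_1 phi_rec power2_eq_square field_simps)

lemma phi_deriv: "(phi n has_real_derivative real n * psi n x) (at x within S)"
proof -
  have "(phi n has_real_derivative real n * psi n x) (at x)" for x
  proof (induction n rule: cheb_T.induct)
    case 1 then show ?case by (simp add: phi_0[abs_def])
  next
    case 2 then show ?case by (auto simp: phi_1[abs_def] intro!: derivative_eq_intros)
  next
    case (3 n)
    have "((\<lambda>x. x * phi (Suc n) x - phi n x) has_real_derivative
        (phi (Suc n) x + x * (real (Suc n) * psi (Suc n) x) - real n * psi n x)) (at x)"
      by (auto intro!: derivative_eq_intros 3)
    also have "phi (Suc n) x + x * (real (Suc n) * psi (Suc n) x) - real n * psi n x
        = real (Suc (Suc n)) * psi (Suc (Suc n)) x"
      unfolding psi_diff[symmetric] by (simp add: algebra_simps)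
    finally show ?case unfolding phi_rec[abs_def] by simp
  qed
  then show ?thesis by (rule has_field_derivative_at_within)
qed

lemma pderiv_phi: "poly (pderiv (phi_poly n)) x = real n * psi n x"
  using DERIV_unique[OF poly_DERIV[of "phi_poly n" x], of "real n * psi n x"] phi_deriv[of n x UNIV]
  by (simp add: poly_phi)

lemma phi_L2: "phi n \<in> L2 beta"
  using beta.poly_L2[of "phi_poly n"] by (simp add: poly_phi)

lemma continuous_phi: "continuous_on S (phi n)"
  unfolding poly_phi[symmetric] by (intro continuous_intros)

lemma continuous_psi: "continuous_on S (psi n)"
proof (induction n rule: cheb_T.induct)
  case (3 n)
  then show ?case unfolding psi.simps(3)[abs_def] by (intro continuous_intros)
qed simp_all

lemma sqrt_deriv:
  assumes "x \<in> {-2<..<2}"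
  shows "((\<lambda>x. sqrt (4 - x\<^sup>2)) has_real_derivative - x / sqrt (4 - x\<^sup>2)) (at x)"
  using sqrt_pos[OF assms] by (auto intro!: derivative_eq_intros simp: field_simps)

text \<open>At $x=2\cos t$ the function $\sqrt{4-x^2}\,\psi_n(x)$ is $\sin nt$, and $dx=-2\sin t\,dt$. The proof
  avoids the substitution by writing the function as $(\phi_{n-1}-\phi_{n+1})/\sqrt{4-x^2}$ and
  differentiating with the algebraic identities.\<close>

lemma sqrt_psi_deriv:
  assumes x: "x \<in> {-2<..<2}"
  shows "((\<lambda>x. sqrt (4 - x\<^sup>2) * psi n x) has_real_derivative - real n * phi n x / sqrt (4 - x\<^sup>2)) (at x)"
proof (cases n)
  case 0
  then show ?thesis by simp
next
  case (Suc m)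
  let ?G = "\<lambda>x. (phi m x - phi (Suc (Suc m)) x) / sqrt (4 - x\<^sup>2)"
  let ?H = "\<lambda>x. sqrt (4 - x\<^sup>2) * psi (Suc m) x"
  define s where "s = sqrt (4 - x\<^sup>2)"
  have s: "s > 0" "s * s = 4 - x\<^sup>2" using sqrt_pos[OF x] by (auto simp: s_def)
  have GH: "?G y = ?H y" if "y \<in> {-2<..<2}" for y
  proof -
    have "0 \<le> 4 - y\<^sup>2" using that by (intro four_minus_sq_nonneg) auto
    then have "(4 - y\<^sup>2) * p / sqrt (4 - y\<^sup>2) = sqrt (4 - y\<^sup>2) * p" for p
      using real_div_sqrt by (metis times_divide_eq_left)
    then show ?thesis by (simp only: four_minus_sq_psi[symmetric])
  qed
  let ?N = "real m * psi m x - real (Suc (Suc m)) * psi (Suc (Suc m)) x"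
  let ?D = "(?N * s - (phi m x - phi (Suc (Suc m)) x) * (- x / s)) / (s * s)"
  have D: "(?G has_real_derivative ?D) (at x)"
    unfolding s_def
    by (intro DERIV_divide DERIV_diff phi_deriv sqrt_deriv[OF x]) (use s(1) in \<open>simp add: s_def\<close>)
  have "(phi m x - phi (Suc (Suc m)) x) * (- x / s) = - s * (x * psi (Suc m) x)"
    unfolding four_minus_sq_psi[symmetric] s(2)[symmetric] using s(1) by simp
  then have "?D = (?N * s - (- s * (x * psi (Suc m) x))) / (s * s)" by (simp only:)
  also have "\<dots> = (?N + x * psi (Suc m) x) * s / (s * s)"
  proof -
    have "N * s - (- s * P) = (N + P) * s" for N P by algebra
    then show ?thesis by (simp only:)
  qed
  also have "\<dots> = (?N + x * psi (Suc m) x) / s" using s(1) by simp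
  also have "?N + x * psi (Suc m) x = - real (Suc m) * (psi (Suc (Suc m)) x - psi m x)"
    by (simp add: algebra_simps)
  also have "\<dots> = - real (Suc m) * phi (Suc m) x" unfolding psi_diff ..
  finally have "?D = - real (Suc m) * phi (Suc m) x / s" .
  with D have "(?G has_real_derivative - real (Suc m) * phi (Suc m) x / s) (at x)" by simp
  then have "(?H has_real_derivative - real (Suc m) * phi (Suc m) x / s) (at x)"
    by (rule has_field_derivative_transform_within_open[where S = "{-2<..<2}"]) (use x GH in auto)
  then show ?thesis unfolding Suc s_def .
qed

lemma integral_phi: "(\<integral>x. phi n x \<partial>beta) = (if n = 0 then 1 else 0)"
proof (cases n)
  case 0
  then show ?thesis by (simp add: phi_0 space_beta)
next
  case (Suc m)
  have "(\<integral>x. - real n * phi n x \<partial>beta) = (sqrt (4 - 2\<^sup>2) * psi n 2 - sqrt (4 - (-2)\<^sup>2) * psi n (-2)) / pi"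
  proof (rule beta_FTC)
    show "integrable beta (\<lambda>x. - real n * phi n x)"
      by (intro integrable_mult_right beta.L2_integrable phi_L2)
    show "continuous_on I2 (\<lambda>x. sqrt (4 - x\<^sup>2) * psi n x)"
      by (intro continuous_intros continuous_psi)
  qed (rule sqrt_psi_deriv)
  then show ?thesis using Suc by simp
qed

lemma phi_mult:
  assumes "x \<in> I2" "m \<le> n" shows "phi n x * phi m x = (phi (n + m) x + phi (n - m) x) / 2"
proof -
  obtain t where t: "x = 2 * cos t" using I2_cos assms by blast
  show ?thesis using assms(2)
    by (simp add: t phi_cos cos_times_cos of_nat_diff left_diff_distrib distrib_right add.commute)
qed

lemma ip_phi: "ip beta (phi n) (phi m) = (if n = m then if n = 0 then 1 else 1/2 else 0)"
proof -
  have le: "ip beta (phi n) (phi m) = (if n = m then if n = 0 then 1 else 1/2 else 0)" if "m \<le> n" for n m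
  proof -
    have "ip beta (phi n) (phi m) = (\<integral>x. (phi (n + m) x + phi (n - m) x) / 2 \<partial>beta)"
      unfolding ip_def using phi_mult[OF _ that]
      by (intro Bochner_Integration.integral_cong) (auto simp: space_beta)
    also have "\<dots> = ((\<integral>x. phi (n + m) x \<partial>beta) + (\<integral>x. phi (n - m) x \<partial>beta)) / 2"
      by (simp add: beta.L2_integrable phi_L2)
    finally show ?thesis using that by (auto simp: integral_phi)
  qed
  show ?thesis
  proof (cases "m \<le> n")
    case False
    then show ?thesis using le[of n m] ip_commute[of beta "phi n" "phi m"] by auto
  qed (rule le)
qed


section \<open>The logarithmic kernel\<close>

text \<open>For \<open>0 \<le> r < 1\<close> this is the Abel mean
  $-\sum_n \frac{2r^n}{n}\phi_n(x)\phi_n(y)$ of the Chebyshev expansion of $\log|x-y|$; with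
  $x=2\cos a$ and $y=2\cos b$ it equals $\log|1-re^{i(a+b)}| + \log|1-re^{i(a-b)}|$.\<close>

definition abel_log :: "real \<Rightarrow> real \<Rightarrow> real \<Rightarrow> real" where
  "abel_log r x y = ln ((1 + r\<^sup>2)\<^sup>2 - r * (1 + r\<^sup>2) * x * y + r\<^sup>2 * (x\<^sup>2 + y\<^sup>2 - 4)) / 2"

text \<open>The factors are $|1-re^{iu}|^2$ at $u=a+b$ and $u=a-b$; their product is symmetric enough to be a
  polynomial in $x$ and $y$.\<close>

lemma abel_log_arg:
  fixes a b r x y :: real
  assumes x: "x = 2 * cos a" and y: "y = 2 * cos b"
  shows "(1 + r\<^sup>2)\<^sup>2 - r * (1 + r\<^sup>2) * x * y + r\<^sup>2 * (x\<^sup>2 + y\<^sup>2 - 4)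
     = (1 - 2 * r * cos (a + b) + r\<^sup>2) * (1 - 2 * r * cos (a - b) + r\<^sup>2)"
proof -
  have sa: "(sin a)\<^sup>2 = 1 - (cos a)\<^sup>2" using sin_cos_squared_add[of a] by linarith
  have sb: "(sin b)\<^sup>2 = 1 - (cos b)\<^sup>2" using sin_cos_squared_add[of b] by linarith
  have 1: "cos (a + b) + cos (a - b) = x * y / 2"
    by (simp add: x y cos_add cos_diff)
  have "cos (a + b) * cos (a - b) = (cos a)\<^sup>2 * (cos b)\<^sup>2 - (sin a)\<^sup>2 * (sin b)\<^sup>2"
    by (simp add: cos_add cos_diff power2_eq_square algebra_simps)
  also have "\<dots> = (x\<^sup>2 + y\<^sup>2 - 4) / 4"
    unfolding sa sb x y by (simp add: power2_eq_square algebra_simps)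
  finally have 2: "cos (a + b) * cos (a - b) = (x\<^sup>2 + y\<^sup>2 - 4) / 4" .
  have "(1 - 2 * r * cos (a + b) + r\<^sup>2) * (1 - 2 * r * cos (a - b) + r\<^sup>2)
      = (1 + r\<^sup>2)\<^sup>2 - 2 * r * (1 + r\<^sup>2) * (cos (a + b) + cos (a - b)) + 4 * r\<^sup>2 * (cos (a + b) * cos (a - b))"
    by (simp add: power2_eq_square algebra_simps)
  also have "\<dots> = (1 + r\<^sup>2)\<^sup>2 - r * (1 + r\<^sup>2) * x * y + r\<^sup>2 * (x\<^sup>2 + y\<^sup>2 - 4)"
    unfolding 1 2 by (simp add: algebra_simps diff_divide_distrib add_divide_distrib)
  finally show ?thesis ..
qed

lemma poisson_factor_pos:
  fixes r u :: real
  assumes "0 \<le> r" "r < 1" shows "0 < 1 - 2 * r * cos u + r\<^sup>2"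
proof -
  have "1 - r \<noteq> 0" using assms by linarith
  then have "0 < (1 - r)\<^sup>2" by (simp only: zero_less_power2 not_False_eq_True)
  also have "(1 - r)\<^sup>2 \<le> 1 - 2 * r * cos u + r\<^sup>2"
    using mult_left_mono[OF cos_le_one[of u] assms(1)] by (simp add: power2_eq_square algebra_simps)
  finally show ?thesis .
qed

text \<open>The real part of the Taylor series of $\log(1-z)$ at $z=re^{iu}$.\<close>

lemma cos_series_log:
  assumes r: "0 \<le> r" "r < 1"
  shows "(\<lambda>n. r ^ n / real n * cos (real n * u)) sums (- ln (1 - 2 * r * cos u + r\<^sup>2) / 2)"
proof -
  define z where "z = complex_of_real r * cis u"
  have nz: "norm z < 1" using r by (simp add: z_def norm_mult)
  have sq: "(norm (1 - z))\<^sup>2 = 1 - 2 * r * cos u + r\<^sup>2"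
  proof -
    have "(norm (1 - z))\<^sup>2 = (1 - r * cos u)\<^sup>2 + (r * sin u)\<^sup>2"
      by (simp add: cmod_power2 z_def)
    also have "\<dots> = 1 - 2 * r * cos u + r\<^sup>2 * ((cos u)\<^sup>2 + (sin u)\<^sup>2)"
      by algebra
    finally show ?thesis by simp
  qed
  have n0: "1 - z \<noteq> 0" using nz by auto
  have "(\<lambda>n. - ((- (- z)) ^ n) / of_nat n) sums ln (1 + - z)"
    by (rule Ln_series') (use nz in simp)
  then have "(\<lambda>n. Re (- (z ^ n) / of_nat n)) sums Re (ln (1 - z))"
    by (intro sums_Re) simp
  moreover have "Re (- (z ^ n) / of_nat n) = - (r ^ n / real n * cos (real n * u))" for n
    by (simp add: z_def power_mult_distrib Complex.DeMoivre Re_divide_of_nat flip: of_real_power)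
  moreover have "Re (ln (1 - z)) = ln (1 - 2 * r * cos u + r\<^sup>2) / 2"
  proof -
    have "ln (1 - 2 * r * cos u + r\<^sup>2) = 2 * ln (norm (1 - z))"
      unfolding sq[symmetric] using n0 by (simp add: ln_realpow)
    then show ?thesis using n0 by simp
  qed
  ultimately have "(\<lambda>n. - (r ^ n / real n * cos (real n * u))) sums (ln (1 - 2 * r * cos u + r\<^sup>2) / 2)"
    by (simp only:)
  from sums_minus[OF this] show ?thesis by simp
qed

lemma abel_log_series:
  assumes r: "0 \<le> r" "r < 1" and "x \<in> I2" "y \<in> I2"
  shows "(\<lambda>n. 2 * r ^ n / real n * phi n x * phi n y) sums (- abel_log r x y)"
proof -
  obtain a b where ab: "x = 2 * cos a" "y = 2 * cos b" using I2_cos assms by metis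
  have "(\<lambda>n. r ^ n / real n * cos (real n * (a + b)) + r ^ n / real n * cos (real n * (a - b)))
      sums (- ln (1 - 2 * r * cos (a + b) + r\<^sup>2) / 2 + - ln (1 - 2 * r * cos (a - b) + r\<^sup>2) / 2)"
    by (intro sums_add cos_series_log r)
  moreover have "- ln (1 - 2 * r * cos (a + b) + r\<^sup>2) / 2 + - ln (1 - 2 * r * cos (a - b) + r\<^sup>2) / 2
      = - abel_log r x y"
    unfolding abel_log_def abel_log_arg[OF ab]
    using poisson_factor_pos[OF r, of "a + b"] poisson_factor_pos[OF r, of "a - b"]
    by (simp add: ln_mult add_divide_distrib)
  moreover have "r ^ n / real n * cos (real n * (a + b)) + r ^ n / real n * cos (real n * (a - b))
      = 2 * r ^ n / real n * phi n x * phi n y" for n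
    by (simp add: ab phi_cos cos_add cos_diff distrib_left right_diff_distrib)
  ultimately show ?thesis by simp
qed

lemma abel_log_measurable: "abel_log r x \<in> borel_measurable beta"
  unfolding abel_log_def by (intro beta.borel_imp_measurable) simp

lemma integral_abel_log_phi:
  assumes r: "0 \<le> r" "r < 1" and x: "x \<in> I2"
  shows "integrable beta (\<lambda>y. - abel_log r x y * phi m y)"
    and "(\<integral>y. - abel_log r x y * phi m y \<partial>beta) = r ^ m / real m * phi m x"
proof -
  let ?f = "\<lambda>n y. 2 * r ^ n / real n * phi n x * phi n y * phi m y"
  have sums: "(\<lambda>n. ?f n y) sums (- abel_log r x y * phi m y)" if "y \<in> I2" for y
    by (intro sums_mult2 abel_log_series r x that)
  have int: "integrable beta (?f n)" for n
    using L2_integrable_mult[OF phi_L2[of n] phi_L2[of m]]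
    by (simp add: mult.assoc)
  have bound: "\<bar>?f n y\<bar> \<le> 2 * r ^ n" if "y \<in> I2" for n y
  proof -
    have "\<bar>phi n x * phi n y * phi m y\<bar> \<le> 1"
      unfolding abs_mult using abs_phi_le_1[OF x, of n] abs_phi_le_1[OF that, of n] abs_phi_le_1[OF that, of m]
      by (intro mult_le_one mult_nonneg_nonneg) auto
    moreover have "\<bar>2 * r ^ n / real n\<bar> \<le> 2 * r ^ n"
    proof (cases n)
      case (Suc k)
      have "2 * r ^ n / real n \<le> 2 * r ^ n / 1"
        using r Suc by (intro divide_left_mono) auto
      then show ?thesis using r by simp
    qed simp
    ultimately have "\<bar>2 * r ^ n / real n\<bar> * \<bar>phi n x * phi n y * phi m y\<bar> \<le> 2 * r ^ n * 1"
      by (intro mult_mono) (use r in auto)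
    then show ?thesis by (simp add: abs_mult mult.assoc)
  qed
  have geom: "summable (\<lambda>n. 2 * r ^ n)" using r by (intro summable_mult summable_geometric) simp
  have s1: "AE y in beta. summable (\<lambda>n. norm (?f n y))"
    using bound by (intro AE_I2 summable_comparison_test'[OF geom, of 0]) (auto simp: space_beta)
  have s2: "summable (\<lambda>n. \<integral>y. norm (?f n y) \<partial>beta)"
  proof (rule summable_comparison_test'[OF geom, of 0])
    fix n
    have "(\<integral>y. norm (?f n y) \<partial>beta) \<le> (\<integral>y. 2 * r ^ n \<partial>beta)"
      by (intro integral_mono integrable_norm[OF int]) (use bound in \<open>simp_all add: space_beta\<close>)
    then show "norm (\<integral>y. norm (?f n y) \<partial>beta) \<le> 2 * r ^ n"
      by (simp add: space_beta)
  qed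
  have eq: "(\<Sum>n. ?f n y) = - abel_log r x y * phi m y" if "y \<in> space beta" for y
    using sums[of y] that by (simp add: sums_iff space_beta)
  show "integrable beta (\<lambda>y. - abel_log r x y * phi m y)"
    using integrable_suminf[OF int s1 s2] Bochner_Integration.integrable_cong[OF refl eq, of beta] by simp
  have "(\<lambda>n. \<integral>y. ?f n y \<partial>beta) sums (\<integral>y. (\<Sum>n. ?f n y) \<partial>beta)"
    by (rule sums_integral[OF int s1 s2])
  also have "(\<integral>y. (\<Sum>n. ?f n y) \<partial>beta) = (\<integral>y. - abel_log r x y * phi m y \<partial>beta)"
    by (intro Bochner_Integration.integral_cong eq refl)
  finally have "(\<lambda>n. \<integral>y. ?f n y \<partial>beta) sums (\<integral>y. - abel_log r x y * phi m y \<partial>beta)" .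
  moreover have "(\<integral>y. ?f n y \<partial>beta) = (if n = m then r ^ n / real n * phi n x else 0)" for n
    using ip_phi[of n m] by (auto simp: ip_def mult.assoc)
  ultimately have "(\<lambda>n. if n = m then r ^ n / real n * phi n x else 0) sums (\<integral>y. - abel_log r x y * phi m y \<partial>beta)"
    by simp
  from sums_unique2[OF this sums_single[of m "\<lambda>m. r ^ m / real m * phi m x"]]
  show "(\<integral>y. - abel_log r x y * phi m y \<partial>beta) = r ^ m / real m * phi m x" by simp
qed

text \<open>For $r\ge\frac12$ each factor satisfies $1-2r\cos u+r^2\ge 1-\cos u$, and
  $(1-\cos(a+b))(1-\cos(a-b))=((x-y)/2)^2$. This bounds all Abel means from below by the limit.\<close>

lemma abel_log_bounds:
  assumes r: "1/2 \<le> r" "r < 1" and xy: "x \<in> I2" "y \<in> I2"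
  shows "abel_log r x y \<le> 2 * ln 2" and "x \<noteq> y \<Longrightarrow> ln \<bar>x - y\<bar> - ln 2 \<le> abel_log r x y"
proof -
  obtain a b where ab: "x = 2 * cos a" "y = 2 * cos b" using I2_cos xy by metis
  let ?A = "1 - 2 * r * cos (a + b) + r\<^sup>2" and ?B = "1 - 2 * r * cos (a - b) + r\<^sup>2"
  have pos: "0 < 1 - 2 * r * cos u + r\<^sup>2" for u using poisson_factor_pos[of r u] r by simp
  have le4: "1 - 2 * r * cos u + r\<^sup>2 \<le> 4" for u
  proof -
    have "1 - 2 * r * cos u + r\<^sup>2 \<le> (1 + r)\<^sup>2"
      using mult_left_mono[OF cos_ge_minus_one[of u], of r] r by (simp add: power2_eq_square algebra_simps)
    also have "\<dots> \<le> 2\<^sup>2" using r by (intro power_mono) auto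
    finally show ?thesis by simp
  qed
  have ge: "1 - cos u \<le> 1 - 2 * r * cos u + r\<^sup>2" for u
  proof -
    have "0 \<le> (1 - r)\<^sup>2 + (2 * r - 1) * (1 - cos u)" using r by simp
    then show ?thesis by (simp add: power2_eq_square algebra_simps)
  qed
  have K: "abel_log r x y = ln (?A * ?B) / 2"
    unfolding abel_log_def abel_log_arg[OF ab] ..
  have "ln (?A * ?B) \<le> ln (4 * 4)"
  proof -
    have "?A * ?B \<le> 4 * 4"
      by (intro mult_mono le4 less_imp_le[OF pos]) simp
    then show ?thesis
      using pos[of "a + b"] pos[of "a - b"] by (subst ln_le_cancel_iff) simp_all
  qed
  also have "ln (4 * 4 :: real) = 4 * ln 2"
    using ln_realpow[of 2 4] by simp
  finally show "abel_log r x y \<le> 2 * ln 2" unfolding K by simp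
  assume ne: "x \<noteq> y"
  have "(1 - cos (a + b)) * (1 - cos (a - b)) \<le> ?A * ?B"
    using ge[of "a + b"] ge[of "a - b"] pos[of "a + b"] by (intro mult_mono) auto
  moreover have "(1 - cos (a + b)) * (1 - cos (a - b)) = ((x - y) / 2)\<^sup>2"
  proof -
    have "(1 - cos (a + b)) * (1 - cos (a - b)) = (1 - 2 * 1 * cos (a + b) + 1\<^sup>2) * (1 - 2 * 1 * cos (a - b) + 1\<^sup>2) / 4"
      by (simp add: algebra_simps)
    also have "\<dots> = ((x - y) / 2)\<^sup>2"
      unfolding abel_log_arg[OF ab, of 1, symmetric] by (simp add: power2_eq_square algebra_simps)
    finally show ?thesis .
  qed
  ultimately have "((x - y) / 2)\<^sup>2 \<le> ?A * ?B" by simp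
  then have "ln (((x - y) / 2)\<^sup>2) \<le> ln (?A * ?B)"
    using ne pos[of "a + b"] pos[of "a - b"] by (subst ln_le_cancel_iff) auto
  moreover have "ln (((x - y) / 2)\<^sup>2) = 2 * (ln \<bar>x - y\<bar> - ln 2)"
    using ne ln_realpow[of "\<bar>x - y\<bar> / 2" 2] by (simp add: power_divide ln_div)
  moreover have "w \<le> v / 2" if "u \<le> v" "u = 2 * w" for u v w :: real using that by simp
  ultimately show "ln \<bar>x - y\<bar> - ln 2 \<le> abel_log r x y" unfolding K by blast
qed

text \<open>A sequence of radii in $[\frac12,1)$, so that the limit $r\to1$ is taken with the sequential
  convergence theorems.\<close>

definition abel_seq :: "nat \<Rightarrow> real" where "abel_seq k = 1 - 1 / real (k + 2)"

lemma abel_seq: "1/2 \<le> abel_seq k" "abel_seq k < 1" "0 \<le> abel_seq k" "abel_seq \<longlonglongrightarrow> 1"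
proof -
  show "1/2 \<le> abel_seq k" "abel_seq k < 1" "0 \<le> abel_seq k"
    by (simp_all add: abel_seq_def field_simps)
  have "(\<lambda>k. 1 - 1 / real (k + 2)) \<longlonglongrightarrow> 1 - 0"
    by (intro tendsto_intros LIMSEQ_ignore_initial_segment[OF lim_inverse_n'])
  then show "abel_seq \<longlonglongrightarrow> 1" by (simp add: abel_seq_def[abs_def])
qed

lemma abel_log_tendsto:
  assumes "x \<noteq> y" shows "(\<lambda>k. abel_log (abel_seq k) x y) \<longlonglongrightarrow> ln \<bar>x - y\<bar>"
proof -
  have eq: "(1 + 1\<^sup>2)\<^sup>2 - 1 * (1 + 1\<^sup>2) * x * y + 1\<^sup>2 * (x\<^sup>2 + y\<^sup>2 - 4) = (x - y)\<^sup>2"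
    by (simp add: power2_eq_square algebra_simps)
  have "(\<lambda>k. abel_log (abel_seq k) x y) \<longlonglongrightarrow> ln ((1 + 1\<^sup>2)\<^sup>2 - 1 * (1 + 1\<^sup>2) * x * y + 1\<^sup>2 * (x\<^sup>2 + y\<^sup>2 - 4)) / 2"
    unfolding abel_log_def by (intro tendsto_intros abel_seq) (use assms eq in auto)
  moreover have "ln ((x - y)\<^sup>2) / 2 = ln \<bar>x - y\<bar>"
    using assms ln_realpow[of "\<bar>x - y\<bar>" 2] by simp
  ultimately show ?thesis unfolding eq by simp
qed

lemma ln_abs_diff_le: "x \<in> I2 \<Longrightarrow> y \<in> I2 \<Longrightarrow> ln \<bar>x - y\<bar> \<le> 2 * ln 2"
proof (cases "x = y")
  case False
  assume "x \<in> I2" "y \<in> I2"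
  then have "ln \<bar>x - y\<bar> \<le> ln 4" using False by (subst ln_le_cancel_iff) auto
  also have "ln (4::real) = 2 * ln 2" using ln_realpow[of 2 2] by simp
  finally show ?thesis .
qed simp

lemma ln_abs_diff_measurable: "(\<lambda>y. ln \<bar>x - y\<bar>) \<in> borel_measurable beta"
  by (intro beta.borel_imp_measurable) simp

text \<open>Integrability of the logarithm, uniformly in \<open>x\<close>, comes from Fatou's lemma, since the Abel
  means are orthogonal to the constants and bounded above by $2\log 2$.\<close>

lemma
  assumes x: "x \<in> I2"
  shows log_integrable: "integrable beta (\<lambda>y. ln \<bar>x - y\<bar>)"
    and integral_abs_log_le: "(\<integral>y. \<bar>ln \<bar>x - y\<bar>\<bar> \<partial>beta) \<le> 4 * ln 2"
proof -
  have K: "integrable beta (abel_log (abel_seq k) x)" "(\<integral>y. abel_log (abel_seq k) x y \<partial>beta) = 0" for k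
    using integral_abel_log_phi[OF abel_seq(3,2) x, of k 0] by (simp_all add: phi_0)
  have nn: "0 \<le> 2 * ln 2 - ln \<bar>x - y\<bar>" if "y \<in> I2" for y using ln_abs_diff_le[OF x that] by simp
  have meas: "abel_log r x \<in> borel_measurable beta" for r by (rule abel_log_measurable)
  note [measurable] = ln_abs_diff_measurable[of x] meas
  have "(\<integral>\<^sup>+y. ennreal (2 * ln 2 - ln \<bar>x - y\<bar>) \<partial>beta)
      = (\<integral>\<^sup>+y. liminf (\<lambda>k. ennreal (2 * ln 2 - abel_log (abel_seq k) x y)) \<partial>beta)"
    using AE_beta_neq[of x]
  proof (intro nn_integral_cong_AE, eventually_elim)
    case (elim y)
    have "(\<lambda>k. ennreal (2 * ln 2 - abel_log (abel_seq k) x y)) \<longlonglongrightarrow> ennreal (2 * ln 2 - ln \<bar>x - y\<bar>)"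
      using elim by (intro tendsto_ennrealI tendsto_intros abel_log_tendsto) auto
    from lim_imp_Liminf[OF sequentially_bot this] show ?case by simp
  qed
  also have "\<dots> \<le> liminf (\<lambda>k. \<integral>\<^sup>+y. ennreal (2 * ln 2 - abel_log (abel_seq k) x y) \<partial>beta)"
    by (intro nn_integral_liminf) simp
  also have "(\<lambda>k. \<integral>\<^sup>+y. ennreal (2 * ln 2 - abel_log (abel_seq k) x y) \<partial>beta) = (\<lambda>k. ennreal (2 * ln 2))"
  proof
    fix k
    have "(\<integral>\<^sup>+y. ennreal (2 * ln 2 - abel_log (abel_seq k) x y) \<partial>beta)
        = ennreal (\<integral>y. 2 * ln 2 - abel_log (abel_seq k) x y \<partial>beta)"
      using abel_log_bounds(1)[OF abel_seq(1,2) x] K(1)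
      by (intro nn_integral_eq_integral AE_I2) (auto simp: space_beta)
    also have "(\<integral>y. 2 * ln 2 - abel_log (abel_seq k) x y \<partial>beta) = 2 * ln 2"
      using K by (simp add: space_beta)
    finally show "(\<integral>\<^sup>+y. ennreal (2 * ln 2 - abel_log (abel_seq k) x y) \<partial>beta) = ennreal (2 * ln 2)" .
  qed
  finally have le: "(\<integral>\<^sup>+y. ennreal (2 * ln 2 - ln \<bar>x - y\<bar>) \<partial>beta) \<le> ennreal (2 * ln 2)"
    by (simp add: Liminf_const)
  have int: "integrable beta (\<lambda>y. 2 * ln 2 - ln \<bar>x - y\<bar>)"
    using le nn by (intro integrableI_nonneg AE_I2) (auto simp: space_beta intro: le_less_trans)
  have "integrable beta (\<lambda>y. 2 * ln 2 - (2 * ln 2 - ln \<bar>x - y\<bar>))"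
    by (intro Bochner_Integration.integrable_diff int) simp
  then show log: "integrable beta (\<lambda>y. ln \<bar>x - y\<bar>)" by simp
  have "ennreal (\<integral>y. 2 * ln 2 - ln \<bar>x - y\<bar> \<partial>beta) \<le> ennreal (2 * ln 2)"
  proof -
    have "AE y in beta. 0 \<le> 2 * ln 2 - ln \<bar>x - y\<bar>"
      using nn by (intro AE_I2) (simp add: space_beta)
    from nn_integral_eq_integral[OF int this] show ?thesis using le by (simp only:)
  qed
  then have i: "(\<integral>y. 2 * ln 2 - ln \<bar>x - y\<bar> \<partial>beta) \<le> 2 * ln 2" by simp
  have "\<bar>ln \<bar>x - y\<bar>\<bar> \<le> (2 * ln 2 - ln \<bar>x - y\<bar>) + 2 * ln 2" if "y \<in> I2" for y
    using nn[OF that] by (auto simp: abs_le_iff)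
  then have "(\<integral>y. \<bar>ln \<bar>x - y\<bar>\<bar> \<partial>beta) \<le> (\<integral>y. (2 * ln 2 - ln \<bar>x - y\<bar>) + 2 * ln 2 \<partial>beta)"
    using log by (intro integral_mono) (auto simp: space_beta)
  also have "\<dots> = (\<integral>y. 2 * ln 2 - ln \<bar>x - y\<bar> \<partial>beta) + 2 * ln 2"
    using log by (simp add: space_beta)
  finally show "(\<integral>y. \<bar>ln \<bar>x - y\<bar>\<bar> \<partial>beta) \<le> 4 * ln 2" using i by linarith
qed

lemma log_bounded_integrable:
  assumes x: "x \<in> I2" and f: "f \<in> borel_measurable beta" and B: "\<And>y. y \<in> I2 \<Longrightarrow> \<bar>f y\<bar> \<le> B"
  shows "integrable beta (\<lambda>y. ln \<bar>x - y\<bar> * f y)"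
    and "\<bar>\<integral>y. ln \<bar>x - y\<bar> * f y \<partial>beta\<bar> \<le> 4 * ln 2 * B"
proof -
  note [measurable] = ln_abs_diff_measurable[of x] f
  have B0: "0 \<le> B" using B[of 0] by simp
  have le: "\<bar>ln \<bar>x - y\<bar> * f y\<bar> \<le> \<bar>ln \<bar>x - y\<bar>\<bar> * B" if "y \<in> I2" for y
    unfolding abs_mult using B[OF that] by (intro mult_left_mono) auto
  have int: "integrable beta (\<lambda>y. \<bar>ln \<bar>x - y\<bar>\<bar> * B)"
    using log_integrable[OF x] by simp
  show 1: "integrable beta (\<lambda>y. ln \<bar>x - y\<bar> * f y)"
  proof (intro Bochner_Integration.integrable_bound[OF int] AE_I2)
    fix y assume "y \<in> space beta"
    then show "norm (ln \<bar>x - y\<bar> * f y) \<le> norm (\<bar>ln \<bar>x - y\<bar>\<bar> * B)"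
      using order_trans[OF le abs_ge_self] by (simp only: real_norm_def space_beta)
  qed simp
  have "\<bar>\<integral>y. ln \<bar>x - y\<bar> * f y \<partial>beta\<bar> \<le> (\<integral>y. \<bar>ln \<bar>x - y\<bar> * f y\<bar> \<partial>beta)"
    by (rule integral_abs_bound)
  also have "\<dots> \<le> (\<integral>y. \<bar>ln \<bar>x - y\<bar>\<bar> * B \<partial>beta)"
    using 1 int le by (intro integral_mono) (auto simp: space_beta)
  also have "\<dots> \<le> 4 * ln 2 * B"
    using integral_abs_log_le[OF x] B0 by (simp add: mult_right_mono)
  finally show "\<bar>\<integral>y. ln \<bar>x - y\<bar> * f y \<partial>beta\<bar> \<le> 4 * ln 2 * B" .
qed

text \<open>The eigenvalue equation for the logarithmic potential, by letting \<open>r\<close> tend to 1 under the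
  bound of \<open>abel_log_bounds\<close>. For \<open>n = 0\<close> the convention $1/0=0$ gives the right value.\<close>

lemma E_op_phi:
  assumes x: "x \<in> I2"
  shows "E_op (phi n) x = 1 / real n * phi n x"
proof -
  note [measurable] = ln_abs_diff_measurable[of x] abel_log_measurable
  have [measurable]: "phi n \<in> borel_measurable beta" using phi_L2 by (rule L2_D)
  let ?u = "\<lambda>k y. - abel_log (abel_seq k) x y * phi n y"
  have "(\<lambda>k. \<integral>y. ?u k y \<partial>beta) \<longlonglongrightarrow> (\<integral>y. - ln \<bar>x - y\<bar> * phi n y \<partial>beta)"
  proof (rule integral_dominated_convergence[where w = "\<lambda>y. \<bar>ln \<bar>x - y\<bar>\<bar> + 2 * ln 2"])
    show "integrable beta (\<lambda>y. \<bar>ln \<bar>x - y\<bar>\<bar> + 2 * ln 2)"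
      using log_integrable[OF x] by simp
    show "AE y in beta. (\<lambda>k. ?u k y) \<longlonglongrightarrow> - ln \<bar>x - y\<bar> * phi n y"
      using AE_beta_neq[of x]
    proof eventually_elim
      case (elim y)
      then show ?case by (intro tendsto_intros abel_log_tendsto) auto
    qed
    fix k
    show "AE y in beta. norm (?u k y) \<le> \<bar>ln \<bar>x - y\<bar>\<bar> + 2 * ln 2"
      using AE_beta_neq[of x] AE_space
    proof eventually_elim
      case (elim y)
      then have y: "y \<in> I2" by (simp add: space_beta)
      have "\<bar>abel_log (abel_seq k) x y\<bar> \<le> \<bar>ln \<bar>x - y\<bar>\<bar> + 2 * ln 2"
      proof -
        have "0 < ln (2::real)" by simp
        then show ?thesis using abel_log_bounds[OF abel_seq(1,2) x y, of k] elim(1) by linarith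
      qed
      then have "\<bar>abel_log (abel_seq k) x y\<bar> * \<bar>phi n y\<bar> \<le> (\<bar>ln \<bar>x - y\<bar>\<bar> + 2 * ln 2) * 1"
        using abs_phi_le_1[OF y] by (intro mult_mono) auto
      then show ?case by (simp add: abs_mult)
    qed
  qed simp_all
  moreover have "(\<lambda>k. \<integral>y. ?u k y \<partial>beta) \<longlonglongrightarrow> 1 ^ n / real n * phi n x"
    unfolding integral_abel_log_phi(2)[OF abel_seq(3,2) x] divide_inverse
    by (intro tendsto_intros abel_seq)
  ultimately have "(\<integral>y. - ln \<bar>x - y\<bar> * phi n y \<partial>beta) = 1 / real n * phi n x"
    using LIMSEQ_unique by fastforce
  then show ?thesis by (simp add: E_op_def)
qed


section \<open>Approximation of smooth functions by polynomials\<close>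

lemma dI_eqI:
  assumes "x \<in> I2" "(f has_real_derivative D) (at x within I2)"
  shows "dI f x = D"
  unfolding dI_def
  by (rule vector_derivative_within_cbox[of "-2" 2, simplified])
     (use assms in \<open>simp_all add: has_real_derivative_iff_has_vector_derivative\<close>)

lemma has_dI:
  assumes "f differentiable_on I2" "x \<in> I2"
  shows "(f has_real_derivative dI f x) (at x within I2)"
  using assms by (simp add: differentiable_on_def vector_derivative_works[symmetric] dI_def
      has_real_derivative_iff_has_vector_derivative)

lemma differentiable_on_I2I:
  assumes "\<And>x. x \<in> I2 \<Longrightarrow> (f has_real_derivative f' x) (at x within I2)"
  shows "f differentiable_on I2"
  using assms unfolding differentiable_on_def
  by (metis real_differentiable_def)

lemma has_dI_cong:
  assumes eq: "\<And>x. x \<in> I2 \<Longrightarrow> f x = g x" and x: "x \<in> I2"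
  shows "(f has_real_derivative D) (at x within I2) \<longleftrightarrow> (g has_real_derivative D) (at x within I2)"
  unfolding has_field_derivative_def
  using has_derivative_transform[OF x, of f g] has_derivative_transform[OF x, of g f] eq by metis

lemma dI_cong:
  assumes eq: "\<And>x. x \<in> I2 \<Longrightarrow> f x = g x" and x: "x \<in> I2"
  shows "dI f x = dI g x"
  unfolding dI_def vector_derivative_def has_real_derivative_iff_has_vector_derivative[symmetric]
  using has_dI_cong[OF eq x] by auto

lemma Ck_cong:
  assumes "\<And>x. x \<in> I2 \<Longrightarrow> f x = g x"
  shows "Ck k f \<longleftrightarrow> Ck k g"
  using assms
proof (induction k arbitrary: f g)
  case 0
  then show ?case using continuous_on_cong[OF refl, of I2 f g] by simp
next
  case (Suc k)
  have "f differentiable_on I2 \<longleftrightarrow> g differentiable_on I2"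
  proof
    assume "f differentiable_on I2"
    from has_dI[OF this] show "g differentiable_on I2"
      using has_dI_cong[of f g, OF Suc.prems] by (blast intro: differentiable_on_I2I)
  next
    assume "g differentiable_on I2"
    from has_dI[OF this] show "f differentiable_on I2"
      using has_dI_cong[of f g, OF Suc.prems] by (blast intro: differentiable_on_I2I)
  qed
  moreover have "Ck k (dI f) \<longleftrightarrow> Ck k (dI g)"
    by (rule Suc.IH) (rule dI_cong[OF Suc.prems])
  ultimately show ?case by simp
qed

lemma Ck_Suc_D: "Ck (Suc k) f \<Longrightarrow> Ck k f"
  by (induction k arbitrary: f) (auto intro: differentiable_imp_continuous_on)

lemma Ck_mono: "Ck k f \<Longrightarrow> j \<le> k \<Longrightarrow> Ck j f"
  using Ck_Suc_D by (induction k) (auto simp: le_Suc_eq simp del: Ck.simps(2))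

lemma Ck_continuous: "Ck k f \<Longrightarrow> continuous_on I2 f"
  using Ck_mono[of k f 0] by simp

lemma Ck_has_dI: "Ck (Suc k) f \<Longrightarrow> x \<in> I2 \<Longrightarrow> (f has_real_derivative dI f x) (at x within I2)"
  by (simp add: has_dI)

lemma Ck_L2: "Ck k f \<Longrightarrow> f \<in> L2 beta"
  by (intro beta.continuous_L2 Ck_continuous)

lemma Ck_dI_measurable: "Ck (Suc k) f \<Longrightarrow> dI f \<in> borel_measurable beta"
  by (intro beta.continuous_measurable Ck_continuous[of k]) simp

lemma poly_has_derivative: "(poly p has_real_derivative poly (pderiv p) x) (at x within S)"
  by (rule has_field_derivative_at_within[OF poly_DERIV])

lemma dI_poly: "x \<in> I2 \<Longrightarrow> dI (poly p) x = poly (pderiv p) x"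
  by (intro dI_eqI poly_has_derivative)

lemma Ck_poly: "Ck k (poly p)"
proof (induction k arbitrary: p)
  case (Suc k)
  have "Ck k (dI (poly p)) \<longleftrightarrow> Ck k (poly (pderiv p))" by (intro Ck_cong dI_poly)
  then show ?case using Suc
    by (auto intro!: differentiable_on_I2I[of _ "poly (pderiv p)"] poly_has_derivative)
qed (auto intro!: continuous_intros)

lemma Lipschitz_I2:
  fixes f :: "real \<Rightarrow> real"
  assumes "\<And>x. x \<in> I2 \<Longrightarrow> (f has_real_derivative f' x) (at x within I2)" "\<And>x. x \<in> I2 \<Longrightarrow> \<bar>f' x\<bar> \<le> B"
    and "x \<in> I2" "y \<in> I2"
  shows "\<bar>f x - f y\<bar> \<le> B * \<bar>x - y\<bar>"
  using field_differentiable_bound[of I2 f f' B x y] assms by simp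

lemma continuous_bounded_I2:
  fixes f :: "real \<Rightarrow> real"
  assumes "continuous_on I2 f"
  obtains B where "0 \<le> B" "\<And>x. x \<in> I2 \<Longrightarrow> \<bar>f x\<bar> \<le> B"
proof -
  have "bounded (f ` I2)"
    by (intro compact_imp_bounded compact_continuous_image assms) simp
  then obtain B where B: "\<And>x. x \<in> I2 \<Longrightarrow> \<bar>f x\<bar> \<le> B" unfolding bounded_iff by force
  show ?thesis using B[of 0] by (intro that[of B] B) auto
qed

lemma pderiv_sum: "pderiv (\<Sum>i\<in>I. f i) = (\<Sum>i\<in>I. pderiv (f i))"
  by (induction I rule: infinite_finite_induct) (simp_all add: pderiv_add)

lemma poly_antiderivative: "\<exists>p. pderiv p = (q :: real poly)"
proof
  have "pderiv (\<Sum>i\<le>degree q. monom (coeff q i / real (Suc i)) (Suc i)) = (\<Sum>i\<le>degree q. monom (coeff q i) i)"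
    by (simp add: pderiv_sum pderiv_monom del: of_nat_Suc)
  also have "\<dots> = q" by (rule poly_as_sum_of_monoms)
  finally show "pderiv (\<Sum>i\<le>degree q. monom (coeff q i / real (Suc i)) (Suc i)) = q" .
qed

text \<open>Approximation in $C^k$ goes from the highest derivative downwards: a uniform approximation of the
  derivative is integrated, which multiplies the error by at most the length of the interval.\<close>

lemma poly_approx_antiderivative:
  assumes f: "f differentiable_on I2" and q: "\<And>x. x \<in> I2 \<Longrightarrow> \<bar>dI f x - poly q x\<bar> \<le> e"
  shows "\<exists>p. pderiv p = q \<and> (\<forall>x\<in>I2. \<bar>f x - poly p x\<bar> \<le> 4 * e)"
proof -
  obtain p0 where p0: "pderiv p0 = q" using poly_antiderivative by blast
  define p where "p = p0 + [:f 0 - poly p0 0:]"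
  have p: "pderiv p = q" "poly p 0 = f 0" by (simp_all add: p_def p0 pderiv_add pderiv_pCons)
  have e: "0 \<le> e" using q[of 0] by simp
  have "\<bar>f x - poly p x\<bar> \<le> 4 * e" if x: "x \<in> I2" for x
  proof -
    have "\<bar>(f x - poly p x) - (f 0 - poly p 0)\<bar> \<le> e * \<bar>x - 0\<bar>"
    proof (rule Lipschitz_I2[where f = "\<lambda>x. f x - poly p x" and f' = "\<lambda>y. dI f y - poly q y"])
      fix y :: real assume y: "y \<in> I2"
      show "((\<lambda>x. f x - poly p x) has_real_derivative dI f y - poly q y) (at y within I2)"
        unfolding p(1)[symmetric]
        by (intro DERIV_diff has_dI[OF f y] poly_has_derivative)
    qed (use q x in auto)
    also have "\<dots> \<le> e * 4" using x e by (intro mult_left_mono) auto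
    finally show ?thesis using p(2) by simp
  qed
  then show ?thesis using p(1) by blast
qed

text \<open>The common error bound of all approximating sequences below, which makes them combine without
  choosing subsequences.\<close>

definition err :: "nat \<Rightarrow> real" where "err k = 1 / real (Suc k)"

lemma err_pos: "0 < err k" by (simp add: err_def)

lemma err_tendsto: "err \<longlonglongrightarrow> 0"
  using lim_inverse_n'[THEN LIMSEQ_Suc] by (simp add: err_def[abs_def])

lemma tendsto_err:
  fixes a :: "nat \<Rightarrow> real"
  assumes "\<And>k. \<bar>a k - l\<bar> \<le> C * err k" shows "a \<longlonglongrightarrow> l"
proof -
  have "(\<lambda>k. a k - l) \<longlonglongrightarrow> 0"
  proof (rule Lim_null_comparison)
    show "\<forall>\<^sub>F k in sequentially. norm (a k - l) \<le> C * err k" using assms by simp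
    show "(\<lambda>k. C * err k) \<longlonglongrightarrow> 0" using tendsto_mult_left[OF err_tendsto, of C] by simp
  qed
  then show ?thesis by (simp add: LIM_zero_iff)
qed

lemma C1_poly_seq:
  assumes "Ck 1 f"
  obtains p where "\<And>k x. x \<in> I2 \<Longrightarrow> \<bar>f x - poly (p k) x\<bar> \<le> err k"
    "\<And>k x. x \<in> I2 \<Longrightarrow> \<bar>dI f x - poly (pderiv (p k)) x\<bar> \<le> err k"
proof -
  have f: "f differentiable_on I2" "continuous_on I2 (dI f)" using assms by (simp_all add: One_nat_def)
  have "\<exists>p. \<forall>x\<in>I2. \<bar>f x - poly p x\<bar> \<le> err k \<and> \<bar>dI f x - poly (pderiv p) x\<bar> \<le> err k" for k
  proof -
    have ek: "0 < err k / 4" using err_pos[of k] by simp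
    obtain q where q: "\<forall>x\<in>I2. \<bar>dI f x - poly q x\<bar> < err k / 4"
      using Weierstrass_poly[OF f(2) ek] by blast
    have "\<exists>p. pderiv p = q \<and> (\<forall>x\<in>I2. \<bar>f x - poly p x\<bar> \<le> 4 * (err k / 4))"
      by (rule poly_approx_antiderivative[OF f(1)]) (use q in \<open>auto intro: less_imp_le\<close>)
    then obtain p where p: "pderiv p = q" "\<forall>x\<in>I2. \<bar>f x - poly p x\<bar> \<le> 4 * (err k / 4)" by blast
    have "\<bar>f x - poly p x\<bar> \<le> err k \<and> \<bar>dI f x - poly (pderiv p) x\<bar> \<le> err k" if "x \<in> I2" for x
      using bspec[OF q that] bspec[OF p(2) that] ek unfolding p(1) by linarith
    then show ?thesis by blast
  qed
  then obtain p where "\<And>k. \<forall>x\<in>I2. \<bar>f x - poly (p k) x\<bar> \<le> err k \<and> \<bar>dI f x - poly (pderiv (p k)) x\<bar> \<le> err k"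
    by metis
  then show ?thesis using that by blast
qed

lemma C2_poly_seq:
  assumes "Ck 2 f"
  obtains p where "\<And>k x. x \<in> I2 \<Longrightarrow> \<bar>f x - poly (p k) x\<bar> \<le> err k"
    "\<And>k x. x \<in> I2 \<Longrightarrow> \<bar>dI f x - poly (pderiv (p k)) x\<bar> \<le> err k"
    "\<And>k x. x \<in> I2 \<Longrightarrow> \<bar>dI (dI f) x - poly (pderiv (pderiv (p k))) x\<bar> \<le> err k"
proof -
  have f: "f differentiable_on I2" "dI f differentiable_on I2" "continuous_on I2 (dI (dI f))"
    using assms by (simp_all add: numeral_2_eq_2)
  have "\<exists>p. \<forall>x\<in>I2. \<bar>f x - poly p x\<bar> \<le> err k \<and> \<bar>dI f x - poly (pderiv p) x\<bar> \<le> err k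
      \<and> \<bar>dI (dI f) x - poly (pderiv (pderiv p)) x\<bar> \<le> err k" for k
  proof -
    have ek: "0 < err k / 16" using err_pos[of k] by simp
    obtain q where q: "\<forall>x\<in>I2. \<bar>dI (dI f) x - poly q x\<bar> < err k / 16"
      using Weierstrass_poly[OF f(3) ek] by blast
    have "\<exists>p. pderiv p = q \<and> (\<forall>x\<in>I2. \<bar>dI f x - poly p x\<bar> \<le> 4 * (err k / 16))"
      by (rule poly_approx_antiderivative[OF f(2)]) (use q in \<open>auto intro: less_imp_le\<close>)
    then obtain q1 where q1: "pderiv q1 = q" "\<forall>x\<in>I2. \<bar>dI f x - poly q1 x\<bar> \<le> 4 * (err k / 16)" by blast
    have "\<exists>p. pderiv p = q1 \<and> (\<forall>x\<in>I2. \<bar>f x - poly p x\<bar> \<le> 4 * (4 * (err k / 16)))"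
      by (rule poly_approx_antiderivative[OF f(1)]) (use q1 in auto)
    then obtain p where p: "pderiv p = q1" "\<forall>x\<in>I2. \<bar>f x - poly p x\<bar> \<le> 4 * (4 * (err k / 16))" by blast
    have "\<bar>f x - poly p x\<bar> \<le> err k \<and> \<bar>dI f x - poly (pderiv p) x\<bar> \<le> err k
      \<and> \<bar>dI (dI f) x - poly (pderiv (pderiv p)) x\<bar> \<le> err k" if "x \<in> I2" for x
      using bspec[OF q that] bspec[OF q1(2) that] bspec[OF p(2) that] ek unfolding p(1) q1(1) by linarith
    then show ?thesis by blast
  qed
  then obtain p where "\<And>k. \<forall>x\<in>I2. \<bar>f x - poly (p k) x\<bar> \<le> err k \<and> \<bar>dI f x - poly (pderiv (p k)) x\<bar> \<le> err k
      \<and> \<bar>dI (dI f) x - poly (pderiv (pderiv (p k))) x\<bar> \<le> err k"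
    by metis
  then show ?thesis using that by blast
qed

inductive phi_span :: "real poly \<Rightarrow> bool" where
  base: "phi_span (smult c (phi_poly n))"
| add: "phi_span p \<Longrightarrow> phi_span q \<Longrightarrow> phi_span (p + q)"

lemma phi_span_X_mult: "phi_span p \<Longrightarrow> phi_span ([:0, 1:] * p)"
proof (induction rule: phi_span.induct)
  case (base c n)
  show ?case
  proof (cases n)
    case 0
    have "[:0, 1:] * smult c (phi_poly n) = smult (2 * c) (phi_poly 1)"
      using 0 by (simp add: poly_eq_poly_eq_iff[symmetric] fun_eq_iff poly_phi phi_0 phi_1)
    then show ?thesis by (metis phi_span.base)
  next
    case (Suc m)
    have "[:0, 1:] * smult c (phi_poly n) = smult c (phi_poly (Suc (Suc m))) + smult c (phi_poly m)"
      using Suc by (simp add: poly_eq_poly_eq_iff[symmetric] fun_eq_iff poly_phi phi_rec algebra_simps)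
    then show ?thesis by (metis phi_span.base phi_span.add)
  qed
next
  case (add p q)
  then show ?case by (metis phi_span.add distrib_left)
qed

lemma phi_span: "phi_span p"
proof (induction p rule: pCons_induct)
  case 0
  show ?case using phi_span.base[of 0 0] by simp
next
  case (pCons a p)
  have "pCons a p = smult a (phi_poly 0) + [:0, 1:] * p"
    by (simp add: poly_eq_poly_eq_iff[symmetric] fun_eq_iff poly_phi phi_0)
  then show ?case using phi_span.add[OF phi_span.base[of a 0] phi_span_X_mult[OF pCons(2)]] by simp
qed

text \<open>Every polynomial is a linear combination of the $\phi_n$, so a property stable under addition
  need only be checked on multiples of the $\phi_n$.\<close>

lemma poly_phi_induct [case_names phi add]:
  assumes "\<And>c n. P (smult c (phi_poly n))" "\<And>p q. P p \<Longrightarrow> P q \<Longrightarrow> P (p + q)"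
  shows "P p"
  using phi_span[of p] by (induction rule: phi_span.induct) (auto intro: assms)


section \<open>The operators on polynomials\<close>

text \<open>The singular part of $\mathcal{N}$ is this operator applied to the derivative; on polynomials it is
  also the derivative of the logarithmic potential.\<close>

definition quot_op :: "(real \<Rightarrow> real) \<Rightarrow> real \<Rightarrow> real" where
  "quot_op f x = (\<integral>y. (f x - f y) / (x - y) \<partial>beta)"

lemma N_op_quot: "N_op f x = (\<integral>y. y * dI f y \<partial>beta) + x * (\<integral>y. dI f y \<partial>beta) - (4 - x\<^sup>2) * quot_op (dI f) x"
  by (simp add: N_op_def quot_op_def)

lemma abs_quot_le:
  fixes f :: "real \<Rightarrow> real"
  assumes "\<bar>f x - f y\<bar> \<le> B * \<bar>x - y\<bar>" "0 \<le> B"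
  shows "\<bar>(f x - f y) / (x - y)\<bar> \<le> B"
  using assms by (cases "x = y") (auto simp: abs_divide divide_le_eq)

lemma abs_integral_beta_le:
  fixes f :: "real \<Rightarrow> real"
  assumes "f \<in> borel_measurable beta" "\<And>x. x \<in> I2 \<Longrightarrow> \<bar>f x\<bar> \<le> B"
  shows "\<bar>\<integral>x. f x \<partial>beta\<bar> \<le> B"
proof -
  have int: "integrable beta f" using assms by (intro beta.bounded_integrable) (auto simp: space_beta)
  have "\<bar>\<integral>x. f x \<partial>beta\<bar> \<le> (\<integral>x. \<bar>f x\<bar> \<partial>beta)" by (rule integral_abs_bound)
  also have "\<dots> \<le> (\<integral>x. B \<partial>beta)"
    using int assms(2) by (intro integral_mono) (auto simp: space_beta)
  finally show ?thesis by (simp add: space_beta)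
qed

lemma quot_measurable:
  fixes f :: "real \<Rightarrow> real"
  assumes [measurable]: "f \<in> borel_measurable beta"
  shows "(\<lambda>y. (f x - f y) / (x - y)) \<in> borel_measurable beta"
proof -
  have [measurable]: "(\<lambda>y. y) \<in> borel_measurable beta" by (rule beta.borel_imp_measurable) simp
  show ?thesis by measurable
qed

lemma
  assumes f: "f \<in> borel_measurable beta" and L: "\<And>y. y \<in> I2 \<Longrightarrow> \<bar>f x - f y\<bar> \<le> B * \<bar>x - y\<bar>" "0 \<le> B"
  shows quot_integrable: "integrable beta (\<lambda>y. (f x - f y) / (x - y))"
    and abs_quot_op_le: "\<bar>quot_op f x\<bar> \<le> B"
proof -
  have le: "\<bar>(f x - f y) / (x - y)\<bar> \<le> B" if "y \<in> I2" for y
    using L that by (intro abs_quot_le) auto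
  show "integrable beta (\<lambda>y. (f x - f y) / (x - y))"
    by (intro beta.bounded_integrable[where B = B] quot_measurable f) (use le in \<open>auto simp: space_beta\<close>)
  show "\<bar>quot_op f x\<bar> \<le> B"
    unfolding quot_op_def by (intro abs_integral_beta_le quot_measurable f le)
qed

lemma poly_Lipschitz:
  assumes "\<And>x. x \<in> I2 \<Longrightarrow> \<bar>poly (pderiv p) x\<bar> \<le> B" "x \<in> I2" "y \<in> I2"
  shows "\<bar>poly p x - poly p y\<bar> \<le> B * \<bar>x - y\<bar>"
  by (rule Lipschitz_I2[where f' = "poly (pderiv p)"])
     (use assms in \<open>auto intro!: poly_has_derivative\<close>)

lemma poly_measurable_beta [measurable]: "poly p \<in> borel_measurable beta"
  by (rule beta.borel_imp_measurable) (intro borel_measurable_continuous_onI continuous_intros)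

lemma poly_quot_integrable:
  assumes "x \<in> I2"
  shows "integrable beta (\<lambda>y. (poly p x - poly p y) / (x - y))"
proof -
  have "continuous_on I2 (poly (pderiv p))" by (intro continuous_intros)
  then obtain B where "0 \<le> B" "\<And>x. x \<in> I2 \<Longrightarrow> \<bar>poly (pderiv p) x\<bar> \<le> B"
    using continuous_bounded_I2 by blast
  then show ?thesis using poly_Lipschitz[of p B x] assms
    by (intro quot_integrable[where B = B]) auto
qed

lemma phi_quot_integrable: "x \<in> I2 \<Longrightarrow> integrable beta (\<lambda>y. (phi n x - phi n y) / (x - y))"
  using poly_quot_integrable[of x "phi_poly n"] by (simp add: poly_phi)

lemma psi_eq_poly: "\<exists>p. psi n = poly p"
proof (induction n rule: cheb_T.induct)
  case 1
  show ?case by (intro exI[of _ 0]) (simp add: fun_eq_iff)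
next
  case 2
  show ?case by (intro exI[of _ "[:1/2:]"]) (simp add: fun_eq_iff)
next
  case (3 n)
  then obtain p q where "psi n = poly p" "psi (Suc n) = poly q" by blast
  then show ?case by (intro exI[of _ "[:0, 1:] * q - p"]) (simp add: fun_eq_iff)
qed

lemma phi_measurable [measurable]: "phi n \<in> borel_measurable beta"
  using phi_L2 by (rule L2_D)

text \<open>Dividing the recursion of the $\phi_n$ by $x-y$ and integrating reproduces the recursion of the
  $\psi_n$; the extra term $\int\phi_{n+1}\,d\beta$ vanishes.\<close>

lemma quot_op_phi: "x \<in> I2 \<Longrightarrow> quot_op (phi n) x = psi n x"
proof (induction n rule: cheb_T.induct)
  case 1
  then show ?case by (simp add: quot_op_def phi_0)
next
  case 2
  have "quot_op (phi (Suc 0)) x = (\<integral>y. 1/2 \<partial>beta)"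
    unfolding quot_op_def
  proof (rule integral_cong_AE)
    show "AE y in beta. (phi (Suc 0) x - phi (Suc 0) y) / (x - y) = 1/2"
      using AE_beta_neq[of x] by eventually_elim (simp add: phi_1 field_simps)
  qed (auto intro!: quot_measurable phi_measurable)
  then show ?case by (simp add: space_beta)
next
  case (3 n)
  note int = phi_quot_integrable[OF 3(3), of "Suc n"] phi_quot_integrable[OF 3(3), of n]
    beta.L2_integrable[OF phi_L2[of "Suc n"]]
  have "quot_op (phi (Suc (Suc n))) x
    = (\<integral>y. x * ((phi (Suc n) x - phi (Suc n) y) / (x - y)) + phi (Suc n) y - (phi n x - phi n y) / (x - y) \<partial>beta)"
    unfolding quot_op_def
  proof (rule integral_cong_AE)
    show "AE y in beta. (phi (Suc (Suc n)) x - phi (Suc (Suc n)) y) / (x - y)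
      = x * ((phi (Suc n) x - phi (Suc n) y) / (x - y)) + phi (Suc n) y - (phi n x - phi n y) / (x - y)"
      using AE_beta_neq[of x]
    proof eventually_elim
      case (elim y)
      have num: "phi (Suc (Suc n)) x - phi (Suc (Suc n)) y
          = x * (phi (Suc n) x - phi (Suc n) y) + phi (Suc n) y * (x - y) - (phi n x - phi n y)"
        by (simp add: phi_rec algebra_simps)
      have "(a * b + c * d - f) / d = a * (b / d) + c - f / d" if "d \<noteq> 0" for a b c d f :: real
        using that by (simp add: add_divide_distrib diff_divide_distrib)
      then show ?case unfolding num using elim by simp
    qed
  qed (intro quot_measurable phi_measurable borel_measurable_add borel_measurable_diff borel_measurable_times
      borel_measurable_const)+
  also have "\<dots> = x * quot_op (phi (Suc n)) x + (\<integral>y. phi (Suc n) y \<partial>beta) - quot_op (phi n) x"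
    unfolding quot_op_def
    by (simp only: Bochner_Integration.integral_diff Bochner_Integration.integral_add integral_mult_right_zero
        Bochner_Integration.integrable_add integrable_mult_right int)
  also have "\<dots> = psi (Suc (Suc n)) x" using 3 by (simp add: integral_phi)
  finally show ?case .
qed

lemma dI_phi: "x \<in> I2 \<Longrightarrow> dI (phi n) x = real n * psi n x"
  using dI_poly[of x "phi_poly n"] by (simp add: poly_phi pderiv_phi)

text \<open>Moving the factor $4-x^2$ inside the difference quotient turns the defining formula into
  $\mathcal{N}\phi_n=-n\int\frac{h(x)-h(y)}{x-y}\beta(dy)$ with
  $h=(4-x^2)\psi_n=\phi_{n-1}-\phi_{n+1}$.\<close>

lemma N_op_phi:
  assumes x: "x \<in> I2"
  shows "N_op (phi n) x = real n * phi n x"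
proof (cases n)
  case 0
  have "dI (phi 0) y = 0" if "y \<in> I2" for y using dI_phi[OF that, of 0] by simp
  moreover from this have "(\<integral>y. y * dI (phi 0) y \<partial>beta) = (\<integral>y. 0 \<partial>beta)" "(\<integral>y. dI (phi 0) y \<partial>beta) = (\<integral>y. 0 \<partial>beta)"
    "quot_op (dI (phi 0)) x = (\<integral>y. 0 \<partial>beta)"
    unfolding quot_op_def using x by (intro Bochner_Integration.integral_cong; simp add: space_beta)+
  ultimately show ?thesis using 0 by (simp add: N_op_quot)
next
  case (Suc m)
  obtain p where p: "psi n = poly p" using psi_eq_poly by blast
  have int_q: "integrable beta (\<lambda>y. (psi n x - psi n y) / (x - y))"
    unfolding p by (rule poly_quot_integrable[OF x])
  have int: "integrable beta (psi n)" unfolding p by (intro beta.L2_integrable beta.poly_L2)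
  have int_y: "integrable beta (\<lambda>y. y * psi n y)"
  proof -
    have "(\<lambda>y. y * psi n y) = poly ([:0, 1:] * p)" by (simp add: p fun_eq_iff)
    then show ?thesis by (simp only: beta.L2_integrable beta.poly_L2)
  qed
  have 1: "(\<integral>y. y * dI (phi n) y \<partial>beta) = real n * (\<integral>y. y * psi n y \<partial>beta)"
  proof -
    have "(\<integral>y. y * dI (phi n) y \<partial>beta) = (\<integral>y. real n * (y * psi n y) \<partial>beta)"
      by (intro Bochner_Integration.integral_cong) (auto simp: space_beta dI_phi)
    then show ?thesis by simp
  qed
  have 2: "(\<integral>y. dI (phi n) y \<partial>beta) = real n * (\<integral>y. psi n y \<partial>beta)"
  proof -
    have "(\<integral>y. dI (phi n) y \<partial>beta) = (\<integral>y. real n * psi n y \<partial>beta)"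
      by (intro Bochner_Integration.integral_cong) (auto simp: space_beta dI_phi)
    then show ?thesis by simp
  qed
  have 3: "quot_op (dI (phi n)) x = real n * quot_op (psi n) x"
  proof -
    have "quot_op (dI (phi n)) x = (\<integral>y. real n * ((psi n x - psi n y) / (x - y)) \<partial>beta)"
      unfolding quot_op_def
    proof (intro Bochner_Integration.integral_cong refl)
      fix y assume "y \<in> space beta"
      then show "(dI (phi n) x - dI (phi n) y) / (x - y) = real n * ((psi n x - psi n y) / (x - y))"
        by (simp only: space_beta dI_phi x right_diff_distrib[symmetric] times_divide_eq_right)
    qed
    also have "\<dots> = real n * quot_op (psi n) x" unfolding quot_op_def by (rule integral_mult_right_zero)
    finally show ?thesis .
  qed
  have "psi m x - psi (Suc (Suc m)) x = quot_op (phi m) x - quot_op (phi (Suc (Suc m))) x"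
    by (simp only: quot_op_phi[OF x])
  also have "\<dots> = (\<integral>y. (phi m x - phi m y) / (x - y) - (phi (Suc (Suc m)) x - phi (Suc (Suc m)) y) / (x - y) \<partial>beta)"
    unfolding quot_op_def by (rule Bochner_Integration.integral_diff[symmetric]) (rule phi_quot_integrable[OF x])+
  also have "\<dots> = (\<integral>y. (4 - x\<^sup>2) * ((psi n x - psi n y) / (x - y)) - (x * psi n y + y * psi n y) \<partial>beta)"
  proof (rule integral_cong_AE)
    show "AE y in beta. (phi m x - phi m y) / (x - y) - (phi (Suc (Suc m)) x - phi (Suc (Suc m)) y) / (x - y)
        = (4 - x\<^sup>2) * ((psi n x - psi n y) / (x - y)) - (x * psi n y + y * psi n y)"
      using AE_beta_neq[of x]
    proof eventually_elim
      case (elim y)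
      have "(phi m x - phi m y) - (phi (Suc (Suc m)) x - phi (Suc (Suc m)) y)
          = (4 - x\<^sup>2) * psi n x - (4 - y\<^sup>2) * psi n y"
        unfolding Suc four_minus_sq_psi by simp
      also have "\<dots> = (4 - x\<^sup>2) * (psi n x - psi n y) - (x * psi n y + y * psi n y) * (x - y)"
        by (simp add: power2_eq_square algebra_simps)
      finally have "((phi m x - phi m y) - (phi (Suc (Suc m)) x - phi (Suc (Suc m)) y)) / (x - y)
        = ((4 - x\<^sup>2) * (psi n x - psi n y) - (x * psi n y + y * psi n y) * (x - y)) / (x - y)" by simp
      then show ?case using elim by (simp add: diff_divide_distrib[symmetric]) (simp add: diff_divide_distrib)
    qed
  next
    show "(\<lambda>y. (phi m x - phi m y) / (x - y) - (phi (Suc (Suc m)) x - phi (Suc (Suc m)) y) / (x - y)) \<in> borel_measurable beta"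
      by (intro borel_measurable_diff borel_measurable_integrable phi_quot_integrable x)
    show "(\<lambda>y. (4 - x\<^sup>2) * ((psi n x - psi n y) / (x - y)) - (x * psi n y + y * psi n y)) \<in> borel_measurable beta"
      by (intro borel_measurable_diff borel_measurable_add borel_measurable_times borel_measurable_const
          borel_measurable_integrable int_q int int_y)
  qed
  also have "\<dots> = (4 - x\<^sup>2) * quot_op (psi n) x - (x * (\<integral>y. psi n y \<partial>beta) + (\<integral>y. y * psi n y \<partial>beta))"
    unfolding quot_op_def
    by (subst Bochner_Integration.integral_diff)
       (intro Bochner_Integration.integrable_add integrable_mult_right int_q int int_y |
        simp only: integral_mult_right_zero Bochner_Integration.integral_add integrable_mult_right int int_y)+
  finally have "(4 - x\<^sup>2) * quot_op (psi n) x - (x * (\<integral>y. psi n y \<partial>beta) + (\<integral>y. y * psi n y \<partial>beta)) = - phi n x"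
    unfolding Suc psi_diff[symmetric] by simp
  then have "real n * ((4 - x\<^sup>2) * quot_op (psi n) x - (x * (\<integral>y. psi n y \<partial>beta) + (\<integral>y. y * psi n y \<partial>beta))) = real n * (- phi n x)"
    by simp
  then show ?thesis unfolding N_op_quot 1 2 3 by (simp add: algebra_simps)
qed

lemma poly_integrable_beta: "integrable beta (poly p)"
  by (intro beta.L2_integrable beta.poly_L2)

lemma N_op_poly:
  assumes x: "x \<in> I2"
  shows "N_op (poly p) x = (\<integral>y. y * poly (pderiv p) y \<partial>beta) + x * (\<integral>y. poly (pderiv p) y \<partial>beta)
    - (4 - x\<^sup>2) * quot_op (poly (pderiv p)) x"
proof -
  have "(\<integral>y. y * dI (poly p) y \<partial>beta) = (\<integral>y. y * poly (pderiv p) y \<partial>beta)"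
    "(\<integral>y. dI (poly p) y \<partial>beta) = (\<integral>y. poly (pderiv p) y \<partial>beta)"
    "quot_op (dI (poly p)) x = quot_op (poly (pderiv p)) x"
    unfolding quot_op_def using x
    by (intro Bochner_Integration.integral_cong; simp add: space_beta dI_poly)+
  then show ?thesis by (simp add: N_op_quot)
qed

lemma quot_op_poly_add: "x \<in> I2 \<Longrightarrow> quot_op (poly (p + q)) x = quot_op (poly p) x + quot_op (poly q) x"
  unfolding quot_op_def
  by (simp add: Bochner_Integration.integral_add[OF poly_quot_integrable poly_quot_integrable, symmetric]
      add_divide_distrib[symmetric] add_diff_add)

lemma quot_op_smult: "quot_op (poly (smult c p)) x = c * quot_op (poly p) x"
proof -
  have "(\<lambda>y. (poly (smult c p) x - poly (smult c p) y) / (x - y)) = (\<lambda>y. c * ((poly p x - poly p y) / (x - y)))"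
    by (simp add: fun_eq_iff right_diff_distrib[symmetric])
  then show ?thesis unfolding quot_op_def by (simp only: integral_mult_right_zero)
qed

lemma N_op_poly_add:
  assumes "x \<in> I2" shows "N_op (poly (p + q)) x = N_op (poly p) x + N_op (poly q) x"
proof -
  have int: "integrable beta (\<lambda>y. y * poly p y)" for p
    by (intro beta.L2_integrable beta.continuous_L2 continuous_intros)
  have "(\<integral>y. y * poly (pderiv (p + q)) y \<partial>beta) = (\<integral>y. y * poly (pderiv p) y \<partial>beta) + (\<integral>y. y * poly (pderiv q) y \<partial>beta)"
    by (simp add: pderiv_add distrib_left int)
  moreover have "(\<integral>y. poly (pderiv (p + q)) y \<partial>beta) = (\<integral>y. poly (pderiv p) y \<partial>beta) + (\<integral>y. poly (pderiv q) y \<partial>beta)"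
    unfolding pderiv_add poly_add by (intro Bochner_Integration.integral_add poly_integrable_beta)
  moreover have "quot_op (poly (pderiv (p + q))) x = quot_op (poly (pderiv p)) x + quot_op (poly (pderiv q)) x"
    unfolding pderiv_add by (rule quot_op_poly_add[OF assms])
  ultimately show ?thesis by (simp only: N_op_poly[OF assms]) (simp add: algebra_simps)
qed

lemma N_op_smult:
  assumes "x \<in> I2" shows "N_op (poly (smult c p)) x = c * N_op (poly p) x"
proof -
  have "(\<integral>y. y * poly (pderiv (smult c p)) y \<partial>beta) = c * (\<integral>y. y * poly (pderiv p) y \<partial>beta)"
    by (simp add: pderiv_smult mult.left_commute[of _ c])
  moreover have "(\<integral>y. poly (pderiv (smult c p)) y \<partial>beta) = c * (\<integral>y. poly (pderiv p) y \<partial>beta)"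
    by (simp add: pderiv_smult poly_smult[abs_def])
  moreover have "quot_op (poly (pderiv (smult c p))) x = c * quot_op (poly (pderiv p)) x"
    unfolding pderiv_smult by (rule quot_op_smult)
  ultimately show ?thesis by (simp only: N_op_poly[OF assms]) (simp add: algebra_simps)
qed

lemma E_op_add:
  assumes x: "x \<in> I2" and f: "continuous_on I2 f" and g: "continuous_on I2 g"
  shows "E_op (\<lambda>y. f y + g y) x = E_op f x + E_op g x"
proof -
  have int: "integrable beta (\<lambda>y. ln \<bar>x - y\<bar> * f y)" if "continuous_on I2 f" for f
    using continuous_bounded_I2[OF that] beta.continuous_measurable[OF that] log_bounded_integrable(1)[OF x]
    by metis
  show ?thesis unfolding E_op_def by (simp add: distrib_left int f g)
qed

lemma E_op_cmult: "E_op (\<lambda>y. c * f y) x = c * E_op f x"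
  unfolding E_op_def by (simp add: mult.left_commute)

lemma E_op_cong:
  assumes "\<And>y. y \<in> I2 \<Longrightarrow> f y = g y" shows "E_op f x = E_op g x"
  unfolding E_op_def
  using Bochner_Integration.integral_cong[OF refl, of beta "\<lambda>y. ln \<bar>x - y\<bar> * f y" "\<lambda>y. ln \<bar>x - y\<bar> * g y"]
    assms by (simp add: space_beta)

lemma E_op_poly_add: "x \<in> I2 \<Longrightarrow> E_op (poly (p + q)) x = E_op (poly p) x + E_op (poly q) x"
  using E_op_add[of x "poly p" "poly q"] by (simp add: poly_add[abs_def] continuous_intros)

lemma E_op_smult: "E_op (poly (smult c p)) x = c * E_op (poly p) x"
  using E_op_cmult[of c "poly p"] by (simp add: poly_smult[abs_def])

lemma E_op_diff_le:
  assumes x: "x \<in> I2" and f: "continuous_on I2 f" and g: "continuous_on I2 g"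
    and le: "\<And>y. y \<in> I2 \<Longrightarrow> \<bar>f y - g y\<bar> \<le> B"
  shows "\<bar>E_op f x - E_op g x\<bar> \<le> 4 * ln 2 * B"
proof -
  have c: "continuous_on I2 (\<lambda>y. f y - g y)" by (intro continuous_intros f g)
  have "E_op f x = E_op (\<lambda>y. f y - g y) x + E_op g x"
    using E_op_add[OF x c g] by simp
  moreover have "\<bar>E_op (\<lambda>y. f y - g y) x\<bar> \<le> 4 * ln 2 * B"
    unfolding E_op_def abs_minus_cancel
    by (rule log_bounded_integrable(2)[OF x beta.continuous_measurable[OF c] le])
  ultimately show ?thesis by simp
qed

text \<open>The primitive \<open>e\<close> of \<open>quot_op p\<close> that occurs here is the potential itself: derivatives of
  potentials are controlled through \<open>quot_op\<close>. All three properties are linear in \<open>p\<close> and hold on the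
  $\phi_n$.\<close>

lemma E_op_poly_exists:
  "\<exists>e. \<forall>x\<in>I2. E_op (poly p) x = poly e x \<and> quot_op (poly p) x = poly (pderiv e) x
      \<and> N_op (poly e) x = poly p x - (\<integral>y. poly p y \<partial>beta)"
proof (induction p rule: poly_phi_induct)
  case (phi c n)
  show ?case
  proof (intro exI ballI conjI)
    fix x assume x: "x \<in> I2"
    show "E_op (poly (smult c (phi_poly n))) x = poly (smult (c / real n) (phi_poly n)) x"
      by (simp add: E_op_smult poly_phi E_op_phi[OF x])
    show "quot_op (poly (smult c (phi_poly n))) x = poly (pderiv (smult (c / real n) (phi_poly n))) x"
      by (cases "n = 0") (simp_all add: quot_op_smult poly_phi quot_op_phi[OF x] pderiv_smult pderiv_phi)
    show "N_op (poly (smult (c / real n) (phi_poly n))) x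
        = poly (smult c (phi_poly n)) x - (\<integral>y. poly (smult c (phi_poly n)) y \<partial>beta)"
      by (simp add: N_op_smult[OF x] poly_phi N_op_phi[OF x] integral_phi phi_0)
  qed
next
  case (add p q)
  then obtain e1 e2 where e: "\<forall>x\<in>I2. E_op (poly p) x = poly e1 x \<and> quot_op (poly p) x = poly (pderiv e1) x
      \<and> N_op (poly e1) x = poly p x - (\<integral>y. poly p y \<partial>beta)"
    "\<forall>x\<in>I2. E_op (poly q) x = poly e2 x \<and> quot_op (poly q) x = poly (pderiv e2) x
      \<and> N_op (poly e2) x = poly q x - (\<integral>y. poly q y \<partial>beta)" by blast
  have "(\<integral>y. poly (p + q) y \<partial>beta) = (\<integral>y. poly p y \<partial>beta) + (\<integral>y. poly q y \<partial>beta)"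
    by (simp add: poly_integrable_beta)
  then show ?case using e
    by (intro exI[of _ "e1 + e2"])
       (simp add: E_op_poly_add quot_op_poly_add N_op_poly_add pderiv_add del: poly_add, simp)
qed

lemma N_op_poly_exists:
  "\<exists>g. (\<forall>x\<in>I2. N_op (poly p) x = poly g x \<and> E_op (poly g) x = poly p x - (\<integral>y. poly p y \<partial>beta))
      \<and> (\<forall>m. ip beta (poly g) (phi m) = real m * ip beta (poly p) (phi m))"
proof (induction p rule: poly_phi_induct)
  case (phi c n)
  show ?case
  proof (intro exI conjI ballI allI)
    fix x assume x: "x \<in> I2"
    show "N_op (poly (smult c (phi_poly n))) x = poly (smult (c * real n) (phi_poly n)) x"
      by (simp add: N_op_smult[OF x] poly_phi N_op_phi[OF x])
    show "E_op (poly (smult (c * real n) (phi_poly n))) x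
        = poly (smult c (phi_poly n)) x - (\<integral>y. poly (smult c (phi_poly n)) y \<partial>beta)"
      by (simp add: E_op_smult poly_phi E_op_phi[OF x] integral_phi phi_0)
  next
    fix m
    show "ip beta (poly (smult (c * real n) (phi_poly n))) (phi m) = real m * ip beta (poly (smult c (phi_poly n))) (phi m)"
      by (simp add: poly_smult[abs_def] ip_cmult_left poly_phi ip_phi)
  qed
next
  case (add p q)
  then obtain e1 e2 where e: "\<forall>x\<in>I2. N_op (poly p) x = poly e1 x \<and> E_op (poly e1) x = poly p x - (\<integral>y. poly p y \<partial>beta)"
      "\<forall>m. ip beta (poly e1) (phi m) = real m * ip beta (poly p) (phi m)"
    "\<forall>x\<in>I2. N_op (poly q) x = poly e2 x \<and> E_op (poly e2) x = poly q x - (\<integral>y. poly q y \<partial>beta)"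
      "\<forall>m. ip beta (poly e2) (phi m) = real m * ip beta (poly q) (phi m)" by blast
  have "(\<integral>y. poly (p + q) y \<partial>beta) = (\<integral>y. poly p y \<partial>beta) + (\<integral>y. poly q y \<partial>beta)"
    by (simp add: poly_integrable_beta)
  moreover have "ip beta (poly (p + q)) (phi m) = ip beta (poly p) (phi m) + ip beta (poly q) (phi m)" for p q m
    unfolding poly_add[abs_def] by (intro ip_add_left beta.poly_L2 phi_L2)
  ultimately show ?case using e
    by (intro exI[of _ "e1 + e2"])
       (simp add: E_op_poly_add N_op_poly_add distrib_left del: poly_add, simp)
qed


section \<open>The two operators are inverse to each other\<close>

text \<open>$\mathcal{N}$ involves two derivatives, the second through the Lipschitz constant of the first in the
  difference quotient. The constant is $2+2+4$ for the three terms.\<close>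

lemma N_op_approx:
  assumes f: "Ck 2 f" and x: "x \<in> I2"
    and p1: "\<And>y. y \<in> I2 \<Longrightarrow> \<bar>dI f y - poly (pderiv p) y\<bar> \<le> e"
    and p2: "\<And>y. y \<in> I2 \<Longrightarrow> \<bar>dI (dI f) y - poly (pderiv (pderiv p)) y\<bar> \<le> e"
  shows "\<bar>N_op f x - N_op (poly p) x\<bar> \<le> 8 * e"
proof -
  have f': "Ck (Suc 0) (dI f)" "Ck 0 (dI (dI f))" using f by (simp_all add: numeral_2_eq_2)
  have e: "0 \<le> e" using p1[of 0] by simp
  define g where "g y = dI f y - poly (pderiv p) y" for y
  have c1: "continuous_on I2 (dI f)" using f' by (intro Ck_continuous)
  have cg: "continuous_on I2 g" unfolding g_def by (intro continuous_intros c1)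
  have m1: "dI f \<in> borel_measurable beta" and mg: "g \<in> borel_measurable beta"
    using c1 cg by (auto intro: beta.continuous_measurable)
  have i1: "integrable beta (dI f)" "integrable beta (\<lambda>y. y * dI f y)"
    by (intro beta.L2_integrable beta.continuous_L2 continuous_intros c1)+
  have i2: "integrable beta (\<lambda>y. y * poly (pderiv p) y)"
    by (intro beta.L2_integrable beta.continuous_L2 continuous_intros)
  obtain B where B: "0 \<le> B" "\<And>x. x \<in> I2 \<Longrightarrow> \<bar>dI (dI f) x\<bar> \<le> B"
    using continuous_bounded_I2[OF Ck_continuous[OF f'(2)]] by blast
  have i3: "integrable beta (\<lambda>y. (dI f x - dI f y) / (x - y))"
    using Lipschitz_I2[OF Ck_has_dI[OF f'(1)] B(2) x] B(1) by (intro quot_integrable[OF m1]) auto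
  have Lg: "\<bar>g x - g y\<bar> \<le> e * \<bar>x - y\<bar>" if "y \<in> I2" for y
  proof (rule Lipschitz_I2[where f' = "\<lambda>y. dI (dI f) y - poly (pderiv (pderiv p)) y", OF _ _ x that])
    show "(g has_real_derivative dI (dI f) y - poly (pderiv (pderiv p)) y) (at y within I2)" if "y \<in> I2" for y
      unfolding g_def[abs_def]
      by (intro DERIV_diff Ck_has_dI[OF f'(1)] poly_has_derivative that)
  qed (rule p2)
  have q: "quot_op g x = quot_op (dI f) x - quot_op (poly (pderiv p)) x"
    unfolding quot_op_def g_def
    by (subst Bochner_Integration.integral_diff[OF i3 poly_quot_integrable[OF x], symmetric])
       (simp add: diff_divide_distrib[symmetric] algebra_simps)
  have eq: "N_op f x - N_op (poly p) x = (\<integral>y. y * g y \<partial>beta) + x * (\<integral>y. g y \<partial>beta) - (4 - x\<^sup>2) * quot_op g x"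
    unfolding q N_op_poly[OF x] N_op_quot[of f]
    by (simp add: g_def right_diff_distrib i1 i2 poly_integrable_beta)
  have "\<bar>\<integral>y. y * g y \<partial>beta\<bar> \<le> 2 * e"
  proof (rule abs_integral_beta_le)
    show "(\<lambda>y. y * g y) \<in> borel_measurable beta"
      by (intro beta.continuous_measurable continuous_intros cg)
    show "\<bar>y * g y\<bar> \<le> 2 * e" if "y \<in> I2" for y
      unfolding abs_mult using that p1[OF that] by (intro mult_mono) (auto simp: g_def)
  qed
  moreover have "\<bar>x * (\<integral>y. g y \<partial>beta)\<bar> \<le> 2 * e"
  proof -
    have "\<bar>\<integral>y. g y \<partial>beta\<bar> \<le> e" by (rule abs_integral_beta_le[OF mg]) (use p1 in \<open>simp add: g_def\<close>)
    then show ?thesis unfolding abs_mult using x e by (intro mult_mono) auto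
  qed
  moreover have "\<bar>(4 - x\<^sup>2) * quot_op g x\<bar> \<le> 4 * e"
    unfolding abs_mult using four_minus_sq_nonneg[OF x] abs_quot_op_le[OF mg Lg e]
    by (intro mult_mono) auto
  ultimately show ?thesis unfolding eq by linarith
qed

lemma continuous_on_poly_limit:
  assumes "\<And>k x. x \<in> I2 \<Longrightarrow> \<bar>f x - poly (p k) x\<bar> \<le> C * err k"
  shows "continuous_on I2 f"
proof (rule uniform_limit_theorem[where F = sequentially and f = "\<lambda>k. poly (p k)"])
  show "uniform_limit I2 (\<lambda>k. poly (p k)) f sequentially"
  proof (rule uniform_limitI)
    fix e :: real assume "0 < e"
    have "(\<lambda>k. C * err k) \<longlonglongrightarrow> 0" using tendsto_mult_left[OF err_tendsto, of C] by simp
    then have "\<forall>\<^sub>F k in sequentially. C * err k < e" using \<open>0 < e\<close> by (rule order_tendstoD)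
    then show "\<forall>\<^sub>F k in sequentially. \<forall>x\<in>I2. dist (poly (p k) x) (f x) < e"
      by eventually_elim (auto simp: dist_real_def abs_minus_commute intro: le_less_trans[OF assms])
  qed
qed (auto intro!: always_eventually continuous_intros)

lemma integral_poly_limit:
  assumes "continuous_on I2 f" "\<And>k x. x \<in> I2 \<Longrightarrow> \<bar>f x - poly (p k) x\<bar> \<le> err k"
  shows "(\<lambda>k. \<integral>x. poly (p k) x \<partial>beta) \<longlonglongrightarrow> (\<integral>x. f x \<partial>beta)"
proof (rule tendsto_err[where C = 1])
  fix k
  have f: "integrable beta f" using assms(1) by (intro beta.L2_integrable beta.continuous_L2)
  have "\<bar>\<integral>x. f x - poly (p k) x \<partial>beta\<bar> \<le> err k"
    using assms by (intro abs_integral_beta_le beta.continuous_measurable continuous_intros) auto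
  then show "\<bar>(\<integral>x. poly (p k) x \<partial>beta) - (\<integral>x. f x \<partial>beta)\<bar> \<le> 1 * err k"
    using f by (simp add: poly_integrable_beta abs_minus_commute)
qed

lemma poly_limit:
  assumes "\<And>k x. x \<in> I2 \<Longrightarrow> \<bar>f x - poly (p k) x\<bar> \<le> C * err k" "x \<in> I2"
  shows "(\<lambda>k. poly (p k) x) \<longlonglongrightarrow> f x"
  using assms by (intro tendsto_err[where C = C]) (simp add: abs_minus_commute)

text \<open>Approximating \<open>f\<close> in $C^2$ approximates $\mathcal{N}f$ uniformly, so the identities for polynomials
  pass to the limit.\<close>

lemma N_op_poly_seq:
  assumes f: "Ck 2 f"
  obtains p g where "\<And>k x. x \<in> I2 \<Longrightarrow> \<bar>f x - poly (p k) x\<bar> \<le> err k"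
    "\<And>k x. x \<in> I2 \<Longrightarrow> \<bar>N_op f x - poly (g k) x\<bar> \<le> 8 * err k"
    "\<And>k x. x \<in> I2 \<Longrightarrow> E_op (poly (g k)) x = poly (p k) x - (\<integral>y. poly (p k) y \<partial>beta)"
    "\<And>k m. ip beta (poly (g k)) (phi m) = real m * ip beta (poly (p k)) (phi m)"
proof -
  obtain p where p: "\<And>k x. x \<in> I2 \<Longrightarrow> \<bar>f x - poly (p k) x\<bar> \<le> err k"
    "\<And>k x. x \<in> I2 \<Longrightarrow> \<bar>dI f x - poly (pderiv (p k)) x\<bar> \<le> err k"
    "\<And>k x. x \<in> I2 \<Longrightarrow> \<bar>dI (dI f) x - poly (pderiv (pderiv (p k))) x\<bar> \<le> err k"
    using C2_poly_seq[OF f] by blast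
  have "\<forall>k. \<exists>g. (\<forall>x\<in>I2. N_op (poly (p k)) x = poly g x \<and>
        E_op (poly g) x = poly (p k) x - (\<integral>y. poly (p k) y \<partial>beta))
      \<and> (\<forall>m. ip beta (poly g) (phi m) = real m * ip beta (poly (p k)) (phi m))"
    using N_op_poly_exists by blast
  from choice[OF this] obtain g where g: "\<And>k. (\<forall>x\<in>I2. N_op (poly (p k)) x = poly (g k) x \<and>
        E_op (poly (g k)) x = poly (p k) x - (\<integral>y. poly (p k) y \<partial>beta))
      \<and> (\<forall>m. ip beta (poly (g k)) (phi m) = real m * ip beta (poly (p k)) (phi m))"
    by blast
  have "\<bar>N_op f x - poly (g k) x\<bar> \<le> 8 * err k" if "x \<in> I2" for k x
    using N_op_approx[OF f that p(2)[where k = k] p(3)[where k = k]] g that by simp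
  with p(1) g show ?thesis using that by blast
qed

lemma continuous_N_op: "Ck 2 f \<Longrightarrow> continuous_on I2 (N_op f)"
  using N_op_poly_seq[of f] continuous_on_poly_limit[of "N_op f" _ 8] by metis

lemma E_op_N_op:
  assumes f: "Ck 2 f" and x: "x \<in> I2"
  shows "E_op (N_op f) x = f x - (\<integral>y. f y \<partial>beta)"
proof -
  obtain p g where pg: "\<And>k x. x \<in> I2 \<Longrightarrow> \<bar>f x - poly (p k) x\<bar> \<le> err k"
    "\<And>k x. x \<in> I2 \<Longrightarrow> \<bar>N_op f x - poly (g k) x\<bar> \<le> 8 * err k"
    "\<And>k x. x \<in> I2 \<Longrightarrow> E_op (poly (g k)) x = poly (p k) x - (\<integral>y. poly (p k) y \<partial>beta)"
    using N_op_poly_seq[OF f] by metis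
  have "(\<lambda>k. E_op (poly (g k)) x) \<longlonglongrightarrow> E_op (N_op f) x"
  proof (rule tendsto_err)
    fix k
    have "\<bar>E_op (N_op f) x - E_op (poly (g k)) x\<bar> \<le> 4 * ln 2 * (8 * err k)"
      by (intro E_op_diff_le x continuous_N_op f pg continuous_intros)
    then show "\<bar>E_op (poly (g k)) x - E_op (N_op f) x\<bar> \<le> (4 * ln 2 * 8) * err k"
      by (simp add: abs_minus_commute mult.assoc)
  qed
  moreover have "(\<lambda>k. poly (p k) x - (\<integral>y. poly (p k) y \<partial>beta)) \<longlonglongrightarrow> f x - (\<integral>y. f y \<partial>beta)"
    by (intro tendsto_intros integral_poly_limit Ck_continuous[OF f] pg poly_limit[where C = 1]) (use pg x in auto)
  ultimately show ?thesis using pg(3)[OF x] LIMSEQ_unique by simp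
qed

text \<open>The slopes of \<open>quot_op f\<close> are averages of differences of \<open>f'\<close>: in
  $\frac{f(x)-f(y)}{x-y}-\frac{f(x')-f(y)}{x'-y}$ apply the mean value theorem to the dilation with
  centre \<open>y\<close>. Hence the logarithmic potential inherits the smoothness of \<open>f\<close> without any
  singular integral.\<close>

lemma quot_diff_le:
  assumes B: "\<And>z. z \<in> I2 \<Longrightarrow> \<bar>poly (pderiv (pderiv p)) z\<bar> \<le> B"
    and I2: "x \<in> I2" "x' \<in> I2" "y \<in> I2" and ne: "y \<noteq> x" "y \<noteq> x'"
  shows "\<bar>(poly p x - poly p y) / (x - y) - (poly p x' - poly p y) / (x' - y)\<bar> \<le> B * \<bar>x - x'\<bar>"
proof -
  define h where "h s = poly p (y + s * (x - y)) / (x - y) - poly p (y + s * (x' - y)) / (x' - y)" for s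
  define h' where "h' s = poly (pderiv p) (y + s * (x - y)) - poly (pderiv p) (y + s * (x' - y))" for s
  have deriv: "(h has_real_derivative h' s) (at s)" for s
    unfolding h_def[abs_def] h'_def using ne
    by (auto intro!: derivative_eq_intros DERIV_chain2[OF poly_DERIV])
  obtain s where s: "0 < s" "s < 1" "h 1 - h 0 = (1 - 0) * h' s"
    using MVT2[of 0 1 h h'] deriv by auto
  have mem: "y + s * (z - y) \<in> I2" if "z \<in> I2" for z
  proof -
    have eq: "y + s * (z - y) = (1 - s) * y + s * z" by algebra
    have "(1 - s) * y + s * z \<le> (1 - s) * 2 + s * 2" "(1 - s) * (-2) + s * (-2) \<le> (1 - s) * y + s * z"
      using s(1,2) that I2(3) by (intro add_mono mult_left_mono; auto)+
    then show ?thesis unfolding eq by (simp add: algebra_simps)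
  qed
  have "\<bar>h' s\<bar> \<le> B * \<bar>(y + s * (x - y)) - (y + s * (x' - y))\<bar>"
    unfolding h'_def by (intro poly_Lipschitz B mem I2)
  also have "(y + s * (x - y)) - (y + s * (x' - y)) = s * (x - x')" by algebra
  also have "B * \<bar>s * (x - x')\<bar> \<le> B * \<bar>x - x'\<bar>"
  proof -
    have "0 \<le> B" using B[of 0] by simp
    moreover have "\<bar>s * (x - x')\<bar> \<le> 1 * \<bar>x - x'\<bar>"
      unfolding abs_mult using s by (intro mult_right_mono) auto
    ultimately show ?thesis by (intro mult_left_mono) auto
  qed
  finally have "\<bar>h' s\<bar> \<le> B * \<bar>x - x'\<bar>" .
  moreover have "(poly p x - poly p y) / (x - y) - (poly p x' - poly p y) / (x' - y) = h 1 - h 0"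
    by (simp add: h_def diff_divide_distrib)
  ultimately show ?thesis using s(3) by simp
qed

lemma quot_op_Lipschitz:
  assumes B: "\<And>z. z \<in> I2 \<Longrightarrow> \<bar>poly (pderiv (pderiv p)) z\<bar> \<le> B" and x: "x \<in> I2" "x' \<in> I2"
  shows "\<bar>quot_op (poly p) x - quot_op (poly p) x'\<bar> \<le> B * \<bar>x - x'\<bar>"
proof -
  let ?d = "\<lambda>y. (poly p x - poly p y) / (x - y) - (poly p x' - poly p y) / (x' - y)"
  have int: "integrable beta ?d" by (intro Bochner_Integration.integrable_diff poly_quot_integrable x)
  have "\<bar>quot_op (poly p) x - quot_op (poly p) x'\<bar> = \<bar>\<integral>y. ?d y \<partial>beta\<bar>"
    unfolding quot_op_def using x by (simp add: poly_quot_integrable)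
  also have "\<dots> \<le> (\<integral>y. \<bar>?d y\<bar> \<partial>beta)" by (rule integral_abs_bound)
  also have "\<dots> \<le> (\<integral>y. B * \<bar>x - x'\<bar> \<partial>beta)"
  proof (rule integral_mono_AE)
    show "AE y in beta. \<bar>?d y\<bar> \<le> B * \<bar>x - x'\<bar>"
      using AE_beta_neq[of x] AE_beta_neq[of x'] AE_space
      by eventually_elim (rule quot_diff_le[OF B x], auto simp: space_beta)
  qed (use int in auto)
  finally show ?thesis by (simp add: space_beta)
qed

lemma poly_deriv_le_Lipschitz:
  assumes L: "\<And>x y. x \<in> I2 \<Longrightarrow> y \<in> I2 \<Longrightarrow> \<bar>poly p x - poly p y\<bar> \<le> B * \<bar>x - y\<bar>" and x: "x \<in> I2"
  shows "\<bar>poly (pderiv p) x\<bar> \<le> B"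
proof -
  have "((\<lambda>y. (poly p y - poly p x) / (y - x)) \<longlongrightarrow> poly (pderiv p) x) (at x within I2)"
    using poly_has_derivative[of p x I2]
    by (simp add: has_field_derivative_iff)
  then have lim: "((\<lambda>y. \<bar>(poly p y - poly p x) / (y - x)\<bar>) \<longlongrightarrow> \<bar>poly (pderiv p) x\<bar>) (at x within I2)"
    by (rule tendsto_rabs)
  have nb: "at x within I2 \<noteq> bot"
    using x by (simp add: trivial_limit_within islimpt_Icc)
  show ?thesis
  proof (rule tendsto_upperbound[OF lim _ nb])
    show "\<forall>\<^sub>F y in at x within I2. \<bar>(poly p y - poly p x) / (y - x)\<bar> \<le> B"
      using L[OF _ x] unfolding eventually_at_filter
      by (intro always_eventually) (auto simp: abs_divide divide_le_eq)
  qed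
qed

text \<open>A pointwise limit of polynomials whose derivatives are uniformly Cauchy is continuously
  differentiable, with the limit of the derivatives as its derivative.\<close>

lemma poly_limit_deriv:
  assumes lim: "\<And>x. x \<in> I2 \<Longrightarrow> (\<lambda>k. poly (e k) x) \<longlonglongrightarrow> f x"
    and Cauchy: "\<And>k l x. x \<in> I2 \<Longrightarrow> \<bar>poly (pderiv (e k)) x - poly (pderiv (e l)) x\<bar> \<le> err k + err l"
  shows "f differentiable_on I2" and "\<And>k x. x \<in> I2 \<Longrightarrow> \<bar>dI f x - poly (pderiv (e k)) x\<bar> \<le> err k"
proof -
  have "convergent (\<lambda>k. poly (pderiv (e k)) x)" if x: "x \<in> I2" for x
  proof (intro Cauchy_convergent CauchyI)
    fix \<epsilon> :: real assume "0 < \<epsilon>"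
    then have "\<forall>\<^sub>F k in sequentially. err k < \<epsilon> / 2"
      by (intro order_tendstoD(2)[OF err_tendsto]) simp
    then obtain K where K: "\<And>k. k \<ge> K \<Longrightarrow> err k < \<epsilon> / 2" by (auto simp: eventually_sequentially)
    have "norm (poly (pderiv (e k)) x - poly (pderiv (e l)) x) < \<epsilon>" if "k \<ge> K" "l \<ge> K" for k l
      using Cauchy[OF x, of k l] K[OF that(1)] K[OF that(2)] unfolding real_norm_def by linarith
    then show "\<exists>M. \<forall>m\<ge>M. \<forall>n\<ge>M. norm (poly (pderiv (e m)) x - poly (pderiv (e n)) x) < \<epsilon>" by blast
  qed
  then obtain G where G: "\<And>x. x \<in> I2 \<Longrightarrow> (\<lambda>k. poly (pderiv (e k)) x) \<longlonglongrightarrow> G x"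
    unfolding convergent_def by metis
  have Gk: "\<bar>G x - poly (pderiv (e k)) x\<bar> \<le> err k" if x: "x \<in> I2" for x k
  proof (rule LIMSEQ_le)
    show "(\<lambda>l. \<bar>poly (pderiv (e l)) x - poly (pderiv (e k)) x\<bar>) \<longlonglongrightarrow> \<bar>G x - poly (pderiv (e k)) x\<bar>"
      by (intro tendsto_intros G x)
    show "(\<lambda>l. err l + err k) \<longlonglongrightarrow> err k"
      using tendsto_add[OF err_tendsto tendsto_const[of "err k"]] by simp
    show "\<exists>N. \<forall>l\<ge>N. \<bar>poly (pderiv (e l)) x - poly (pderiv (e k)) x\<bar> \<le> err l + err k"
      using Cauchy[OF x] by blast
  qed
  have "\<exists>g. \<forall>x\<in>I2. (\<lambda>k. poly (e k) x) \<longlonglongrightarrow> g x \<and> (g has_derivative (\<lambda>h. G x * h)) (at x within I2)"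
  proof (rule has_derivative_sequence)
    show "convex I2" by simp
    show "(poly (e n) has_derivative (\<lambda>h. poly (pderiv (e n)) x * h)) (at x within I2)" for n x
      using poly_has_derivative[of "e n" x I2]
      by (simp add: has_field_derivative_def)
    show "\<forall>\<^sub>F n in sequentially. \<forall>x\<in>I2. \<forall>h. norm (poly (pderiv (e n)) x * h - G x * h) \<le> \<epsilon> * norm h"
      if "0 < \<epsilon>" for \<epsilon>
      using order_tendstoD(2)[OF err_tendsto that]
    proof eventually_elim
      case (elim n)
      have "\<bar>poly (pderiv (e n)) x * h - G x * h\<bar> \<le> \<epsilon> * \<bar>h\<bar>" if "x \<in> I2" for x h
        using Gk[OF that, of n] elim
        unfolding left_diff_distrib[symmetric] abs_mult
        by (intro mult_right_mono) (auto simp: abs_minus_commute)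
      then show ?case by simp
    qed
    show "(0::real) \<in> I2" by simp
    show "(\<lambda>n. poly (e n) 0) \<longlonglongrightarrow> f 0" by (rule lim) simp
  qed
  then obtain g where g: "\<And>x. x \<in> I2 \<Longrightarrow> (\<lambda>k. poly (e k) x) \<longlonglongrightarrow> g x"
      "\<And>x. x \<in> I2 \<Longrightarrow> (g has_real_derivative G x) (at x within I2)"
    unfolding has_field_derivative_def by blast
  have fg: "f x = g x" if "x \<in> I2" for x using LIMSEQ_unique[OF lim[OF that] g(1)[OF that]] .
  have deriv: "(f has_real_derivative G x) (at x within I2)" if "x \<in> I2" for x
    using has_dI_cong[OF fg that] g(2)[OF that] by simp
  then show "f differentiable_on I2" by (rule differentiable_on_I2I)
  show "\<bar>dI f x - poly (pderiv (e k)) x\<bar> \<le> err k" if "x \<in> I2" for x k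
    using Gk[OF that] dI_eqI[OF that deriv[OF that]] by simp
qed

text \<open>If the \<open>p k\<close> approximate \<open>f\<close> in $C^2$, their potentials \<open>e k\<close> have the derivatives \<open>quot_op (p k)\<close>.
  The bounds on \<open>quot_op\<close> of a difference and on its Lipschitz constant make the first and second
  derivatives of the \<open>e k\<close> uniformly Cauchy. So the potentials converge in $C^2$, and
  $\mathcal{N}$ is continuous for this convergence.\<close>

lemma
  assumes f: "Ck 2 f"
  shows Ck_E_op: "Ck 2 (E_op f)"
    and N_op_E_op: "x \<in> I2 \<Longrightarrow> N_op (E_op f) x = f x - (\<integral>y. f y \<partial>beta)"
proof -
  obtain p where p: "\<And>k x. x \<in> I2 \<Longrightarrow> \<bar>f x - poly (p k) x\<bar> \<le> err k"
    "\<And>k x. x \<in> I2 \<Longrightarrow> \<bar>dI f x - poly (pderiv (p k)) x\<bar> \<le> err k"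
    "\<And>k x. x \<in> I2 \<Longrightarrow> \<bar>dI (dI f) x - poly (pderiv (pderiv (p k))) x\<bar> \<le> err k"
    using C2_poly_seq[OF f] by blast
  have "\<forall>k. \<exists>e. \<forall>x\<in>I2. E_op (poly (p k)) x = poly e x \<and> quot_op (poly (p k)) x = poly (pderiv e) x
      \<and> N_op (poly e) x = poly (p k) x - (\<integral>y. poly (p k) y \<partial>beta)"
    using E_op_poly_exists by blast
  from choice[OF this] obtain e where e: "\<And>k x. x \<in> I2 \<Longrightarrow> E_op (poly (p k)) x = poly (e k) x"
      "\<And>k x. x \<in> I2 \<Longrightarrow> quot_op (poly (p k)) x = poly (pderiv (e k)) x"
      "\<And>k x. x \<in> I2 \<Longrightarrow> N_op (poly (e k)) x = poly (p k) x - (\<integral>y. poly (p k) y \<partial>beta)"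
    by blast
  have lim: "(\<lambda>k. poly (e k) x) \<longlonglongrightarrow> E_op f x" if x: "x \<in> I2" for x
  proof (rule tendsto_err)
    fix k
    have "\<bar>E_op f x - E_op (poly (p k)) x\<bar> \<le> 4 * ln 2 * err k"
      by (intro E_op_diff_le x Ck_continuous[OF f] p continuous_intros)
    then show "\<bar>poly (e k) x - E_op f x\<bar> \<le> 4 * ln 2 * err k"
      using e(1)[OF x] by (simp add: abs_minus_commute)
  qed
  have d1: "\<bar>poly (pderiv (p k - p l)) x\<bar> \<le> err k + err l"
    and d2: "\<bar>poly (pderiv (pderiv (p k - p l))) x\<bar> \<le> err k + err l" if x: "x \<in> I2" for k l x
    using p(2,3)[OF x, of k] p(2,3)[OF x, of l] by (simp_all add: pderiv_diff)
  have q: "quot_op (poly (p k - p l)) x = poly (pderiv (e k)) x - poly (pderiv (e l)) x" if x: "x \<in> I2" for k l x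
  proof -
    have "quot_op (poly (p k - p l + p l)) x = quot_op (poly (p k - p l)) x + quot_op (poly (p l)) x"
      by (rule quot_op_poly_add[OF x])
    then show ?thesis using e(2)[OF x] by simp
  qed
  have C1: "\<bar>poly (pderiv (e k)) x - poly (pderiv (e l)) x\<bar> \<le> err k + err l" if x: "x \<in> I2" for k l x
    unfolding q[OF x, symmetric]
    by (intro abs_quot_op_le poly_measurable_beta poly_Lipschitz d1 x)
      (assumption | intro add_nonneg_nonneg less_imp_le err_pos)+
  have C2: "\<bar>poly (pderiv (pderiv (e k))) x - poly (pderiv (pderiv (e l))) x\<bar> \<le> err k + err l" if x: "x \<in> I2" for k l x
  proof -
    have "\<bar>poly (pderiv (pderiv (e k - e l))) x\<bar> \<le> err k + err l"
    proof (rule poly_deriv_le_Lipschitz[OF _ x])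
      fix y z :: real assume yz: "y \<in> I2" "z \<in> I2"
      show "\<bar>poly (pderiv (e k - e l)) y - poly (pderiv (e k - e l)) z\<bar> \<le> (err k + err l) * \<bar>y - z\<bar>"
        using quot_op_Lipschitz[of "p k - p l", OF d2 yz] q[OF yz(1)] q[OF yz(2)] by (simp add: pderiv_diff)
    qed
    then show ?thesis by (simp add: pderiv_diff)
  qed
  note D1 = poly_limit_deriv[OF lim C1]
  have lim2: "(\<lambda>k. poly (pderiv (e k)) x) \<longlonglongrightarrow> dI (E_op f) x" if x: "x \<in> I2" for x
    by (rule poly_limit[where C = 1]) (use D1(2) x in auto)
  note D2 = poly_limit_deriv[OF lim2 C2]
  have "continuous_on I2 (dI (dI (E_op f)))"
    by (rule continuous_on_poly_limit[where C = 1 and p = "\<lambda>k. pderiv (pderiv (e k))"]) (use D2(2) in auto)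
  then show C: "Ck 2 (E_op f)" using D1(1) D2(1) by (simp add: numeral_2_eq_2)
  show "N_op (E_op f) x = f x - (\<integral>y. f y \<partial>beta)" if x: "x \<in> I2"
  proof -
    have "(\<lambda>k. N_op (poly (e k)) x) \<longlonglongrightarrow> N_op (E_op f) x"
    proof (rule tendsto_err)
      fix k
      show "\<bar>N_op (poly (e k)) x - N_op (E_op f) x\<bar> \<le> 8 * err k"
        using N_op_approx[OF C x D1(2) D2(2), of k] by (simp add: abs_minus_commute)
    qed
    moreover have "(\<lambda>k. poly (p k) x - (\<integral>y. poly (p k) y \<partial>beta)) \<longlonglongrightarrow> f x - (\<integral>y. f y \<partial>beta)"
      by (intro tendsto_intros integral_poly_limit Ck_continuous[OF f] p poly_limit[where C = 1]) (use p x in auto)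
    ultimately show ?thesis using e(3)[OF x] LIMSEQ_unique by simp
  qed
qed


section \<open>Chebyshev expansions\<close>

text \<open>The factor 2 is the inverse of $\|\phi_n\|^2=\frac12$ for $n\ge1$.\<close>

definition cheb_coeff :: "(real \<Rightarrow> real) \<Rightarrow> nat \<Rightarrow> real" where
  "cheb_coeff f n = (if n = 0 then 1 else 2) * ip beta f (phi n)"

definition cheb_sum :: "(real \<Rightarrow> real) \<Rightarrow> nat \<Rightarrow> real \<Rightarrow> real" where
  "cheb_sum f k x = (\<Sum>n<k. cheb_coeff f n * phi n x)"

lemma phi_sum_L2: "(\<lambda>x. \<Sum>n<k. a n * phi n x) \<in> L2 beta"
  by (intro L2_sum L2_cmult phi_L2)

lemma ip_phi_sum:
  "ip beta (\<lambda>x. \<Sum>n<k. a n * phi n x) (phi m) = (if m < k then a m * (if m = 0 then 1 else 1/2) else 0)"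
proof -
  have "ip beta (\<lambda>x. \<Sum>n<k. a n * phi n x) (phi m) = (\<Sum>n<k. if n = m then a m * (if m = 0 then 1 else 1/2) else 0)"
  proof (subst ip_sum_left)
    show "(\<Sum>n<k. ip beta (\<lambda>x. a n * phi n x) (phi m)) = (\<Sum>n<k. if n = m then a m * (if m = 0 then 1 else 1/2) else 0)"
      by (rule sum.cong) (simp_all add: ip_cmult_left ip_phi)
  qed (auto intro: L2_cmult phi_L2)
  then show ?thesis by simp
qed

lemma cheb_sum_L2: "cheb_sum f k \<in> L2 beta"
  unfolding cheb_sum_def[abs_def] by (rule phi_sum_L2)

lemma ip_cheb_sum: "n < k \<Longrightarrow> ip beta (cheb_sum f k) (phi n) = ip beta f (phi n)"
  unfolding cheb_sum_def[abs_def] by (simp add: ip_phi_sum cheb_coeff_def)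

lemma cheb_sum_orth_poly:
  assumes f: "f \<in> L2 beta"
  shows "\<exists>N. \<forall>k\<ge>N. ip beta (\<lambda>x. f x - cheb_sum f k x) (poly p) = 0"
proof (induction p rule: poly_phi_induct)
  case (phi c n)
  show ?case
    by (intro exI[of _ "Suc n"] allI impI)
       (simp add: poly_smult[abs_def] ip_cmult_right poly_phi ip_diff_left f cheb_sum_L2 phi_L2 ip_cheb_sum)
next
  case (add p q)
  then obtain N N' where "\<forall>k\<ge>N. ip beta (\<lambda>x. f x - cheb_sum f k x) (poly p) = 0"
    "\<forall>k\<ge>N'. ip beta (\<lambda>x. f x - cheb_sum f k x) (poly q) = 0" by blast
  then show ?case
    by (intro exI[of _ "max N N'"] allI impI)
       (simp add: poly_add[abs_def] ip_add_right beta.poly_L2 L2_diff f cheb_sum_L2)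
qed

lemma cheb_sum_orth: "f \<in> L2 beta \<Longrightarrow> ip beta (\<lambda>x. f x - cheb_sum f k x) (cheb_sum f k) = 0"
  unfolding cheb_sum_def[of f k, abs_def]
  by (subst ip_sum_right)
     (auto simp: ip_cmult_right ip_diff_left cheb_sum_L2 phi_L2 ip_cheb_sum cheb_sum_def[symmetric]
       intro!: L2_cmult L2_diff phi_L2 sum.neutral)

text \<open>The Chebyshev series of \<open>f\<close> converges in $L^2(\beta)$, because its partial sums are best
  approximations and the polynomials are dense.\<close>

lemma cheb_sum_lim:
  assumes f: "f \<in> L2 beta"
  shows "L2_lim beta (cheb_sum f) f"
proof (rule L2_limI[OF cheb_sum_L2 f], rule LIMSEQ_I)
  fix e :: real assume "0 < e"
  let ?r = "\<lambda>k x. f x - cheb_sum f k x"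
  have rL: "?r k \<in> L2 beta" for k by (intro L2_diff f cheb_sum_L2)
  obtain p where p: "L2_lim beta (\<lambda>k. poly (p k)) f" using beta.polys_dense[OF f] by blast
  obtain j where j: "ip beta (\<lambda>x. poly (p j) x - f x) (\<lambda>x. poly (p j) x - f x) < e"
    using order_tendstoD(2)[OF L2_limD(3)[OF p] \<open>0 < e\<close>] by (auto simp: eventually_sequentially)
  obtain N where N: "\<And>k. k \<ge> N \<Longrightarrow> ip beta (?r k) (poly (p j)) = 0"
    using cheb_sum_orth_poly[OF f, of "p j"] by blast
  have "norm (ip beta (\<lambda>x. cheb_sum f k x - f x) (\<lambda>x. cheb_sum f k x - f x) - 0) < e" if k: "k \<ge> N" for k
  proof -
    let ?d = "\<lambda>x. poly (p j) x - cheb_sum f k x"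
    have dL: "?d \<in> L2 beta" by (intro L2_diff beta.poly_L2 cheb_sum_L2)
    have orth: "ip beta (?r k) ?d = 0"
      using N[OF k] cheb_sum_orth[OF f] by (simp add: ip_diff_right beta.poly_L2 cheb_sum_L2 rL)
    have "ip beta (\<lambda>x. ?d x - ?r k x) (\<lambda>x. ?d x - ?r k x) = ip beta ?d ?d + ip beta (?r k) (?r k)"
      using orth ip_commute[of beta ?d "?r k"]
      by (simp only: ip_diff_left[OF dL rL L2_diff[OF dL rL]] ip_diff_right[OF dL rL dL] ip_diff_right[OF dL rL rL])
    moreover have "(\<lambda>x. ?d x - ?r k x) = (\<lambda>x. poly (p j) x - f x)" by auto
    ultimately have "ip beta (?r k) (?r k) < e" using j ip_self_nonneg[of beta ?d] by simp
    moreover have "ip beta (\<lambda>x. cheb_sum f k x - f x) (\<lambda>x. cheb_sum f k x - f x) = ip beta (?r k) (?r k)"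
      unfolding ip_self by (simp add: power2_commute)
    ultimately show ?thesis using ip_self_nonneg[of beta "?r k"] by simp
  qed
  then show "\<exists>no. \<forall>k\<ge>no. norm (ip beta (\<lambda>x. cheb_sum f k x - f x) (\<lambda>x. cheb_sum f k x - f x) - 0) < e"
    by blast
qed

lemma cheb_coeff_unique:
  assumes "f \<in> L2 beta" "g \<in> L2 beta" "\<And>n. ip beta f (phi n) = ip beta g (phi n)"
  shows "AE x in beta. f x = g x"
proof -
  have "cheb_sum f = cheb_sum g" using assms(3) by (simp add: cheb_sum_def[abs_def] cheb_coeff_def)
  then show ?thesis using cheb_sum_lim[OF assms(1)] cheb_sum_lim[OF assms(2)] L2_lim_unique by metis
qed

lemma Parseval:
  assumes "f \<in> L2 beta" "g \<in> L2 beta"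
  shows "(\<lambda>k. \<Sum>n<k. cheb_coeff f n * ip beta g (phi n)) \<longlonglongrightarrow> ip beta f g"
proof -
  have "ip beta (cheb_sum f k) g = (\<Sum>n<k. cheb_coeff f n * ip beta g (phi n))" for k
    unfolding cheb_sum_def[abs_def] using assms(2)
    by (subst ip_sum_left) (auto simp: ip_cmult_left ip_commute[of beta "phi _" g] intro!: L2_cmult phi_L2)
  then show ?thesis using L2_lim_ip_const[OF cheb_sum_lim[OF assms(1)] assms(2)] by simp
qed

text \<open>The Chebyshev series of a function in $L^2(\beta)$ always converges, so the convergence of the two
  series amounts to square integrability of the two functions.\<close>

lemma number_graph_iff:
  "(f, g) \<in> number_graph \<longleftrightarrow> f \<in> L2 beta \<and> g \<in> L2 beta \<and> (\<forall>n. ip beta g (phi n) = real n * ip beta f (phi n))"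
proof
  assume "(f, g) \<in> number_graph"
  then obtain a where a: "L2_lim beta (\<lambda>k x. \<Sum>n<k. a n * phi n x) f"
    "L2_lim beta (\<lambda>k x. \<Sum>n<k. real n * a n * phi n x) g" by (auto simp: number_graph_def)
  have coeff: "ip beta h (phi n) = b n * (if n = 0 then 1 else 1/2)"
    if "L2_lim beta (\<lambda>k x. \<Sum>n<k. b n * phi n x) h" for b h n
  proof -
    have "(\<lambda>k. ip beta (\<lambda>x. \<Sum>n<k. b n * phi n x) (phi n)) \<longlonglongrightarrow> ip beta h (phi n)"
      by (rule L2_lim_ip_const[OF that phi_L2])
    moreover have "\<forall>\<^sub>F k in sequentially. ip beta (\<lambda>x. \<Sum>n<k. b n * phi n x) (phi n) = b n * (if n = 0 then 1 else 1/2)"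
      using eventually_gt_at_top[of n] by eventually_elim (simp add: ip_phi_sum)
    ultimately show ?thesis using LIMSEQ_unique[OF _ tendsto_eventually] by blast
  qed
  show "f \<in> L2 beta \<and> g \<in> L2 beta \<and> (\<forall>n. ip beta g (phi n) = real n * ip beta f (phi n))"
    using coeff[OF a(1)] coeff[OF a(2)] L2_limD(2)[OF a(1)] L2_limD(2)[OF a(2)] by simp
next
  assume *: "f \<in> L2 beta \<and> g \<in> L2 beta \<and> (\<forall>n. ip beta g (phi n) = real n * ip beta f (phi n))"
  then have "cheb_coeff g n = real n * cheb_coeff f n" for n by (simp add: cheb_coeff_def)
  then have "cheb_sum g = (\<lambda>k x. \<Sum>n<k. real n * cheb_coeff f n * phi n x)"
    by (simp add: cheb_sum_def[abs_def])
  then show "(f, g) \<in> number_graph"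
    using cheb_sum_lim[of f] cheb_sum_lim[of g] * unfolding number_graph_def
    by (auto simp: cheb_sum_def[abs_def] intro!: exI[of _ "cheb_coeff f"])
qed

lemma number_op_graph: "f \<in> Domain number_graph \<Longrightarrow> (f, number_op f) \<in> number_graph"
  unfolding number_op_def by (metis Domain.cases someI_ex)

lemma number_op_AE:
  assumes "(f, g) \<in> number_graph" shows "AE x in beta. number_op f x = g x"
proof -
  have "(f, number_op f) \<in> number_graph" using assms by (intro number_op_graph) blast
  then show ?thesis using assms unfolding number_graph_iff by (intro cheb_coeff_unique) auto
qed

lemma ip_number_op:
  assumes "(f, g) \<in> number_graph" "h \<in> L2 beta"
  shows "ip beta (number_op f) h = ip beta g h"
proof -
  have "(f, number_op f) \<in> number_graph" using assms(1) by (intro number_op_graph) blast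
  then show ?thesis
    using assms number_op_AE[OF assms(1)] unfolding number_graph_iff
    by (intro ip_cong_AE) (auto intro: L2_D)
qed

lemma number_graph_add:
  "(f, g) \<in> number_graph \<Longrightarrow> (f', g') \<in> number_graph \<Longrightarrow> ((\<lambda>x. f x + f' x), (\<lambda>x. g x + g' x)) \<in> number_graph"
  by (auto simp: number_graph_iff L2_add ip_add_left phi_L2 distrib_left)

lemma number_graph_diff:
  "(f, g) \<in> number_graph \<Longrightarrow> (f', g') \<in> number_graph \<Longrightarrow> ((\<lambda>x. f x - f' x), (\<lambda>x. g x - g' x)) \<in> number_graph"
  by (auto simp: number_graph_iff L2_diff ip_diff_left phi_L2 right_diff_distrib)

lemma number_graph_poly: "\<exists>g. (poly p, poly g) \<in> number_graph"
  using N_op_poly_exists[of p] by (auto simp: number_graph_iff beta.poly_L2)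

lemma number_graph_N_op:
  assumes f: "Ck 2 f"
  shows "(f, N_op f) \<in> number_graph"
proof -
  obtain p g where pg: "\<And>k x. x \<in> I2 \<Longrightarrow> \<bar>f x - poly (p k) x\<bar> \<le> err k"
    "\<And>k x. x \<in> I2 \<Longrightarrow> \<bar>N_op f x - poly (g k) x\<bar> \<le> 8 * err k"
    "\<And>k m. ip beta (poly (g k)) (phi m) = real m * ip beta (poly (p k)) (phi m)"
    using N_op_poly_seq[OF f] by metis
  have fL: "f \<in> L2 beta" and NL: "N_op f \<in> L2 beta"
    using f by (auto intro: Ck_L2 beta.continuous_L2 continuous_N_op)
  have p: "L2_lim beta (\<lambda>k. poly (p k)) f"
    by (rule beta.L2_lim_uniform[OF beta.poly_L2 fL err_tendsto])
       (use pg(1) in \<open>simp add: space_beta abs_minus_commute\<close>)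
  have "(\<lambda>k. 8 * err k) \<longlonglongrightarrow> 0" using tendsto_mult_left[OF err_tendsto, of 8] by simp
  then have g: "L2_lim beta (\<lambda>k. poly (g k)) (N_op f)"
    by (rule beta.L2_lim_uniform[OF beta.poly_L2 NL])
       (use pg(2) in \<open>simp add: space_beta abs_minus_commute\<close>)
  have "ip beta (N_op f) (phi n) = real n * ip beta f (phi n)" for n
  proof (rule LIMSEQ_unique)
    show "(\<lambda>k. ip beta (poly (g k)) (phi n)) \<longlonglongrightarrow> ip beta (N_op f) (phi n)"
      by (rule L2_lim_ip_const[OF g phi_L2])
    show "(\<lambda>k. ip beta (poly (g k)) (phi n)) \<longlonglongrightarrow> real n * ip beta f (phi n)"
      unfolding pg(3) by (intro tendsto_intros L2_lim_ip_const[OF p phi_L2])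
  qed
  then show ?thesis using fL NL by (simp add: number_graph_iff)
qed


section \<open>The measure \<open>omega\<close>\<close>

lemma restrict_space_lborel_pair:
  "restrict_space lborel I2 \<Otimes>\<^sub>M restrict_space lborel I2 = restrict_space lborel (I2 \<times> I2 :: (real \<times> real) set)"
proof (rule pair_measure_eqI)
  let ?R = "restrict_space (lborel :: real measure) I2"
  let ?M = "restrict_space lborel (I2 \<times> I2 :: (real \<times> real) set)"
  have "emeasure ?R (space ?R) < \<infinity>"
    by (simp add: emeasure_restrict_space space_restrict_space)
  then have "finite_measure ?R" by (intro finite_measureI) auto
  then show "sigma_finite_measure ?R" "sigma_finite_measure ?R"
    by (simp_all add: finite_measure.sigma_finite_measure)
  have closed: "I2 \<times> I2 \<in> sets (borel :: (real \<times> real) measure)"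
    by (intro borel_closed closed_Times) auto
  have sp: "space (?R \<Otimes>\<^sub>M ?R) = I2 \<times> I2" by (simp add: space_pair_measure space_restrict_space)
  show "sets (?R \<Otimes>\<^sub>M ?R) = sets ?M"
  proof
    show "sets ?M \<subseteq> sets (?R \<Otimes>\<^sub>M ?R)"
    proof
      fix A assume "A \<in> sets ?M"
      then obtain C where "C \<in> sets (lborel :: (real \<times> real) measure)" "A = I2 \<times> I2 \<inter> C"
        unfolding sets_restrict_space by blast
      then have C: "C \<in> sets (lborel \<Otimes>\<^sub>M lborel :: (real \<times> real) measure)" "A = I2 \<times> I2 \<inter> C"
        unfolding lborel_prod by blast+
      have "(\<lambda>z. (fst z, snd z)) \<in> ?R \<Otimes>\<^sub>M ?R \<rightarrow>\<^sub>M lborel \<Otimes>\<^sub>M lborel"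
        by (intro measurable_Pair measurable_compose[OF measurable_fst] measurable_compose[OF measurable_snd]
            measurable_restrict_space1) simp_all
      from measurable_sets[OF this C(1)] show "A \<in> sets (?R \<Otimes>\<^sub>M ?R)"
        unfolding sp C(2) by (simp add: vimage_def Int_def conj_commute)
    qed
    show "sets (?R \<Otimes>\<^sub>M ?R) \<subseteq> sets ?M"
    proof (rule sets_pair_in_sets)
      fix a b assume ab: "a \<in> sets ?R" "b \<in> sets ?R"
      then have "a \<times> b \<in> sets (lborel \<Otimes>\<^sub>M lborel :: (real \<times> real) measure)"
        by (intro pair_measureI) (auto simp: sets_restrict_space_iff)
      moreover have "a \<times> b \<subseteq> I2 \<times> I2" using ab by (auto simp: sets_restrict_space_iff)
      ultimately show "a \<times> b \<in> sets ?M"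
        using closed unfolding lborel_prod by (simp add: sets_restrict_space_iff)
    qed
  qed
  fix A B assume AB: "A \<in> sets ?R" "B \<in> sets ?R"
  then have sub: "A \<subseteq> I2" "B \<subseteq> I2" "A \<in> sets lborel" "B \<in> sets lborel" by (auto simp: sets_restrict_space_iff)
  have "emeasure ?M (A \<times> B) = emeasure (lborel \<Otimes>\<^sub>M lborel) (A \<times> B)"
    unfolding lborel_prod using closed sub by (intro emeasure_restrict_space) auto
  also have "\<dots> = emeasure lborel A * emeasure lborel B"
    by (intro lborel.emeasure_pair_measure_Times sub)
  also have "\<dots> = emeasure ?R A * emeasure ?R B"
    using sub by (simp add: emeasure_restrict_space)
  finally show "emeasure ?R A * emeasure ?R B = emeasure ?M (A \<times> B)" ..
qed

lemma
  assumes M: "sets M = sets (restrict_space borel I2)" and N: "sets N = sets (restrict_space borel I2)"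
  shows fst_pair_I2_measurable: "fst \<in> borel_measurable (M \<Otimes>\<^sub>M N)"
    and snd_pair_I2_measurable: "snd \<in> borel_measurable (M \<Otimes>\<^sub>M N)"
proof -
  have id: "(\<lambda>x. x) \<in> borel_measurable (restrict_space borel I2)" by (intro measurable_restrict_space1) simp
  have "(\<lambda>x. x) \<in> borel_measurable M" "(\<lambda>x. x) \<in> borel_measurable N"
    using id by (simp_all only: measurable_cong_sets[OF M refl] measurable_cong_sets[OF N refl])
  from measurable_compose[OF measurable_fst this(1)] measurable_compose[OF measurable_snd this(2)]
  show "fst \<in> borel_measurable (M \<Otimes>\<^sub>M N)" "snd \<in> borel_measurable (M \<Otimes>\<^sub>M N)" by - assumption+
qed

lemmas fst_beta_measurable [measurable] = fst_pair_I2_measurable[OF sets_beta sets_beta]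
lemmas snd_beta_measurable [measurable] = snd_pair_I2_measurable[OF sets_beta sets_beta]

lemma mult_le_4: "x \<in> I2 \<Longrightarrow> y \<in> I2 \<Longrightarrow> \<bar>x * y :: real\<bar> \<le> 4"
  using mult_mono[of "\<bar>x\<bar>" 2 "\<bar>y\<bar>" 2] by (auto simp: abs_mult)

text \<open>With respect to the product of two arcsine laws, \<open>omega\<close> has the bounded density $(4-xy)/4$; this makes
  Fubini available for iterated integrals against \<open>beta\<close>.\<close>

lemma omega_eq: "omega = density (beta \<Otimes>\<^sub>M beta) (\<lambda>(x, y). ennreal ((4 - x * y) / 4))"
proof -
  let ?R = "restrict_space (lborel :: real measure) I2"
  let ?w = "\<lambda>x. ennreal (1 / (pi * sqrt (4 - x\<^sup>2)))"
  have w: "?w \<in> borel_measurable ?R"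
    using measurable_compose[OF arcsine_weight_measurable measurable_ennreal] .
  have "emeasure ?R (space ?R) < \<infinity>"
    by (simp add: emeasure_restrict_space space_restrict_space)
  then have "finite_measure ?R" by (intro finite_measureI) auto
  then have "sigma_finite_measure ?R" by (simp add: finite_measure.sigma_finite_measure)
  from pair_measure_density[OF w w this beta.sigma_finite_measure_axioms[unfolded beta_def]]
  have bb: "beta \<Otimes>\<^sub>M beta = density (?R \<Otimes>\<^sub>M ?R) (\<lambda>(x, y). ?w x * ?w y)"
    by (simp only: beta_def)
  have setsR: "sets ?R = sets (restrict_space borel I2)" by (simp cong: sets_restrict_space_cong)
  note [measurable] = fst_pair_I2_measurable[OF setsR setsR] snd_pair_I2_measurable[OF setsR setsR]
  have "density (beta \<Otimes>\<^sub>M beta) (\<lambda>(x, y). ennreal ((4 - x * y) / 4))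
     = density (?R \<Otimes>\<^sub>M ?R) (\<lambda>z. (case z of (x, y) \<Rightarrow> ?w x * ?w y) * (case z of (x, y) \<Rightarrow> ennreal ((4 - x * y) / 4)))"
    unfolding bb by (intro density_density_eq) measurable
  also have "\<dots> = density (?R \<Otimes>\<^sub>M ?R) (\<lambda>(x, y). ennreal ((4 - x * y) / (4 * pi\<^sup>2 * sqrt ((4 - x\<^sup>2) * (4 - y\<^sup>2)))))"
  proof (intro density_cong AE_I2)
    fix z assume "z \<in> space (?R \<Otimes>\<^sub>M ?R)"
    then obtain x y where z: "z = (x, y)" "x \<in> I2" "y \<in> I2"
      by (auto simp: space_pair_measure space_restrict_space)
    have nn: "0 \<le> (4 - x * y) / 4" using mult_le_4[OF z(2,3)] by simp
    have "?w x * ?w y * ennreal ((4 - x * y) / 4)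
        = ennreal (1 / (pi * sqrt (4 - x\<^sup>2)) * (1 / (pi * sqrt (4 - y\<^sup>2))) * ((4 - x * y) / 4))"
      using arcsine_weight_nonneg[OF z(2)] arcsine_weight_nonneg[OF z(3)] nn
      by (simp only: ennreal_mult mult_nonneg_nonneg)
    also have "1 / (pi * sqrt (4 - x\<^sup>2)) * (1 / (pi * sqrt (4 - y\<^sup>2))) * ((4 - x * y) / 4)
        = (4 - x * y) / (4 * pi\<^sup>2 * sqrt ((4 - x\<^sup>2) * (4 - y\<^sup>2)))"
      by (simp add: real_sqrt_mult power2_eq_square mult_ac)
    finally show "(case z of (x, y) \<Rightarrow> ?w x * ?w y) * (case z of (x, y) \<Rightarrow> ennreal ((4 - x * y) / 4))
        = (case z of (x, y) \<Rightarrow> ennreal ((4 - x * y) / (4 * pi\<^sup>2 * sqrt ((4 - x\<^sup>2) * (4 - y\<^sup>2)))))"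
      by (simp add: z)
  qed measurable
  finally show ?thesis unfolding omega_def restrict_space_lborel_pair ..
qed

interpretation bb: pair_prob_space beta beta ..

lemma measurable_omega [simp]: "borel_measurable omega = borel_measurable (beta \<Otimes>\<^sub>M beta)"
  by (rule measurable_cong_sets) (simp_all add: omega_eq)

lemma space_omega: "space omega = I2 \<times> I2"
  by (simp add: omega_eq space_pair_measure space_beta)

interpretation omega: finite_measure omega
proof (rule finite_measureI)
  have "emeasure omega (space omega) \<le> (\<integral>\<^sup>+z. 2 \<partial>(beta \<Otimes>\<^sub>M beta))"
    unfolding omega_eq space_density
  proof (subst emeasure_density)
    show "(\<integral>\<^sup>+z. (case z of (x, y) \<Rightarrow> ennreal ((4 - x * y) / 4)) * indicator (space (beta \<Otimes>\<^sub>M beta)) z \<partial>(beta \<Otimes>\<^sub>M beta))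
        \<le> (\<integral>\<^sup>+z. 2 \<partial>(beta \<Otimes>\<^sub>M beta))"
    proof (rule nn_integral_mono)
      fix z assume "z \<in> space (beta \<Otimes>\<^sub>M beta)"
      then obtain x y where z: "z = (x, y)" "x \<in> I2" "y \<in> I2" by (auto simp: space_pair_measure space_beta)
      have "ennreal ((4 - x * y) / 4) \<le> ennreal 2" using mult_le_4[OF z(2,3)] by (intro ennreal_leI) auto
      then show "(case z of (x, y) \<Rightarrow> ennreal ((4 - x * y) / 4)) * indicator (space (beta \<Otimes>\<^sub>M beta)) z \<le> 2"
        by (simp add: z indicator_def)
    qed
  qed measurable
  also have "\<dots> < \<infinity>" by (simp add: bb.P.emeasure_space_1)
  finally show "emeasure omega (space omega) \<noteq> \<infinity>" by simp
qed

lemma omega_integral: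
  fixes F :: "real \<Rightarrow> real \<Rightarrow> real"
  assumes F: "(\<lambda>(x, y). F x y) \<in> borel_measurable (beta \<Otimes>\<^sub>M beta)"
    and B: "\<And>x y. x \<in> I2 \<Longrightarrow> y \<in> I2 \<Longrightarrow> \<bar>F x y\<bar> \<le> B"
  shows "(\<integral>(x, y). F x y \<partial>omega) = (\<integral>x. \<integral>y. (4 - x * y) / 4 * F x y \<partial>beta \<partial>beta)"
proof -
  note [measurable] = F
  have "(\<integral>(x, y). F x y \<partial>omega) = (\<integral>z. (case z of (x, y) \<Rightarrow> (4 - x * y) / 4) * (case z of (x, y) \<Rightarrow> F x y) \<partial>(beta \<Otimes>\<^sub>M beta))"
  proof -
    have dens: "(\<lambda>(x, y). ennreal ((4 - x * y) / 4)) = (\<lambda>z. ennreal (case z of (x, y) \<Rightarrow> (4 - x * y) / 4))" by auto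
    have "(\<lambda>(x, y). (4 - x * y) / 4) \<in> borel_measurable (beta \<Otimes>\<^sub>M beta)" by measurable
    moreover have "AE z in beta \<Otimes>\<^sub>M beta. 0 \<le> (case z of (x, y) \<Rightarrow> (4 - x * y) / 4)"
      by (rule AE_I2) (use mult_le_4 in \<open>force simp: space_pair_measure space_beta abs_le_iff\<close>)
    ultimately show ?thesis
      unfolding omega_eq dens by (subst integral_density[OF F]) simp_all
  qed
  also have "\<dots> = (\<integral>z. (case z of (x, y) \<Rightarrow> (4 - x * y) / 4 * F x y) \<partial>(beta \<Otimes>\<^sub>M beta))"
    by (rule Bochner_Integration.integral_cong) auto
  also have "\<dots> = (\<integral>x. \<integral>y. (4 - x * y) / 4 * F x y \<partial>beta \<partial>beta)"
  proof (rule bb.integral_fst[symmetric], rule bb.P.bounded_integrable)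
    show "(\<lambda>(x, y). (4 - x * y) / 4 * F x y) \<in> borel_measurable (beta \<Otimes>\<^sub>M beta)" by measurable
    fix z assume "z \<in> space (beta \<Otimes>\<^sub>M beta)"
    then obtain x y where z: "z = (x, y)" "x \<in> I2" "y \<in> I2" by (auto simp: space_pair_measure space_beta)
    have "\<bar>(4 - x * y) / 4 * F x y\<bar> \<le> 2 * B"
      unfolding abs_mult using mult_le_4[OF z(2,3)] B[OF z(2,3)] by (intro mult_mono) auto
    then show "\<bar>case z of (x, y) \<Rightarrow> (4 - x * y) / 4 * F x y\<bar> \<le> 2 * B" by (simp add: z)
  qed
  finally show ?thesis .
qed


section \<open>The Dirichlet form of the counting number operator\<close>

lemma poly_quotient: "\<exists>q. \<forall>y. poly p y - poly p x = (y - x) * poly q (y :: real)"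
proof -
  have "poly (p - [:poly p x:]) x = 0" by simp
  then obtain q where "p - [:poly p x:] = [:- x, 1:] * q"
    unfolding poly_eq_0_iff_dvd dvd_def by blast
  then have "poly (p - [:poly p x:]) y = poly ([:- x, 1:] * q) y" for y by simp
  then show ?thesis by (intro exI[of _ q]) (simp add: algebra_simps)
qed

text \<open>Since $\partial_y\frac{\sqrt{4-y^2}}{x-y} = \frac{4-xy}{(x-y)^2\sqrt{4-y^2}}$, the weight of
  \<open>omega\<close> over $(x-y)^2$ is an exact derivative, and an integration by parts in \<open>y\<close> lowers the
  order of the singularity.\<close>

lemma phi_quot_parts:
  assumes x: "x \<in> I2"
  shows "(\<integral>y. (4 - x * y) / 4 * ((phi n x - phi n y) * (phi m x - phi m y) / (x - y)\<^sup>2) \<partial>beta)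
    = (\<integral>y. (4 - y\<^sup>2) / 4 * (real n * psi n y * ((phi m x - phi m y) / (x - y))
        + real m * psi m y * ((phi n x - phi n y) / (x - y))) \<partial>beta)"
proof -
  obtain a where a: "\<And>y. phi n y - phi n x = (y - x) * poly a y"
    using poly_quotient[of "phi_poly n" x] by (auto simp: poly_phi)
  obtain b where b: "\<And>y. phi m y - phi m x = (y - x) * poly b y"
    using poly_quotient[of "phi_poly m" x] by (auto simp: poly_phi)
  have deriv: "real n * psi n y = poly a y + (y - x) * poly (pderiv a) y"
    if a: "\<And>y. phi n y - phi n x = (y - x) * poly a y" for n a y
  proof (rule DERIV_unique[OF phi_deriv])
    have "phi n = (\<lambda>y. phi n x + (y - x) * poly a y)" using a by (auto simp: fun_eq_iff algebra_simps)
    moreover have "((\<lambda>y. phi n x + (y - x) * poly a y) has_real_derivative poly a y + (y - x) * poly (pderiv a) y) (at y)"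
      by (auto intro!: derivative_eq_intros)
    ultimately show "(phi n has_real_derivative poly a y + (y - x) * poly (pderiv a) y) (at y)" by simp
  qed
  note da = deriv[OF a] and db = deriv[OF b]
  let ?L = "\<lambda>y. (4 - x * y) / 4 * (poly a y * poly b y)"
  let ?R = "\<lambda>y. (4 - y\<^sup>2) / 4 * (real n * psi n y * poly b y + real m * psi m y * poly a y)"
  have int: "integrable beta ?L" "integrable beta ?R"
    unfolding da db by (intro beta.L2_integrable beta.continuous_L2 continuous_intros; simp)+
  have "(\<integral>y. ?L y - ?R y \<partial>beta) = (((x - 2) * (poly a 2 * poly b 2) / 4 * sqrt (4 - 2\<^sup>2)
      - (x - (-2)) * (poly a (-2) * poly b (-2)) / 4 * sqrt (4 - (-2)\<^sup>2))) / pi"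
  proof (rule beta_FTC)
    show "integrable beta (\<lambda>y. ?L y - ?R y)" using int by (rule Bochner_Integration.integrable_diff)
    show "continuous_on I2 (\<lambda>y. (x - y) * (poly a y * poly b y) / 4 * sqrt (4 - y\<^sup>2))"
      by (intro continuous_intros) auto
    fix y :: real assume y: "y \<in> {-2<..<2}"
    define s where "s = sqrt (4 - y\<^sup>2)"
    have s: "s > 0" "s * s = 4 - y\<^sup>2" using sqrt_pos[OF y] by (auto simp: s_def)
    let ?E = "(- (poly a y * poly b y) + (x - y) * (poly (pderiv a) y * poly b y + poly a y * poly (pderiv b) y)) / 4"
    let ?Q = "(x - y) * (poly a y * poly b y) / 4"
    have "((\<lambda>y. (x - y) * (poly a y * poly b y)) has_real_derivative
        - (poly a y * poly b y) + (x - y) * (poly (pderiv a) y * poly b y + poly a y * poly (pderiv b) y)) (at y)"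
      by (auto intro!: derivative_eq_intros simp: algebra_simps)
    from DERIV_mult[OF DERIV_cdivide[OF this, of 4] sqrt_deriv[OF y]]
    have "((\<lambda>y. (x - y) * (poly a y * poly b y) / 4 * sqrt (4 - y\<^sup>2)) has_real_derivative ?E * s + - y / s * ?Q) (at y)"
      unfolding s_def .
    also have "?E * s + - y / s * ?Q = (?E * (s * s) - y * ?Q) / s" using s(1) by (simp add: field_simps)
    also have "?E * (s * s) - y * ?Q = ?L y - ?R y"
    proof -
      have "(- (A * B) + (x - y) * (A' * B + A * B')) / 4 * (4 - y\<^sup>2) - y * ((x - y) * (A * B) / 4)
        = (4 - x * y) / 4 * (A * B) - (4 - y\<^sup>2) / 4 * ((A + (y - x) * A') * B + (B + (y - x) * B') * A)" for A B A' B'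
        by (simp add: power2_eq_square algebra_simps add_divide_distrib diff_divide_distrib)
      then show ?thesis unfolding s(2) da db by (simp only: mult.commute[of "poly b y"])
    qed
    finally show "((\<lambda>y. (x - y) * (poly a y * poly b y) / 4 * sqrt (4 - y\<^sup>2)) has_real_derivative
        (?L y - ?R y) / sqrt (4 - y\<^sup>2)) (at y)" unfolding s_def .
  qed
  then have eq: "(\<integral>y. ?L y \<partial>beta) = (\<integral>y. ?R y \<partial>beta)" using int by simp
  have quot: "(phi n x - phi n y) / (x - y) = poly a y" "(phi m x - phi m y) / (x - y) = poly b y" if "y \<noteq> x" for y
    using a[of y] b[of y] that by (simp_all add: field_simps)
  have "(\<integral>y. (4 - x * y) / 4 * ((phi n x - phi n y) * (phi m x - phi m y) / (x - y)\<^sup>2) \<partial>beta) = (\<integral>y. ?L y \<partial>beta)"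
  proof (rule integral_cong_AE)
    show "AE y in beta. (4 - x * y) / 4 * ((phi n x - phi n y) * (phi m x - phi m y) / (x - y)\<^sup>2) = ?L y"
      using AE_beta_neq[of x]
    proof eventually_elim
      case (elim y)
      show ?case unfolding quot[OF elim, symmetric] by (simp add: power2_eq_square)
    qed
    have [measurable]: "(\<lambda>y. y) \<in> borel_measurable beta" by (rule beta.borel_imp_measurable) simp
    show "(\<lambda>y. (4 - x * y) / 4 * ((phi n x - phi n y) * (phi m x - phi m y) / (x - y)\<^sup>2)) \<in> borel_measurable beta"
      by measurable
  qed (rule borel_measurable_integrable[OF int(1)])
  moreover have "(\<integral>y. (4 - y\<^sup>2) / 4 * (real n * psi n y * ((phi m x - phi m y) / (x - y))
        + real m * psi m y * ((phi n x - phi n y) / (x - y))) \<partial>beta) = (\<integral>y. ?R y \<partial>beta)"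
  proof (rule integral_cong_AE)
    show "AE y in beta. (4 - y\<^sup>2) / 4 * (real n * psi n y * ((phi m x - phi m y) / (x - y))
        + real m * psi m y * ((phi n x - phi n y) / (x - y))) = ?R y"
      using AE_beta_neq[of x]
    proof eventually_elim
      case (elim y)
      show ?case by (simp only: quot[OF elim])
    qed
    have [measurable]: "(\<lambda>y. y) \<in> borel_measurable beta" by (rule beta.borel_imp_measurable) simp
    have [measurable]: "psi n \<in> borel_measurable beta" for n by (intro beta.continuous_measurable continuous_psi)
    show "(\<lambda>y. (4 - y\<^sup>2) / 4 * (real n * psi n y * ((phi m x - phi m y) / (x - y))
        + real m * psi m y * ((phi n x - phi n y) / (x - y)))) \<in> borel_measurable beta"
      by measurable
  qed (rule borel_measurable_integrable[OF int(2)])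
  ultimately show ?thesis using eq by simp
qed

lemma has_dI_interior:
  assumes "Ck (Suc k) f" "x \<in> {-2<..<2}"
  shows "(f has_real_derivative dI f x) (at x)"
proof -
  have "at x within I2 = at x" using assms(2) by (intro at_within_interior) auto
  then show ?thesis using Ck_has_dI[OF assms(1), of x] assms(2) by simp
qed

text \<open>Integration by parts against \<open>sqrt_psi_deriv\<close>.\<close>

lemma integral_psi_dI:
  assumes f: "Ck 1 f"
  shows "(\<integral>x. (4 - x\<^sup>2) * psi n x * dI f x \<partial>beta) = real n * (\<integral>x. phi n x * f x \<partial>beta)"
proof -
  have f1: "Ck (Suc 0) f" using f by simp
  have c: "continuous_on I2 f" "continuous_on I2 (dI f)" using f1 by (auto intro: differentiable_imp_continuous_on)
  have int: "integrable beta (\<lambda>x. (4 - x\<^sup>2) * psi n x * dI f x)" "integrable beta (\<lambda>x. real n * phi n x * f x)"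
    by (intro beta.L2_integrable beta.continuous_L2 continuous_intros c continuous_psi continuous_phi)+
  have "(\<integral>x. (4 - x\<^sup>2) * psi n x * dI f x - real n * phi n x * f x \<partial>beta)
      = (sqrt (4 - 2\<^sup>2) * psi n 2 * f 2 - sqrt (4 - (-2)\<^sup>2) * psi n (-2) * f (-2)) / pi"
  proof (rule beta_FTC)
    show "integrable beta (\<lambda>x. (4 - x\<^sup>2) * psi n x * dI f x - real n * phi n x * f x)"
      using int by (rule Bochner_Integration.integrable_diff)
    show "continuous_on I2 (\<lambda>x. sqrt (4 - x\<^sup>2) * psi n x * f x)"
      by (intro continuous_intros c continuous_psi)
    fix x :: real assume x: "x \<in> {-2<..<2}"
    have s: "sqrt (4 - x\<^sup>2) > 0" "sqrt (4 - x\<^sup>2) * sqrt (4 - x\<^sup>2) = 4 - x\<^sup>2" using sqrt_pos[OF x] by auto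
    from DERIV_mult[OF sqrt_psi_deriv[OF x, of n] has_dI_interior[OF f1 x]]
    have "((\<lambda>x. sqrt (4 - x\<^sup>2) * psi n x * f x) has_real_derivative
        (- real n * phi n x / sqrt (4 - x\<^sup>2)) * f x + dI f x * (sqrt (4 - x\<^sup>2) * psi n x)) (at x)" .
    also have "(- real n * phi n x / sqrt (4 - x\<^sup>2)) * f x + dI f x * (sqrt (4 - x\<^sup>2) * psi n x)
        = ((sqrt (4 - x\<^sup>2) * sqrt (4 - x\<^sup>2)) * psi n x * dI f x - real n * phi n x * f x) / sqrt (4 - x\<^sup>2)"
    proof -
      have "(- N * F / s) * u + D * (s * P) = (s * s * P * D - N * F * u) / s" if "0 < s" for N F u D s P :: real
        using that by (simp add: field_simps)
      then show ?thesis using s(1) .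
    qed
    finally show "((\<lambda>x. sqrt (4 - x\<^sup>2) * psi n x * f x) has_real_derivative
        ((4 - x\<^sup>2) * psi n x * dI f x - real n * phi n x * f x) / sqrt (4 - x\<^sup>2)) (at x)"
      unfolding s(2) .
  qed
  then show ?thesis using int by (simp add: mult.assoc)
qed

lemma Ck_phi: "Ck k (phi n)"
  using Ck_poly[of k "phi_poly n"] by (simp add: poly_phi)

text \<open>Orthogonality of the $\psi_n$ with respect to $(4-x^2)\beta(dx)$. The form with the factor $n+m$ is
  symmetric and also covers the index 0.\<close>

lemma integral_psi_psi: "(real n + real m) * (\<integral>x. (4 - x\<^sup>2) * psi n x * psi m x \<partial>beta) = 2 * real n * ip beta (phi n) (phi m)"
proof -
  have 1: "real m * (\<integral>x. (4 - x\<^sup>2) * psi n x * psi m x \<partial>beta) = real n * ip beta (phi n) (phi m)" for n m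
  proof -
    have "real m * (\<integral>x. (4 - x\<^sup>2) * psi n x * psi m x \<partial>beta) = (\<integral>x. real m * ((4 - x\<^sup>2) * psi n x * psi m x) \<partial>beta)"
      by simp
    also have "\<dots> = (\<integral>x. (4 - x\<^sup>2) * psi n x * dI (phi m) x \<partial>beta)"
      by (intro Bochner_Integration.integral_cong) (simp_all add: space_beta dI_phi mult_ac)
    also have "\<dots> = real n * ip beta (phi n) (phi m)"
      unfolding ip_def by (rule integral_psi_dI[OF Ck_phi])
    finally show ?thesis .
  qed
  have "real n * (\<integral>x. (4 - x\<^sup>2) * psi n x * psi m x \<partial>beta) = real m * ip beta (phi m) (phi n)"
    using 1[of n m] by (simp add: mult_ac)
  then show ?thesis using 1[where n = n and m = m] by (auto simp: distrib_right ip_phi)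
qed

definition omega_form :: "(real \<Rightarrow> real) \<Rightarrow> (real \<Rightarrow> real) \<Rightarrow> real" where
  "omega_form f g = (\<integral>(x, y). (f x - f y) * (g x - g y) / (x - y)\<^sup>2 \<partial>omega)"

definition Lip :: "(real \<Rightarrow> real) \<Rightarrow> bool" where
  "Lip f \<longleftrightarrow> f \<in> borel_measurable beta \<and> (\<exists>B\<ge>0. \<forall>x\<in>I2. \<forall>y\<in>I2. \<bar>f x - f y\<bar> \<le> B * \<bar>x - y\<bar>)"

lemma Lip_C1:
  assumes f: "Ck 1 f" shows "Lip f"
proof -
  have f1: "Ck (Suc 0) f" using f by simp
  then have "continuous_on I2 (dI f)" by simp
  then obtain B where "0 \<le> B" "\<And>x. x \<in> I2 \<Longrightarrow> \<bar>dI f x\<bar> \<le> B" using continuous_bounded_I2 by blast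
  then show ?thesis
    unfolding Lip_def using Lipschitz_I2[OF Ck_has_dI[OF f1]] beta.continuous_measurable[OF Ck_continuous[OF f]]
    by blast
qed

lemma form_measurable:
  assumes [measurable]: "f \<in> borel_measurable beta" "g \<in> borel_measurable beta"
  shows "(\<lambda>(x, y). (f x - f y) * (g x - g y) / (x - y)\<^sup>2) \<in> borel_measurable (beta \<Otimes>\<^sub>M beta)"
  by measurable

lemma form_bound:
  fixes f g :: "real \<Rightarrow> real"
  assumes "\<bar>f x - f y\<bar> \<le> B * \<bar>x - y\<bar>" "\<bar>g x - g y\<bar> \<le> C * \<bar>x - y\<bar>" "0 \<le> B" "0 \<le> C"
  shows "\<bar>(f x - f y) * (g x - g y) / (x - y)\<^sup>2\<bar> \<le> B * C"
proof -
  have "\<bar>(f x - f y) / (x - y)\<bar> * \<bar>(g x - g y) / (x - y)\<bar> \<le> B * C"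
    using assms by (intro mult_mono abs_quot_le) auto
  then show ?thesis by (simp add: abs_mult[symmetric] power2_eq_square)
qed

lemma form_integrable:
  assumes f: "Lip f" and g: "Lip g"
  shows "integrable omega (\<lambda>(x, y). (f x - f y) * (g x - g y) / (x - y)\<^sup>2)"
proof -
  obtain B C where "0 \<le> B" "\<forall>x\<in>I2. \<forall>y\<in>I2. \<bar>f x - f y\<bar> \<le> B * \<bar>x - y\<bar>"
    "0 \<le> C" "\<forall>x\<in>I2. \<forall>y\<in>I2. \<bar>g x - g y\<bar> \<le> C * \<bar>x - y\<bar>" using f g unfolding Lip_def by blast
  then show ?thesis using f g
    by (intro omega.bounded_integrable[where B = "B * C"])
       (auto simp: space_omega Lip_def simp del: times_divide_eq_right abs_divide intro!: form_measurable form_bound)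
qed

lemma omega_form_add_left:
  assumes "Lip f" "Lip f'" "Lip g"
  shows "omega_form (\<lambda>x. f x + f' x) g = omega_form f g + omega_form f' g"
proof -
  have "(\<lambda>(x, y). ((f x + f' x) - (f y + f' y)) * (g x - g y) / (x - y)\<^sup>2)
      = (\<lambda>z. (case z of (x, y) \<Rightarrow> (f x - f y) * (g x - g y) / (x - y)\<^sup>2)
          + (case z of (x, y) \<Rightarrow> (f' x - f' y) * (g x - g y) / (x - y)\<^sup>2))"
    by (auto simp: fun_eq_iff add_divide_distrib[symmetric] algebra_simps)
  then show ?thesis unfolding omega_form_def
    by (simp only: Bochner_Integration.integral_add form_integrable assms)
qed

lemma omega_form_commute: "omega_form f g = omega_form g f"
  unfolding omega_form_def by (simp add: mult.commute)

lemma omega_form_cmult_left: "omega_form (\<lambda>x. c * f x) g = c * omega_form f g"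
proof -
  have "(\<lambda>(x, y). (c * f x - c * f y) * (g x - g y) / (x - y)\<^sup>2)
      = (\<lambda>z. c * (case z of (x, y) \<Rightarrow> (f x - f y) * (g x - g y) / (x - y)\<^sup>2))"
    by (auto simp: fun_eq_iff right_diff_distrib[symmetric])
  then show ?thesis unfolding omega_form_def by (simp only: integral_mult_right_zero)
qed

text \<open>After \<open>phi_quot_parts\<close> the integrand is a function of \<open>y\<close> times a difference quotient. Exchanging
  the integrals and integrating in \<open>x\<close> replaces the quotients by $\psi_m(y)$ and $\psi_n(y)$, which
  leaves the inner product of \<open>integral_psi_psi\<close>.\<close>

lemma omega_form_phi: "2 * omega_form (phi n) (phi m) = real n * ip beta (phi n) (phi m)"
proof -
  obtain B C where BC: "0 \<le> B" "\<And>x y. x \<in> I2 \<Longrightarrow> y \<in> I2 \<Longrightarrow> \<bar>phi n x - phi n y\<bar> \<le> B * \<bar>x - y\<bar>"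
    "0 \<le> C" "\<And>x y. x \<in> I2 \<Longrightarrow> y \<in> I2 \<Longrightarrow> \<bar>phi m x - phi m y\<bar> \<le> C * \<bar>x - y\<bar>"
    using Lip_C1[OF Ck_phi, of n] Lip_C1[OF Ck_phi, of m] unfolding Lip_def by blast
  have [measurable]: "psi n \<in> borel_measurable beta" for n by (intro beta.continuous_measurable continuous_psi)
  define q where "q n x y = (phi n x - phi n y) / (x - y)" for n x y
  define F where "F y x = (4 - y\<^sup>2) / 4 * (real n * psi n y * q m x y + real m * psi m y * q n x y)" for y x
  have qm: "(\<lambda>(y, x). q n x y) \<in> borel_measurable (beta \<Otimes>\<^sub>M beta)" for n
    unfolding q_def by measurable
  have Fm: "(\<lambda>(y, x). F y x) \<in> borel_measurable (beta \<Otimes>\<^sub>M beta)"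
    unfolding F_def q_def by measurable
  obtain Bn Bm where bnd: "\<And>y. y \<in> I2 \<Longrightarrow> \<bar>psi n y\<bar> \<le> Bn" "\<And>y. y \<in> I2 \<Longrightarrow> \<bar>psi m y\<bar> \<le> Bm" "0 \<le> Bn" "0 \<le> Bm"
    using continuous_bounded_I2[OF continuous_psi[of I2 n]] continuous_bounded_I2[OF continuous_psi[of I2 m]] by metis
  have FB: "\<bar>F y x\<bar> \<le> real n * Bn * C + real m * Bm * B" if "x \<in> I2" "y \<in> I2" for x y
  proof -
    have q: "\<bar>q n x y\<bar> \<le> B" "\<bar>q m x y\<bar> \<le> C" unfolding q_def by (intro abs_quot_le BC that)+
    have "\<bar>real n * psi n y * q m x y + real m * psi m y * q n x y\<bar> \<le> real n * Bn * C + real m * Bm * B"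
    proof (rule order_trans[OF abs_triangle_ineq add_mono])
      show "\<bar>real n * psi n y * q m x y\<bar> \<le> real n * Bn * C"
        unfolding abs_mult using q(2) bnd(1)[OF that(2)] bnd(3) by (intro mult_mono) simp_all
      show "\<bar>real m * psi m y * q n x y\<bar> \<le> real m * Bm * B"
        unfolding abs_mult using q(1) bnd(2)[OF that(2)] bnd(4) by (intro mult_mono) simp_all
    qed
    moreover have "\<bar>(4 - y\<^sup>2) / 4\<bar> \<le> 1" using four_minus_sq_nonneg[OF that(2)] by auto
    ultimately have "\<bar>(4 - y\<^sup>2) / 4\<bar> * \<bar>real n * psi n y * q m x y + real m * psi m y * q n x y\<bar>
        \<le> 1 * (real n * Bn * C + real m * Bm * B)" by (intro mult_mono) auto
    then show ?thesis by (simp add: F_def abs_mult)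
  qed
  have "omega_form (phi n) (phi m) = (\<integral>x. \<integral>y. (4 - x * y) / 4 * ((phi n x - phi n y) * (phi m x - phi m y) / (x - y)\<^sup>2) \<partial>beta \<partial>beta)"
    unfolding omega_form_def
    by (rule omega_integral[OF form_measurable[OF phi_measurable phi_measurable]
          form_bound[OF BC(2) BC(4) BC(1) BC(3)]])
  also have "\<dots> = (\<integral>x. \<integral>y. F y x \<partial>beta \<partial>beta)"
    unfolding F_def q_def by (intro Bochner_Integration.integral_cong refl phi_quot_parts) (simp add: space_beta)
  also have "\<dots> = (\<integral>y. \<integral>x. F y x \<partial>beta \<partial>beta)"
  proof (rule bb.Fubini_integral, rule bb.P.bounded_integrable[OF Fm])
    fix z assume "z \<in> space (beta \<Otimes>\<^sub>M beta)"
    then obtain y x where z: "z = (y, x)" "y \<in> I2" "x \<in> I2" unfolding space_pair_measure space_beta by blast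
    show "\<bar>case z of (y, x) \<Rightarrow> F y x\<bar> \<le> real n * Bn * C + real m * Bm * B"
      unfolding z(1) prod.case by (rule FB[OF z(3,2)])
  qed
  also have "\<dots> = (\<integral>y. (real n + real m) / 4 * ((4 - y\<^sup>2) * psi n y * psi m y) \<partial>beta)"
  proof (intro Bochner_Integration.integral_cong refl)
    fix y assume "y \<in> space beta"
    then have y: "y \<in> I2" by (simp add: space_beta)
    have q: "integrable beta (\<lambda>x. q n x y)" "(\<integral>x. q n x y \<partial>beta) = psi n y" for n
    proof -
      have "q n x y = (phi n y - phi n x) / (y - x)" for x
        unfolding q_def by (cases "x = y") (simp_all add: divide_simps algebra_simps)
      then show "integrable beta (\<lambda>x. q n x y)" "(\<integral>x. q n x y \<partial>beta) = psi n y"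
        using phi_quot_integrable[OF y, of n] quot_op_phi[OF y, of n] unfolding quot_op_def by (simp_all only:)
    qed
    have "(\<integral>x. F y x \<partial>beta) = (4 - y\<^sup>2) / 4 * (real n * psi n y * psi m y + real m * psi m y * psi n y)"
      unfolding F_def integral_mult_right_zero
      by (simp only: Bochner_Integration.integral_add integrable_mult_right integral_mult_right_zero q)
    then show "(\<integral>x. F y x \<partial>beta) = (real n + real m) / 4 * ((4 - y\<^sup>2) * psi n y * psi m y)"
      by (simp add: field_simps)
  qed
  also have "\<dots> = (real n + real m) / 4 * (\<integral>y. (4 - y\<^sup>2) * psi n y * psi m y \<partial>beta)"
    by (rule integral_mult_right_zero)
  also have "\<dots> = real n / 2 * ip beta (phi n) (phi m)"
    using integral_psi_psi[of n m] by simp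
  finally show ?thesis by simp
qed

lemma Lip_poly: "Lip (poly p)"
  using Lip_C1[OF Ck_poly] .

lemma number_form_poly:
  assumes "(poly p, g) \<in> number_graph"
  shows "ip beta g (poly q) = 2 * omega_form (poly p) (poly q)"
proof (induction q rule: poly_phi_induct)
  case (phi c m)
  have "2 * omega_form (poly p) (phi m) = real m * ip beta (poly p) (phi m)"
  proof (induction p rule: poly_phi_induct)
    case (phi c n)
    then show ?case using omega_form_phi[of n m]
      by (auto simp: poly_smult[abs_def] omega_form_cmult_left ip_cmult_left poly_phi ip_phi)
  next
    case (add p q)
    have "Lip (phi m)" using Lip_C1[OF Ck_phi] .
    with add show ?case
      by (simp add: poly_add[abs_def] omega_form_add_left Lip_poly ip_add_left beta.poly_L2 phi_L2 distrib_left)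
  qed
  then show ?case using assms
    by (simp add: poly_smult[abs_def] ip_cmult_right poly_phi number_graph_iff omega_form_cmult_left
        omega_form_commute[of "poly p"])
next
  case (add q r)
  have g: "g \<in> L2 beta" using assms by (simp add: number_graph_iff)
  show ?case using add omega_form_add_left[OF Lip_poly[of q] Lip_poly[of r] Lip_poly[of p]]
    by (simp add: poly_add[abs_def] ip_add_right g beta.poly_L2 omega_form_commute[of "poly p"])
qed

text \<open>The norm identity $\|\mathcal{N}p\|^2=2\int p'^2\,d\alpha$: derivatives control $\mathcal{N}$ in
  $L^2(\beta)$, which is why $C^1$ functions are in the domain of $\mathcal{N}$.\<close>

lemma number_norm_poly:
  assumes g: "(poly p, g) \<in> number_graph" and h: "(poly q, h) \<in> number_graph"
  shows "ip beta g h = (\<integral>x. (4 - x\<^sup>2) * poly (pderiv q) x * poly (pderiv p) x \<partial>beta)"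
  using h
proof (induction q arbitrary: h rule: poly_phi_induct)
  case (phi c m)
  have gL: "g \<in> L2 beta" and gc: "ip beta g (phi m) = real m * ip beta (poly p) (phi m)"
    using g by (simp_all add: number_graph_iff)
  have "(poly (smult c (phi_poly m)), (\<lambda>x. c * real m * phi m x)) \<in> number_graph"
    using beta.poly_L2[of "smult c (phi_poly m)"]
    by (auto simp: number_graph_iff poly_smult[abs_def] poly_phi ip_cmult_left ip_phi intro: L2_cmult L2_zero phi_L2)
  from number_op_AE[OF this] number_op_AE[OF phi] have ae: "AE x in beta. h x = c * real m * phi m x"
    by eventually_elim simp
  have "ip beta g h = ip beta g (\<lambda>x. c * real m * phi m x)"
    using ae phi gL by (intro ip_cong_AE) (auto simp: number_graph_iff intro: L2_D)
  also have "\<dots> = c * real m * (real m * (\<integral>x. phi m x * poly p x \<partial>beta))"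
    unfolding ip_cmult_right gc by (simp add: ip_def mult.commute)
  also have "\<dots> = c * real m * (\<integral>x. (4 - x\<^sup>2) * psi m x * dI (poly p) x \<partial>beta)"
    by (simp only: integral_psi_dI[OF Ck_poly])
  also have "\<dots> = (\<integral>x. c * real m * ((4 - x\<^sup>2) * psi m x * dI (poly p) x) \<partial>beta)"
    by (rule integral_mult_right_zero[symmetric])
  also have "\<dots> = (\<integral>x. (4 - x\<^sup>2) * poly (pderiv (smult c (phi_poly m))) x * poly (pderiv p) x \<partial>beta)"
    by (intro Bochner_Integration.integral_cong) (simp_all add: space_beta dI_poly pderiv_smult pderiv_phi mult_ac)
  finally show ?case .
next
  case (add q r)
  obtain h1 h2 where h12: "(poly q, h1) \<in> number_graph" "(poly r, h2) \<in> number_graph"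
    using number_graph_poly by metis
  have gL: "g \<in> L2 beta" and hL: "h1 \<in> L2 beta" "h2 \<in> L2 beta" using g h12 by (simp_all add: number_graph_iff)
  have "(poly (q + r), (\<lambda>x. h1 x + h2 x)) \<in> number_graph"
    using number_graph_add[OF h12] by (simp add: poly_add[abs_def])
  from number_op_AE[OF this] number_op_AE[OF add(3)] have ae: "AE x in beta. h x = h1 x + h2 x"
    by eventually_elim simp
  have "ip beta g h = ip beta g (\<lambda>x. h1 x + h2 x)"
    using ae add(3) gL L2_add[OF hL] by (intro ip_cong_AE) (auto simp: number_graph_iff intro: L2_D)
  also have "\<dots> = ip beta g h1 + ip beta g h2" by (rule ip_add_right[OF hL gL])
  also have "\<dots> = (\<integral>x. (4 - x\<^sup>2) * poly (pderiv (q + r)) x * poly (pderiv p) x \<partial>beta)"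
  proof -
    have "integrable beta (\<lambda>x. (4 - x\<^sup>2) * poly (pderiv q) x * poly (pderiv p) x)" for q
      by (intro beta.L2_integrable beta.continuous_L2 continuous_intros)
    then show ?thesis
      unfolding add(1)[OF h12(1)] add(2)[OF h12(2)] by (simp add: pderiv_add distrib_left distrib_right)
  qed
  finally show ?case .
qed

text \<open>By \<open>number_norm_poly\<close> the images of a sequence of polynomials that converges in $C^1$ form a Cauchy
  sequence in $L^2(\beta)$; their limit has the right coefficients because inner products with the
  $\phi_n$ are continuous.\<close>

lemma C1_number_seq:
  assumes f: "Ck 1 f"
  obtains p g h where "\<And>k x. x \<in> I2 \<Longrightarrow> \<bar>f x - poly (p k) x\<bar> \<le> err k"
    "\<And>k x. x \<in> I2 \<Longrightarrow> \<bar>dI f x - poly (pderiv (p k)) x\<bar> \<le> err k"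
    "\<And>k. (poly (p k), g k) \<in> number_graph" "(f, h) \<in> number_graph" "L2_lim beta g h"
proof -
  obtain p where p: "\<And>k x. x \<in> I2 \<Longrightarrow> \<bar>f x - poly (p k) x\<bar> \<le> err k"
    "\<And>k x. x \<in> I2 \<Longrightarrow> \<bar>dI f x - poly (pderiv (p k)) x\<bar> \<le> err k"
    using C1_poly_seq[OF f] by blast
  have "\<forall>k. \<exists>g. (poly (p k), g) \<in> number_graph" using number_graph_poly by blast
  from choice[OF this] obtain g where g: "\<And>k. (poly (p k), g k) \<in> number_graph" by blast
  have gL: "g k \<in> L2 beta" for k using g by (simp add: number_graph_iff)
  have diff: "ip beta (\<lambda>x. g k x - g l x) (\<lambda>x. g k x - g l x) \<le> 4 * (err k + err l)\<^sup>2" for k l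
  proof -
    have "(poly (p k - p l), (\<lambda>x. g k x - g l x)) \<in> number_graph"
      using number_graph_diff[OF g g] by (simp add: poly_diff[abs_def])
    from number_norm_poly[OF this this]
    have eq: "ip beta (\<lambda>x. g k x - g l x) (\<lambda>x. g k x - g l x)
        = (\<integral>x. (4 - x\<^sup>2) * poly (pderiv (p k - p l)) x * poly (pderiv (p k - p l)) x \<partial>beta)" .
    have "\<bar>\<integral>x. (4 - x\<^sup>2) * poly (pderiv (p k - p l)) x * poly (pderiv (p k - p l)) x \<partial>beta\<bar> \<le> 4 * (err k + err l)\<^sup>2"
    proof (rule abs_integral_beta_le)
      show "(\<lambda>x. (4 - x\<^sup>2) * poly (pderiv (p k - p l)) x * poly (pderiv (p k - p l)) x) \<in> borel_measurable beta"
        by (intro beta.continuous_measurable continuous_intros)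
      fix x :: real assume x: "x \<in> I2"
      have d: "\<bar>poly (pderiv (p k - p l)) x\<bar> \<le> err k + err l"
        using p(2)[OF x, of k] p(2)[OF x, of l] by (simp add: pderiv_diff)
      have "\<bar>4 - x\<^sup>2\<bar> * \<bar>poly (pderiv (p k - p l)) x\<bar> * \<bar>poly (pderiv (p k - p l)) x\<bar> \<le> 4 * (err k + err l) * (err k + err l)"
      proof -
        have "0 \<le> err k + err l" by (intro add_nonneg_nonneg less_imp_le err_pos)
        moreover have "\<bar>4 - x\<^sup>2\<bar> \<le> 4" using four_minus_sq_nonneg[OF x] by simp
        ultimately show ?thesis by (intro mult_mono d mult_nonneg_nonneg) simp_all
      qed
      then show "\<bar>(4 - x\<^sup>2) * poly (pderiv (p k - p l)) x * poly (pderiv (p k - p l)) x\<bar> \<le> 4 * (err k + err l)\<^sup>2"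
        by (simp only: abs_mult power2_eq_square mult.assoc)
    qed
    then show ?thesis unfolding eq by linarith
  qed
  have "\<exists>h. L2_lim beta g h"
  proof (rule beta.L2_complete[OF gL])
    fix e :: real assume "0 < e"
    have "(\<lambda>k. 16 * (err k)\<^sup>2) \<longlonglongrightarrow> 16 * 0\<^sup>2" by (intro tendsto_intros err_tendsto)
    then have "\<forall>\<^sub>F k in sequentially. 16 * (err k)\<^sup>2 < e" using \<open>0 < e\<close> by (intro order_tendstoD(2)) auto
    then obtain K where K: "16 * (err K)\<^sup>2 < e" by (auto simp: eventually_sequentially)
    have "ip beta (\<lambda>x. g k x - g l x) (\<lambda>x. g k x - g l x) < e" if "k \<ge> K" "l \<ge> K" for k l
    proof -
      have "err k \<le> err K" "err l \<le> err K" using that by (auto simp: err_def field_simps)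
      then have "(err k + err l)\<^sup>2 \<le> (2 * err K)\<^sup>2"
        using err_pos[of k] err_pos[of l] by (intro power_mono) auto
      then have "4 * (err k + err l)\<^sup>2 \<le> 16 * (err K)\<^sup>2" by (simp add: power_mult_distrib)
      then show ?thesis using diff[of k l] K by linarith
    qed
    then show "\<exists>K. \<forall>k\<ge>K. \<forall>l\<ge>K. ip beta (\<lambda>x. g k x - g l x) (\<lambda>x. g k x - g l x) < e" by blast
  qed
  then obtain h where h: "L2_lim beta g h" by blast
  have fL: "f \<in> L2 beta" using f by (rule Ck_L2)
  have pL: "L2_lim beta (\<lambda>k. poly (p k)) f"
    by (rule beta.L2_lim_uniform[OF beta.poly_L2 fL err_tendsto])
       (use p(1) in \<open>simp add: space_beta abs_minus_commute\<close>)
  have "ip beta h (phi n) = real n * ip beta f (phi n)" for n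
  proof (rule LIMSEQ_unique)
    show "(\<lambda>k. ip beta (g k) (phi n)) \<longlonglongrightarrow> ip beta h (phi n)"
      by (rule L2_lim_ip_const[OF h phi_L2])
    have "ip beta (g k) (phi n) = real n * ip beta (poly (p k)) (phi n)" for k
      using g by (simp add: number_graph_iff)
    then show "(\<lambda>k. ip beta (g k) (phi n)) \<longlonglongrightarrow> real n * ip beta f (phi n)"
      by (simp only:) (intro tendsto_intros L2_lim_ip_const[OF pL phi_L2])
  qed
  then have "(f, h) \<in> number_graph" using fL L2_limD(2)[OF h] by (simp add: number_graph_iff)
  with p g h show ?thesis using that by blast
qed

text \<open>The polynomials of a $C^1$-convergent sequence have a common Lipschitz constant, which dominates the
  integrands of \<open>omega_form\<close>.\<close>

lemma C1_number_form:
  assumes f: "Ck 1 f" and g: "Ck 1 g"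
  shows "f \<in> Domain number_graph" and "ip beta (number_op f) g = 2 * omega_form f g"
proof -
  obtain p u h where p: "\<And>k x. x \<in> I2 \<Longrightarrow> \<bar>f x - poly (p k) x\<bar> \<le> err k"
    "\<And>k x. x \<in> I2 \<Longrightarrow> \<bar>dI f x - poly (pderiv (p k)) x\<bar> \<le> err k"
    and u: "\<And>k. (poly (p k), u k) \<in> number_graph" "(f, h) \<in> number_graph" "L2_lim beta u h"
    using C1_number_seq[OF f] by blast
  obtain q where q: "\<And>k x. x \<in> I2 \<Longrightarrow> \<bar>g x - poly (q k) x\<bar> \<le> err k"
    "\<And>k x. x \<in> I2 \<Longrightarrow> \<bar>dI g x - poly (pderiv (q k)) x\<bar> \<le> err k"
    using C1_poly_seq[OF g] by blast
  show "f \<in> Domain number_graph" using u(2) by blast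
  have gL: "g \<in> L2 beta" using g by (rule Ck_L2)
  have qL: "L2_lim beta (\<lambda>k. poly (q k)) g"
    by (rule beta.L2_lim_uniform[OF beta.poly_L2 gL err_tendsto])
       (use q(1) in \<open>simp add: space_beta abs_minus_commute\<close>)
  have uniform: "\<exists>B\<ge>0. \<forall>k. \<forall>x\<in>I2. \<forall>y\<in>I2. \<bar>poly (p k) x - poly (p k) y\<bar> \<le> B * \<bar>x - y\<bar>"
    if f: "Ck 1 f" and p: "\<And>k x. x \<in> I2 \<Longrightarrow> \<bar>dI f x - poly (pderiv (p k)) x\<bar> \<le> err k" for f p
  proof -
    have "continuous_on I2 (dI f)" using f by simp
    then obtain B where B: "0 \<le> B" "\<And>x. x \<in> I2 \<Longrightarrow> \<bar>dI f x\<bar> \<le> B" using continuous_bounded_I2 by blast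
    have "\<bar>poly (pderiv (p k)) x\<bar> \<le> B + 1" if "x \<in> I2" for k x
    proof -
      have "err k \<le> 1" by (simp add: err_def)
      then show ?thesis using p[OF that, of k] B(2)[OF that] by linarith
    qed
    then show ?thesis using poly_Lipschitz B(1) by (intro exI[of _ "B + 1"]) auto
  qed
  obtain B where B: "0 \<le> B" "\<And>k x y. x \<in> I2 \<Longrightarrow> y \<in> I2 \<Longrightarrow> \<bar>poly (p k) x - poly (p k) y\<bar> \<le> B * \<bar>x - y\<bar>"
    using uniform[OF f p(2)] by blast
  obtain C where C: "0 \<le> C" "\<And>k x y. x \<in> I2 \<Longrightarrow> y \<in> I2 \<Longrightarrow> \<bar>poly (q k) x - poly (q k) y\<bar> \<le> C * \<bar>x - y\<bar>"
    using uniform[OF g q(2)] by blast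
  have "(\<lambda>k. omega_form (poly (p k)) (poly (q k))) \<longlonglongrightarrow> omega_form f g"
    unfolding omega_form_def
  proof (rule integral_dominated_convergence[where w = "\<lambda>z. B * C"])
    show "AE z in omega. (\<lambda>k. case z of (x, y) \<Rightarrow> (poly (p k) x - poly (p k) y) * (poly (q k) x - poly (q k) y) / (x - y)\<^sup>2)
        \<longlonglongrightarrow> (case z of (x, y) \<Rightarrow> (f x - f y) * (g x - g y) / (x - y)\<^sup>2)"
    proof (rule AE_I2)
      fix z assume "z \<in> space omega"
      then obtain x y where z: "z = (x, y)" "x \<in> I2" "y \<in> I2" by (auto simp: space_omega)
      have "(\<lambda>k. poly (p k) x) \<longlonglongrightarrow> f x" "(\<lambda>k. poly (q k) x) \<longlonglongrightarrow> g x" if "x \<in> I2" for x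
        using poly_limit[of f p 1 x] poly_limit[of g q 1 x] p(1) q(1) that by auto
      then show "(\<lambda>k. case z of (x, y) \<Rightarrow> (poly (p k) x - poly (p k) y) * (poly (q k) x - poly (q k) y) / (x - y)\<^sup>2)
        \<longlonglongrightarrow> (case z of (x, y) \<Rightarrow> (f x - f y) * (g x - g y) / (x - y)\<^sup>2)"
        unfolding z prod.case divide_inverse using z by (intro tendsto_intros) auto
    qed
    show "AE z in omega. norm (case z of (x, y) \<Rightarrow> (poly (p k) x - poly (p k) y) * (poly (q k) x - poly (q k) y) / (x - y)\<^sup>2) \<le> B * C" for k
      by (rule AE_I2) (use B C in \<open>auto simp: space_omega simp del: abs_divide intro!: form_bound\<close>)
  qed (simp_all add: form_measurable poly_measurable_beta L2_D(1)[OF Ck_L2[OF f]] L2_D(1)[OF Ck_L2[OF g]])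
  moreover have "(\<lambda>k. ip beta (u k) (poly (q k))) \<longlonglongrightarrow> ip beta h g" by (rule L2_lim_ip[OF u(3) qL])
  ultimately have "ip beta h g = 2 * omega_form f g"
    unfolding number_form_poly[OF u(1)] using LIMSEQ_unique tendsto_mult_left by blast
  then show "ip beta (number_op f) g = 2 * omega_form f g" using ip_number_op[OF u(2) gL] by simp
qed


section \<open>The Jacobi operator\<close>

lemma space_alpha: "space alpha = I2"
  by (rule alpha.space_M)

lemma ip_alpha:
  assumes "f \<in> borel_measurable beta" "g \<in> borel_measurable beta"
  shows "2 * ip alpha f g = (\<integral>x. (4 - x\<^sup>2) * (f x * g x) \<partial>beta)"
proof -
  have "2 * ip alpha f g = 2 * (\<integral>x. (4 - x\<^sup>2) / 2 * (f x * g x) \<partial>beta)"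
    unfolding ip_def using assms by (subst integral_alpha) auto
  also have "\<dots> = (\<integral>x. 2 * ((4 - x\<^sup>2) / 2 * (f x * g x)) \<partial>beta)" by (rule integral_mult_right_zero[symmetric])
  also have "\<dots> = (\<integral>x. (4 - x\<^sup>2) * (f x * g x) \<partial>beta)"
    by (rule Bochner_Integration.integral_cong) simp_all
  finally show ?thesis .
qed

lemma continuous_jacobi: "Ck 2 f \<Longrightarrow> continuous_on I2 (jacobi f)"
proof -
  assume "Ck 2 f"
  then have "continuous_on I2 (dI f)" "continuous_on I2 (dI (dI f))"
    by (auto simp: numeral_2_eq_2 intro: differentiable_imp_continuous_on)
  then show ?thesis unfolding jacobi_def[abs_def] by (intro continuous_intros)
qed

text \<open>In divergence form the Jacobi operator is
  $f\mapsto -\sqrt{4-x^2}\,(\sqrt{4-x^2}f')'$, so this is an integration by parts.\<close>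

lemma ip_jacobi:
  assumes f: "Ck 2 f" and g: "Ck 1 g"
  shows "ip beta (jacobi f) g = 2 * (\<integral>x. dI f x * dI g x \<partial>alpha)"
proof -
  have f1: "Ck (Suc 0) (dI f)" and f2: "Ck (Suc (Suc 0)) f" and g1: "Ck (Suc 0) g"
    using f g by (simp_all add: numeral_2_eq_2)
  have c: "continuous_on I2 (dI f)" "continuous_on I2 (dI g)" "continuous_on I2 g" "continuous_on I2 (jacobi f)"
    using g1 Ck_continuous[OF f1] Ck_continuous[OF g1] continuous_jacobi[OF f] by auto
  have int: "integrable beta (\<lambda>x. jacobi f x * g x)" "integrable beta (\<lambda>x. (4 - x\<^sup>2) * (dI f x * dI g x))"
    by (intro beta.L2_integrable beta.continuous_L2 continuous_intros c)+
  have "(\<integral>x. (4 - x\<^sup>2) * (dI f x * dI g x) - jacobi f x * g x \<partial>beta)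
      = (sqrt (4 - 2\<^sup>2) * (dI f 2 * g 2) - sqrt (4 - (-2)\<^sup>2) * (dI f (-2) * g (-2))) / pi"
  proof (rule beta_FTC)
    show "integrable beta (\<lambda>x. (4 - x\<^sup>2) * (dI f x * dI g x) - jacobi f x * g x)"
      using int by (intro Bochner_Integration.integrable_diff)
    show "continuous_on I2 (\<lambda>x. sqrt (4 - x\<^sup>2) * (dI f x * g x))"
      by (intro continuous_intros c)
    fix x :: real assume x: "x \<in> {-2<..<2}"
    define s where "s = sqrt (4 - x\<^sup>2)"
    have s: "s > 0" "4 - x\<^sup>2 = s * s" using sqrt_pos[OF x] by (auto simp: s_def)
    from DERIV_mult[OF sqrt_deriv[OF x] DERIV_mult[OF has_dI_interior[OF f1 x] has_dI_interior[OF g1 x]]]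
    have "((\<lambda>x. sqrt (4 - x\<^sup>2) * (dI f x * g x)) has_real_derivative
        - x / s * (dI f x * g x) + (dI (dI f) x * g x + dI g x * dI f x) * s) (at x)" unfolding s_def .
    also have "- x / s * (dI f x * g x) + (dI (dI f) x * g x + dI g x * dI f x) * s
        = ((4 - x\<^sup>2) * (dI f x * dI g x) - jacobi f x * g x) / s"
      unfolding jacobi_def s(2) using s(1) by (simp add: field_simps)
    finally show "((\<lambda>x. sqrt (4 - x\<^sup>2) * (dI f x * g x)) has_real_derivative
        ((4 - x\<^sup>2) * (dI f x * dI g x) - jacobi f x * g x) / sqrt (4 - x\<^sup>2)) (at x)" unfolding s_def .
  qed
  then have "ip beta (jacobi f) g = (\<integral>x. (4 - x\<^sup>2) * (dI f x * dI g x) \<partial>beta)"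
    using int by (simp add: ip_def)
  also have "\<dots> = 2 * ip alpha (dI f) (dI g)"
    by (intro ip_alpha[symmetric] beta.continuous_measurable c)
  finally show ?thesis by (simp add: ip_def)
qed

lemma ip_jacobi_phi:
  assumes f: "Ck 2 f"
  shows "ip beta (jacobi f) (phi n) = (real n)\<^sup>2 * ip beta f (phi n)"
proof -
  have f1: "Ck 1 f" using Ck_mono[OF f, of 1] by simp
  then have c: "dI f \<in> borel_measurable beta" using Ck_dI_measurable[of 0 f] by simp
  have "ip beta (jacobi f) (phi n) = 2 * ip alpha (dI f) (dI (phi n))"
    using ip_jacobi[OF f Ck_phi] by (simp add: ip_def)
  also have "\<dots> = (\<integral>x. (4 - x\<^sup>2) * (dI f x * dI (phi n) x) \<partial>beta)"
    using Ck_dI_measurable[OF Ck_phi] by (intro ip_alpha c)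
  also have "\<dots> = (\<integral>x. real n * ((4 - x\<^sup>2) * psi n x * dI f x) \<partial>beta)"
    by (intro Bochner_Integration.integral_cong) (simp_all add: space_beta dI_phi)
  also have "\<dots> = real n * (real n * (\<integral>x. phi n x * f x \<partial>beta))"
    by (simp only: integral_mult_right_zero integral_psi_dI[OF f1])
  finally show ?thesis by (simp add: ip_def power2_eq_square mult.commute)
qed

text \<open>$\mathcal{N}f$ has the coefficients $n\langle f,\phi_n\rangle$ up to normalization, and the Jacobi
  operator multiplies coefficients by $n^2$; hence the image of $\mathcal{N}f$ under the counting number
  operator exists and is the Jacobi operator applied to \<open>f\<close>.\<close>

lemma number_op_jacobi:
  assumes f: "Ck 2 f"
  shows "(number_op f, jacobi f) \<in> number_graph"
proof -
  have "(f, number_op f) \<in> number_graph"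
    using number_graph_N_op[OF f] by (intro number_op_graph) blast
  then show ?thesis
    using ip_jacobi_phi[OF f] beta.continuous_L2[OF continuous_jacobi[OF f]]
    by (simp add: number_graph_iff power2_eq_square)
qed

lemma L_op_jacobi: "Ck 2 f \<Longrightarrow> AE x in beta. L_op f x = jacobi f x"
  unfolding L_op_def by (rule number_op_AE[OF number_op_jacobi])

lemma L_op_graph: "Ck 2 f \<Longrightarrow> (number_op f, L_op f) \<in> number_graph"
  unfolding L_op_def using number_op_jacobi by (intro number_op_graph) blast

lemma ip_L_op: "Ck 2 f \<Longrightarrow> g \<in> L2 beta \<Longrightarrow> ip beta (L_op f) g = ip beta (jacobi f) g"
  unfolding L_op_def by (rule ip_number_op[OF number_op_jacobi])

lemma invariant_L_op: "invariant_measure beta L_op {f. Ck 2 f}"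
  unfolding invariant_measure_def
proof (intro ballI conjI)
  fix f assume "f \<in> {f. Ck 2 f}"
  then have f: "Ck 2 f" by simp
  have one: "phi 0 = (\<lambda>x. 1)" by (simp add: phi_0[abs_def])
  show "integrable beta (L_op f)"
    using L_op_graph[OF f] by (auto simp: number_graph_iff intro: beta.L2_integrable)
  have "ip beta (L_op f) (phi 0) = 0"
    using ip_L_op[OF f phi_L2] ip_jacobi_phi[OF f, of 0] by simp
  then show "(\<integral>x. L_op f x \<partial>beta) = 0" by (simp add: ip_def one)
qed


section \<open>The selfadjoint extension\<close>

text \<open>Multiplication of the Chebyshev coefficients by $n^2$ on the largest domain in $L^2(\beta)$ on which
  it makes sense.\<close>

definition L_selfadj :: "((real \<Rightarrow> real) \<times> (real \<Rightarrow> real)) set" where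
  "L_selfadj = {(f, g). f \<in> L2 beta \<and> g \<in> L2 beta \<and>
     (\<forall>n. ip beta g (phi n) = (real n)\<^sup>2 * ip beta f (phi n))}"

lemma L_graph_subset: "L_graph \<subseteq> L_selfadj"
proof -
  have "(f, L_op f) \<in> L_selfadj" if f: "Ck 2 f" for f
  proof -
    have "(f, number_op f) \<in> number_graph"
      using number_graph_N_op[OF f] by (intro number_op_graph) blast
    then show ?thesis using L_op_graph[OF f]
      by (simp add: L_selfadj_def number_graph_iff power2_eq_square)
  qed
  then show ?thesis by (auto simp: L_graph_def)
qed

lemma jacobi_L_selfadj: "Ck 2 f \<Longrightarrow> (f, jacobi f) \<in> L_selfadj"
  by (simp add: L_selfadj_def Ck_L2 beta.continuous_L2 continuous_jacobi ip_jacobi_phi)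

text \<open>Testing against the eigenfunctions alone already determines the adjoint.\<close>

lemma adjoint_L_graph: "adjoint_graph beta L_graph \<subseteq> L_selfadj"
proof safe
  fix g h assume gh: "(g, h) \<in> adjoint_graph beta L_graph"
  then have L2: "g \<in> L2 beta" "h \<in> L2 beta" and adj: "\<And>f k. (f, k) \<in> L_graph \<Longrightarrow> ip beta k g = ip beta f h"
    by (auto simp: adjoint_graph_def)
  have "ip beta h (phi n) = (real n)\<^sup>2 * ip beta g (phi n)" for n
  proof -
    have G: "(phi n, L_op (phi n)) \<in> L_graph" using Ck_phi by (auto simp: L_graph_def)
    with L_graph_subset have LL: "(phi n, L_op (phi n)) \<in> L_selfadj" by blast
    have ae: "AE x in beta. L_op (phi n) x = (real n)\<^sup>2 * phi n x"
      using LL by (intro cheb_coeff_unique) (auto simp: L_selfadj_def ip_cmult_left ip_phi intro: L2_cmult phi_L2)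
    have "ip beta h (phi n) = ip beta (L_op (phi n)) g" using adj[OF G] by (simp add: ip_commute)
    also have "\<dots> = ip beta (\<lambda>x. (real n)\<^sup>2 * phi n x) g"
      using ae LL L2 by (intro ip_cong_AE) (auto simp: L_selfadj_def intro: L2_D)
    finally show ?thesis by (simp add: ip_cmult_left ip_commute)
  qed
  then show "(g, h) \<in> L_selfadj" using L2 by (simp add: L_selfadj_def)
qed

lemma L_selfadj_symmetric:
  assumes fk: "(f, k) \<in> L_selfadj" and gh: "(g, h) \<in> L_selfadj"
  shows "ip beta k g = ip beta f h"
proof (rule LIMSEQ_unique)
  have L2: "f \<in> L2 beta" "k \<in> L2 beta" "g \<in> L2 beta" "h \<in> L2 beta" using fk gh by (auto simp: L_selfadj_def)
  show "(\<lambda>N. \<Sum>n<N. cheb_coeff k n * ip beta g (phi n)) \<longlonglongrightarrow> ip beta k g" by (rule Parseval[OF L2(2,3)])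
  have "cheb_coeff k n * ip beta g (phi n) = cheb_coeff f n * ip beta h (phi n)" for n
    using fk gh by (simp add: L_selfadj_def cheb_coeff_def)
  then show "(\<lambda>N. \<Sum>n<N. cheb_coeff k n * ip beta g (phi n)) \<longlonglongrightarrow> ip beta f h"
    using Parseval[OF L2(1,4)] by simp
qed

lemma adjoint_graph_antimono: "G \<subseteq> G' \<Longrightarrow> adjoint_graph M G' \<subseteq> adjoint_graph M G"
  unfolding adjoint_graph_def by blast

lemma adjoint_L_selfadj: "adjoint_graph beta L_selfadj = L_selfadj"
proof
  show "adjoint_graph beta L_selfadj \<subseteq> L_selfadj"
    using adjoint_graph_antimono[OF L_graph_subset] adjoint_L_graph by blast
  show "L_selfadj \<subseteq> adjoint_graph beta L_selfadj"
  proof (rule subrelI)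
    fix g h assume gh: "(g, h) \<in> L_selfadj"
    have "\<forall>(f, k) \<in> L_selfadj. ip beta k g = ip beta f h" using L_selfadj_symmetric[OF _ gh] by blast
    moreover have "g \<in> L2 beta" "h \<in> L2 beta" using gh by (simp_all add: L_selfadj_def)
    ultimately show "(g, h) \<in> adjoint_graph beta L_selfadj" unfolding adjoint_graph_def by blast
  qed
qed

lemma selfadjoint_L_selfadj: "selfadjoint beta L_selfadj"
  unfolding selfadjoint_def
proof (intro conjI)
  show "adjoint_graph beta L_selfadj = L_selfadj" by (rule adjoint_L_selfadj)
  show "operator_graph beta L_selfadj"
    unfolding operator_graph_def
  proof (intro conjI allI impI)
    fix f g f' g' assume fg: "(f, g) \<in> L_selfadj" "(f', g') \<in> L_selfadj" and ae: "AE x in beta. f x = f' x"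
    have "ip beta f (phi n) = ip beta f' (phi n)" for n
      using fg ae phi_measurable by (intro ip_cong_AE) (auto simp: L_selfadj_def intro: L2_D)
    then show "AE x in beta. g x = g' x"
      using fg by (intro cheb_coeff_unique) (auto simp: L_selfadj_def)
  qed (auto simp: L_selfadj_def L2_zero L2_add L2_cmult ip_zero_left ip_add_left ip_cmult_left phi_L2 distrib_left)
  show "densely_defined beta L_selfadj"
    unfolding densely_defined_def
  proof
    fix f assume "f \<in> L2 beta"
    then obtain p where p: "L2_lim beta (\<lambda>k. poly (p k)) f" using beta.polys_dense by blast
    have "poly q \<in> Domain L_selfadj" for q using jacobi_L_selfadj[OF Ck_poly] by blast
    then show "\<exists>u. (\<forall>k. u k \<in> Domain L_selfadj) \<and> L2_lim beta u f"
      using p by (intro exI[of _ "\<lambda>k. poly (p k)"]) simp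
  qed
qed

text \<open>Passing to adjoints reverses inclusions: the extension \<open>G\<close> is contained in the adjoint of
  \<open>L_graph\<close>, hence in \<open>L_selfadj\<close>, and taking adjoints once more gives the other inclusion.\<close>

lemma selfadjoint_extension_unique:
  assumes G: "selfadjoint beta G" and sub: "L_graph \<subseteq> G"
  shows "G = L_selfadj"
proof
  have adj: "adjoint_graph beta G = G" using G by (simp add: selfadjoint_def)
  show 1: "G \<subseteq> L_selfadj"
    using adjoint_graph_antimono[OF sub, of beta] adjoint_L_graph unfolding adj by blast
  show "L_selfadj \<subseteq> G"
    using adjoint_graph_antimono[OF 1, of beta] unfolding adj adjoint_L_selfadj .
qed


section \<open>The form domain\<close>

definition primitive :: "(real \<Rightarrow> real) \<Rightarrow> real \<Rightarrow> real" where
  "primitive g x = (LINT y:{-2..x}|lborel. g y)"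

lemma L2_alpha_weighted:
  assumes g: "g \<in> L2 alpha"
  shows "(\<lambda>y. sqrt (4 - y\<^sup>2) * g y) \<in> L2 beta"
    and "ip beta (\<lambda>y. sqrt (4 - y\<^sup>2) * g y) (\<lambda>y. sqrt (4 - y\<^sup>2) * g y) = 2 * ip alpha g g"
proof -
  have gm: "g \<in> borel_measurable beta" using L2_D(1)[OF g] by simp
  have wm: "(\<lambda>y. sqrt (4 - y\<^sup>2)) \<in> borel_measurable beta" by (intro beta.borel_imp_measurable) simp
  have sq: "(sqrt (4 - y\<^sup>2) * g y)\<^sup>2 = (4 - y\<^sup>2) * (g y * g y)" if "y \<in> space beta" for y
    using four_minus_sq_nonneg that by (simp add: space_beta power_mult_distrib power2_eq_square)
  have "integrable beta (\<lambda>y. (4 - y\<^sup>2) / 2 * (g y)\<^sup>2)"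
    using L2_D(2)[OF g] gm by (subst (asm) integrable_alpha_iff) auto
  then have "integrable beta (\<lambda>y. 2 * ((4 - y\<^sup>2) / 2 * (g y)\<^sup>2))" by (rule integrable_mult_right)
  then have "integrable beta (\<lambda>y. (sqrt (4 - y\<^sup>2) * g y)\<^sup>2)"
    by (rule iffD1[OF Bochner_Integration.integrable_cong[OF refl], rotated])
       (simp only: sq, simp add: power2_eq_square)
  then show "(\<lambda>y. sqrt (4 - y\<^sup>2) * g y) \<in> L2 beta" using wm gm by (simp add: L2_def)
  show "ip beta (\<lambda>y. sqrt (4 - y\<^sup>2) * g y) (\<lambda>y. sqrt (4 - y\<^sup>2) * g y) = 2 * ip alpha g g"
    unfolding ip_alpha[OF gm gm] unfolding ip_self by (intro Bochner_Integration.integral_cong refl sq)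
qed

lemma indicator_beta_L2: "(indicator {-2..x} :: real \<Rightarrow> real) \<in> L2 beta"
  by (intro beta.bounded_L2[where B = 1] beta.borel_imp_measurable) (auto simp: indicator_def)

text \<open>Lebesgue measure is $\pi\sqrt{4-y^2}\,\beta(dy)$, so a primitive is an inner product in
  $L^2(\beta)$ and depends continuously on its derivative in $L^2(\alpha)$.\<close>

lemma primitive_eq_ip:
  assumes g: "g \<in> L2 alpha" and x: "x \<in> I2"
  shows "primitive g x = pi * ip beta (indicator {-2..x}) (\<lambda>y. sqrt (4 - y\<^sup>2) * g y)"
proof -
  have gm: "g \<in> borel_measurable beta" using L2_D(1)[OF g] by simp
  let ?k = "\<lambda>y. indicator {-2..x} y * (sqrt (4 - y\<^sup>2) * g y)"
  have kint: "integrable beta ?k"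
    by (rule L2_integrable_mult[OF indicator_beta_L2 L2_alpha_weighted(1)[OF g]])
  have km: "?k \<in> borel_measurable beta" using kint by (rule borel_measurable_integrable)
  have "ip beta (indicator {-2..x}) (\<lambda>y. sqrt (4 - y\<^sup>2) * g y) = (LINT y:I2|lborel. ?k y / (pi * sqrt (4 - y\<^sup>2)))"
    unfolding ip_def by (rule integral_beta[OF km])
  also have "\<dots> = (LINT y:{-2..x}|lborel. g y / pi)"
    unfolding set_lebesgue_integral_def
  proof (rule integral_cong_AE)
    have "set_integrable lborel I2 (\<lambda>y. ?k y / (pi * sqrt (4 - y\<^sup>2)))" using kint integrable_beta_iff[OF km] by simp
    then show "(\<lambda>y. indicator I2 y *\<^sub>R (?k y / (pi * sqrt (4 - y\<^sup>2)))) \<in> borel_measurable lborel"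
      unfolding set_integrable_def by (rule borel_measurable_integrable)
    have "g \<in> borel_measurable (restrict_space borel I2)"
      using gm by (simp add: measurable_cong_sets[OF sets_beta refl])
    then have I: "(\<lambda>y. indicator I2 y *\<^sub>R g y) \<in> borel_measurable borel"
      by (subst (asm) borel_measurable_restrict_space_iff) auto
    have "(\<lambda>y. indicator {-2..x} y * (indicator I2 y *\<^sub>R g y) / pi) \<in> borel_measurable borel"
      using I by measurable
    moreover have "(\<lambda>y. indicator {-2..x} y * (indicator I2 y *\<^sub>R g y) / pi) = (\<lambda>y. indicator {-2..x} y *\<^sub>R (g y / pi))"
      using x by (auto simp: fun_eq_iff indicator_def)
    ultimately show "(\<lambda>y. indicator {-2..x} y *\<^sub>R (g y / pi)) \<in> borel_measurable lborel" by simp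
    show "AE y in lborel. indicator I2 y *\<^sub>R (?k y / (pi * sqrt (4 - y\<^sup>2))) = indicator {-2..x} y *\<^sub>R (g y / pi)"
      using AE_lborel_singleton[of "-2"] AE_lborel_singleton[of 2]
    proof eventually_elim
      case (elim y)
      show ?case
      proof (cases "y \<in> {-2..x}")
        case True
        then have "y \<in> {-2<..<2}" using elim x by auto
        from sqrt_pos[OF this] have "sqrt (4 - y\<^sup>2) \<noteq> 0" by linarith
        then show ?thesis using True x by (simp add: indicator_def)
      qed (simp add: indicator_def)
    qed
  qed
  also have "\<dots> = primitive g x / pi" by (simp add: primitive_def)
  finally show ?thesis by simp
qed

lemma primitive_diff_le:
  assumes g: "g \<in> L2 alpha" and h: "h \<in> L2 alpha" and x: "x \<in> I2"
  shows "\<bar>primitive g x - primitive h x\<bar> \<le> pi * sqrt (2 * ip alpha (\<lambda>y. g y - h y) (\<lambda>y. g y - h y))"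
proof -
  let ?s = "\<lambda>g y. sqrt (4 - y\<^sup>2) * g y"
  have d: "(\<lambda>y. g y - h y) \<in> L2 alpha" using g h by (rule L2_diff)
  note w = L2_alpha_weighted[OF d]
  have "?s (\<lambda>y. g y - h y) = (\<lambda>y. ?s g y - ?s h y)" by (simp add: right_diff_distrib)
  then have eq: "primitive g x - primitive h x = pi * ip beta (indicator {-2..x}) (?s (\<lambda>y. g y - h y))"
    unfolding primitive_eq_ip[OF g x] primitive_eq_ip[OF h x]
    by (simp only: ip_diff_right[OF L2_alpha_weighted(1)[OF g] L2_alpha_weighted(1)[OF h] indicator_beta_L2] right_diff_distrib)
  have one: "ip beta (indicator {-2..x}) (indicator {-2..x}) \<le> 1"
  proof -
    have "\<bar>\<integral>y. (indicator {-2..x} y)\<^sup>2 \<partial>beta\<bar> \<le> (1 :: real)"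
      by (intro abs_integral_beta_le beta.borel_imp_measurable) (auto simp: indicator_def)
    then show ?thesis by (simp add: ip_self)
  qed
  have "(ip beta (indicator {-2..x}) (?s (\<lambda>y. g y - h y)))\<^sup>2
      \<le> ip beta (indicator {-2..x}) (indicator {-2..x}) * ip beta (?s (\<lambda>y. g y - h y)) (?s (\<lambda>y. g y - h y))"
    by (intro Cauchy_Schwarz_ip indicator_beta_L2 w)
  also have "\<dots> \<le> 1 * (2 * ip alpha (\<lambda>y. g y - h y) (\<lambda>y. g y - h y))"
    unfolding w(2) by (intro mult_right_mono one mult_nonneg_nonneg ip_self_nonneg) simp
  finally have "\<bar>ip beta (indicator {-2..x}) (?s (\<lambda>y. g y - h y))\<bar> \<le> sqrt (2 * ip alpha (\<lambda>y. g y - h y) (\<lambda>y. g y - h y))"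
    by (intro real_le_rsqrt) simp
  then show ?thesis unfolding eq abs_mult by simp
qed

lemma primitive_poly:
  assumes x: "x \<in> I2"
  shows "primitive (poly (pderiv q)) x = poly q x - poly q (-2)"
proof -
  have "set_integrable lborel {-2..x} (poly (pderiv q))"
    by (intro borel_integrable_atLeastAtMost' continuous_intros)
  from set_borel_integral_eq_integral(2)[OF this]
  have "primitive (poly (pderiv q)) x = integral {-2..x} (poly (pderiv q))" by (simp add: primitive_def)
  also have "\<dots> = poly q x - poly q (-2)"
    using x poly_has_derivative
    by (intro integral_unique fundamental_theorem_of_calculus)
       (auto simp: has_real_derivative_iff_has_vector_derivative[symmetric])
  finally show ?thesis .
qed

lemma poly_alpha_L2: "poly p \<in> L2 alpha"
  by (rule alpha.poly_L2)

lemma primitive_lim: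
  assumes lim: "L2_lim alpha (\<lambda>k. poly (pderiv (q k))) g"
  obtains e where "e \<longlonglongrightarrow> 0" "\<And>k x. x \<in> I2 \<Longrightarrow> \<bar>(poly (q k) x - poly (q k) (-2)) - primitive g x\<bar> \<le> e k"
proof
  let ?e = "\<lambda>k. pi * sqrt (2 * ip alpha (\<lambda>y. poly (pderiv (q k)) y - g y) (\<lambda>y. poly (pderiv (q k)) y - g y))"
  have "?e \<longlonglongrightarrow> pi * sqrt (2 * 0)" by (intro tendsto_intros L2_limD(3)[OF lim])
  then show "?e \<longlonglongrightarrow> 0" by simp
  show "\<bar>(poly (q k) x - poly (q k) (-2)) - primitive g x\<bar> \<le> ?e k" if x: "x \<in> I2" for k x
    unfolding primitive_poly[OF x, symmetric]
    by (rule primitive_diff_le[OF poly_alpha_L2 L2_limD(2)[OF lim] x])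
qed

text \<open>A primitive is a uniform limit of polynomials, hence continuous.\<close>

lemma primitive_L2_lim:
  assumes lim: "L2_lim alpha (\<lambda>k. poly (pderiv (q k))) g"
  shows "L2_lim beta (\<lambda>k x. poly (q k) x - poly (q k) (-2)) (primitive g)"
proof -
  obtain e where e: "e \<longlonglongrightarrow> 0" "\<And>k x. x \<in> I2 \<Longrightarrow> \<bar>(poly (q k) x - poly (q k) (-2)) - primitive g x\<bar> \<le> e k"
    using primitive_lim[OF lim] by blast
  have "continuous_on I2 (primitive g)"
  proof (rule uniform_limit_theorem[where F = sequentially and f = "\<lambda>k x. poly (q k) x - poly (q k) (-2)"])
    show "uniform_limit I2 (\<lambda>k x. poly (q k) x - poly (q k) (-2)) (primitive g) sequentially"
    proof (rule uniform_limitI)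
      fix d :: real assume "0 < d"
      show "\<forall>\<^sub>F k in sequentially. \<forall>x\<in>I2. dist (poly (q k) x - poly (q k) (-2)) (primitive g x) < d"
        using order_tendstoD(2)[OF e(1) \<open>0 < d\<close>]
        by eventually_elim (auto simp: dist_real_def intro: le_less_trans[OF e(2)])
    qed
  qed (auto intro!: always_eventually continuous_intros)
  then have P: "primitive g \<in> L2 beta" by (rule beta.continuous_L2)
  have "(\<lambda>x. poly (q k) x - poly (q k) (-2)) \<in> L2 beta" for k
    by (intro beta.continuous_L2 continuous_intros)
  from beta.L2_lim_uniform[OF this P e(1)] show ?thesis by (simp add: space_beta e(2))
qed

lemma L2_lim_cong_AE:
  assumes lim: "L2_lim M u f" and g: "g \<in> L2 M" and ae: "AE x in M. f x = g x"
  shows "L2_lim M u g"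
proof (rule L2_limI[OF L2_limD(1)[OF lim] g])
  have "ip M (\<lambda>x. u k x - g x) (\<lambda>x. u k x - g x) = ip M (\<lambda>x. u k x - f x) (\<lambda>x. u k x - f x)" for k
  proof (rule ip_cong_AE)
    show "(\<lambda>x. u k x - f x) \<in> borel_measurable M" "(\<lambda>x. u k x - g x) \<in> borel_measurable M"
      using L2_diff[OF L2_limD(1)[OF lim, of k] L2_limD(2)[OF lim]] L2_diff[OF L2_limD(1)[OF lim, of k] g]
      by (auto dest: L2_D)
    then show "(\<lambda>x. u k x - f x) \<in> borel_measurable M" "(\<lambda>x. u k x - g x) \<in> borel_measurable M" .
    show "AE x in M. u k x - g x = u k x - f x" using ae by eventually_elim simp
    then show "AE x in M. u k x - g x = u k x - f x" .
  qed
  then show "(\<lambda>k. ip M (\<lambda>x. u k x - g x) (\<lambda>x. u k x - g x)) \<longlonglongrightarrow> 0"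
    using L2_limD(3)[OF lim] by simp
qed

lemma ip_jacobi_poly:
  "ip beta (jacobi (poly q)) (poly w) = 2 * ip alpha (poly (pderiv q)) (poly (pderiv w))"
proof -
  have "(\<integral>x. dI (poly q) x * dI (poly w) x \<partial>alpha) = ip alpha (poly (pderiv q)) (poly (pderiv w))"
    unfolding ip_def by (intro Bochner_Integration.integral_cong) (simp_all add: space_alpha dI_poly)
  then show ?thesis using ip_jacobi[OF Ck_poly Ck_poly, of q w] by simp
qed

text \<open>Approximate the weak derivative in $L^2(\alpha)$ by polynomials and integrate them, with the value \<open>c\<close>
  at $-2$. The primitives converge to \<open>f\<close>, and on polynomials the form is twice the squared
  $L^2(\alpha)$ norm of the derivative, so it is Cauchy along the sequence.\<close>

lemma form_domain_superset:
  assumes H: "(\<lambda>x. f x - c) \<in> H_space"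
  shows "f \<in> form_domain beta L_selfadj"
proof -
  obtain g where g: "g \<in> L2 alpha" and ae: "AE x in beta. f x - c = primitive g x" and fc: "(\<lambda>x. f x - c) \<in> L2 beta"
    using H by (auto simp: H_space_def primitive_def)
  have const: "(\<lambda>x. c) \<in> L2 beta" by (rule beta.continuous_L2) simp
  have f: "f \<in> L2 beta" using L2_add[OF fc const] by simp
  obtain p where p: "L2_lim alpha (\<lambda>k. poly (p k)) g" using alpha.polys_dense[OF g] by blast
  have "\<forall>k. \<exists>q. pderiv q = p k \<and> poly q (-2) = c"
  proof
    fix k
    obtain q where q: "pderiv q = p k" using poly_antiderivative by blast
    show "\<exists>q. pderiv q = p k \<and> poly q (-2) = c"
      by (intro exI[of _ "q + [:c - poly q (-2):]"]) (simp add: q pderiv_add pderiv_pCons)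
  qed
  from choice[OF this] obtain q where q: "\<And>k. pderiv (q k) = p k" "\<And>k. poly (q k) (-2) = c" by blast
  have "L2_lim beta (\<lambda>k x. poly (q k) x - poly (q k) (-2)) (primitive g)"
    by (rule primitive_L2_lim) (simp add: q p)
  from L2_lim_add[OF this L2_lim_const[OF const]]
  have "L2_lim beta (\<lambda>k. poly (q k)) (\<lambda>x. primitive g x + c)" by (simp add: q)
  then have lim: "L2_lim beta (\<lambda>k. poly (q k)) f"
    by (rule L2_lim_cong_AE[OF _ f]) (use ae in \<open>eventually_elim, simp\<close>)
  have "\<exists>K. \<forall>k\<ge>K. \<forall>l\<ge>K. \<bar>ip beta (\<lambda>x. jacobi (poly (q k)) x - jacobi (poly (q l)) x) (\<lambda>x. poly (q k) x - poly (q l) x)\<bar> < e"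
    if "0 < e" for e
  proof -
    have J: "jacobi (poly q) \<in> L2 beta" for q by (intro beta.continuous_L2 continuous_jacobi Ck_poly)
    have eq: "ip beta (\<lambda>x. jacobi (poly (q k)) x - jacobi (poly (q l)) x) (\<lambda>x. poly (q k) x - poly (q l) x)
        = 2 * ip alpha (\<lambda>x. poly (p k) x - poly (p l) x) (\<lambda>x. poly (p k) x - poly (p l) x)" for k l
    proof -
      have dL: "(\<lambda>x. poly (p k) x - poly (p l) x) \<in> L2 alpha" by (intro L2_diff poly_alpha_L2)
      have "ip beta (\<lambda>x. jacobi (poly (q k)) x - jacobi (poly (q l)) x) (\<lambda>x. poly (q k) x - poly (q l) x)
          = ip beta (\<lambda>x. jacobi (poly (q k)) x - jacobi (poly (q l)) x) (poly (q k - q l))"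
        by (simp add: poly_diff[abs_def])
      also have "\<dots> = ip beta (jacobi (poly (q k))) (poly (q k - q l)) - ip beta (jacobi (poly (q l))) (poly (q k - q l))"
        by (rule ip_diff_left[OF J J beta.poly_L2])
      also have "\<dots> = 2 * ip alpha (poly (p k)) (poly (p k - p l)) - 2 * ip alpha (poly (p l)) (poly (p k - p l))"
        by (simp only: ip_jacobi_poly pderiv_diff q)
      also have "\<dots> = 2 * ip alpha (\<lambda>x. poly (p k) x - poly (p l) x) (\<lambda>x. poly (p k) x - poly (p l) x)"
        by (simp add: poly_diff[abs_def] ip_diff_left[OF poly_alpha_L2 poly_alpha_L2 dL])
      finally show ?thesis .
    qed
    obtain K where K: "\<And>k l. k \<ge> K \<Longrightarrow> l \<ge> K \<Longrightarrow>
        ip alpha (\<lambda>x. poly (p k) x - poly (p l) x) (\<lambda>x. poly (p k) x - poly (p l) x) < e / 2"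
      using L2_lim_Cauchy[OF p, of "e/2"] \<open>0 < e\<close> by auto
    have "\<bar>2 * ip alpha (\<lambda>x. poly (p k) x - poly (p l) x) (\<lambda>x. poly (p k) x - poly (p l) x)\<bar> < e"
      if "k \<ge> K" "l \<ge> K" for k l
      using K[OF that] ip_self_nonneg[of alpha "\<lambda>x. poly (p k) x - poly (p l) x"] by linarith
    then show ?thesis unfolding eq by blast
  qed
  with lim jacobi_L_selfadj[OF Ck_poly] show ?thesis
    unfolding form_domain_def mem_Collect_eq
    by (intro exI[of _ "\<lambda>k. poly (q k)"] exI[of _ "\<lambda>k. jacobi (poly (q k))"]) simp
qed

lemma ip_alpha_psi: "real n * (real m * ip alpha (psi n) (psi m)) = (if n = m then (real n)\<^sup>2 / 4 else 0)"
proof -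
  have pm: "psi n \<in> borel_measurable beta" for n by (intro beta.continuous_measurable continuous_psi)
  have eq: "2 * ip alpha (psi n) (psi m) = (\<integral>x. (4 - x\<^sup>2) * psi n x * psi m x \<partial>beta)"
    by (simp add: ip_alpha[OF pm pm] mult.assoc)
  show ?thesis
  proof (cases "real n + real m = 0")
    case False
    have "(real n + real m) * (2 * ip alpha (psi n) (psi m)) = 2 * real n * ip beta (phi n) (phi m)"
      unfolding eq by (rule integral_psi_psi)
    then have "ip alpha (psi n) (psi m) = real n * ip beta (phi n) (phi m) / (real n + real m)"
      using False by (simp add: field_simps)
    then show ?thesis by (simp add: ip_phi power2_eq_square)
  next
    case True
    then have "real n = 0" "real m = 0" by simp_all
    then show ?thesis by simp
  qed
qed

definition cheb_poly :: "(real \<Rightarrow> real) \<Rightarrow> nat \<Rightarrow> real poly" where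
  "cheb_poly f k = (\<Sum>n<k. smult (cheb_coeff f n) (phi_poly n))"

lemma poly_cheb_poly: "poly (cheb_poly f k) = cheb_sum f k"
  by (simp add: cheb_poly_def cheb_sum_def fun_eq_iff poly_sum poly_phi)

lemma ip_deriv_cheb_sum:
  assumes "k \<le> l"
  shows "ip alpha (\<lambda>x. poly (pderiv (cheb_poly f l)) x - poly (pderiv (cheb_poly f k)) x)
      (\<lambda>x. poly (pderiv (cheb_poly f l)) x - poly (pderiv (cheb_poly f k)) x)
    = (\<Sum>n=k..<l. (real n * ip beta f (phi n))\<^sup>2)"
proof -
  let ?a = "\<lambda>n x. (cheb_coeff f n * real n) * psi n x"
  have "poly (pderiv (cheb_poly f k)) x = (\<Sum>n<k. ?a n x)" for k x
    by (simp add: cheb_poly_def pderiv_sum poly_sum pderiv_smult pderiv_phi mult.assoc)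
  then have D: "poly (pderiv (cheb_poly f l)) x - poly (pderiv (cheb_poly f k)) x = (\<Sum>n=k..<l. ?a n x)" for x
    using sum_diff_nat_ivl[of 0 k l "\<lambda>n. ?a n x"] assms by (simp add: atLeast0LessThan)
  have psiL: "psi n \<in> L2 alpha" for n by (intro alpha.continuous_L2 continuous_psi)
  have aL: "?a n \<in> L2 alpha" for n by (intro L2_cmult psiL)
  have ip_terms: "ip alpha (?a n) (?a m) = (if n = m then (real n * ip beta f (phi n))\<^sup>2 else 0)" for n m
  proof -
    have "ip alpha (?a n) (?a m) = cheb_coeff f n * cheb_coeff f m * (real n * (real m * ip alpha (psi n) (psi m)))"
      by (simp only: ip_cmult_left ip_cmult_right) (simp only: mult_ac)
    then show ?thesis unfolding ip_alpha_psi by (simp add: cheb_coeff_def power2_eq_square)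
  qed
  have "ip alpha (\<lambda>x. \<Sum>n=k..<l. ?a n x) (\<lambda>x. \<Sum>n=k..<l. ?a n x) = (\<Sum>n=k..<l. \<Sum>m=k..<l. ip alpha (?a n) (?a m))"
    by (subst ip_sum_left[OF aL L2_sum[OF aL]], rule sum.cong[OF refl], subst ip_sum_right[OF aL aL], rule refl)
  also have "\<dots> = (\<Sum>n=k..<l. (real n * ip beta f (phi n))\<^sup>2)"
    unfolding ip_terms by (intro sum.cong refl) (simp add: sum.delta)
  finally show ?thesis unfolding D .
qed

text \<open>By Parseval, $\langle v,u\rangle$ is the sum of these terms with weight 1 for $n=0$ and 2 otherwise.\<close>

lemma energy_partial_sum_le:
  assumes uv: "(u, v) \<in> L_selfadj"
  shows "(\<Sum>n<N. (real n * ip beta u (phi n))\<^sup>2) \<le> ip beta v u"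
proof -
  have L2: "u \<in> L2 beta" "v \<in> L2 beta" using uv by (auto simp: L_selfadj_def)
  have coeff: "cheb_coeff v n * ip beta u (phi n) = (if n = 0 then 1 else 2) * (real n * ip beta u (phi n))\<^sup>2" for n
    using uv by (simp add: L_selfadj_def cheb_coeff_def power2_eq_square)
  have "(\<Sum>n<N. (real n * ip beta u (phi n))\<^sup>2) \<le> (\<Sum>n<N. cheb_coeff v n * ip beta u (phi n))"
    unfolding coeff by (intro sum_mono) (simp add: mult_le_cancel_right1)
  also have "\<dots> \<le> ip beta v u"
  proof (rule incseq_le[OF _ Parseval[OF L2(2,1)]])
    show "incseq (\<lambda>k. \<Sum>n<k. cheb_coeff v n * ip beta u (phi n))"
      unfolding coeff by (intro incseq_SucI) simp
  qed
  finally show ?thesis .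
qed

lemma L_selfadj_diff:
  "(f, g) \<in> L_selfadj \<Longrightarrow> (f', g') \<in> L_selfadj \<Longrightarrow> ((\<lambda>x. f x - f' x), (\<lambda>x. g x - g' x)) \<in> L_selfadj"
  by (auto simp: L_selfadj_def L2_diff ip_diff_left phi_L2 right_diff_distrib)

text \<open>If \<open>f\<close> is in the form domain then $\sum_n n^2\langle f,\phi_n\rangle^2$ converges, so the derivatives
  of the partial Chebyshev sums converge in $L^2(\alpha)$, and \<open>f\<close> is a primitive of their limit up
  to a constant.\<close>

lemma form_domain_subset:
  assumes f: "f \<in> form_domain beta L_selfadj"
  shows "\<exists>c. (\<lambda>x. f x - c) \<in> H_space"
proof -
  obtain u v where uv: "\<And>k. (u k, v k) \<in> L_selfadj" and lim: "L2_lim beta u f"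
    and C: "\<And>e. e > 0 \<Longrightarrow> \<exists>K. \<forall>k\<ge>K. \<forall>l\<ge>K. \<bar>ip beta (\<lambda>x. v k x - v l x) (\<lambda>x. u k x - u l x)\<bar> < e"
    using f by (auto simp: form_domain_def)
  have fL: "f \<in> L2 beta" and uL: "u k \<in> L2 beta" for k using lim by (auto intro: L2_limD)
  let ?t = "\<lambda>f n. (real n * ip beta f (phi n))\<^sup>2"
  obtain K where K: "\<And>l. l \<ge> K \<Longrightarrow> \<bar>ip beta (\<lambda>x. v K x - v l x) (\<lambda>x. u K x - u l x)\<bar> < 1"
    using C[of 1] by auto
  \<comment> \<open>Compare \<open>f\<close> with the single element \<open>u K\<close>; the form of the difference is at most 1 in the limit.\<close>
  have bound: "(\<Sum>n<N. ?t f n) \<le> 2 + 2 * ip beta (v K) (u K)" for N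
  proof -
    have "(\<Sum>n<N. ?t (\<lambda>x. u K x - f x) n) \<le> 1"
    proof (rule LIMSEQ_le_const2)
      show "(\<lambda>l. \<Sum>n<N. ?t (\<lambda>x. u K x - u l x) n) \<longlonglongrightarrow> (\<Sum>n<N. ?t (\<lambda>x. u K x - f x) n)"
        by (intro tendsto_intros L2_lim_ip_const[OF L2_lim_diff[OF L2_lim_const[OF uL] lim] phi_L2])
      have "(\<Sum>n<N. ?t (\<lambda>x. u K x - u l x) n) \<le> 1" if "l \<ge> K" for l
        using energy_partial_sum_le[OF L_selfadj_diff[OF uv uv], of K l N] K[OF that] by linarith
      then show "\<exists>M. \<forall>l\<ge>M. (\<Sum>n<N. ?t (\<lambda>x. u K x - u l x) n) \<le> 1" by blast
    qed
    moreover have "?t f n \<le> 2 * ?t (\<lambda>x. u K x - f x) n + 2 * ?t (u K) n" for n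
    proof -
      have "a\<^sup>2 \<le> 2 * (b - a)\<^sup>2 + 2 * b\<^sup>2" for a b :: real
        using zero_le_power2[of "2 * b - a"] by (simp add: power2_eq_square algebra_simps)
      then show ?thesis by (simp add: ip_diff_left uL fL phi_L2 right_diff_distrib)
    qed
    then have "(\<Sum>n<N. ?t f n) \<le> (\<Sum>n<N. 2 * ?t (\<lambda>x. u K x - f x) n + 2 * ?t (u K) n)" by (intro sum_mono)
    ultimately show ?thesis
      using energy_partial_sum_le[OF uv, of K N] by (simp add: sum.distrib sum_distrib_left[symmetric])
  qed
  have "summable (?t f)"
    by (rule bounded_imp_summable[where B = "2 + 2 * ip beta (v K) (u K)"])
       (use bound[of "Suc _"] in \<open>simp_all add: lessThan_Suc_atMost\<close>)
  let ?D = "\<lambda>k. poly (pderiv (cheb_poly f k))"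
  have "\<exists>g. L2_lim alpha ?D g"
  proof (rule alpha.L2_complete[OF poly_alpha_L2])
    fix e :: real assume "0 < e"
    then obtain N where N: "\<And>m n. m \<ge> N \<Longrightarrow> norm (sum (?t f) {m..<n}) < e"
      using \<open>summable (?t f)\<close> unfolding summable_Cauchy by blast
    have sym: "ip alpha (\<lambda>x. ?D k x - ?D l x) (\<lambda>x. ?D k x - ?D l x) = ip alpha (\<lambda>x. ?D l x - ?D k x) (\<lambda>x. ?D l x - ?D k x)" for k l
      unfolding ip_self by (simp only: power2_commute)
    have "ip alpha (\<lambda>x. ?D k x - ?D l x) (\<lambda>x. ?D k x - ?D l x) < e" if "k \<ge> N" "l \<ge> N" for k l
    proof (cases "k \<le> l")
      case True
      show ?thesis unfolding sym[of k l] ip_deriv_cheb_sum[OF True] using N[OF that(1), of l] by simp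
    next
      case False
      then have "l \<le> k" by simp
      show ?thesis unfolding ip_deriv_cheb_sum[OF \<open>l \<le> k\<close>] using N[OF that(2), of k] by simp
    qed
    then show "\<exists>K. \<forall>k\<ge>K. \<forall>l\<ge>K. ip alpha (\<lambda>x. ?D k x - ?D l x) (\<lambda>x. ?D k x - ?D l x) < e" by blast
  qed
  then obtain g where g: "L2_lim alpha ?D g" by blast
  have 1: "L2_lim beta (\<lambda>k. poly (cheb_poly f k)) f"
    unfolding poly_cheb_poly using cheb_sum_lim[OF fL] .
  have const: "(\<lambda>x. c) \<in> L2 beta" for c by (rule beta.continuous_L2) simp
  \<comment> \<open>The constants of integration converge because everything else does.\<close>
  define \<kappa> where "\<kappa> k = poly (cheb_poly f k) (-2)" for k
  from L2_lim_diff[OF 1 primitive_L2_lim[OF g]]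
  have 2: "L2_lim beta (\<lambda>k x. \<kappa> k) (\<lambda>x. f x - primitive g x)" by (simp add: \<kappa>_def)
  define c where "c = ip beta (\<lambda>x. f x - primitive g x) (\<lambda>x. 1)"
  have "\<kappa> \<longlonglongrightarrow> c"
    using L2_lim_ip_const[OF 2 const[of 1]] by (simp add: c_def ip_def space_beta)
  then have "(\<lambda>k. \<bar>\<kappa> k - c\<bar>) \<longlonglongrightarrow> 0" by (simp add: LIM_zero tendsto_rabs_zero)
  then have 3: "L2_lim beta (\<lambda>k x. \<kappa> k) (\<lambda>x. c)"
    by (rule beta.L2_lim_uniform[OF const const]) simp
  have "AE x in beta. f x - primitive g x = c" by (rule L2_lim_unique[OF 2 3])
  then have "AE x in beta. f x - c = (LINT y:{-2..x}|lborel. g y)"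
    unfolding primitive_def by eventually_elim simp
  moreover have "(\<lambda>x. f x - c) \<in> L2 beta" by (intro L2_diff fL const)
  ultimately show ?thesis using L2_limD(2)[OF g] by (auto simp: H_space_def)
qed

lemma form_domain_L_selfadj: "form_domain beta L_selfadj = {f. \<exists>c. (\<lambda>x. f x - c) \<in> H_space}"
  using form_domain_subset form_domain_superset by blast


section \<open>Jordan decomposition of finite signed measures\<close>

lemma signed_measure_empty:
  assumes "signed_measure M \<nu>" shows "\<nu> {} = 0"
proof -
  have "(\<lambda>i::nat. \<nu> {}) sums \<nu> (\<Union>i::nat. {})"
    using assms[unfolded signed_measure_def, rule_format, of "\<lambda>_. {}"] by (auto simp: disjoint_family_on_def)
  then have "summable (\<lambda>i::nat. \<nu> {})" by (rule sums_summable)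
  then show ?thesis by (simp add: summable_const_iff)
qed

lemma total_variation_upper:
  assumes "finite F" "F \<subseteq> sets M" "disjoint F" "\<Union>F \<subseteq> A"
  shows "ennreal (\<Sum>B\<in>F. \<bar>\<nu> B\<bar>) \<le> total_variation M \<nu> A"
  unfolding total_variation_def using assms by (intro SUP_upper) auto

lemma total_variation_least:
  assumes "\<And>F. finite F \<Longrightarrow> F \<subseteq> sets M \<Longrightarrow> disjoint F \<Longrightarrow> \<Union>F \<subseteq> A \<Longrightarrow> ennreal (\<Sum>B\<in>F. \<bar>\<nu> B\<bar>) \<le> c"
  shows "total_variation M \<nu> A \<le> c"
  unfolding total_variation_def using assms by (intro SUP_least) auto

lemma total_variation_mono: "A \<subseteq> B \<Longrightarrow> total_variation M \<nu> A \<le> total_variation M \<nu> B"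
  by (rule total_variation_least) (rule total_variation_upper, auto)

lemma abs_le_total_variation: "A \<in> sets M \<Longrightarrow> ennreal \<bar>\<nu> A\<bar> \<le> total_variation M \<nu> A"
  using total_variation_upper[of "{A}" M A \<nu>] by simp

text \<open>Partitions of two disjoint sets combine to one of the union; only the empty set can occur in both.\<close>

lemma total_variation_superadditive:
  assumes \<nu>: "\<nu> {} = 0" and disj: "A \<inter> B = {}"
  shows "total_variation M \<nu> A + total_variation M \<nu> B \<le> total_variation M \<nu> (A \<union> B)"
proof -
  let ?S = "\<lambda>A. {F. finite F \<and> F \<subseteq> sets M \<and> disjoint F \<and> \<Union>F \<subseteq> A}"
  have ne: "?S A \<noteq> {}" for A by (auto intro!: exI[of _ "{}"])
  have FG: "ennreal (\<Sum>B\<in>F. \<bar>\<nu> B\<bar>) + ennreal (\<Sum>B\<in>G. \<bar>\<nu> B\<bar>) \<le> total_variation M \<nu> (A \<union> B)"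
    if F: "F \<in> ?S A" and G: "G \<in> ?S B" for F G
  proof -
    have "F \<inter> G \<subseteq> {{}}" using F G disj by blast
    then have "(\<Sum>B\<in>F \<inter> G. \<bar>\<nu> B\<bar>) = 0" using \<nu> by (intro sum.neutral) auto
    then have "(\<Sum>B\<in>F \<union> G. \<bar>\<nu> B\<bar>) = (\<Sum>B\<in>F. \<bar>\<nu> B\<bar>) + (\<Sum>B\<in>G. \<bar>\<nu> B\<bar>)"
      using sum.union_inter[of F G "\<lambda>B. \<bar>\<nu> B\<bar>"] F G by simp
    moreover have "ennreal (\<Sum>B\<in>F \<union> G. \<bar>\<nu> B\<bar>) \<le> total_variation M \<nu> (A \<union> B)"
    proof (rule total_variation_upper)
      show "disjoint (F \<union> G)"
      proof (rule disjointI)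
        fix a b assume ab: "a \<in> F \<union> G" "b \<in> F \<union> G" "a \<noteq> b"
        show "a \<inter> b = {}"
        proof (cases "(a \<in> F \<and> b \<in> F) \<or> (a \<in> G \<and> b \<in> G)")
          case True
          then show ?thesis using F G ab(3) by (auto dest: disjointD)
        next
          case False
          then show ?thesis using F G ab disj by blast
        qed
      qed
    qed (use F G in auto)
    ultimately show ?thesis by (simp add: ennreal_plus sum_nonneg)
  qed
  have "total_variation M \<nu> A + total_variation M \<nu> B
      = (SUP F\<in>?S A. ennreal (\<Sum>B\<in>F. \<bar>\<nu> B\<bar>) + total_variation M \<nu> B)"
    unfolding total_variation_def[of M \<nu> A] by (rule ennreal_SUP_add_left[symmetric]) (rule ne)
  also have "\<dots> \<le> total_variation M \<nu> (A \<union> B)"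
  proof (rule SUP_least)
    fix F assume F: "F \<in> ?S A"
    have "ennreal (\<Sum>B\<in>F. \<bar>\<nu> B\<bar>) + total_variation M \<nu> B
        = (SUP G\<in>?S B. ennreal (\<Sum>B\<in>F. \<bar>\<nu> B\<bar>) + ennreal (\<Sum>B\<in>G. \<bar>\<nu> B\<bar>))"
      unfolding total_variation_def[of M \<nu> B] add.commute[of "ennreal (\<Sum>B\<in>F. \<bar>\<nu> B\<bar>)"]
      by (rule ennreal_SUP_add_left[symmetric]) (rule ne)
    also have "\<dots> \<le> total_variation M \<nu> (A \<union> B)" by (rule SUP_least) (rule FG[OF F])
    finally show "ennreal (\<Sum>B\<in>F. \<bar>\<nu> B\<bar>) + total_variation M \<nu> B \<le> total_variation M \<nu> (A \<union> B)" .
  qed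
  finally show ?thesis .
qed

text \<open>A partition of the union is refined by intersecting it with the \<open>A i\<close>.\<close>

lemma total_variation_subadditive:
  fixes A :: "nat \<Rightarrow> 'a set"
  assumes \<nu>: "signed_measure M \<nu>" and A: "range A \<subseteq> sets M" "disjoint_family A"
  shows "total_variation M \<nu> (\<Union>i. A i) \<le> (\<Sum>i. total_variation M \<nu> (A i))"
proof (rule total_variation_least)
  fix F assume F: "finite F" "F \<subseteq> sets M" "disjoint F" "\<Union>F \<subseteq> (\<Union>i. A i)"
  have e: "\<nu> {} = 0" using signed_measure_empty[OF \<nu>] .
  have 1: "ennreal \<bar>\<nu> B\<bar> \<le> (\<Sum>i. ennreal \<bar>\<nu> (B \<inter> A i)\<bar>)" if "B \<in> F" for B
  proof -
    have "(\<lambda>i. \<nu> (B \<inter> A i)) sums \<nu> (\<Union>i. B \<inter> A i)"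
    proof (rule \<nu>[unfolded signed_measure_def, rule_format])
      show "range (\<lambda>i. B \<inter> A i) \<subseteq> sets M" using A(1) F(2) that by auto
      show "disjoint_family (\<lambda>i. B \<inter> A i)" using A(2) by (auto simp: disjoint_family_on_def)
    qed
    moreover have "(\<Union>i. B \<inter> A i) = B" using F(4) that by auto
    ultimately have "(\<lambda>n. \<Sum>i<n. \<nu> (B \<inter> A i)) \<longlonglongrightarrow> \<nu> B" by (simp add: sums_def)
    then have lim: "(\<lambda>n. ennreal \<bar>\<Sum>i<n. \<nu> (B \<inter> A i)\<bar>) \<longlonglongrightarrow> ennreal \<bar>\<nu> B\<bar>"
      by (intro tendsto_ennrealI tendsto_rabs)
    show ?thesis
    proof (rule LIMSEQ_le_const2[OF lim], intro exI allI impI)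
      fix n :: nat
      have "ennreal \<bar>\<Sum>i<n. \<nu> (B \<inter> A i)\<bar> \<le> ennreal (\<Sum>i<n. \<bar>\<nu> (B \<inter> A i)\<bar>)"
        by (intro ennreal_leI sum_abs)
      also have "\<dots> = (\<Sum>i<n. ennreal \<bar>\<nu> (B \<inter> A i)\<bar>)" by (simp add: sum_ennreal)
      also have "\<dots> \<le> (\<Sum>i. ennreal \<bar>\<nu> (B \<inter> A i)\<bar>)" by (intro sum_le_suminf) auto
      finally show "ennreal \<bar>\<Sum>i<n. \<nu> (B \<inter> A i)\<bar> \<le> (\<Sum>i. ennreal \<bar>\<nu> (B \<inter> A i)\<bar>)" .
    qed
  qed
  have 2: "(\<Sum>B\<in>F. ennreal \<bar>\<nu> (B \<inter> A i)\<bar>) \<le> total_variation M \<nu> (A i)" for i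
  proof -
    let ?F = "(\<lambda>B. B \<inter> A i) ` F"
    have "(\<Sum>B\<in>?F. \<bar>\<nu> B\<bar>) = (\<Sum>B\<in>F. \<bar>\<nu> (B \<inter> A i)\<bar>)"
    proof (rule sum.reindex_nontrivial[OF F(1), unfolded o_def])
      fix B C assume BC: "B \<in> F" "C \<in> F" "B \<noteq> C" "B \<inter> A i = C \<inter> A i"
      have "B \<inter> C = {}" using F(3) BC(1-3) by (rule disjointD)
      then have "B \<inter> A i = {}" using BC(4) by blast
      then show "\<bar>\<nu> (B \<inter> A i)\<bar> = 0" using e by simp
    qed
    moreover have "ennreal (\<Sum>B\<in>?F. \<bar>\<nu> B\<bar>) \<le> total_variation M \<nu> (A i)"
    proof (rule total_variation_upper)
      show "?F \<subseteq> sets M" using F(2) A(1) by auto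
      show "disjoint ?F"
      proof (rule disjointI)
        fix a b assume "a \<in> ?F" "b \<in> ?F" "a \<noteq> b"
        then obtain B C where "B \<in> F" "C \<in> F" "B \<noteq> C" "a = B \<inter> A i" "b = C \<inter> A i" by auto
        then show "a \<inter> b = {}" using disjointD[OF F(3), of B C] by blast
      qed
    qed (use F in auto)
    ultimately show ?thesis by (simp add: sum_ennreal)
  qed
  have "ennreal (\<Sum>B\<in>F. \<bar>\<nu> B\<bar>) = (\<Sum>B\<in>F. ennreal \<bar>\<nu> B\<bar>)" by (simp add: sum_ennreal)
  also have "\<dots> \<le> (\<Sum>B\<in>F. \<Sum>i. ennreal \<bar>\<nu> (B \<inter> A i)\<bar>)" by (intro sum_mono 1)
  also have "\<dots> = (\<Sum>i. \<Sum>B\<in>F. ennreal \<bar>\<nu> (B \<inter> A i)\<bar>)" by (rule suminf_sum[symmetric]) simp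
  also have "\<dots> \<le> (\<Sum>i. total_variation M \<nu> (A i))" by (intro suminf_le 2) auto
  finally show "ennreal (\<Sum>B\<in>F. \<bar>\<nu> B\<bar>) \<le> (\<Sum>i. total_variation M \<nu> (A i))" .
qed

lemma total_variation_countably_additive:
  fixes A :: "nat \<Rightarrow> 'a set"
  assumes \<nu>: "signed_measure M \<nu>" and A: "range A \<subseteq> sets M" "disjoint_family A"
  shows "total_variation M \<nu> (\<Union>i. A i) = (\<Sum>i. total_variation M \<nu> (A i))"
proof (rule antisym[OF total_variation_subadditive[OF assms]])
  have e: "\<nu> {} = 0" using signed_measure_empty[OF \<nu>] .
  have fin: "(\<Sum>i<n. total_variation M \<nu> (A i)) \<le> total_variation M \<nu> (\<Union>i<n. A i)" for n
  proof (induction n)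
    case (Suc n)
    have "A i \<inter> A n = {}" if "i < n" for i using A(2) that by (simp add: disjoint_family_on_def)
    then have "(\<Union>i<n. A i) \<inter> A n = {}" by blast
    from order_trans[OF add_right_mono[OF Suc] total_variation_superadditive[of \<nu> "\<Union>i<n. A i" "A n" M, OF e this]]
    have "(\<Sum>i<n. total_variation M \<nu> (A i)) + total_variation M \<nu> (A n) \<le> total_variation M \<nu> ((\<Union>i<n. A i) \<union> A n)" .
    also have "(\<Union>i<n. A i) \<union> A n = (\<Union>i<Suc n. A i)" by (auto simp: less_Suc_eq)
    finally show ?case by simp
  qed simp
  show "(\<Sum>i. total_variation M \<nu> (A i)) \<le> total_variation M \<nu> (\<Union>i. A i)"
  proof (rule suminf_le_const)
    show "(\<Sum>i<n. total_variation M \<nu> (A i)) \<le> total_variation M \<nu> (\<Union>i. A i)" for n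
      by (rule order_trans[OF fin total_variation_mono]) blast
  qed simp
qed

lemma signed_measure_uminus: "signed_measure M \<nu> \<Longrightarrow> signed_measure M (\<lambda>A. - \<nu> A)"
  by (simp add: signed_measure_def sums_minus)

lemma total_variation_uminus: "total_variation M (\<lambda>A. - \<nu> A) = total_variation M \<nu>"
  by (simp add: total_variation_def fun_eq_iff)

lemma finite_signed_measure_uminus: "finite_signed_measure M \<nu> \<Longrightarrow> finite_signed_measure M (\<lambda>A. - \<nu> A)"
  by (simp add: finite_signed_measure_def signed_measure_uminus total_variation_uminus)

lemma neg_variation_eq: "neg_variation M \<nu> = pos_variation M (\<lambda>A. - \<nu> A)"
  by (simp add: neg_variation_def pos_variation_def total_variation_uminus)

lemma total_variation_finite:
  assumes "finite_signed_measure M \<nu>" "A \<in> sets M"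
  shows "total_variation M \<nu> A = ennreal (enn2real (total_variation M \<nu> A))"
    and "\<bar>\<nu> A\<bar> \<le> enn2real (total_variation M \<nu> A)"
proof -
  have "total_variation M \<nu> A \<le> total_variation M \<nu> (space M)"
    using sets.sets_into_space[OF assms(2)] by (rule total_variation_mono)
  then have lt: "total_variation M \<nu> A < \<infinity>"
    using assms(1) by (auto simp: finite_signed_measure_def intro: le_less_trans)
  then show eq: "total_variation M \<nu> A = ennreal (enn2real (total_variation M \<nu> A))"
    by (simp add: less_top)
  have "ennreal \<bar>\<nu> A\<bar> \<le> ennreal (enn2real (total_variation M \<nu> A))"
    using abs_le_total_variation[OF assms(2), of \<nu>] eq by simp
  then show "\<bar>\<nu> A\<bar> \<le> enn2real (total_variation M \<nu> A)" by (simp add: ennreal_le_iff)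
qed

lemma sets_pos_variation: "sets (pos_variation M \<nu>) = sets M"
  unfolding pos_variation_def using sets.space_closed by (simp add: sets_measure_of)

lemma emeasure_pos_variation:
  assumes \<nu>: "finite_signed_measure M \<nu>" and A: "A \<in> sets M"
  shows "emeasure (pos_variation M \<nu>) A = ennreal ((enn2real (total_variation M \<nu> A) + \<nu> A) / 2)"
proof (rule emeasure_measure_of[OF pos_variation_def sets.space_closed])
  let ?T = "\<lambda>A. enn2real (total_variation M \<nu> A)"
  have sm: "signed_measure M \<nu>" using \<nu> by (simp add: finite_signed_measure_def)
  have e: "\<nu> {} = 0" using signed_measure_empty[OF sm] .
  have "total_variation M \<nu> {} \<le> 0"
  proof (rule total_variation_least)
    fix F :: "'a set set" assume "\<Union>F \<subseteq> {}"
    then have "F \<subseteq> {{}}" by blast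
    then have "(\<Sum>B\<in>F. \<bar>\<nu> B\<bar>) = (\<Sum>B\<in>F. 0)" using e by (intro sum.cong refl) auto
    then show "ennreal (\<Sum>B\<in>F. \<bar>\<nu> B\<bar>) \<le> 0" by simp
  qed
  then show "positive (sets (pos_variation M \<nu>)) (\<lambda>A. ennreal ((?T A + \<nu> A) / 2))"
    using e by (simp add: positive_def)
  show "countably_additive (sets (pos_variation M \<nu>)) (\<lambda>A. ennreal ((?T A + \<nu> A) / 2))"
    unfolding sets_pos_variation
  proof (rule countably_additiveI)
    fix A :: "nat \<Rightarrow> 'a set" assume A: "range A \<subseteq> sets M" "disjoint_family A"
    have Ai: "A i \<in> sets M" for i using A(1) by auto
    then have U: "(\<Union>i. A i) \<in> sets M" by auto
    have "(\<lambda>i. ennreal (?T (A i))) sums ennreal (?T (\<Union>i. A i))"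
      using total_variation_countably_additive[OF sm A] total_variation_finite(1)[OF \<nu> U]
        total_variation_finite(1)[OF \<nu> Ai] summable_sums[OF summableI, of "\<lambda>i. total_variation M \<nu> (A i)"] by simp
    then have "(\<lambda>i. ?T (A i)) sums ?T (\<Union>i. A i)" by (subst (asm) sums_ennreal) auto
    moreover have "(\<lambda>i. \<nu> (A i)) sums \<nu> (\<Union>i. A i)" using sm A unfolding signed_measure_def by blast
    ultimately have "(\<lambda>i. (?T (A i) + \<nu> (A i)) / 2) sums ((?T (\<Union>i. A i) + \<nu> (\<Union>i. A i)) / 2)"
      by (intro sums_divide sums_add)
    moreover have "0 \<le> (?T (A i) + \<nu> (A i)) / 2" for i
      using total_variation_finite(2)[OF \<nu> Ai, of i] by (simp add: abs_le_iff)
    ultimately show "(\<Sum>i. ennreal ((?T (A i) + \<nu> (A i)) / 2)) = ennreal ((?T (\<Union>i. A i) + \<nu> (\<Union>i. A i)) / 2)"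
      by (intro suminf_ennreal_eq)
  qed
  show "A \<in> sets (pos_variation M \<nu>)" using A by (simp add: sets_pos_variation)
qed

lemma finite_pos_variation:
  assumes \<nu>: "finite_signed_measure M \<nu>" shows "finite_measure (pos_variation M \<nu>)"
proof (rule finite_measureI)
  have "space (pos_variation M \<nu>) = space M" using sets_pos_variation by (rule sets_eq_imp_space_eq)
  then show "emeasure (pos_variation M \<nu>) (space (pos_variation M \<nu>)) \<noteq> \<infinity>"
    using emeasure_pos_variation[OF \<nu> sets.top] by simp
qed

lemma measure_pos_neg_variation:
  assumes \<nu>: "finite_signed_measure M \<nu>" and A: "A \<in> sets M"
  shows "measure (pos_variation M \<nu>) A - measure (neg_variation M \<nu>) A = \<nu> A"
proof -
  have "measure (pos_variation M \<nu>) A = (enn2real (total_variation M \<nu> A) + \<nu> A) / 2"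
    unfolding measure_def emeasure_pos_variation[OF \<nu> A]
    using total_variation_finite(2)[OF \<nu> A] by (simp add: abs_le_iff)
  moreover have "measure (neg_variation M \<nu>) A = (enn2real (total_variation M \<nu> A) - \<nu> A) / 2"
    unfolding measure_def neg_variation_eq emeasure_pos_variation[OF finite_signed_measure_uminus[OF \<nu>] A]
    using total_variation_finite(2)[OF \<nu> A] by (simp add: total_variation_uminus abs_le_iff)
  ultimately show ?thesis by simp
qed

text \<open>Uniqueness of the Jordan decomposition: two finite measures carried by complementary sets are
  the variations of their difference.\<close>

lemma variations_of_difference:
  assumes P: "finite_measure P" "sets P = sets M" and Q: "finite_measure Q" "sets Q = sets M"
    and S: "S \<in> sets M" "emeasure P (space M - S) = 0" "emeasure Q S = 0"
    and \<nu>: "\<And>A. A \<in> sets M \<Longrightarrow> \<nu> A = measure P A - measure Q A"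
  shows "finite_signed_measure M \<nu>" "pos_variation M \<nu> = P" "neg_variation M \<nu> = Q"
proof -
  interpret P: finite_measure P by fact
  interpret Q: finite_measure Q by fact
  have Sc: "space M - S \<in> sets M" using S(1) by auto
  have TV: "total_variation M \<nu> A = ennreal (measure P A + measure Q A)" if A: "A \<in> sets M" for A
  proof (rule antisym)
    show "total_variation M \<nu> A \<le> ennreal (measure P A + measure Q A)"
    proof (rule total_variation_least)
      fix F assume F: "finite F" "F \<subseteq> sets M" "disjoint F" "\<Union>F \<subseteq> A"
      have "(\<Sum>B\<in>F. \<bar>\<nu> B\<bar>) \<le> (\<Sum>B\<in>F. measure P B + measure Q B)"
        using F(2) \<nu> by (intro sum_mono) (auto simp: abs_le_iff)
      also have "\<dots> = measure P (\<Union>F) + measure Q (\<Union>F)"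
      proof -
        have d: "disjoint_family_on (\<lambda>x. x) F" using F(3) by (auto simp: disjoint_family_on_def disjoint_def)
        have "measure P (\<Union>B\<in>F. B) = (\<Sum>B\<in>F. measure P B)"
          by (rule P.finite_measure_finite_Union[OF F(1) _ d]) (use F(2) in \<open>simp add: P(2)\<close>)
        moreover have "measure Q (\<Union>B\<in>F. B) = (\<Sum>B\<in>F. measure Q B)"
          by (rule Q.finite_measure_finite_Union[OF F(1) _ d]) (use F(2) in \<open>simp add: Q(2)\<close>)
        ultimately show ?thesis by (simp add: sum.distrib)
      qed
      also have "\<dots> \<le> measure P A + measure Q A"
        using A F(4) by (intro add_mono P.finite_measure_mono Q.finite_measure_mono) (simp_all add: P(2) Q(2))
      finally show "ennreal (\<Sum>B\<in>F. \<bar>\<nu> B\<bar>) \<le> ennreal (measure P A + measure Q A)" by (rule ennreal_leI)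
    qed
    let ?B = "A \<inter> S" and ?C = "A \<inter> (space M - S)"
    have BC: "?B \<in> sets M" "?C \<in> sets M" using A S(1) by auto
    have null: "measure Q ?B = 0" "measure P ?C = 0"
    proof -
      have "measure Q ?B \<le> measure Q S" "measure P ?C \<le> measure P (space M - S)"
        using S(1) Sc by (auto intro!: P.finite_measure_mono Q.finite_measure_mono simp: P(2) Q(2))
      moreover have "measure Q S = 0" "measure P (space M - S) = 0" using S by (simp_all add: measure_def)
      ultimately show "measure Q ?B = 0" "measure P ?C = 0" using measure_nonneg by (metis antisym)+
    qed
    have A_eq: "A = ?B \<union> ?C" using sets.sets_into_space[OF A] by auto
    have "measure P A = measure P ?B + measure P ?C" "measure Q A = measure Q ?B + measure Q ?C"
      using P.finite_measure_Union[of ?B ?C] Q.finite_measure_Union[of ?B ?C] BC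
      by (subst A_eq, auto simp: P(2) Q(2))+
    then have "measure P A + measure Q A = \<bar>\<nu> ?B\<bar> + \<bar>\<nu> ?C\<bar>"
      using \<nu>[OF BC(1)] \<nu>[OF BC(2)] null by simp
    also have "\<dots> = (\<Sum>B\<in>{?B, ?C}. \<bar>\<nu> B\<bar>)"
    proof (cases "?B = ?C")
      case True
      then have "?B = {}" "?C = {}" by auto
      then show ?thesis using \<nu>[of "{}"] by simp
    qed simp
    finally have "ennreal (measure P A + measure Q A) = ennreal (\<Sum>B\<in>{?B, ?C}. \<bar>\<nu> B\<bar>)" by simp
    also have "\<dots> \<le> total_variation M \<nu> A"
      using BC by (intro total_variation_upper) (auto simp: disjoint_def)
    finally show "ennreal (measure P A + measure Q A) \<le> total_variation M \<nu> A" .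
  qed
  have TV_real: "enn2real (total_variation M \<nu> A) = measure P A + measure Q A" if "A \<in> sets M" for A
    unfolding TV[OF that] by (rule enn2real_ennreal) simp
  show fsm: "finite_signed_measure M \<nu>"
    unfolding finite_signed_measure_def signed_measure_def
  proof (intro conjI allI impI)
    fix A :: "nat \<Rightarrow> 'a set" assume A: "range A \<subseteq> sets M" "disjoint_family A"
    have "(\<lambda>i. measure P (A i) - measure Q (A i)) sums (measure P (\<Union>i. A i) - measure Q (\<Union>i. A i))"
      using A by (intro sums_diff P.finite_measure_UNION Q.finite_measure_UNION) (auto simp: P(2) Q(2))
    moreover have "\<nu> (A i) = measure P (A i) - measure Q (A i)" for i using A(1) by (intro \<nu>) auto
    moreover have "\<nu> (\<Union>i. A i) = measure P (\<Union>i. A i) - measure Q (\<Union>i. A i)" using A(1) by (intro \<nu>) auto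
    ultimately show "(\<lambda>i. \<nu> (A i)) sums \<nu> (\<Union>i. A i)" by simp
  next
    show "total_variation M \<nu> (space M) < \<infinity>" unfolding TV[OF sets.top] by simp
  qed
  show "pos_variation M \<nu> = P"
  proof (rule measure_eqI)
    show "sets (pos_variation M \<nu>) = sets P" by (simp add: sets_pos_variation P(2))
    fix A assume "A \<in> sets (pos_variation M \<nu>)"
    then have A: "A \<in> sets M" by (simp add: sets_pos_variation)
    show "emeasure (pos_variation M \<nu>) A = emeasure P A"
      unfolding emeasure_pos_variation[OF fsm A] TV_real[OF A] \<nu>[OF A] by (simp add: P.emeasure_eq_measure)
  qed
  show "neg_variation M \<nu> = Q"
    unfolding neg_variation_eq
  proof (rule measure_eqI)
    show "sets (pos_variation M (\<lambda>A. - \<nu> A)) = sets Q" by (simp add: sets_pos_variation Q(2))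
    fix A assume "A \<in> sets (pos_variation M (\<lambda>A. - \<nu> A))"
    then have A: "A \<in> sets M" by (simp add: sets_pos_variation)
    show "emeasure (pos_variation M (\<lambda>A. - \<nu> A)) A = emeasure Q A"
      unfolding emeasure_pos_variation[OF finite_signed_measure_uminus[OF fsm] A] total_variation_uminus TV_real[OF A] \<nu>[OF A]
      by (simp add: Q.emeasure_eq_measure)
  qed
qed


section \<open>Signed measures with a prescribed logarithmic potential\<close>

text \<open>For a continuous density \<open>h\<close> with respect to \<open>beta\<close>, the measures \<open>P\<close> and \<open>Q\<close> with the densities
  $h^+$ and $h^-$ are the Jordan decomposition; \<open>signed_integral\<close> is then a single integral against
  \<open>beta\<close>.\<close>

locale beta_density =
  fixes h :: "real \<Rightarrow> real"
  assumes h: "continuous_on I2 h"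
begin

abbreviation "P \<equiv> density beta (\<lambda>x. ennreal (max 0 (h x)))"
abbreviation "Q \<equiv> density beta (\<lambda>x. ennreal (max 0 (- h x)))"

lemma h_measurable [measurable]: "h \<in> borel_measurable beta"
  by (rule beta.continuous_measurable[OF h])

lemma h_integrable: "integrable beta h"
  by (intro beta.L2_integrable beta.continuous_L2 h)

lemma max_integrable: "integrable beta (\<lambda>x. max 0 (h x))" "integrable beta (\<lambda>x. max 0 (- h x))"
  using h_integrable by auto

lemma I2_measure_density:
  assumes "integrable beta g" "\<And>x. 0 \<le> g x" shows "I2_measure (density beta (\<lambda>x. ennreal (g x)))"
proof -
  have [measurable]: "g \<in> borel_measurable beta" using assms(1) by (rule borel_measurable_integrable)
  have "emeasure (density beta (\<lambda>x. ennreal (g x))) (space beta) = (\<integral>\<^sup>+x. ennreal (g x) \<partial>beta)"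
    by (subst emeasure_density) (auto intro!: nn_integral_cong)
  also have "\<dots> < \<infinity>" using assms by (subst nn_integral_eq_integral) auto
  finally have "finite_measure (density beta (\<lambda>x. ennreal (g x)))" by (intro finite_measureI) simp
  then show ?thesis by (simp add: I2_measure_def I2_measure_axioms_def sets_beta)
qed

sublocale P: I2_measure P
  by (rule I2_measure_density[OF max_integrable(1)]) simp

sublocale Q: I2_measure Q
  by (rule I2_measure_density[OF max_integrable(2)]) simp

lemma integral_P_Q:
  assumes f: "f \<in> borel_measurable beta" and fh: "integrable beta (\<lambda>x. f x * h x)"
  shows "(\<integral>x. f x \<partial>P) - (\<integral>x. f x \<partial>Q) = (\<integral>x. f x * h x \<partial>beta)"
proof -
  note [measurable] = f
  have int: "integrable beta (\<lambda>x. max 0 (h x) * f x)" "integrable beta (\<lambda>x. max 0 (- h x) * f x)"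
  proof -
    have le: "norm (max 0 a * b) \<le> norm (b * a)" "norm (max 0 (- a) * b) \<le> norm (b * a)" for a b :: real
    proof -
      have "max 0 a \<le> \<bar>a\<bar>" "max 0 (- a) \<le> \<bar>a\<bar>" by auto
      from this[THEN mult_right_mono, of "\<bar>b\<bar>"]
      show "norm (max 0 a * b) \<le> norm (b * a)" "norm (max 0 (- a) * b) \<le> norm (b * a)"
        by (simp_all add: abs_mult mult.commute)
    qed
    show "integrable beta (\<lambda>x. max 0 (h x) * f x)" "integrable beta (\<lambda>x. max 0 (- h x) * f x)"
      by (rule Bochner_Integration.integrable_bound[OF fh], simp, rule AE_I2, rule le)+
  qed
  have "(\<integral>x. f x \<partial>P) = (\<integral>x. max 0 (h x) * f x \<partial>beta)" "(\<integral>x. f x \<partial>Q) = (\<integral>x. max 0 (- h x) * f x \<partial>beta)"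
    by (subst integral_density; simp)+
  then have "(\<integral>x. f x \<partial>P) - (\<integral>x. f x \<partial>Q) = (\<integral>x. max 0 (h x) * f x - max 0 (- h x) * f x \<partial>beta)"
    using int by simp
  also have "\<dots> = (\<integral>x. f x * h x \<partial>beta)"
    by (rule Bochner_Integration.integral_cong) (auto simp: max_def)
  finally show ?thesis .
qed

lemma measure_P_Q:
  assumes B: "B \<in> sets beta"
  shows "measure P B - measure Q B = (LINT x:B|beta. h x)"
proof -
  have "(\<integral>x. indicator B x \<partial>P) - (\<integral>x. indicator B x \<partial>Q) = (\<integral>x. indicator B x * h x \<partial>beta)"
    using B h_integrable by (intro integral_P_Q integrable_real_mult_indicator borel_measurable_indicator)
      (simp_all add: mult.commute integrable_real_mult_indicator)
  then show ?thesis using B sets.sets_into_space[OF B]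
    by (simp add: set_lebesgue_integral_def Int_absorb1 Int_absorb2)
qed

lemma
  assumes \<mu>: "\<And>B. B \<in> sets beta \<Longrightarrow> \<mu> B = (LINT x:B|beta. h x)"
  shows finite_signed_measure_density: "finite_signed_measure beta \<mu>"
    and signed_integral_density: "f \<in> borel_measurable beta \<Longrightarrow> integrable beta (\<lambda>x. f x * h x) \<Longrightarrow>
      signed_integral beta \<mu> f = (\<integral>x. f x * h x \<partial>beta)"
proof -
  let ?S = "{x \<in> space beta. 0 \<le> h x}"
  have S: "?S \<in> sets beta" by measurable
  have "emeasure P (space beta - ?S) = (\<integral>\<^sup>+x. ennreal (max 0 (h x)) * indicator (space beta - ?S) x \<partial>beta)"
    using S by (intro emeasure_density) auto
  also have "\<dots> = (\<integral>\<^sup>+x. 0 \<partial>beta)"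
    by (rule nn_integral_cong) (auto simp: indicator_def max_def)
  finally have 1: "emeasure P (space beta - ?S) = 0" by simp
  have "emeasure Q (?S) = (\<integral>\<^sup>+x. ennreal (max 0 (- h x)) * indicator (?S) x \<partial>beta)"
    using S by (intro emeasure_density) auto
  also have "\<dots> = (\<integral>\<^sup>+x. 0 \<partial>beta)"
    by (rule nn_integral_cong) (auto simp: indicator_def max_def)
  finally have 2: "emeasure Q ?S = 0" by simp
  note var = variations_of_difference[OF P.finite_measure_axioms _ Q.finite_measure_axioms _ S 1 2]
  have eq: "\<mu> B = measure P B - measure Q B" if "B \<in> sets beta" for B
    using \<mu>[OF that] measure_P_Q[OF that] by simp
  show "finite_signed_measure beta \<mu>" by (rule var(1)) (simp_all add: eq)
  have pv: "pos_variation beta \<mu> = P" by (rule var(2)) (simp_all add: eq)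
  have nv: "neg_variation beta \<mu> = Q" by (rule var(3)) (simp_all add: eq)
  show "signed_integral beta \<mu> f = (\<integral>x. f x * h x \<partial>beta)"
    if "f \<in> borel_measurable beta" "integrable beta (\<lambda>x. f x * h x)"
    unfolding signed_integral_def pv nv using that by (rule integral_P_Q)
qed

end

text \<open>The four measures are two signed measures given by their positive and negative parts. Indicators of
  half-lines are bounded limits of polynomials, and the half-lines determine the rest.\<close>

lemma moments_determine_measures:
  assumes "I2_measure P" "I2_measure Q" "I2_measure P'" "I2_measure Q'"
    and eq: "\<And>p. (\<integral>x. poly p x \<partial>P) - (\<integral>x. poly p x \<partial>Q) = (\<integral>x. poly p x \<partial>P') - (\<integral>x. poly p x \<partial>Q')"
    and B: "B \<in> sets beta"
  shows "measure P B - measure Q B = measure P' B - measure Q' B"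
  using B
proof (induction rule: beta.sets_induct)
  case (basic a)
  obtain p where p: "\<And>k x. x \<in> I2 \<Longrightarrow> \<bar>poly (p k) x\<bar> \<le> 2"
      "\<And>x. x \<in> I2 \<Longrightarrow> (\<lambda>k. poly (p k) x) \<longlonglongrightarrow> indicator {a<..} x"
    using poly_approx_indicator[of a] by blast
  have lim: "(\<lambda>k. \<integral>x. poly (p k) x \<partial>M) \<longlonglongrightarrow> measure M (I2 \<inter> {a<..})" if "I2_measure M" for M
  proof -
    interpret M: I2_measure M by fact
    have "(\<lambda>k. \<integral>x. poly (p k) x \<partial>M) \<longlonglongrightarrow> (\<integral>x. indicator {a<..} x \<partial>M)"
    proof (rule integral_dominated_convergence[where w = "\<lambda>x. 2"])
      show "(indicator {a<..} :: real \<Rightarrow> real) \<in> borel_measurable M" by (rule M.borel_imp_measurable) simp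
    qed (use p M.poly_L2 in \<open>auto simp: M.space_M L2_D intro!: AE_I2\<close>)
    also have "(\<integral>x. indicator {a<..} x \<partial>M) = measure M ({a<..} \<inter> space M)"
      by simp
    finally show ?thesis by (simp add: M.space_M Int_commute)
  qed
  have "(\<lambda>k. (\<integral>x. poly (p k) x \<partial>P) - (\<integral>x. poly (p k) x \<partial>Q)) \<longlonglongrightarrow> measure P (I2 \<inter> {a<..}) - measure Q (I2 \<inter> {a<..})"
    by (intro tendsto_diff lim assms)
  moreover have "(\<lambda>k. (\<integral>x. poly (p k) x \<partial>P) - (\<integral>x. poly (p k) x \<partial>Q)) \<longlonglongrightarrow> measure P' (I2 \<inter> {a<..}) - measure Q' (I2 \<inter> {a<..})"
    unfolding eq by (intro tendsto_diff lim assms)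
  ultimately show ?case by (rule LIMSEQ_unique)
next
  case empty
  show ?case by simp
next
  case (compl A)
  have c: "measure M (I2 - A) = (\<integral>x. poly 1 x \<partial>M) - measure M A" if "I2_measure M" for M
  proof -
    interpret M: I2_measure M by fact
    have "A \<in> sets M" using compl(1) by (simp add: M.sets_M sets_beta)
    then show ?thesis using M.finite_measure_compl[of A] by (simp add: M.space_M)
  qed
  show ?case unfolding c[OF assms(1)] c[OF assms(2)] c[OF assms(3)] c[OF assms(4)] using compl(2) eq[of 1] by linarith
next
  case (union A)
  have s: "(\<lambda>i. measure M (A i)) sums measure M (\<Union>i. A i)" if "I2_measure M" for M
  proof -
    interpret M: I2_measure M by fact
    show ?thesis using union(1,2) by (intro M.finite_measure_UNION) (auto simp: M.sets_M sets_beta)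
  qed
  have "(\<lambda>i. measure P (A i) - measure Q (A i)) sums (measure P (\<Union>i. A i) - measure Q (\<Union>i. A i))"
    "(\<lambda>i. measure P' (A i) - measure Q' (A i)) sums (measure P' (\<Union>i. A i) - measure Q' (\<Union>i. A i))"
    by (intro sums_diff s assms)+
  then show ?case unfolding union(3) by (rule sums_unique2)
qed

lemma ln_diff_pair_measurable:
  assumes M: "sets M = sets (restrict_space borel I2)" and N: "sets N = sets (restrict_space borel I2)"
  shows "(\<lambda>(y, x). ln \<bar>x - y\<bar>) \<in> borel_measurable (M \<Otimes>\<^sub>M N)"
proof -
  note [measurable] = fst_pair_I2_measurable[OF M N] snd_pair_I2_measurable[OF M N]
  show ?thesis by measurable
qed

text \<open>The potential of any finite measure on the interval is integrated against \<open>beta\<close> by Fubini,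
  as the logarithm is integrable uniformly in the other variable.\<close>

lemma
  assumes M: "I2_measure M" and f: "f \<in> borel_measurable beta" and B: "\<And>x. x \<in> I2 \<Longrightarrow> \<bar>f x\<bar> \<le> B"
  shows integrable_potential: "integrable beta (\<lambda>x. (\<integral>y. ln \<bar>x - y\<bar> \<partial>M) * f x)"
    and integral_potential: "(\<integral>x. (\<integral>y. ln \<bar>x - y\<bar> \<partial>M) * f x \<partial>beta) = - (\<integral>y. E_op f y \<partial>M)"
proof -
  interpret M: I2_measure M by fact
  interpret Mb: pair_sigma_finite M beta ..
  note [measurable] = ln_diff_pair_measurable[OF M.sets_M sets_beta] f
  have sp: "space M = I2" by (rule M.space_M)
  have [measurable]: "(\<lambda>(y, x). ln \<bar>x - y\<bar> * f x) \<in> borel_measurable (M \<Otimes>\<^sub>M beta)"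
  proof -
    have "(\<lambda>z. (case z of (y, x) \<Rightarrow> ln \<bar>x - y\<bar>) * f (snd z)) \<in> borel_measurable (M \<Otimes>\<^sub>M beta)" by measurable
    then show ?thesis by (simp add: case_prod_beta)
  qed
  have int1: "integrable beta (\<lambda>x. ln \<bar>x - y\<bar> * f x)" if "y \<in> I2" for y
    using log_bounded_integrable(1)[OF that f B] by (simp add: abs_minus_commute)
  have bnd: "(\<integral>x. \<bar>ln \<bar>x - y\<bar> * f x\<bar> \<partial>beta) \<le> 4 * ln 2 * B" if y: "y \<in> I2" for y
  proof -
    have B0: "0 \<le> B" using B[of 0] by simp
    have "(\<integral>x. \<bar>ln \<bar>x - y\<bar> * f x\<bar> \<partial>beta) \<le> (\<integral>x. \<bar>ln \<bar>y - x\<bar>\<bar> * B \<partial>beta)"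
    proof (rule integral_mono)
      show "integrable beta (\<lambda>x. \<bar>ln \<bar>x - y\<bar> * f x\<bar>)" by (rule integrable_abs[OF int1[OF y]])
      show "integrable beta (\<lambda>x. \<bar>ln \<bar>y - x\<bar>\<bar> * B)" by (intro integrable_mult_left integrable_abs log_integrable y)
      show "\<bar>ln \<bar>x - y\<bar> * f x\<bar> \<le> \<bar>ln \<bar>y - x\<bar>\<bar> * B" if "x \<in> space beta" for x
        using B[of x] that unfolding abs_mult abs_minus_commute[of x y]
        by (intro mult_left_mono) (simp_all add: space_beta)
    qed
    also have "\<dots> \<le> 4 * ln 2 * B"
      using mult_right_mono[OF integral_abs_log_le[OF y] B0] by simp
    finally show ?thesis .
  qed
  have int: "integrable (M \<Otimes>\<^sub>M beta) (\<lambda>(y, x). ln \<bar>x - y\<bar> * f x)"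
  proof (rule Mb.Fubini_integrable)
    show "integrable M (\<lambda>y. \<integral>x. norm (case (y, x) of (y, x) \<Rightarrow> ln \<bar>x - y\<bar> * f x) \<partial>beta)"
    proof (rule M.bounded_integrable[where B = "4 * ln 2 * B"])
      show "(\<lambda>y. \<integral>x. norm (case (y, x) of (y, x) \<Rightarrow> ln \<bar>x - y\<bar> * f x) \<partial>beta) \<in> borel_measurable M"
        by measurable
      show "\<bar>\<integral>x. norm (case (y, x) of (y, x) \<Rightarrow> ln \<bar>x - y\<bar> * f x) \<partial>beta\<bar> \<le> 4 * ln 2 * B" if "y \<in> space M" for y
        using bnd that by (simp add: sp integral_nonneg)
    qed
  qed (use int1 in \<open>auto simp: sp\<close>)
  have F: "(\<integral>x. (\<integral>y. ln \<bar>x - y\<bar> * f x \<partial>M) \<partial>beta) = (\<integral>y. (\<integral>x. ln \<bar>x - y\<bar> * f x \<partial>beta) \<partial>M)"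
    by (rule Mb.Fubini_integral[OF int])
  show "integrable beta (\<lambda>x. (\<integral>y. ln \<bar>x - y\<bar> \<partial>M) * f x)"
    using Mb.integrable_snd[OF int] by simp
  show "(\<integral>x. (\<integral>y. ln \<bar>x - y\<bar> \<partial>M) * f x \<partial>beta) = - (\<integral>y. E_op f y \<partial>M)"
    using F by (simp add: E_op_def abs_minus_commute)
qed

lemma AE_lborel_imp_AE_beta:
  assumes "AE x in lborel. x \<in> I2 \<longrightarrow> P x" shows "AE x in beta. P x"
  unfolding beta_def using measurable_compose[OF arcsine_weight_measurable measurable_ennreal] assms
  by (subst AE_density) (auto simp: AE_restrict_space_iff)

text \<open>Existence is $\mathcal{E}\mathcal{N}V=V-\int V\,d\beta$ together with the constancy of the potential
  of \<open>beta\<close>. For uniqueness, integrate the equation for the potential against $\phi_n\,d\beta$: by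
  Fubini the left-hand side is $-\frac2n\int\phi_n\,d\mu$ for $n\ge1$, the unknown constant drops out,
  and $n=0$ is the prescribed mass. So all moments are known.\<close>

lemma signed_log_potential:
  assumes V: "Ck 2 V"
  shows "(finite_signed_measure beta \<mu> \<and> \<mu> I2 = A \<and>
       (\<exists>C. AE x in lborel. x \<in> I2 \<longrightarrow> 2 * signed_integral beta \<mu> (\<lambda>y. ln \<bar>x - y\<bar>) = V x + C)) \<longleftrightarrow>
      (\<forall>B \<in> sets beta. \<mu> B = (LINT x:B|beta. A - 1 / 2 * N_op V x))"
proof -
  define h where "h x = A - 1 / 2 * N_op V x" for x
  have cN: "continuous_on I2 (N_op V)" by (rule continuous_N_op[OF V])
  have ch: "continuous_on I2 h" unfolding h_def by (intro continuous_intros cN)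
  interpret beta_density h by (rule beta_density.intro[OF ch])
  have NL: "N_op V \<in> L2 beta" by (rule beta.continuous_L2[OF cN])
  have coeff: "ip beta (N_op V) (phi n) = real n * ip beta V (phi n)" for n
    using number_graph_N_op[OF V] by (simp add: number_graph_iff)
  have h_phi: "(\<integral>x. phi n x * h x \<partial>beta) = (if n = 0 then A else 0) - real n / 2 * ip beta V (phi n)" for n
  proof -
    have "(\<integral>x. phi n x * h x \<partial>beta) = (\<integral>x. A * phi n x - 1 / 2 * (N_op V x * phi n x) \<partial>beta)"
      by (rule Bochner_Integration.integral_cong) (simp_all add: h_def algebra_simps)
    also have "\<dots> = A * (\<integral>x. phi n x \<partial>beta) - 1 / 2 * ip beta (N_op V) (phi n)"
      using L2_integrable_mult[OF NL phi_L2] beta.L2_integrable[OF phi_L2] by (simp add: ip_def)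
    finally show ?thesis by (simp add: coeff integral_phi)
  qed
  have sp: "I2 \<in> sets beta" using sets.top[of beta] by (simp add: space_beta)
  show ?thesis unfolding h_def[symmetric]
  proof
    assume \<mu>: "\<forall>B \<in> sets beta. \<mu> B = (LINT x:B|beta. h x)"
    then have \<mu>': "\<And>B. B \<in> sets beta \<Longrightarrow> \<mu> B = (LINT x:B|beta. h x)" by blast
    have "\<mu> I2 = (\<integral>x. phi 0 x * h x \<partial>beta)"
      unfolding \<mu>'[OF sp] set_lebesgue_integral_def
      by (rule Bochner_Integration.integral_cong) (simp_all add: space_beta phi_0)
    then have mass: "\<mu> I2 = A" by (simp add: h_phi)
    have "2 * signed_integral beta \<mu> (\<lambda>y. ln \<bar>x - y\<bar>) = V x + (- (\<integral>y. V y \<partial>beta))" if x: "x \<in> I2" for x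
    proof -
      obtain B where B: "0 \<le> B" "\<And>x. x \<in> I2 \<Longrightarrow> \<bar>h x\<bar> \<le> B" using continuous_bounded_I2[OF ch] by blast
      have "signed_integral beta \<mu> (\<lambda>y. ln \<bar>x - y\<bar>) = (\<integral>y. ln \<bar>x - y\<bar> * h y \<partial>beta)"
        using log_bounded_integrable(1)[OF x h_measurable B(2)]
        by (intro signed_integral_density \<mu>' ln_abs_diff_measurable)
      also have "\<dots> = - E_op h x" by (simp add: E_op_def)
      also have "E_op h x = E_op (\<lambda>y. A * phi 0 y + (- (1/2)) * N_op V y) x"
        by (rule E_op_cong) (simp add: h_def phi_0)
      also have "\<dots> = A * E_op (phi 0) x + (- (1/2)) * E_op (N_op V) x"
        by (subst E_op_add[OF x]) (intro continuous_intros continuous_phi cN | simp only: E_op_cmult)+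
      also have "\<dots> = - (1/2) * (V x - (\<integral>y. V y \<partial>beta))"
        by (simp add: E_op_phi[OF x] E_op_N_op[OF V x])
      finally show ?thesis by simp
    qed
    then have "AE x in lborel. x \<in> I2 \<longrightarrow> 2 * signed_integral beta \<mu> (\<lambda>y. ln \<bar>x - y\<bar>) = V x + (- (\<integral>y. V y \<partial>beta))"
      by simp
    then show "finite_signed_measure beta \<mu> \<and> \<mu> I2 = A \<and>
       (\<exists>C. AE x in lborel. x \<in> I2 \<longrightarrow> 2 * signed_integral beta \<mu> (\<lambda>y. ln \<bar>x - y\<bar>) = V x + C)"
      using mass finite_signed_measure_density[OF \<mu>'] by blast
  next
    assume asm: "finite_signed_measure beta \<mu> \<and> \<mu> I2 = A \<and>
       (\<exists>C. AE x in lborel. x \<in> I2 \<longrightarrow> 2 * signed_integral beta \<mu> (\<lambda>y. ln \<bar>x - y\<bar>) = V x + C)"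
    then obtain C where \<mu>: "finite_signed_measure beta \<mu>" "\<mu> I2 = A"
      and "AE x in lborel. x \<in> I2 \<longrightarrow> 2 * signed_integral beta \<mu> (\<lambda>y. ln \<bar>x - y\<bar>) = V x + C"
      by blast
    then have pot: "AE x in beta. 2 * signed_integral beta \<mu> (\<lambda>y. ln \<bar>x - y\<bar>) = V x + C"
      by (intro AE_lborel_imp_AE_beta)
    let ?p = "pos_variation beta \<mu>" and ?n = "neg_variation beta \<mu>"
    have Mp: "I2_measure ?p"
      using finite_pos_variation[OF \<mu>(1)] by (simp add: I2_measure_def I2_measure_axioms_def sets_pos_variation sets_beta)
    have Mn: "I2_measure ?n"
      using finite_pos_variation[OF finite_signed_measure_uminus[OF \<mu>(1)]]
      by (simp add: neg_variation_eq I2_measure_def I2_measure_axioms_def sets_pos_variation sets_beta)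
    have phi_eq: "(\<integral>x. phi n x \<partial>?p) - (\<integral>x. phi n x \<partial>?n) = (\<integral>x. phi n x * h x \<partial>beta)" for n
    proof (cases "n = 0")
      case True
      have "measure ?p (space ?p) - measure ?n (space ?n) = A"
        using measure_pos_neg_variation[OF \<mu>(1) sp] \<mu>(2) I2_measure.space_M[OF Mp] I2_measure.space_M[OF Mn] by simp
      then show ?thesis using True by (simp add: h_phi) (simp add: phi_0[abs_def])
    next
      case False
      have VL: "integrable beta (\<lambda>x. V x * phi n x)" by (intro L2_integrable_mult Ck_L2[OF V] phi_L2)
      have E: "(\<integral>y. E_op (phi n) y \<partial>M) = 1 / real n * (\<integral>y. phi n y \<partial>M)" if "I2_measure M" for M
      proof -
        have "(\<integral>y. E_op (phi n) y \<partial>M) = (\<integral>y. 1 / real n * phi n y \<partial>M)"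
          by (rule Bochner_Integration.integral_cong) (simp_all add: I2_measure.space_M[OF that] E_op_phi)
        then show ?thesis by simp
      qed
      let ?u = "\<lambda>M x. (\<integral>y. ln \<bar>x - y\<bar> \<partial>M) * phi n x"
      note pp = integrable_potential[OF Mp phi_measurable abs_phi_le_1] integral_potential[OF Mp phi_measurable abs_phi_le_1]
      note nn = integrable_potential[OF Mn phi_measurable abs_phi_le_1] integral_potential[OF Mn phi_measurable abs_phi_le_1]
      have "(\<integral>x. 2 * (?u ?p x - ?u ?n x) \<partial>beta) = (\<integral>x. V x * phi n x + C * phi n x \<partial>beta)"
      proof (rule integral_cong_AE)
        show "AE x in beta. 2 * (?u ?p x - ?u ?n x) = V x * phi n x + C * phi n x"
          using pot
        proof eventually_elim
          case (elim x)
          have "2 * (?u ?p x - ?u ?n x) = (2 * signed_integral beta \<mu> (\<lambda>y. ln \<bar>x - y\<bar>)) * phi n x"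
            by (simp add: signed_integral_def algebra_simps)
          then show ?case unfolding elim by (simp add: algebra_simps)
        qed
      qed (use pp(1)[of n] nn(1)[of n] L2_D(1)[OF Ck_L2[OF V]] phi_measurable[of n] in \<open>auto intro!: borel_measurable_add borel_measurable_times\<close>)
      then have "2 * (- (1 / real n * (\<integral>y. phi n y \<partial>?p)) + (1 / real n * (\<integral>y. phi n y \<partial>?n))) = ip beta V (phi n) + C * (\<integral>x. phi n x \<partial>beta)"
      proof -
        assume eq: "(\<integral>x. 2 * (?u ?p x - ?u ?n x) \<partial>beta) = (\<integral>x. V x * phi n x + C * phi n x \<partial>beta)"
        have "(\<integral>x. 2 * (?u ?p x - ?u ?n x) \<partial>beta) = 2 * ((\<integral>x. ?u ?p x \<partial>beta) - (\<integral>x. ?u ?n x \<partial>beta))"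
          by (simp only: integral_mult_right_zero Bochner_Integration.integral_diff pp(1) nn(1))
        also have "\<dots> = 2 * (- (1 / real n * (\<integral>y. phi n y \<partial>?p)) + (1 / real n * (\<integral>y. phi n y \<partial>?n)))"
          by (simp only: pp(2) nn(2) E[OF Mp] E[OF Mn] diff_minus_eq_add)
        also have "(\<integral>x. 2 * (?u ?p x - ?u ?n x) \<partial>beta) = ip beta V (phi n) + C * (\<integral>x. phi n x \<partial>beta)"
          unfolding eq ip_def using VL beta.L2_integrable[OF phi_L2] by simp
        finally show ?thesis by simp
      qed
      then show ?thesis unfolding h_phi using False by (simp add: integral_phi field_simps)
    qed
    have poly_eq: "(\<integral>x. poly p x \<partial>?p) - (\<integral>x. poly p x \<partial>?n) = (\<integral>x. poly p x * h x \<partial>beta)" for p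
    proof (induction p rule: poly_phi_induct)
      case (phi c n)
      then show ?case using phi_eq[of n] by (simp add: poly_phi right_diff_distrib[symmetric] mult.assoc)
    next
      case (add p q)
      have "integrable ?p (poly p)" "integrable ?n (poly p)" for p
        using Mp Mn by (auto intro!: finite_measure.L2_integrable I2_measure.poly_L2 simp: I2_measure_def)
      moreover have "integrable beta (\<lambda>x. poly p x * h x)" for p
        by (intro beta.L2_integrable beta.continuous_L2 continuous_intros ch)
      ultimately show ?case using add by (simp add: distrib_right)
    qed
    show "\<forall>B \<in> sets beta. \<mu> B = (LINT x:B|beta. h x)"
    proof
      fix B assume B: "B \<in> sets beta"
      have "measure ?p B - measure ?n B = measure P B - measure Q B"
      proof (rule moments_determine_measures[OF Mp Mn P.I2_measure_axioms Q.I2_measure_axioms _ B])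
        fix p
        have "integrable beta (\<lambda>x. poly p x * h x)"
          by (intro beta.L2_integrable beta.continuous_L2 continuous_intros ch)
        from integral_P_Q[OF poly_measurable_beta this]
        show "(\<integral>x. poly p x \<partial>?p) - (\<integral>x. poly p x \<partial>?n) = (\<integral>x. poly p x \<partial>P) - (\<integral>x. poly p x \<partial>Q)"
          unfolding poly_eq ..
      qed
      then show "\<mu> B = (LINT x:B|beta. h x)"
        using measure_pos_neg_variation[OF \<mu>(1) B] measure_P_Q[OF B] by simp
    qed
  qed
qed


section \<open>Logarithmic energy\<close>

text \<open>The kernel is shifted by $\log 4$, which makes it nonnegative on the square; potentials and
  energies are then integrals with values in $[0,\infty]$ and Tonelli applies.\<close>

definition log_kernel :: "real \<Rightarrow> real \<Rightarrow> ennreal" where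
  "log_kernel x y = (if x = y then \<infinity> else ennreal (2 * ln 2 - ln \<bar>x - y\<bar>))"

definition log_pot :: "real measure \<Rightarrow> real \<Rightarrow> ennreal" where
  "log_pot \<mu> x = (\<integral>\<^sup>+y. log_kernel x y \<partial>\<mu>)"

definition mutual_energy :: "real measure \<Rightarrow> real measure \<Rightarrow> ennreal" where
  "mutual_energy \<mu> \<nu> = (\<integral>\<^sup>+x. log_pot \<nu> x \<partial>\<mu>)"

lemma log_kernel_commute: "log_kernel x y = log_kernel y x"
  by (simp add: log_kernel_def abs_minus_commute)

lemma prob_measuresD:
  assumes "\<mu> \<in> prob_measures"
  shows "prob_space \<mu>" "sets \<mu> = sets (restrict_space borel I2)" "I2_measure \<mu>"
proof -
  show p: "prob_space \<mu>" and s: "sets \<mu> = sets (restrict_space borel I2)"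
    using assms by (auto simp: prob_measures_def)
  interpret prob_space \<mu> by fact
  show "I2_measure \<mu>" by (simp add: I2_measure_def I2_measure_axioms_def s finite_measure_axioms)
qed

lemma beta_prob_measures: "beta \<in> prob_measures"
  by (simp add: prob_measures_def beta.prob_space_axioms sets_beta)

lemma log_kernel_measurable:
  assumes M: "sets M = sets (restrict_space borel I2)" and N: "sets N = sets (restrict_space borel I2)"
  shows "(\<lambda>(x, y). log_kernel x y) \<in> borel_measurable (M \<Otimes>\<^sub>M N)"
proof -
  note [measurable] = fst_pair_I2_measurable[OF M N] snd_pair_I2_measurable[OF M N]
  show ?thesis unfolding log_kernel_def case_prod_beta by measurable
qed

lemma log_kernel_measurable1:
  assumes M: "sets M = sets (restrict_space borel I2)"
  shows "log_kernel x \<in> borel_measurable M"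
proof -
  have "log_kernel x \<in> borel_measurable borel" unfolding log_kernel_def[abs_def] by measurable
  then show ?thesis by (subst measurable_cong_sets[OF M refl]) (rule measurable_restrict_space1)
qed

lemma log_pot_measurable:
  assumes \<mu>: "\<mu> \<in> prob_measures" and M: "sets M = sets (restrict_space borel I2)"
  shows "log_pot \<mu> \<in> borel_measurable M"
proof -
  interpret prob_space \<mu> using \<mu> by (rule prob_measuresD)
  note [measurable] = log_kernel_measurable[OF M prob_measuresD(2)[OF \<mu>]]
  show ?thesis unfolding log_pot_def[abs_def] by measurable
qed

lemma mutual_energy_commute:
  assumes \<mu>: "\<mu> \<in> prob_measures" and \<nu>: "\<nu> \<in> prob_measures"
  shows "mutual_energy \<mu> \<nu> = mutual_energy \<nu> \<mu>"
proof -
  interpret \<mu>: prob_space \<mu> using \<mu> by (rule prob_measuresD)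
  interpret \<nu>: prob_space \<nu> using \<nu> by (rule prob_measuresD)
  interpret pair_sigma_finite \<mu> \<nu> ..
  have "(\<integral>\<^sup>+y. \<integral>\<^sup>+x. (case (x, y) of (x, y) \<Rightarrow> log_kernel x y) \<partial>\<mu> \<partial>\<nu>) = (\<integral>\<^sup>+x. \<integral>\<^sup>+y. (case (x, y) of (x, y) \<Rightarrow> log_kernel x y) \<partial>\<nu> \<partial>\<mu>)"
    by (rule Fubini[OF log_kernel_measurable[OF prob_measuresD(2)[OF \<mu>] prob_measuresD(2)[OF \<nu>]]])
  then show ?thesis unfolding mutual_energy_def log_pot_def by (simp add: log_kernel_commute)
qed

text \<open>The arcsine law is the equilibrium measure of the interval, whose capacity is 1: its unshifted
  potential is \<open>E_op (phi 0) = 0\<close>.\<close>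

lemma log_pot_beta:
  assumes x: "x \<in> I2" shows "log_pot beta x = ennreal (2 * ln 2)"
proof -
  have "log_pot beta x = (\<integral>\<^sup>+y. ennreal (2 * ln 2 - ln \<bar>x - y\<bar>) \<partial>beta)"
    unfolding log_pot_def
  proof (rule nn_integral_cong_AE)
    show "AE y in beta. log_kernel x y = ennreal (2 * ln 2 - ln \<bar>x - y\<bar>)"
      using AE_beta_neq[of x] by eventually_elim (simp add: log_kernel_def)
  qed
  also have "\<dots> = ennreal (\<integral>y. 2 * ln 2 - ln \<bar>x - y\<bar> \<partial>beta)"
    using log_integrable[OF x] ln_abs_diff_le[OF x] by (intro nn_integral_eq_integral AE_I2) (auto simp: space_beta)
  also have "(\<integral>y. 2 * ln 2 - ln \<bar>x - y\<bar> \<partial>beta) = 2 * ln 2 + E_op (phi 0) x"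
    using log_integrable[OF x] by (simp add: E_op_def phi_0 space_beta)
  finally show ?thesis by (simp add: E_op_phi[OF x])
qed

lemma mutual_energy_beta:
  assumes \<mu>: "\<mu> \<in> prob_measures" shows "mutual_energy \<mu> beta = ennreal (2 * ln 2)"
proof -
  interpret prob_space \<mu> using \<mu> by (rule prob_measuresD)
  have "mutual_energy \<mu> beta = (\<integral>\<^sup>+x. ennreal (2 * ln 2) \<partial>\<mu>)"
    unfolding mutual_energy_def
    by (rule nn_integral_cong) (simp add: log_pot_beta I2_measure.space_M[OF prob_measuresD(3)[OF \<mu>]])
  then show ?thesis by (simp add: emeasure_space_1)
qed

lemma ereal_shift:
  assumes "a + ennreal c = ennreal r + k" "0 \<le> c" "0 \<le> r"
  shows "enn2ereal a - enn2ereal (ennreal r) = enn2ereal k - ereal c"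
proof (cases a)
  case (real s)
  then have "ennreal (s + c) = ennreal r + k" using assms by simp
  then have "k \<noteq> \<top>" by auto
  then obtain t where t: "k = ennreal t" "0 \<le> t" by (cases k) auto
  then have "s + c = r + t"
    using assms real by (simp add: ennreal_plus[symmetric] del: ennreal_plus)
  then show ?thesis using real t assms by simp
next
  case top
  then have "k = \<top>"
    using assms by (cases k) (auto simp: ennreal_plus[symmetric] simp del: ennreal_plus)
  then show ?thesis using top assms by simp
qed

text \<open>The definition of the energy subtracts the integral of the negative part of the kernel, which is
  bounded by $\log 4$; adding this constant to the kernel moves everything into $[0,\infty]$.\<close>

lemma log_energy_eq_mutual:
  assumes \<mu>: "\<mu> \<in> prob_measures"
  shows "log_energy \<mu> = enn2ereal (mutual_energy \<mu> \<mu>) - ereal (2 * ln 2)"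
proof -
  interpret \<mu>: prob_space \<mu> using \<mu> by (rule prob_measuresD)
  interpret mm: pair_prob_space \<mu> \<mu> ..
  have S: "sets \<mu> = sets (restrict_space borel I2)" using \<mu> by (rule prob_measuresD)
  have sp: "space \<mu> = I2" using I2_measure.space_M[OF prob_measuresD(3)[OF \<mu>]] .
  note [measurable] = fst_pair_I2_measurable[OF S S] snd_pair_I2_measurable[OF S S] log_kernel_measurable[OF S S]
  have [measurable]: "neg_log \<in> borel_measurable borel" unfolding neg_log_def[abs_def] by measurable
  let ?f = "\<lambda>z. case z of (x, y) \<Rightarrow> e2ennreal (neg_log (x - y))"
  let ?g = "\<lambda>z. case z of (x, y) \<Rightarrow> e2ennreal (- neg_log (x - y))"
  let ?k = "\<lambda>z. case z of (x, y) \<Rightarrow> log_kernel x y"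
  have c: "0 \<le> 2 * ln (2 :: real)" by simp
  have pt: "?f z + ennreal (2 * ln 2) = ?g z + ?k z" and gle: "?g z \<le> ennreal (2 * ln 2)" if z: "z \<in> space (\<mu> \<Otimes>\<^sub>M \<mu>)" for z
  proof -
    obtain x y where xy: "z = (x, y)" "x \<in> I2" "y \<in> I2" using z by (auto simp: space_pair_measure sp)
    have l: "ln \<bar>x - y\<bar> \<le> 2 * ln 2" by (rule ln_abs_diff_le[OF xy(2,3)])
    have sum: "ennreal (- l) + ennreal c = ennreal l + ennreal (c - l)" if "l \<le> c" "0 \<le> c" for l c
    proof (cases "0 \<le> l")
      case True
      then show ?thesis using that by (simp add: ennreal_neg ennreal_plus[symmetric] del: ennreal_plus)
    next
      case False
      then show ?thesis using that by (simp add: ennreal_neg ennreal_plus[symmetric] del: ennreal_plus)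
    qed
    show "?f z + ennreal (2 * ln 2) = ?g z + ?k z"
      using sum[OF l c] by (cases "x = y") (simp_all add: xy(1) neg_log_def log_kernel_def)
    show "?g z \<le> ennreal (2 * ln 2)"
      using l by (cases "x = y") (simp_all add: xy(1) neg_log_def ennreal_leI e2ennreal_neg)
  qed
  have "(\<integral>\<^sup>+z. ?f z + ennreal (2 * ln 2) \<partial>(\<mu> \<Otimes>\<^sub>M \<mu>)) = (\<integral>\<^sup>+z. ?g z + ?k z \<partial>(\<mu> \<Otimes>\<^sub>M \<mu>))"
    by (rule nn_integral_cong) (rule pt)
  then have eq: "(\<integral>\<^sup>+z. ?f z \<partial>(\<mu> \<Otimes>\<^sub>M \<mu>)) + ennreal (2 * ln 2) = (\<integral>\<^sup>+z. ?g z \<partial>(\<mu> \<Otimes>\<^sub>M \<mu>)) + (\<integral>\<^sup>+z. ?k z \<partial>(\<mu> \<Otimes>\<^sub>M \<mu>))"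
    by (subst (asm) nn_integral_add, measurable, subst (asm) nn_integral_add, measurable)
       (simp add: mm.P.emeasure_space_1)
  have k: "(\<integral>\<^sup>+z. ?k z \<partial>(\<mu> \<Otimes>\<^sub>M \<mu>)) = mutual_energy \<mu> \<mu>"
    unfolding mutual_energy_def log_pot_def using \<mu>.nn_integral_fst[of ?k \<mu>] by simp
  have "(\<integral>\<^sup>+z. ?g z \<partial>(\<mu> \<Otimes>\<^sub>M \<mu>)) \<le> (\<integral>\<^sup>+z. ennreal (2 * ln 2) \<partial>(\<mu> \<Otimes>\<^sub>M \<mu>))"
    by (rule nn_integral_mono) (rule gle)
  also have "\<dots> = ennreal (2 * ln 2)" by (simp add: mm.P.emeasure_space_1)
  finally obtain r where r: "(\<integral>\<^sup>+z. ?g z \<partial>(\<mu> \<Otimes>\<^sub>M \<mu>)) = ennreal r" "0 \<le> r"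
    by (cases "\<integral>\<^sup>+z. ?g z \<partial>(\<mu> \<Otimes>\<^sub>M \<mu>)") (auto simp: top_unique)
  show ?thesis
    unfolding log_energy_def r(1) by (rule ereal_shift) (use eq k r c in simp_all)
qed

lemma prob_measures_integrable:
  assumes "\<mu> \<in> prob_measures" "continuous_on I2 f" shows "integrable \<mu> (f :: real \<Rightarrow> real)"
  using assms prob_measuresD(3)[OF assms(1)]
  by (intro finite_measure.L2_integrable I2_measure.continuous_L2) (auto simp: I2_measure_def)

lemma energy_finite:
  assumes \<mu>: "\<mu> \<in> prob_measures" and a: "mutual_energy \<mu> \<mu> = ennreal a" "0 \<le> a"
  shows "energy V \<mu> = ereal ((\<integral>x. V x \<partial>\<mu>) + a - 2 * ln 2)"
  using a by (simp add: energy_def log_energy_eq_mutual[OF \<mu>])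

text \<open>A convex combination is the law of a random choice between the two measures, which makes its
  measurability and its integrals instances of the rules for \<open>bind\<close>.\<close>

lemma mixture_exists:
  assumes \<mu>: "\<mu> \<in> prob_measures" and \<nu>: "\<nu> \<in> prob_measures" and t: "0 \<le> t" "t \<le> 1"
  obtains \<eta> where "\<eta> \<in> prob_measures"
    "\<And>f. f \<in> borel_measurable (restrict_space borel I2) \<Longrightarrow>
      (\<integral>\<^sup>+x. f x \<partial>\<eta>) = ennreal t * (\<integral>\<^sup>+x. f x \<partial>\<nu>) + ennreal (1 - t) * (\<integral>\<^sup>+x. f x \<partial>\<mu>)"
proof -
  let ?B = "restrict_space borel I2 :: real measure"
  let ?N = "\<lambda>b. if b then \<nu> else \<mu>"
  have N: "?N \<in> measurable (measure_pmf (bernoulli_pmf t)) (subprob_algebra ?B)"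
  proof -
    have "?N b \<in> space (subprob_algebra ?B)" for b
      using prob_measuresD(1,2)[OF \<mu>] prob_measuresD(1,2)[OF \<nu>]
      by (cases b) (simp_all only: if_True if_False space_subprob_algebra mem_Collect_eq prob_space_imp_subprob_space)
    then show ?thesis by simp
  qed
  let ?\<eta> = "measure_pmf (bernoulli_pmf t) \<bind> ?N"
  have s: "sets ?\<eta> = sets ?B"
    by (rule sets_bind) (auto simp: prob_measuresD[OF \<mu>] prob_measuresD[OF \<nu>])
  have p: "prob_space ?\<eta>"
    using prob_measuresD(1)[OF \<mu>] prob_measuresD(1)[OF \<nu>]
    by (intro measure_pmf.prob_space_bind[OF _ N] AE_I2) (auto split: if_split)
  have nn: "(\<integral>\<^sup>+x. f x \<partial>?\<eta>) = ennreal t * (\<integral>\<^sup>+x. f x \<partial>\<nu>) + ennreal (1 - t) * (\<integral>\<^sup>+x. f x \<partial>\<mu>)"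
    if "f \<in> borel_measurable ?B" for f
    using t by (subst nn_integral_bind[OF that N]) (simp add: mult.commute)
  show ?thesis by (rule that[of ?\<eta>]) (auto simp: prob_measures_def s p nn)
qed

text \<open>Adding a bound of \<open>V\<close> reduces signed integrands to nonnegative ones.\<close>

lemma mixture_integral:
  assumes \<mu>: "\<mu> \<in> prob_measures" and \<nu>: "\<nu> \<in> prob_measures" and \<eta>: "\<eta> \<in> prob_measures"
    and t: "0 \<le> t" "t \<le> 1"
    and nn: "\<And>f. f \<in> borel_measurable (restrict_space borel I2) \<Longrightarrow>
      (\<integral>\<^sup>+x. f x \<partial>\<eta>) = ennreal t * (\<integral>\<^sup>+x. f x \<partial>\<nu>) + ennreal (1 - t) * (\<integral>\<^sup>+x. f x \<partial>\<mu>)"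
    and V: "continuous_on I2 V"
  shows "(\<integral>x. V x \<partial>\<eta>) = t * (\<integral>x. V x \<partial>\<nu>) + (1 - t) * (\<integral>x. V x \<partial>\<mu>)"
proof -
  obtain B where B: "0 \<le> B" "\<And>x. x \<in> I2 \<Longrightarrow> \<bar>V x\<bar> \<le> B" using continuous_bounded_I2[OF V] by blast
  have Vm: "(\<lambda>x. ennreal (V x + B)) \<in> borel_measurable (restrict_space borel I2)"
    using borel_measurable_continuous_on_restrict[OF V] by measurable
  have eq: "(\<integral>\<^sup>+x. ennreal (V x + B) \<partial>M) = ennreal ((\<integral>x. V x \<partial>M) + B)" "0 \<le> (\<integral>x. V x \<partial>M) + B"
    if M: "M \<in> prob_measures" for M
  proof -
    interpret prob_space M using M by (rule prob_measuresD)
    have sp: "space M = I2" by (rule I2_measure.space_M[OF prob_measuresD(3)[OF M]])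
    have int: "integrable M V" by (rule prob_measures_integrable[OF M V])
    have nnB: "0 \<le> V x + B" if "x \<in> space M" for x using B(2)[of x] that by (simp add: sp abs_le_iff)
    have i: "(\<integral>x. V x + B \<partial>M) = (\<integral>x. V x \<partial>M) + B" using int by (simp add: prob_space)
    have "(\<integral>\<^sup>+x. ennreal (V x + B) \<partial>M) = ennreal (\<integral>x. V x + B \<partial>M)"
      using int nnB by (intro nn_integral_eq_integral AE_I2) auto
    then show "(\<integral>\<^sup>+x. ennreal (V x + B) \<partial>M) = ennreal ((\<integral>x. V x \<partial>M) + B)" unfolding i .
    have "0 \<le> (\<integral>x. V x + B \<partial>M)" by (intro integral_nonneg_AE AE_I2 nnB)
    then show "0 \<le> (\<integral>x. V x \<partial>M) + B" unfolding i .
  qed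
  have "ennreal ((\<integral>x. V x \<partial>\<eta>) + B) = ennreal (t * ((\<integral>x. V x \<partial>\<nu>) + B) + (1 - t) * ((\<integral>x. V x \<partial>\<mu>) + B))"
    using nn[OF Vm] t eq(2)[OF \<mu>] eq(2)[OF \<nu>]
    by (simp add: eq(1)[OF \<mu>] eq(1)[OF \<nu>] eq(1)[OF \<eta>] ennreal_mult[symmetric] ennreal_plus[symmetric] del: ennreal_plus)
  moreover have "0 \<le> t * ((\<integral>x. V x \<partial>\<nu>) + B) + (1 - t) * ((\<integral>x. V x \<partial>\<mu>) + B)"
    using t eq(2)[OF \<mu>] eq(2)[OF \<nu>] by simp
  ultimately have "(\<integral>x. V x \<partial>\<eta>) + B = t * ((\<integral>x. V x \<partial>\<nu>) + B) + (1 - t) * ((\<integral>x. V x \<partial>\<mu>) + B)"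
    using eq(2)[OF \<eta>] by simp
  then show ?thesis by (simp add: algebra_simps)
qed

text \<open>The energy of $(1-t)\mu+t\nu$ is a quadratic polynomial in \<open>t\<close> with a minimum at 0 over $[0,1]$, so
  its derivative at 0 is nonnegative.\<close>

lemma first_variation:
  assumes min: "is_minimizer V \<mu>" and V: "continuous_on I2 V" and \<nu>: "\<nu> \<in> prob_measures"
    and a: "mutual_energy \<mu> \<mu> = ennreal a" "0 \<le> a" and b: "mutual_energy \<nu> \<mu> = ennreal b" "0 \<le> b"
    and d: "mutual_energy \<nu> \<nu> = ennreal d" "0 \<le> d"
  shows "(\<integral>x. V x \<partial>\<mu>) + 2 * a \<le> (\<integral>x. V x \<partial>\<nu>) + 2 * b"
proof -
  have \<mu>: "\<mu> \<in> prob_measures" using min by (simp add: is_minimizer_def)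
  define X where "X = (\<integral>x. V x \<partial>\<nu>) - (\<integral>x. V x \<partial>\<mu>) + 2 * b - 2 * a"
  define Y where "Y = d - 2 * b + a"
  have pos: "0 \<le> X + t * Y" if t: "0 < t" "t \<le> 1" for t
  proof -
    have t': "0 \<le> t" "t \<le> 1" using t by auto
    obtain \<eta> where \<eta>: "\<eta> \<in> prob_measures" and nn: "\<And>f. f \<in> borel_measurable (restrict_space borel I2) \<Longrightarrow>
      (\<integral>\<^sup>+x. f x \<partial>\<eta>) = ennreal t * (\<integral>\<^sup>+x. f x \<partial>\<nu>) + ennreal (1 - t) * (\<integral>\<^sup>+x. f x \<partial>\<mu>)"
      using mixture_exists[OF \<mu> \<nu> t'] by blast
    have pot: "log_pot \<eta> x = ennreal t * log_pot \<nu> x + ennreal (1 - t) * log_pot \<mu> x" for x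
      unfolding log_pot_def by (rule nn[OF log_kernel_measurable1[OF refl]])
    have mut: "mutual_energy M \<eta> = ennreal t * mutual_energy M \<nu> + ennreal (1 - t) * mutual_energy M \<mu>" if M: "M \<in> prob_measures" for M
    proof -
      note [measurable] = log_pot_measurable[OF \<mu> prob_measuresD(2)[OF M]] log_pot_measurable[OF \<nu> prob_measuresD(2)[OF M]]
      show ?thesis unfolding mutual_energy_def pot by (simp add: nn_integral_add nn_integral_cmult)
    qed
    have "mutual_energy \<eta> \<eta> = ennreal t * mutual_energy \<eta> \<nu> + ennreal (1 - t) * mutual_energy \<eta> \<mu>" by (rule mut[OF \<eta>])
    also have "mutual_energy \<eta> \<nu> = ennreal t * mutual_energy \<nu> \<nu> + ennreal (1 - t) * mutual_energy \<nu> \<mu>"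
      unfolding mutual_energy_commute[OF \<eta> \<nu>] by (rule mut[OF \<nu>])
    also have "mutual_energy \<eta> \<mu> = ennreal t * mutual_energy \<nu> \<mu> + ennreal (1 - t) * mutual_energy \<mu> \<mu>"
      unfolding mutual_energy_commute[OF \<eta> \<mu>] mutual_energy_commute[OF \<nu> \<mu>] by (rule mut[OF \<mu>])
    finally have "mutual_energy \<eta> \<eta> = ennreal (t * (t * d + (1 - t) * b) + (1 - t) * (t * b + (1 - t) * a))"
      using t' a b d by (simp add: ennreal_mult[symmetric] ennreal_plus[symmetric] del: ennreal_plus)
    then have E: "energy V \<eta> = ereal ((\<integral>x. V x \<partial>\<eta>) + (t * (t * d + (1 - t) * b) + (1 - t) * (t * b + (1 - t) * a)) - 2 * ln 2)"
      using t' a b d by (intro energy_finite[OF \<eta>]) auto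
    have "(\<integral>x. V x \<partial>\<eta>) = t * (\<integral>x. V x \<partial>\<nu>) + (1 - t) * (\<integral>x. V x \<partial>\<mu>)"
      by (rule mixture_integral[OF \<mu> \<nu> \<eta> t' _ V]) (rule nn)
    note E[unfolded this]
    moreover have "energy V \<mu> \<le> energy V \<eta>" using min \<eta> by (simp add: is_minimizer_def)
    ultimately have "(\<integral>x. V x \<partial>\<mu>) + a \<le> t * (\<integral>x. V x \<partial>\<nu>) + (1 - t) * (\<integral>x. V x \<partial>\<mu>)
        + (t * (t * d + (1 - t) * b) + (1 - t) * (t * b + (1 - t) * a))"
      unfolding energy_finite[OF \<mu> a] by simp
    then have "0 \<le> t * (X + t * Y)" by (simp add: X_def Y_def algebra_simps)
    then show ?thesis using t(1) by (simp add: zero_le_mult_iff)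
  qed
  have "(\<lambda>n. X + err n * Y) \<longlonglongrightarrow> X + 0 * Y" by (intro tendsto_intros err_tendsto)
  moreover have "0 \<le> X + err n * Y" for n using pos[OF err_pos] by (simp add: err_def)
  ultimately have "0 \<le> X + 0 * Y" by (intro LIMSEQ_le_const) auto
  then show ?thesis by (simp add: X_def)
qed


text \<open>Off the diagonal the kernel is continuous; on the diagonal it tends to infinity.\<close>

lemma log_kernel_lsc:
  assumes y: "y \<longlonglongrightarrow> x"
  shows "log_kernel x z \<le> liminf (\<lambda>k. log_kernel (y k) z)"
proof (cases "x = z")
  case False
  then have ne: "\<forall>\<^sub>F k in sequentially. y k \<noteq> z" by (rule tendsto_imp_eventually_ne[OF y])
  have "(\<lambda>k. ennreal (2 * ln 2 - ln \<bar>y k - z\<bar>)) \<longlonglongrightarrow> ennreal (2 * ln 2 - ln \<bar>x - z\<bar>)"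
    using False by (intro tendsto_ennrealI tendsto_intros y) auto
  moreover have "\<forall>\<^sub>F k in sequentially. ennreal (2 * ln 2 - ln \<bar>y k - z\<bar>) = log_kernel (y k) z"
    using ne by eventually_elim (simp add: log_kernel_def)
  ultimately have "(\<lambda>k. log_kernel (y k) z) \<longlonglongrightarrow> ennreal (2 * ln 2 - ln \<bar>x - z\<bar>)"
    by (rule Lim_transform_eventually)
  then have "(\<lambda>k. log_kernel (y k) z) \<longlonglongrightarrow> log_kernel x z"
    using False by (simp add: log_kernel_def)
  from lim_imp_Liminf[OF sequentially_bot this] show ?thesis by simp
next
  case True
  show ?thesis
    unfolding le_Liminf_iff
  proof (intro allI impI)
    fix c assume "c < log_kernel x z"
    then obtain r where r: "c = ennreal r" "0 \<le> r" by (cases c) (auto simp: log_kernel_def)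
    have "\<forall>\<^sub>F k in sequentially. dist (y k) x < exp (- r)"
      using y by (rule tendstoD) simp
    then show "\<forall>\<^sub>F k in sequentially. c < log_kernel (y k) z"
    proof eventually_elim
      case (elim k)
      show ?case
      proof (cases "y k = z")
        case False
        then have "ln \<bar>y k - z\<bar> < ln (exp (- r))"
          using elim True by (subst ln_less_cancel_iff) (auto simp: dist_real_def)
        moreover have "ln (exp (- r)) = - r" by (rule ln_exp)
        moreover have "0 < ln (2 :: real)" by simp
        ultimately have "r < 2 * ln 2 - ln \<bar>y k - z\<bar>" by linarith
        then show ?thesis using False r by (simp add: log_kernel_def ennreal_lessI)
      qed (simp add: r log_kernel_def)
    qed
  qed
qed

text \<open>Lower semicontinuity of potentials, by Fatou's lemma.\<close>

lemma log_pot_lsc: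
  assumes \<mu>: "\<mu> \<in> prob_measures" and y: "y \<longlonglongrightarrow> x"
  shows "log_pot \<mu> x \<le> liminf (\<lambda>k. log_pot \<mu> (y k))"
proof -
  have "log_pot \<mu> x \<le> (\<integral>\<^sup>+z. liminf (\<lambda>k. log_kernel (y k) z) \<partial>\<mu>)"
    unfolding log_pot_def by (intro nn_integral_mono log_kernel_lsc y)
  also have "\<dots> \<le> liminf (\<lambda>k. log_pot \<mu> (y k))"
    unfolding log_pot_def by (intro nn_integral_liminf log_kernel_measurable1 prob_measuresD \<mu>)
  finally show ?thesis .
qed

text \<open>The conditioned measure is at most a multiple of \<open>\<mu>\<close>, so its energies remain finite.\<close>

lemma uniform_measure_energy:
  assumes \<mu>: "\<mu> \<in> prob_measures" and fin: "mutual_energy \<mu> \<mu> < \<infinity>" and B: "B \<in> sets \<mu>" "emeasure \<mu> B \<noteq> 0"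
  defines "\<nu> \<equiv> uniform_measure \<mu> B"
  shows "\<nu> \<in> prob_measures" "mutual_energy \<nu> \<mu> < \<infinity>" "mutual_energy \<nu> \<nu> < \<infinity>"
proof -
  interpret \<mu>: prob_space \<mu> using \<mu> by (rule prob_measuresD)
  have m: "emeasure \<mu> B \<noteq> \<infinity>" by simp
  show \<nu>: "\<nu> \<in> prob_measures"
    using prob_space_uniform_measure[OF B(2) m] prob_measuresD(2)[OF \<mu>]
    by (simp add: prob_measures_def \<nu>_def)
  have le: "(\<integral>\<^sup>+x. f x \<partial>\<nu>) \<le> (\<integral>\<^sup>+x. f x \<partial>\<mu>) / emeasure \<mu> B" if f: "f \<in> borel_measurable \<mu>" for f
    unfolding \<nu>_def nn_integral_uniform_measure[OF f B(1)]
    by (intro divide_right_mono_ennreal nn_integral_mono) (auto simp: indicator_def)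
  have fin_div: "a / emeasure \<mu> B < \<infinity>" if "a < \<infinity>" for a
    using that B(2) by (simp add: less_top[symmetric] ennreal_divide_eq_top_iff)
  have "mutual_energy \<nu> \<mu> \<le> mutual_energy \<mu> \<mu> / emeasure \<mu> B"
    unfolding mutual_energy_def by (rule le) (rule log_pot_measurable[OF \<mu> prob_measuresD(2)[OF \<mu>]])
  also have "\<dots> < \<infinity>" using fin by (rule fin_div)
  finally show 1: "mutual_energy \<nu> \<mu> < \<infinity>" .
  have "mutual_energy \<nu> \<nu> \<le> (\<integral>\<^sup>+x. log_pot \<mu> x / emeasure \<mu> B \<partial>\<nu>)"
    unfolding mutual_energy_def log_pot_def
    by (intro nn_integral_mono le log_kernel_measurable1 prob_measuresD \<mu>)
  also have "\<dots> = mutual_energy \<nu> \<mu> / emeasure \<mu> B"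
    unfolding mutual_energy_def using log_pot_measurable[OF \<mu> prob_measuresD(2)[OF \<nu>]] by (rule nn_integral_divide)
  also have "\<dots> < \<infinity>" using 1 by (rule fin_div)
  finally show "mutual_energy \<nu> \<nu> < \<infinity>" .
qed

text \<open>A finite potential excludes an atom at \<open>x\<close>, where the kernel is infinite whereas \<open>ln 0 = 0\<close>.\<close>

lemma integral_ln_log_pot:
  assumes \<mu>: "\<mu> \<in> prob_measures" and x: "x \<in> I2" and fin: "log_pot \<mu> x < \<infinity>"
  shows "(\<integral>y. ln \<bar>x - y\<bar> \<partial>\<mu>) = 2 * ln 2 - enn2real (log_pot \<mu> x)"
proof -
  interpret \<mu>: prob_space \<mu> using \<mu> by (rule prob_measuresD)
  interpret M: I2_measure \<mu> using \<mu> by (rule prob_measuresD)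
  have km: "log_kernel x \<in> borel_measurable \<mu>" by (rule log_kernel_measurable1[OF M.sets_M])
  have "AE y in \<mu>. log_kernel x y \<noteq> \<infinity>"
    using fin by (intro nn_integral_PInf_AE km) (simp add: log_pot_def less_top)
  then have ae: "AE y in \<mu>. log_kernel x y = ennreal (2 * ln 2 - ln \<bar>x - y\<bar>)"
    by eventually_elim (auto simp: log_kernel_def)
  have m: "(\<lambda>y. 2 * ln 2 - ln \<bar>x - y\<bar>) \<in> borel_measurable \<mu>" by (rule M.borel_imp_measurable) simp
  have nn: "AE y in \<mu>. 0 \<le> 2 * ln 2 - ln \<bar>x - y\<bar>"
    using ln_abs_diff_le[OF x] by (intro AE_I2) (simp add: M.space_M)
  have eq: "(\<integral>\<^sup>+y. ennreal (2 * ln 2 - ln \<bar>x - y\<bar>) \<partial>\<mu>) = log_pot \<mu> x"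
    unfolding log_pot_def
  proof (rule nn_integral_cong_AE)
    show "AE y in \<mu>. ennreal (2 * ln 2 - ln \<bar>x - y\<bar>) = log_kernel x y"
      using ae by eventually_elim simp
  qed
  have int: "integrable \<mu> (\<lambda>y. 2 * ln 2 - ln \<bar>x - y\<bar>)"
    using fin eq by (intro integrableI_nonneg m nn) simp
  have "(\<integral>y. 2 * ln 2 - ln \<bar>x - y\<bar> \<partial>\<mu>) = enn2real (log_pot \<mu> x)"
    unfolding eq[symmetric] by (rule integral_eq_nn_integral[OF m nn])
  moreover have "(\<integral>y. ln \<bar>x - y\<bar> \<partial>\<mu>) = (\<integral>y. 2 * ln 2 - (2 * ln 2 - ln \<bar>x - y\<bar>) \<partial>\<mu>)" by simp
  moreover have "\<dots> = 2 * ln 2 - (\<integral>y. 2 * ln 2 - ln \<bar>x - y\<bar> \<partial>\<mu>)"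
    by (subst Bochner_Integration.integral_diff[OF _ int]) (simp_all add: \<mu>.prob_space)
  ultimately show ?thesis by simp
qed

lemma integral_enn2real:
  assumes f: "f \<in> borel_measurable M" and fin: "(\<integral>\<^sup>+x. f x \<partial>M) < \<infinity>"
  shows "integrable M (\<lambda>x. enn2real (f x))" "(\<integral>x. enn2real (f x) \<partial>M) = enn2real (\<integral>\<^sup>+x. f x \<partial>M)"
proof -
  have "AE x in M. f x \<noteq> \<infinity>" using f fin by (intro nn_integral_PInf_AE) (auto simp: less_top)
  then have "AE x in M. ennreal (enn2real (f x)) = f x" by eventually_elim (simp add: less_top)
  then have eq: "(\<integral>\<^sup>+x. ennreal (enn2real (f x)) \<partial>M) = (\<integral>\<^sup>+x. f x \<partial>M)" by (rule nn_integral_cong_AE)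
  have m: "(\<lambda>x. enn2real (f x)) \<in> borel_measurable M" using f by measurable
  show "integrable M (\<lambda>x. enn2real (f x))" using fin eq by (intro integrableI_nonneg m) auto
  show "(\<integral>x. enn2real (f x) \<partial>M) = enn2real (\<integral>\<^sup>+x. f x \<partial>M)"
    unfolding eq[symmetric] by (rule integral_eq_nn_integral[OF m]) simp
qed


section \<open>Minimizers of the logarithmic energy\<close>

text \<open>The Euler--Lagrange condition for a minimizer with full support. The first variation in the
  direction of restrictions of \<open>\<mu>\<close> gives equality of $V+2U^\mu$ with a constant on a set of full
  \<open>\<mu>\<close>-measure, which is dense; lower semicontinuity turns this into an upper bound everywhere. The
  potential of \<open>beta\<close> is constant, so the first variation in the direction of \<open>beta\<close> identifies the
  constant and forces equality almost everywhere.\<close>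

lemma minimizer_potential:
  assumes V: "continuous_on I2 V" and min: "is_minimizer V \<mu>" and supp: "supp \<mu> = I2"
  shows "mutual_energy \<mu> \<mu> < \<infinity>"
    and "(\<integral>x. V x \<partial>\<mu>) + 2 * enn2real (mutual_energy \<mu> \<mu>) = (\<integral>x. V x \<partial>beta) + 4 * ln 2"
    and "AE x in beta. log_pot \<mu> x < \<infinity> \<and> V x + 2 * enn2real (log_pot \<mu> x) = (\<integral>x. V x \<partial>beta) + 4 * ln 2"
proof -
  have \<mu>: "\<mu> \<in> prob_measures" using min by (simp add: is_minimizer_def)
  interpret \<mu>: prob_space \<mu> using \<mu> by (rule prob_measuresD)
  interpret M: I2_measure \<mu> using \<mu> by (rule prob_measuresD)
  have ln2: "0 \<le> 2 * ln (2::real)" by simp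
  have mb: "mutual_energy beta beta = ennreal (2 * ln 2)" by (rule mutual_energy_beta[OF beta_prob_measures])
  have "energy V \<mu> \<le> energy V beta" using min beta_prob_measures by (simp add: is_minimizer_def)
  also have "\<dots> = ereal (\<integral>x. V x \<partial>beta)"
    using energy_finite[OF beta_prob_measures mb ln2] by simp
  finally have "energy V \<mu> \<noteq> \<infinity>" by auto
  then show fin: "mutual_energy \<mu> \<mu> < \<infinity>"
    by (cases "mutual_energy \<mu> \<mu>") (auto simp: energy_def log_energy_eq_mutual[OF \<mu>])
  define a where "a = enn2real (mutual_energy \<mu> \<mu>)"
  have a: "mutual_energy \<mu> \<mu> = ennreal a" "0 \<le> a" using fin by (simp_all add: a_def less_top)
  define c where "c = (\<integral>x. V x \<partial>\<mu>) + 2 * a"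
  define u where "u x = enn2real (log_pot \<mu> x)" for x
  have pm: "log_pot \<mu> \<in> borel_measurable \<mu>" by (rule log_pot_measurable[OF \<mu> M.sets_M])
  have pmb: "log_pot \<mu> \<in> borel_measurable beta" by (rule log_pot_measurable[OF \<mu> sets_beta])
  have Vm: "V \<in> borel_measurable \<mu>" by (rule M.continuous_measurable[OF V])
  have Vint: "integrable \<mu> V" by (rule prob_measures_integrable[OF \<mu> V])
  note [measurable] = pm Vm
  have u: "integrable \<mu> u" "(\<integral>x. u x \<partial>\<mu>) = a"
    using integral_enn2real[OF pm] fin by (simp_all add: u_def[abs_def] a_def mutual_energy_def)
  have pfin: "AE x in \<mu>. log_pot \<mu> x \<noteq> \<infinity>"
    using fin by (intro nn_integral_PInf_AE pm) (simp add: mutual_energy_def less_top)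

  \<comment> \<open>If $V+2U^\mu<c$ on a set of positive measure, moving mass into this set would lower the energy.\<close>
  define B where "B = {x \<in> space \<mu>. log_pot \<mu> x \<noteq> \<infinity> \<and> V x + 2 * u x < c}"
  have Bm: "B \<in> sets \<mu>" unfolding B_def u_def by measurable
  have B0: "emeasure \<mu> B = 0"
  proof (rule ccontr)
    assume nz: "emeasure \<mu> B \<noteq> 0"
    define \<nu> where "\<nu> = uniform_measure \<mu> B"
    note en = uniform_measure_energy[OF \<mu> fin Bm nz, folded \<nu>_def]
    interpret \<nu>: prob_space \<nu> using en(1) by (rule prob_measuresD)
    have cle: "c \<le> (\<integral>x. V x \<partial>\<nu>) + 2 * enn2real (mutual_energy \<nu> \<mu>)"
      unfolding c_def using en
      by (intro first_variation[OF min V en(1) a, where d = "enn2real (mutual_energy \<nu> \<nu>)"]) (auto simp: less_top)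
    have pmn: "log_pot \<mu> \<in> borel_measurable \<nu>" by (rule log_pot_measurable[OF \<mu> prob_measuresD(2)[OF en(1)]])
    have un: "integrable \<nu> u" "(\<integral>x. u x \<partial>\<nu>) = enn2real (mutual_energy \<nu> \<mu>)"
      using integral_enn2real[OF pmn] en(2) by (simp_all add: u_def[abs_def] mutual_energy_def)
    have Vn: "integrable \<nu> V" by (rule prob_measures_integrable[OF en(1) V])
    have val: "(\<integral>x. c - V x - 2 * u x \<partial>\<nu>) = c - (\<integral>x. V x \<partial>\<nu>) - 2 * enn2real (mutual_energy \<nu> \<mu>)"
      using un Vn by (simp add: \<nu>.prob_space)
    have aeB: "AE x in \<nu>. x \<in> B"
      unfolding \<nu>_def using nz by (intro AE_uniform_measureI Bm) auto
    then have pos: "AE x in \<nu>. 0 < c - V x - 2 * u x" by eventually_elim (simp add: B_def)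
    then have nnn: "AE x in \<nu>. 0 \<le> c - V x - 2 * u x" by eventually_elim simp
    have int: "integrable \<nu> (\<lambda>x. c - V x - 2 * u x)" using un Vn by simp
    have "(\<integral>x. c - V x - 2 * u x \<partial>\<nu>) = 0"
      using integral_nonneg_AE[OF nnn] cle val by linarith
    then have "AE x in \<nu>. c - V x - 2 * u x = 0"
      using integral_nonneg_eq_0_iff_AE[OF int nnn] by simp
    with pos have "AE x in \<nu>. False" by eventually_elim simp
    then show False by (simp add: \<nu>.AE_False)
  qed
  have "AE x in \<mu>. x \<notin> B" using B0 Bm by (intro AE_not_in) (simp add: null_sets_def)
  then have ge: "AE x in \<mu>. 0 \<le> V x + 2 * u x - c"
    using pfin AE_space by eventually_elim (auto simp: B_def)
  \<comment> \<open>The constant \<open>c\<close> is the mean of $V+2U^\mu$, so the inequality is an equality almost everywhere.\<close>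
  have "(\<integral>x. V x + 2 * u x - c \<partial>\<mu>) = 0"
    using u Vint by (simp add: \<mu>.prob_space c_def)
  then have "AE x in \<mu>. V x + 2 * u x - c = 0"
    using u Vint integral_nonneg_eq_0_iff_AE[OF _ ge] by simp
  then have eq: "AE x in \<mu>. log_pot \<mu> x \<noteq> \<infinity> \<and> V x + 2 * u x = c"
    using pfin by eventually_elim simp

  define D where "D = {x \<in> space \<mu>. log_pot \<mu> x \<noteq> \<infinity> \<and> V x + 2 * u x = c}"
  have Dm: "D \<in> sets \<mu>" unfolding D_def u_def by measurable
  have D1: "emeasure \<mu> (space \<mu> - D) = 0"
  proof -
    have "space \<mu> - D \<in> sets \<mu>" using Dm by (rule sets.compl_sets)
    moreover have "{x \<in> space \<mu>. \<not> (log_pot \<mu> x \<noteq> \<infinity> \<and> V x + 2 * u x = c)} = space \<mu> - D"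
      unfolding D_def by blast
    ultimately show ?thesis using eq by (simp only: AE_iff_measurable)
  qed
  \<comment> \<open>Points of \<open>D\<close> approach every point of the support, and $U^\mu$ can only drop in the limit.\<close>
  have upper: "log_pot \<mu> x < \<infinity> \<and> V x + 2 * u x \<le> c" if x: "x \<in> I2" for x
  proof -
    have "\<exists>y\<in>D. dist y x < err k" for k
    proof -
      have "open (ball x (err k))" "x \<in> ball x (err k)" by (simp_all add: err_pos)
      moreover have "x \<in> supp \<mu>" using x supp by simp
      ultimately have "0 < emeasure \<mu> (ball x (err k) \<inter> space \<mu>)" unfolding supp_def by blast
      moreover have "emeasure \<mu> (ball x (err k) \<inter> space \<mu>) \<le> emeasure \<mu> (space \<mu> - D)"
        if "ball x (err k) \<inter> D = {}"
        using that Dm by (intro emeasure_mono) auto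
      ultimately have "ball x (err k) \<inter> D \<noteq> {}" using D1 by fastforce
      then show ?thesis by (auto simp: dist_commute)
    qed
    then obtain y where y: "\<And>k. y k \<in> D" "\<And>k. dist (y k) x < err k" by metis
    have lim: "y \<longlonglongrightarrow> x"
      using y(2) by (intro tendsto_err[where C = 1]) (simp add: dist_real_def less_imp_le)
    have yI: "y k \<in> I2" for k using y(1)[of k] by (simp add: D_def M.space_M)
    have Vy: "(\<lambda>k. V (y k)) \<longlonglongrightarrow> V x"
      by (rule continuous_on_tendsto_compose[OF V lim x]) (intro always_eventually allI yI)
    then have half: "(\<lambda>k. (c - V (y k)) / 2) \<longlonglongrightarrow> (c - V x) / 2" by (intro tendsto_intros) auto
    have uy: "u (y k) = (c - V (y k)) / 2" for k using y(1)[of k] by (simp add: D_def)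
    have pot: "log_pot \<mu> (y k) = ennreal ((c - V (y k)) / 2)" for k
    proof -
      have "log_pot \<mu> (y k) = ennreal (u (y k))" using y(1)[of k] by (simp add: D_def u_def less_top)
      then show ?thesis by (simp add: uy)
    qed
    have "0 \<le> (c - V (y k)) / 2" for k
      unfolding uy[symmetric] u_def by (rule enn2real_nonneg)
    then have nn: "0 \<le> (c - V x) / 2" by (intro LIMSEQ_le_const[OF half]) auto
    have "log_pot \<mu> x \<le> liminf (\<lambda>k. log_pot \<mu> (y k))" by (rule log_pot_lsc[OF \<mu> lim])
    also have "\<dots> = ennreal ((c - V x) / 2)"
      unfolding pot by (rule lim_imp_Liminf[OF sequentially_bot tendsto_ennrealI[OF half]])
    finally have le: "log_pot \<mu> x \<le> ennreal ((c - V x) / 2)" .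
    then have "u x \<le> (c - V x) / 2"
      unfolding u_def using enn2real_mono[OF le] nn by simp
    then show ?thesis using le by (auto intro: le_less_trans)
  qed

  have mbu: "mutual_energy beta \<mu> = ennreal (2 * ln 2)"
    using mutual_energy_commute[OF beta_prob_measures \<mu>] mutual_energy_beta[OF \<mu>] by simp
  have ub: "integrable beta u" "(\<integral>x. u x \<partial>beta) = 2 * ln 2"
    using integral_enn2real[OF pmb] mbu by (simp_all add: u_def[abs_def] mutual_energy_def)
  have Vb: "integrable beta V" by (intro beta.L2_integrable beta.continuous_L2 V)
  \<comment> \<open>The first variation towards \<open>beta\<close> bounds \<open>c\<close> by the mean of $V+2U^\mu$ under \<open>beta\<close>, and
    \<open>upper\<close> gives the reverse inequality pointwise; so it is an equality almost everywhere.\<close>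
  have cle: "c \<le> (\<integral>x. V x \<partial>beta) + 2 * (2 * ln 2)"
    unfolding c_def by (rule first_variation[OF min V beta_prob_measures a mbu ln2 mb ln2])
  have int: "integrable beta (\<lambda>x. c - V x - 2 * u x)" using ub Vb by simp
  have nn: "AE x in beta. 0 \<le> c - V x - 2 * u x"
    using upper by (intro AE_I2) (fastforce simp: space_beta)
  have val: "(\<integral>x. c - V x - 2 * u x \<partial>beta) = c - (\<integral>x. V x \<partial>beta) - 4 * ln 2"
    using ub Vb by (simp add: space_beta)
  have zero: "(\<integral>x. c - V x - 2 * u x \<partial>beta) = 0"
    using integral_nonneg_AE[OF nn] cle val by linarith
  then have cF: "c = (\<integral>x. V x \<partial>beta) + 4 * ln 2" using val by linarith
  then show "(\<integral>x. V x \<partial>\<mu>) + 2 * enn2real (mutual_energy \<mu> \<mu>) = (\<integral>x. V x \<partial>beta) + 4 * ln 2"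
    by (simp add: c_def a_def)
  have "AE x in beta. c - V x - 2 * u x = 0"
    using integral_nonneg_eq_0_iff_AE[OF int nn] zero by simp
  then show "AE x in beta. log_pot \<mu> x < \<infinity> \<and> V x + 2 * enn2real (log_pot \<mu> x) = (\<integral>x. V x \<partial>beta) + 4 * ln 2"
    using AE_space
  proof eventually_elim
    case (elim x)
    then show ?case using upper[of x] by (simp add: space_beta u_def cF)
  qed
qed

text \<open>The Euler--Lagrange condition gives $2U^\mu=\int V\,d\beta-V$ almost everywhere for the unshifted
  potential. Integrated against $\mathcal{N}V\,d\beta$ and with the integrals exchanged, this yields
  $\int\mathcal{E}\mathcal{N}V\,d\mu=-\frac12\langle\mathcal{N}V,V\rangle$, which
  determines $\int V\,d\mu$. The energy is half the sum of $\int V\,d\mu$ and the Euler--Lagrange constant.\<close>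

lemma min_energy_eq:
  assumes V: "Ck 2 V" and min: "is_minimizer V \<mu>" and supp: "supp \<mu> = I2"
  shows "min_energy V = ereal ((\<integral>x. V x \<partial>beta) - 1 / 4 * ip beta (N_op V) V)"
proof -
  have cV: "continuous_on I2 V" and cN: "continuous_on I2 (N_op V)"
    using V by (auto intro: Ck_continuous continuous_N_op)
  have \<mu>: "\<mu> \<in> prob_measures" using min by (simp add: is_minimizer_def)
  have M: "I2_measure \<mu>" using \<mu> by (rule prob_measuresD)
  interpret \<mu>: prob_space \<mu> using \<mu> by (rule prob_measuresD)
  note pot = minimizer_potential[OF cV min supp]
  define F where "F = (\<integral>x. V x \<partial>beta)"
  obtain B where B: "0 \<le> B" "\<And>x. x \<in> I2 \<Longrightarrow> \<bar>N_op V x\<bar> \<le> B" using continuous_bounded_I2[OF cN] by blast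
  have Nm: "N_op V \<in> borel_measurable beta" by (rule beta.continuous_measurable[OF cN])
  have NV: "integrable beta (\<lambda>x. N_op V x * V x)" "integrable beta (N_op V)"
    by (intro beta.L2_integrable beta.continuous_L2 continuous_intros cV cN)+
  have N0: "(\<integral>x. N_op V x \<partial>beta) = 0"
    using number_graph_N_op[OF V] by (auto simp: number_graph_iff ip_def phi_0 dest: spec[of _ 0])
  have "(\<integral>x. (\<integral>y. ln \<bar>x - y\<bar> \<partial>\<mu>) * N_op V x \<partial>beta) = (\<integral>x. 1 / 2 * (N_op V x * V x) - F / 2 * N_op V x \<partial>beta)"
  proof (rule integral_cong_AE)
    show "(\<lambda>x. (\<integral>y. ln \<bar>x - y\<bar> \<partial>\<mu>) * N_op V x) \<in> borel_measurable beta"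
      by (rule borel_measurable_integrable[OF integrable_potential[OF M Nm B(2)]])
    show "(\<lambda>x. 1 / 2 * (N_op V x * V x) - F / 2 * N_op V x) \<in> borel_measurable beta"
      by (intro beta.continuous_measurable continuous_intros cV cN)
    show "AE x in beta. (\<integral>y. ln \<bar>x - y\<bar> \<partial>\<mu>) * N_op V x = 1 / 2 * (N_op V x * V x) - F / 2 * N_op V x"
      using pot(3) AE_space
    proof eventually_elim
      case (elim x)
      then have "(\<integral>y. ln \<bar>x - y\<bar> \<partial>\<mu>) = 2 * ln 2 - enn2real (log_pot \<mu> x)"
        by (intro integral_ln_log_pot[OF \<mu>]) (auto simp: space_beta)
      also have "\<dots> = V x / 2 - F / 2" using elim by (simp add: F_def)
      finally have "(\<integral>y. ln \<bar>x - y\<bar> \<partial>\<mu>) = V x / 2 - F / 2" .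
      then show ?case by (simp only:) (simp add: algebra_simps)
    qed
  qed
  also have "\<dots> = 1 / 2 * ip beta (N_op V) V"
    using NV N0 by (simp add: ip_def)
  finally have "(\<integral>x. (\<integral>y. ln \<bar>x - y\<bar> \<partial>\<mu>) * N_op V x \<partial>beta) = 1 / 2 * ip beta (N_op V) V" .
  moreover have "(\<integral>x. (\<integral>y. ln \<bar>x - y\<bar> \<partial>\<mu>) * N_op V x \<partial>beta) = - (\<integral>y. E_op (N_op V) y \<partial>\<mu>)"
    by (rule integral_potential[OF M Nm B(2)])
  ultimately have E: "(\<integral>y. E_op (N_op V) y \<partial>\<mu>) = - (1 / 2 * ip beta (N_op V) V)"
    by linarith
  have "(\<integral>y. E_op (N_op V) y \<partial>\<mu>) = (\<integral>y. V y - F \<partial>\<mu>)"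
    by (rule Bochner_Integration.integral_cong) (simp_all add: I2_measure.space_M[OF M] E_op_N_op[OF V] F_def)
  also have "\<dots> = (\<integral>y. V y \<partial>\<mu>) - F"
    using prob_measures_integrable[OF \<mu> cV] by (simp add: \<mu>.prob_space)
  finally have V\<mu>: "(\<integral>y. V y \<partial>\<mu>) = F - 1 / 2 * ip beta (N_op V) V" using E by simp
  have "energy V \<mu> = ereal ((\<integral>x. V x \<partial>\<mu>) + enn2real (mutual_energy \<mu> \<mu>) - 2 * ln 2)"
    using pot(1) by (intro energy_finite[OF \<mu>]) (simp_all add: less_top)
  also have "(\<integral>x. V x \<partial>\<mu>) + enn2real (mutual_energy \<mu> \<mu>) - 2 * ln 2 = F - 1 / 4 * ip beta (N_op V) V"
    using pot(2) V\<mu> unfolding F_def[symmetric] by linarith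
  finally have "energy V \<mu> = ereal (F - 1 / 4 * ip beta (N_op V) V)" .
  moreover have "min_energy V = energy V \<mu>"
    unfolding min_energy_def using min \<mu>
    by (intro antisym INF_lower INF_greatest) (auto simp: is_minimizer_def)
  ultimately show ?thesis by (simp add: F_def)
qed

lemma ip_N_op_self:
  assumes V: "Ck 2 V"
  shows "ip beta (N_op V) V = 2 * (\<integral>(x, y). ((V x - V y) / (x - y))\<^sup>2 \<partial>omega)"
proof -
  have V1: "Ck 1 V" using Ck_mono[OF V, of 1] by simp
  have "ip beta (N_op V) V = 2 * omega_form V V"
    using ip_number_op[OF number_graph_N_op[OF V] Ck_L2[OF V]] C1_number_form(2)[OF V1 V1] by simp
  also have "omega_form V V = (\<integral>(x, y). ((V x - V y) / (x - y))\<^sup>2 \<partial>omega)"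
    by (simp add: omega_form_def power_divide power2_eq_square)
  finally show ?thesis .
qed


section \<open>The logarithmic potential and the counting number operator\<close>

theorem proposition1:
  shows
  "\<comment> \<open>(1)\<close>
   (\<forall>\<phi>. Ck 2 \<phi> \<longrightarrow> Ck 2 (E_op \<phi>) \<and>
      (\<forall>x\<in>{-2..2}. E_op (N_op \<phi>) x = \<phi> x - (\<integral>y. \<phi> y \<partial>beta) \<and>
                     N_op (E_op \<phi>) x = \<phi> x - (\<integral>y. \<phi> y \<partial>beta))) \<and>
   \<comment> \<open>(2)\<close>
   ((\<forall>x\<in>{-2..2}. E_op (phi 0) x = 0) \<and>
    (\<forall>n\<ge>1. \<forall>x\<in>{-2..2}. E_op (phi n) x = 1 / real n * phi n x) \<and>
    (\<forall>n. \<forall>x\<in>{-2..2}. N_op (phi n) x = real n * phi n x) \<and>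
    (\<forall>\<phi>. Ck 2 \<phi> \<longrightarrow> (\<phi>, N_op \<phi>) \<in> number_graph)) \<and>
   \<comment> \<open>(3)\<close>
   (\<forall>\<phi> \<psi>. Ck 1 \<phi> \<longrightarrow> Ck 1 \<psi> \<longrightarrow>
      \<phi> \<in> Domain number_graph \<and> \<psi> \<in> Domain number_graph \<and>
      ip beta (number_op \<phi>) \<psi> =
        2 * (\<integral>(x, y). (\<phi> x - \<phi> y) * (\<psi> x - \<psi> y) / (x - y)\<^sup>2 \<partial>omega) \<and>
      ip beta (number_op \<phi>) \<psi> = ip beta \<phi> (number_op \<psi>)) \<and>
   \<comment> \<open>(4)\<close>
   ((\<forall>\<phi>. Ck 2 \<phi> \<longrightarrow>
       \<phi> \<in> Domain number_graph \<and> number_op \<phi> \<in> Domain number_graph \<and>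
       (\<forall>\<psi>. Ck 1 \<psi> \<longrightarrow> ip beta (L_op \<phi>) \<psi> = 2 * (\<integral>x. dI \<phi> x * dI \<psi> x \<partial>alpha)) \<and>
       (AE x in beta. L_op \<phi> x = jacobi \<phi> x)) \<and>
    invariant_measure beta L_op {\<phi>. Ck 2 \<phi>} \<and>
    (\<exists>!G. selfadjoint beta G \<and> L_graph \<subseteq> G) \<and>
    (\<forall>G. selfadjoint beta G \<longrightarrow> L_graph \<subseteq> G \<longrightarrow>
       form_domain beta G = {\<phi>. \<exists>c. (\<lambda>x. \<phi> x - c) \<in> H_space})) \<and>
   \<comment> \<open>(5)\<close>
   (\<forall>V A \<mu>. Ck 3 V \<longrightarrow>
      (finite_signed_measure beta \<mu> \<and> \<mu> {-2..2} = A \<and>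
       (\<exists>C. AE x in lborel. x \<in> {-2..2} \<longrightarrow>
          2 * signed_integral beta \<mu> (\<lambda>y. ln \<bar>x - y\<bar>) = V x + C)) \<longleftrightarrow>
      (\<forall>B \<in> sets beta. \<mu> B = (LINT x:B|beta. A - 1 / 2 * N_op V x))) \<and>
   \<comment> \<open>(6)\<close>
   (\<forall>V \<mu>. Ck 3 V \<longrightarrow> is_minimizer V \<mu> \<longrightarrow> supp \<mu> = {-2..2} \<longrightarrow>
      min_energy V = ereal ((\<integral>x. V x \<partial>beta) - 1 / 4 * ip beta (N_op V) V) \<and>
      min_energy V = ereal ((\<integral>x. V x \<partial>beta)
        - 1 / 2 * (\<integral>(x, y). ((V x - V y) / (x - y))\<^sup>2 \<partial>omega)))"
proof (intro conjI allI impI ballI)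
  fix \<phi> x assume f: "Ck 2 \<phi>"
  show "Ck 2 (E_op \<phi>)" using f by (rule Ck_E_op)
  assume x: "x \<in> I2"
  show "E_op (N_op \<phi>) x = \<phi> x - (\<integral>y. \<phi> y \<partial>beta)" using f x by (rule E_op_N_op)
  show "N_op (E_op \<phi>) x = \<phi> x - (\<integral>y. \<phi> y \<partial>beta)" using f x by (rule N_op_E_op)
next
  fix x :: real assume x: "x \<in> I2"
  show "E_op (phi 0) x = 0" using E_op_phi[OF x, of 0] by simp
next
  fix n :: nat and x :: real assume x: "x \<in> I2"
  show "E_op (phi n) x = 1 / real n * phi n x" by (rule E_op_phi[OF x])
next
  fix n :: nat and x :: real assume x: "x \<in> I2"
  show "N_op (phi n) x = real n * phi n x" by (rule N_op_phi[OF x])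
next
  fix \<phi> assume f: "Ck 2 \<phi>"
  show "(\<phi>, N_op \<phi>) \<in> number_graph" using f by (rule number_graph_N_op)
next
  fix \<phi> \<psi> assume f: "Ck 1 \<phi>" and g: "Ck 1 \<psi>"
  show "\<phi> \<in> Domain number_graph" "\<psi> \<in> Domain number_graph"
    by (rule C1_number_form[OF f g], rule C1_number_form[OF g f])
  show "ip beta (number_op \<phi>) \<psi> = 2 * (\<integral>(x, y). (\<phi> x - \<phi> y) * (\<psi> x - \<psi> y) / (x - y)\<^sup>2 \<partial>omega)"
    using C1_number_form(2)[OF f g] unfolding omega_form_def .
  show "ip beta (number_op \<phi>) \<psi> = ip beta \<phi> (number_op \<psi>)"
    unfolding C1_number_form(2)[OF f g] ip_commute[of beta \<phi>] C1_number_form(2)[OF g f]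
    by (simp add: omega_form_commute)
next
  fix \<phi> assume f: "Ck 2 \<phi>"
  show "\<phi> \<in> Domain number_graph" using number_graph_N_op[OF f] by blast
  show "number_op \<phi> \<in> Domain number_graph" using number_op_jacobi[OF f] by blast
  show "AE x in beta. L_op \<phi> x = jacobi \<phi> x" using f by (rule L_op_jacobi)
  fix \<psi> assume g: "Ck 1 \<psi>"
  show "ip beta (L_op \<phi>) \<psi> = 2 * (\<integral>x. dI \<phi> x * dI \<psi> x \<partial>alpha)"
    using ip_L_op[OF f Ck_L2[OF g]] ip_jacobi[OF f g] by (rule trans)
next
  show "invariant_measure beta L_op {\<phi>. Ck 2 \<phi>}" by (rule invariant_L_op)
next
  show "\<exists>!G. selfadjoint beta G \<and> L_graph \<subseteq> G"
    using selfadjoint_L_selfadj L_graph_subset selfadjoint_extension_unique by blast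
next
  fix G assume "selfadjoint beta G" "L_graph \<subseteq> G"
  then have G: "G = L_selfadj" by (rule selfadjoint_extension_unique)
  show "form_domain beta G = {\<phi>. \<exists>c. (\<lambda>x. \<phi> x - c) \<in> H_space}"
    unfolding G by (rule form_domain_L_selfadj)
next
  fix V A \<mu> assume "Ck 3 V"
  then have "Ck 2 V" by (rule Ck_mono) simp
  then show "(finite_signed_measure beta \<mu> \<and> \<mu> I2 = A \<and>
       (\<exists>C. AE x in lborel. x \<in> I2 \<longrightarrow> 2 * signed_integral beta \<mu> (\<lambda>y. ln \<bar>x - y\<bar>) = V x + C)) \<longleftrightarrow>
      (\<forall>B \<in> sets beta. \<mu> B = (LINT x:B|beta. A - 1 / 2 * N_op V x))"
    by (rule signed_log_potential)
next
  fix V \<mu> assume "Ck 3 V" and min: "is_minimizer V \<mu>" "supp \<mu> = I2"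
  from \<open>Ck 3 V\<close> have V: "Ck 2 V" by (rule Ck_mono) simp
  show *: "min_energy V = ereal ((\<integral>x. V x \<partial>beta) - 1 / 4 * ip beta (N_op V) V)"
    using V min by (rule min_energy_eq)
  show "min_energy V = ereal ((\<integral>x. V x \<partial>beta) - 1 / 2 * (\<integral>(x, y). ((V x - V y) / (x - y))\<^sup>2 \<partial>omega))"
    unfolding * ip_N_op_self[OF V] by simp
qed

end
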